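(* Let $p\in\mathbb{R}$, $q\ge0$. Assume that $(M,J,g)$ is Kählerian of dimension $2k$ and that $L$ is totally geodesic. Then $(T^\perp L,\tilde J,h_{p,q})$ is Kählerian if and only if $p=0$, $q=0$ and $\nabla^\perp$ is flat.
   Context: All objects are smooth. $(M,g)$ is a Riemannian manifold of dimension $2k$ with an almost complex structure $J$ compatible with $g$ (i.e. $g(JU,JV)=g(U,V)$); Kählerian means that $J$ is parallel for the Levi-Civita connection of $g$ (equivalently $J$ is integrable and the fundamental form is closed). $L\subset M$ is a $k$-dimensional totally real submanifold in the sense that for every $x\in L$, $T_xM$ is the orthogonal direct sum of $T_xL$ and $J(T_xL)$ (so $J$ interchanges $T_xL$ and $T_x^\perp L$). $\langle\cdot,\cdot\rangle$ is the metric induced by $g$ on $L$; $\pi:T^\perp L\to L$ is the normal bundle with fibre metric $\langle\cdot,\cdot\rangle^\perp$ induced by $g$, and normal connection $\nabla^\perp$. The connection map $K:T(T^\perp L)\to T^\perp L$ is the unique bundle morphism such that $K:T_\theta(T^\perp_xL)\to T^\perp_xL$ is the canonical isomorphism for $\theta\in T_x^\perp L$, and $K(\xi_*X)=\nabla^\perp_X\xi$ for every section $\xi$ of $T^\perp L$ and vector field $X$ on $L$. $X^h$ is the horizontal lift of $X$ ($KX^h=0$, $\pi_*X^h=X$), $\xi^v$ the vertical lift of $\xi$ ($\pi_*\xi^v=0$, $K\xi^v=\xi$), $\Theta$ the vertical vector field with $K(\Theta_\theta)=\theta$, and $J^h_\theta=(J\theta)^h_\theta$. With $\omega_\theta=\frac{1}{1+\langle\theta,\theta\rangle^\perp}$,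 the $(p,q)$-metric on $T^\perp L$ is $$h_{p,q}(A,B)=\langle\pi_*A,\pi_*B\rangle+\omega_\theta^p\big(\langle KA,KB\rangle^\perp+q\langle KA,\theta\rangle^\perp\langle KB,\theta\rangle^\perp\big),\quad A,B\in T_\theta(T^\perp L).$$ The almost complex structure $\tilde J$ on $T^\perp L$ (compatible with $h_{p,q}$) is given by $$(\tilde J\xi^v)_\theta=\omega_\theta^{p/2}\left((J\xi)^h_\theta+\frac{q}{1+\sqrt{1+q\langle\theta,\theta\rangle^\perp}}\langle\xi,\theta\rangle^\perp J^h_\theta\right),\quad (\tilde JX^h)_\theta=\omega_\theta^{-p/2}\left((JX)^v_\theta-\frac{q\,\langle JX,\theta\rangle^\perp}{1+q\langle\theta,\theta\rangle^\perp+\sqrt{1+q\langle\theta,\theta\rangle^\perp}}\Theta_\theta\right).$$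
   Formalization: Assumes k ≥ 2 and L nonempty: for k = 1 the claim is false, since T^⊥L is then a surface and every almost Hermitian surface is Kählerian (e.g. M = ℂ, L = ℝ, p = 1, q = 0). *)

theory Defs
  imports "HOL-Analysis.Analysis" "HOL-Library.Function_Algebras"
begin

section \<open>Function spaces as vector spaces; smooth maps between Euclidean spaces\<close>

instantiation "fun" :: (type, real_vector) real_vector
begin

definition scaleR_fun :: "real \<Rightarrow> ('a \<Rightarrow> 'b) \<Rightarrow> 'a \<Rightarrow> 'b"
  where "scaleR_fun r f = (\<lambda>x. r *\<^sub>R f x)"

instance
  by standard (simp_all add: scaleR_fun_def fun_eq_iff algebra_simps)

end

lemma scaleR_fun_apply [simp]: "(r *\<^sub>R f) x = r *\<^sub>R f x"
  by (simp add: scaleR_fun_def)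

text \<open>Derivatives are taken at interior points, hence \<open>S\<close> is meant to be open.\<close>

primrec Ck_on ::
  "nat \<Rightarrow> 'a::real_normed_vector set \<Rightarrow> ('a \<Rightarrow> 'b::real_normed_vector) \<Rightarrow> bool" where
  "Ck_on 0 S f \<longleftrightarrow> continuous_on S f"
| "Ck_on (Suc n) S f \<longleftrightarrow> (\<forall>x\<in>S. f differentiable (at x)) \<and>
     (\<forall>v. Ck_on n S (\<lambda>x. frechet_derivative f (at x) v))"

definition smooth_on ::
  "'a::real_normed_vector set \<Rightarrow> ('a \<Rightarrow> 'b::real_normed_vector) \<Rightarrow> bool" where
  "smooth_on S f \<longleftrightarrow> (\<forall>n. Ck_on n S f)"


section \<open>Smooth manifolds\<close>

text \<open>A chart is its domain together with its coordinate map.  The underlying set and the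
  topology of a manifold are determined by the atlas.  Atlases need not be maximal.\<close>

type_synonym ('a, 'e) chart = "'a set \<times> ('a \<Rightarrow> 'e)"
type_synonym ('a, 'e) atlas = "('a, 'e) chart set"

abbreviation cdom :: "('a, 'e) chart \<Rightarrow> 'a set" where "cdom c \<equiv> fst c"
abbreviation cmap :: "('a, 'e) chart \<Rightarrow> 'a \<Rightarrow> 'e" where "cmap c \<equiv> snd c"

definition cinv :: "('a, 'e) chart \<Rightarrow> 'e \<Rightarrow> 'a" where
  "cinv c = inv_into (cdom c) (cmap c)"

definition points :: "('a, 'e) atlas \<Rightarrow> 'a set" where
  "points A = (\<Union>c\<in>A. cdom c)"

definition smooth_atlas :: "('a, 'e::euclidean_space) atlas \<Rightarrow> bool" where
  "smooth_atlas A \<longleftrightarrow>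
     (\<forall>c\<in>A. inj_on (cmap c) (cdom c)) \<and>
     (\<forall>c\<in>A. \<forall>d\<in>A. open (cmap c ` (cdom c \<inter> cdom d)) \<and>
        smooth_on (cmap c ` (cdom c \<inter> cdom d)) (cmap d \<circ> cinv c))"

definition open_in :: "('a, 'e::euclidean_space) atlas \<Rightarrow> 'a set \<Rightarrow> bool" where
  "open_in A U \<longleftrightarrow> U \<subseteq> points A \<and> (\<forall>c\<in>A. open (cmap c ` (U \<inter> cdom c)))"

lemma istopology_open_in:
  assumes "smooth_atlas A"
  shows "istopology (open_in A)"
proof -
  have "open_in A (S \<inter> T)" if "open_in A S" "open_in A T" for S T
    unfolding open_in_def
  proof (intro conjI ballI)
    show "S \<inter> T \<subseteq> points A" using that by (auto simp: open_in_def)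
    fix c assume c: "c \<in> A"
    then have "inj_on (cmap c) (cdom c)" using assms by (auto simp: smooth_atlas_def)
    then have "cmap c ` ((S \<inter> cdom c) \<inter> (T \<inter> cdom c)) = cmap c ` (S \<inter> cdom c) \<inter> cmap c ` (T \<inter> cdom c)"
      by (intro inj_on_image_Int[of _ "cdom c"]) auto
    moreover have "S \<inter> T \<inter> cdom c = (S \<inter> cdom c) \<inter> (T \<inter> cdom c)" by blast
    ultimately show "open (cmap c ` (S \<inter> T \<inter> cdom c))"
      using that c by (simp add: open_in_def open_Int)
  qed
  moreover have "open_in A (\<Union>\<K>)" if "\<forall>S\<in>\<K>. open_in A S" for \<K>
    unfolding open_in_def
  proof (intro conjI ballI)
    show "\<Union>\<K> \<subseteq> points A" using that by (auto simp: open_in_def)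
    fix c assume c: "c \<in> A"
    have "cmap c ` (\<Union>\<K> \<inter> cdom c) = (\<Union>S\<in>\<K>. cmap c ` (S \<inter> cdom c))" by blast
    then show "open (cmap c ` (\<Union>\<K> \<inter> cdom c))"
      using that c by (auto simp: open_in_def)
  qed
  ultimately show ?thesis unfolding istopology_def by blast
qed

definition manifold_topology :: "('a, 'e::euclidean_space) atlas \<Rightarrow> 'a topology" where
  "manifold_topology A = topology (open_in A)"

definition smooth_manifold :: "('a, 'e::euclidean_space) atlas \<Rightarrow> bool" where
  "smooth_manifold A \<longleftrightarrow> smooth_atlas A \<and>
     Hausdorff_space (manifold_topology A) \<and> second_countable (manifold_topology A)"


section \<open>Tangent vectors\<close>

text \<open>A tangent vector at a point is the family of its components in all charts around that
  point, subject to the transformation law; the components in all other charts are set to zero.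
  Thus the tangent spaces are linear subspaces of a function space.\<close>

type_synonym ('a, 'e) tvec = "('a, 'e) chart \<Rightarrow> 'e"

definition tangent_space ::
  "('a, 'e::euclidean_space) atlas \<Rightarrow> 'a \<Rightarrow> ('a, 'e) tvec set" where
  "tangent_space A x = {v.
     (\<forall>c. c \<notin> A \<or> x \<notin> cdom c \<longrightarrow> v c = 0) \<and>
     (\<forall>c\<in>A. \<forall>d\<in>A. x \<in> cdom c \<and> x \<in> cdom d \<longrightarrow>
        v d = frechet_derivative (cmap d \<circ> cinv c) (at (cmap c x)) (v c))}"

definition chart_at :: "('a, 'e) atlas \<Rightarrow> 'a \<Rightarrow> ('a, 'e) chart" where
  "chart_at A x = (SOME c. c \<in> A \<and> x \<in> cdom c)"

text \<open>The derivative of a vector-valued function along a tangent vector does not depend on the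
  chosen chart.\<close>

definition dir_deriv ::
  "('a, 'e::euclidean_space) atlas \<Rightarrow> ('a \<Rightarrow> 'b::real_normed_vector) \<Rightarrow> 'a \<Rightarrow> ('a, 'e) tvec \<Rightarrow> 'b"
  where
  "dir_deriv A f x v =
     frechet_derivative (f \<circ> cinv (chart_at A x)) (at (cmap (chart_at A x) x)) (v (chart_at A x))"

text \<open>The coordinate vector field of a chart \<open>c\<close> with constant \<open>c\<close>-component \<open>w\<close>.\<close>

definition coord_field ::
  "('a, 'e::euclidean_space) atlas \<Rightarrow> ('a, 'e) chart \<Rightarrow> 'e \<Rightarrow> 'a \<Rightarrow> ('a, 'e) tvec" where
  "coord_field A c w x = (\<lambda>d. if d \<in> A \<and> x \<in> cdom d
     then frechet_derivative (cmap d \<circ> cinv c) (at (cmap c x)) w else 0)"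

definition smooth_fun_on ::
  "('a, 'e::euclidean_space) atlas \<Rightarrow> 'a set \<Rightarrow> ('a \<Rightarrow> real) \<Rightarrow> bool" where
  "smooth_fun_on A U f \<longleftrightarrow> (\<forall>c\<in>A. smooth_on (cmap c ` (U \<inter> cdom c)) (f \<circ> cinv c))"

definition vector_field_on ::
  "('a, 'e::euclidean_space) atlas \<Rightarrow> 'a set \<Rightarrow> ('a \<Rightarrow> ('a, 'e) tvec) \<Rightarrow> bool" where
  "vector_field_on A U X \<longleftrightarrow> (\<forall>x\<in>U. X x \<in> tangent_space A x) \<and>
     (\<forall>c\<in>A. smooth_on (cmap c ` (U \<inter> cdom c)) (\<lambda>u. X (cinv c u) c))"

definition lie_bracket ::
  "('a, 'e::euclidean_space) atlas \<Rightarrow> ('a \<Rightarrow> ('a, 'e) tvec) \<Rightarrow> ('a \<Rightarrow> ('a, 'e) tvec) \<Rightarrow>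
     'a \<Rightarrow> ('a, 'e) tvec" where
  "lie_bracket A X Y x = (\<lambda>c. if c \<in> A \<and> x \<in> cdom c
     then dir_deriv A (\<lambda>y. Y y c) x (X x) - dir_deriv A (\<lambda>y. X y c) x (Y x) else 0)"

definition smooth_map ::
  "('a, 'e::euclidean_space) atlas \<Rightarrow> ('b, 'f::euclidean_space) atlas \<Rightarrow> ('a \<Rightarrow> 'b) \<Rightarrow> bool" where
  "smooth_map A B f \<longleftrightarrow> f ` points A \<subseteq> points B \<and>
     (\<forall>c\<in>A. \<forall>d\<in>B. open (cmap c ` (cdom c \<inter> f -` cdom d)) \<and>
        smooth_on (cmap c ` (cdom c \<inter> f -` cdom d)) (cmap d \<circ> f \<circ> cinv c))"

definition tangent_map ::
  "('a, 'e::euclidean_space) atlas \<Rightarrow> ('b, 'f::euclidean_space) atlas \<Rightarrow> ('a \<Rightarrow> 'b) \<Rightarrow>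
     'a \<Rightarrow> ('a, 'e) tvec \<Rightarrow> ('b, 'f) tvec" where
  "tangent_map A B f x v = (\<lambda>d. if d \<in> B \<and> f x \<in> cdom d then dir_deriv A (cmap d \<circ> f) x v else 0)"

definition velocity ::
  "('a, 'e::euclidean_space) atlas \<Rightarrow> (real \<Rightarrow> 'a) \<Rightarrow> real \<Rightarrow> ('a, 'e) tvec" where
  "velocity A \<gamma> t = (\<lambda>d. if d \<in> A \<and> \<gamma> t \<in> cdom d
     then vector_derivative (cmap d \<circ> \<gamma>) (at t) else 0)"

definition linear_between :: "'v::real_vector set \<Rightarrow> 'w::real_vector set \<Rightarrow> ('v \<Rightarrow> 'w) \<Rightarrow> bool" where
  "linear_between V W f \<longleftrightarrow> f ` V \<subseteq> W \<and>
     (\<forall>u\<in>V. \<forall>v\<in>V. f (u + v) = f u + f v) \<and> (\<forall>a. \<forall>v\<in>V. f (a *\<^sub>R v) = a *\<^sub>R f v)"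


section \<open>Riemannian and almost Hermitian structures\<close>

type_synonym ('a, 'e) metric = "'a \<Rightarrow> ('a, 'e) tvec \<Rightarrow> ('a, 'e) tvec \<Rightarrow> real"
type_synonym ('a, 'e) endo = "'a \<Rightarrow> ('a, 'e) tvec \<Rightarrow> ('a, 'e) tvec"

text \<open>A connection takes a point, a tangent vector at that point and a vector field defined near
  that point.\<close>

type_synonym ('a, 'e) conn =
  "'a \<Rightarrow> ('a, 'e) tvec \<Rightarrow> ('a \<Rightarrow> ('a, 'e) tvec) \<Rightarrow> ('a, 'e) tvec"

definition riemannian_metric ::
  "('a, 'e::euclidean_space) atlas \<Rightarrow> ('a, 'e) metric \<Rightarrow> bool" where
  "riemannian_metric A g \<longleftrightarrow>
     (\<forall>x\<in>points A.
        (\<forall>u\<in>tangent_space A x. linear_between (tangent_space A x) UNIV (g x u)) \<and>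
        (\<forall>u\<in>tangent_space A x. \<forall>v\<in>tangent_space A x. g x u v = g x v u) \<and>
        (\<forall>v\<in>tangent_space A x. v \<noteq> 0 \<longrightarrow> g x v v > 0)) \<and>
     (\<forall>U X Y. open_in A U \<and> vector_field_on A U X \<and> vector_field_on A U Y \<longrightarrow>
        smooth_fun_on A U (\<lambda>x. g x (X x) (Y x)))"

definition almost_complex_structure ::
  "('a, 'e::euclidean_space) atlas \<Rightarrow> ('a, 'e) endo \<Rightarrow> bool" where
  "almost_complex_structure A J \<longleftrightarrow>
     (\<forall>x\<in>points A. linear_between (tangent_space A x) (tangent_space A x) (J x) \<and>
        (\<forall>v\<in>tangent_space A x. J x (J x v) = - v)) \<and>
     (\<forall>U X. open_in A U \<and> vector_field_on A U X \<longrightarrow> vector_field_on A U (\<lambda>x. J x (X x)))"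

definition affine_connection ::
  "('a, 'e::euclidean_space) atlas \<Rightarrow> ('a, 'e) conn \<Rightarrow> bool" where
  "affine_connection A nab \<longleftrightarrow> (\<forall>U. open_in A U \<longrightarrow>
     (\<forall>x\<in>U. \<forall>Y. vector_field_on A U Y \<longrightarrow>
        linear_between (tangent_space A x) (tangent_space A x) (\<lambda>v. nab x v Y)) \<and>
     (\<forall>x\<in>U. \<forall>v\<in>tangent_space A x. \<forall>Y Z. vector_field_on A U Y \<and> vector_field_on A U Z \<longrightarrow>
        nab x v (\<lambda>y. Y y + Z y) = nab x v Y + nab x v Z) \<and>
     (\<forall>x\<in>U. \<forall>v\<in>tangent_space A x. \<forall>f Y. smooth_fun_on A U f \<and> vector_field_on A U Y \<longrightarrow>
        nab x v (\<lambda>y. f y *\<^sub>R Y y) = dir_deriv A f x v *\<^sub>R Y x + f x *\<^sub>R nab x v Y) \<and>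
     (\<forall>X Y. vector_field_on A U X \<and> vector_field_on A U Y \<longrightarrow>
        vector_field_on A U (\<lambda>x. nab x (X x) Y)))"

definition levi_civita ::
  "('a, 'e::euclidean_space) atlas \<Rightarrow> ('a, 'e) metric \<Rightarrow> ('a, 'e) conn \<Rightarrow> bool" where
  "levi_civita A g nab \<longleftrightarrow> affine_connection A nab \<and>
     (\<forall>U X Y. open_in A U \<and> vector_field_on A U X \<and> vector_field_on A U Y \<longrightarrow>
        (\<forall>x\<in>U. nab x (X x) Y - nab x (Y x) X = lie_bracket A X Y x) \<and>
        (\<forall>x\<in>U. \<forall>v\<in>tangent_space A x.
           dir_deriv A (\<lambda>y. g y (X y) (Y y)) x v = g x (nab x v X) (Y x) + g x (X x) (nab x v Y)))"

definition parallel ::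
  "('a, 'e::euclidean_space) atlas \<Rightarrow> ('a, 'e) conn \<Rightarrow> ('a, 'e) endo \<Rightarrow> bool" where
  "parallel A nab J \<longleftrightarrow> (\<forall>U Y. open_in A U \<and> vector_field_on A U Y \<longrightarrow>
     (\<forall>x\<in>U. \<forall>v\<in>tangent_space A x. nab x v (\<lambda>y. J y (Y y)) = J x (nab x v Y)))"

definition kaehlerian ::
  "('a, 'e::euclidean_space) atlas \<Rightarrow> ('a, 'e) endo \<Rightarrow> ('a, 'e) metric \<Rightarrow> bool" where
  "kaehlerian A J g \<longleftrightarrow> riemannian_metric A g \<and> almost_complex_structure A J \<and>
     (\<forall>x\<in>points A. \<forall>u\<in>tangent_space A x. \<forall>v\<in>tangent_space A x. g x (J x u) (J x v) = g x u v) \<and>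
     (\<exists>nab. levi_civita A g nab \<and> parallel A nab J)"


section \<open>Submanifolds\<close>

text \<open>A submanifold is a subset with its own smooth structure for which the inclusion is an
  immersion; this comprises the embedded submanifolds.\<close>

definition incl_map ::
  "('a, 'e::euclidean_space) atlas \<Rightarrow> ('a, 'f::euclidean_space) atlas \<Rightarrow>
     'a \<Rightarrow> ('a, 'e) tvec \<Rightarrow> ('a, 'f) tvec" where
  "incl_map L M = tangent_map L M (\<lambda>x. x)"

definition submanifold ::
  "('a, 'e::euclidean_space) atlas \<Rightarrow> ('a, 'f::euclidean_space) atlas \<Rightarrow> bool" where
  "submanifold L M \<longleftrightarrow> smooth_map L M (\<lambda>x. x) \<and>
     (\<forall>x\<in>points L. inj_on (incl_map L M x) (tangent_space L x))"

definition tan_space ::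
  "('a, 'e::euclidean_space) atlas \<Rightarrow> ('a, 'f::euclidean_space) atlas \<Rightarrow> 'a \<Rightarrow> ('a, 'f) tvec set"
  where
  "tan_space L M x = incl_map L M x ` tangent_space L x"

definition normal_space ::
  "('a, 'e::euclidean_space) atlas \<Rightarrow> ('a, 'f::euclidean_space) atlas \<Rightarrow> ('a, 'f) metric \<Rightarrow>
     'a \<Rightarrow> ('a, 'f) tvec set" where
  "normal_space L M g x = {w \<in> tangent_space M x. \<forall>u\<in>tan_space L M x. g x w u = 0}"

definition normal_part ::
  "('a, 'e::euclidean_space) atlas \<Rightarrow> ('a, 'f::euclidean_space) atlas \<Rightarrow> ('a, 'f) metric \<Rightarrow>
     'a \<Rightarrow> ('a, 'f) tvec \<Rightarrow> ('a, 'f) tvec" where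
  "normal_part L M g x w = (THE n. n \<in> normal_space L M g x \<and> w - n \<in> tan_space L M x)"

text \<open>The inverse of the identification of \<open>T\<^sub>x L\<close> with a subspace of \<open>T\<^sub>x M\<close>.\<close>

definition restrict_tan ::
  "('a, 'e::euclidean_space) atlas \<Rightarrow> ('a, 'f::euclidean_space) atlas \<Rightarrow>
     'a \<Rightarrow> ('a, 'f) tvec \<Rightarrow> ('a, 'e) tvec" where
  "restrict_tan L M x = inv_into (tangent_space L x) (incl_map L M x)"

definition totally_real ::
  "('a, 'e::euclidean_space) atlas \<Rightarrow> ('a, 'f::euclidean_space) atlas \<Rightarrow> ('a, 'f) endo \<Rightarrow>
     ('a, 'f) metric \<Rightarrow> bool" where
  "totally_real L M J g \<longleftrightarrow> (\<forall>x\<in>points L.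
     (\<forall>u\<in>tan_space L M x. \<forall>v\<in>tan_space L M x. g x u (J x v) = 0) \<and>
     tangent_space M x = {u + J x v |u v. u \<in> tan_space L M x \<and> v \<in> tan_space L M x})"

text \<open>Smooth sections over \<open>U \<subseteq> L\<close> of the restriction of \<open>TM\<close> to \<open>L\<close>.\<close>

definition section_on ::
  "('a, 'e::euclidean_space) atlas \<Rightarrow> ('a, 'f::euclidean_space) atlas \<Rightarrow> 'a set \<Rightarrow>
     ('a \<Rightarrow> ('a, 'f) tvec) \<Rightarrow> bool" where
  "section_on L M U \<xi> \<longleftrightarrow> (\<forall>x\<in>U. \<xi> x \<in> tangent_space M x) \<and>
     (\<forall>c\<in>L. \<forall>d\<in>M. smooth_on (cmap c ` (U \<inter> cdom c \<inter> cdom d)) (\<lambda>u. \<xi> (cinv c u) d))"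

definition normal_section_on ::
  "('a, 'e::euclidean_space) atlas \<Rightarrow> ('a, 'f::euclidean_space) atlas \<Rightarrow> ('a, 'f) metric \<Rightarrow>
     'a set \<Rightarrow> ('a \<Rightarrow> ('a, 'f) tvec) \<Rightarrow> bool" where
  "normal_section_on L M g U \<xi> \<longleftrightarrow> section_on L M U \<xi> \<and> (\<forall>x\<in>U. \<xi> x \<in> normal_space L M g x)"

text \<open>The connection induced on the restriction of \<open>TM\<close> to \<open>L\<close>: differentiate the components of
  the section with respect to a coordinate frame of \<open>M\<close> and add the covariant derivative of the
  coordinate vector field whose value at \<open>x\<close> is \<open>\<xi> x\<close>.\<close>

definition induced_conn ::
  "('a, 'e::euclidean_space) atlas \<Rightarrow> ('a, 'f::euclidean_space) atlas \<Rightarrow> ('a, 'f) conn \<Rightarrow>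
     'a \<Rightarrow> ('a, 'e) tvec \<Rightarrow> ('a \<Rightarrow> ('a, 'f) tvec) \<Rightarrow> ('a, 'f) tvec" where
  "induced_conn L M nab x v \<xi> = (\<lambda>d. if d \<in> M \<and> x \<in> cdom d
     then dir_deriv L (\<lambda>y. \<xi> y d) x v + nab x (incl_map L M x v) (coord_field M d (\<xi> x d)) d
     else 0)"

definition totally_geodesic ::
  "('a, 'e::euclidean_space) atlas \<Rightarrow> ('a, 'f::euclidean_space) atlas \<Rightarrow> ('a, 'f) metric \<Rightarrow>
     ('a, 'f) conn \<Rightarrow> bool" where
  "totally_geodesic L M g nab \<longleftrightarrow> (\<forall>U Y. open_in L U \<and> vector_field_on L U Y \<longrightarrow>
     (\<forall>x\<in>U. \<forall>v\<in>tangent_space L x.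
        normal_part L M g x (induced_conn L M nab x v (\<lambda>y. incl_map L M y (Y y))) = 0))"

definition normal_conn ::
  "('a, 'e::euclidean_space) atlas \<Rightarrow> ('a, 'f::euclidean_space) atlas \<Rightarrow> ('a, 'f) metric \<Rightarrow>
     ('a, 'f) conn \<Rightarrow> 'a \<Rightarrow> ('a, 'e) tvec \<Rightarrow> ('a \<Rightarrow> ('a, 'f) tvec) \<Rightarrow> ('a, 'f) tvec" where
  "normal_conn L M g nab x v \<xi> = normal_part L M g x (induced_conn L M nab x v \<xi>)"

definition flat_normal_conn ::
  "('a, 'e::euclidean_space) atlas \<Rightarrow> ('a, 'f::euclidean_space) atlas \<Rightarrow> ('a, 'f) metric \<Rightarrow>
     ('a, 'f) conn \<Rightarrow> bool" where
  "flat_normal_conn L M g nab \<longleftrightarrow> (\<forall>U X Y \<xi>. open_in L U \<and>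
     vector_field_on L U X \<and> vector_field_on L U Y \<and> normal_section_on L M g U \<xi> \<longrightarrow>
     (\<forall>x\<in>U.
        normal_conn L M g nab x (X x) (\<lambda>y. normal_conn L M g nab y (Y y) \<xi>)
        - normal_conn L M g nab x (Y x) (\<lambda>y. normal_conn L M g nab y (X y) \<xi>)
        - normal_conn L M g nab x (lie_bracket L X Y x) \<xi> = 0))"


section \<open>The normal bundle\<close>

type_synonym ('a, 'f) nvec = "'a \<times> ('a, 'f) tvec"

text \<open>A smooth frame of the normal bundle over \<open>V\<close>, regarded as a family of linear isomorphisms
  from the model fibre \<open>'n\<close>.\<close>

definition normal_frame_on ::
  "('a, 'e::euclidean_space) atlas \<Rightarrow> ('a, 'f::euclidean_space) atlas \<Rightarrow> ('a, 'f) metric \<Rightarrow>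
     'a set \<Rightarrow> ('a \<Rightarrow> 'n::euclidean_space \<Rightarrow> ('a, 'f) tvec) \<Rightarrow> bool" where
  "normal_frame_on L M g V F \<longleftrightarrow>
     (\<forall>x\<in>V. linear (F x) \<and> bij_betw (F x) UNIV (normal_space L M g x)) \<and>
     (\<forall>w. normal_section_on L M g V (\<lambda>x. F x w))"

definition bundle_chart ::
  "('a, 'e::euclidean_space) atlas \<Rightarrow> ('a, 'f::euclidean_space) atlas \<Rightarrow> ('a, 'f) metric \<Rightarrow>
     ('a, 'e) chart \<Rightarrow> 'a set \<Rightarrow> ('a \<Rightarrow> 'n::euclidean_space \<Rightarrow> ('a, 'f) tvec) \<Rightarrow>
     (('a, 'f) nvec, 'e \<times> 'n) chart" where
  "bundle_chart L M g c V F =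
     ({(x, \<theta>). x \<in> V \<and> \<theta> \<in> normal_space L M g x}, \<lambda>(x, \<theta>). (cmap c x, inv (F x) \<theta>))"

definition normal_bundle ::
  "('a, 'e::euclidean_space) atlas \<Rightarrow> ('a, 'f::euclidean_space) atlas \<Rightarrow> ('a, 'f) metric \<Rightarrow>
     (('a, 'f) nvec, 'e \<times> 'n::euclidean_space) atlas" where
  "normal_bundle L M g = {bundle_chart L M g c V F |c V F.
     c \<in> L \<and> open_in L V \<and> V \<subseteq> cdom c \<and> normal_frame_on L M g V F}"

type_synonym ('a, 'e, 'f) nbtvec = "(('a, 'f) nvec, 'e \<times> 'e) tvec"

text \<open>From here on the rank of the normal bundle is the dimension of \<open>L\<close>.\<close>

definition proj_map ::
  "('a, 'e::euclidean_space) atlas \<Rightarrow> ('a, 'f::euclidean_space) atlas \<Rightarrow> ('a, 'f) metric \<Rightarrow>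
     ('a, 'f) nvec \<Rightarrow> ('a, 'e, 'f) nbtvec \<Rightarrow> ('a, 'e) tvec" where
  "proj_map L M g = tangent_map (normal_bundle L M g) L fst"

text \<open>The defining properties of the connection map \<open>K\<close>; the canonical isomorphism from the
  vertical space to the fibre sends the velocity of the line \<open>\<theta> + t\<eta>\<close> to \<open>\<eta>\<close>.  These properties
  determine \<open>K\<close> on all tangent vectors of the normal bundle.\<close>

definition connection_map ::
  "('a, 'e::euclidean_space) atlas \<Rightarrow> ('a, 'f::euclidean_space) atlas \<Rightarrow> ('a, 'f) metric \<Rightarrow>
     ('a, 'f) conn \<Rightarrow> (('a, 'f) nvec \<Rightarrow> ('a, 'e, 'f) nbtvec \<Rightarrow> ('a, 'f) tvec) \<Rightarrow> bool" where
  "connection_map L M g nab K \<longleftrightarrow> (\<forall>x\<in>points L. \<forall>\<theta>\<in>normal_space L M g x.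
     linear_between (tangent_space (normal_bundle L M g) (x, \<theta>)) (normal_space L M g x) (K (x, \<theta>)) \<and>
     (\<forall>\<eta>\<in>normal_space L M g x.
        K (x, \<theta>) (velocity (normal_bundle L M g) (\<lambda>t. (x, \<theta> + t *\<^sub>R \<eta>)) 0) = \<eta>) \<and>
     (\<forall>U \<xi>. open_in L U \<and> x \<in> U \<and> normal_section_on L M g U \<xi> \<and> \<xi> x = \<theta> \<longrightarrow>
        (\<forall>v\<in>tangent_space L x.
           K (x, \<theta>) (tangent_map L (normal_bundle L M g) (\<lambda>y. (y, \<xi> y)) x v)
           = normal_conn L M g nab x v \<xi>)))"

definition hor_lift ::
  "('a, 'e::euclidean_space) atlas \<Rightarrow> ('a, 'f::euclidean_space) atlas \<Rightarrow> ('a, 'f) metric \<Rightarrow>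
     (('a, 'f) nvec \<Rightarrow> ('a, 'e, 'f) nbtvec \<Rightarrow> ('a, 'f) tvec) \<Rightarrow>
     ('a, 'f) nvec \<Rightarrow> ('a, 'e) tvec \<Rightarrow> ('a, 'e, 'f) nbtvec" where
  "hor_lift L M g K z X = (THE A. A \<in> tangent_space (normal_bundle L M g) z \<and>
     proj_map L M g z A = X \<and> K z A = 0)"

definition ver_lift ::
  "('a, 'e::euclidean_space) atlas \<Rightarrow> ('a, 'f::euclidean_space) atlas \<Rightarrow> ('a, 'f) metric \<Rightarrow>
     (('a, 'f) nvec \<Rightarrow> ('a, 'e, 'f) nbtvec \<Rightarrow> ('a, 'f) tvec) \<Rightarrow>
     ('a, 'f) nvec \<Rightarrow> ('a, 'f) tvec \<Rightarrow> ('a, 'e, 'f) nbtvec" where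
  "ver_lift L M g K z \<xi> = (THE A. A \<in> tangent_space (normal_bundle L M g) z \<and>
     proj_map L M g z A = 0 \<and> K z A = \<xi>)"

definition omega :: "('a, 'f::euclidean_space) metric \<Rightarrow> ('a, 'f) nvec \<Rightarrow> real" where
  "omega g z = (case z of (x, \<theta>) \<Rightarrow> 1 / (1 + g x \<theta> \<theta>))"

definition pq_metric ::
  "('a, 'e::euclidean_space) atlas \<Rightarrow> ('a, 'f::euclidean_space) atlas \<Rightarrow> ('a, 'f) metric \<Rightarrow>
     (('a, 'f) nvec \<Rightarrow> ('a, 'e, 'f) nbtvec \<Rightarrow> ('a, 'f) tvec) \<Rightarrow> real \<Rightarrow> real \<Rightarrow>
     (('a, 'f) nvec, 'e \<times> 'e) metric" where
  "pq_metric L M g K p q z A B = (case z of (x, \<theta>) \<Rightarrow>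
     g x (incl_map L M x (proj_map L M g z A)) (incl_map L M x (proj_map L M g z B)) +
     omega g z powr p * (g x (K z A) (K z B) + q * g x (K z A) \<theta> * g x (K z B) \<theta>))"

text \<open>Every tangent vector of the normal bundle is \<open>A = (KA)\<^sup>v + (\<pi>\<^sub>*A)\<^sup>h\<close>, so that \<open>J_tilde\<close> is the
  fibrewise linear map with the values \<open>J_ver\<close> and \<open>J_hor\<close> on vertical and horizontal lifts.\<close>

definition J_ver ::
  "('a, 'e::euclidean_space) atlas \<Rightarrow> ('a, 'f::euclidean_space) atlas \<Rightarrow> ('a, 'f) endo \<Rightarrow>
     ('a, 'f) metric \<Rightarrow> (('a, 'f) nvec \<Rightarrow> ('a, 'e, 'f) nbtvec \<Rightarrow> ('a, 'f) tvec) \<Rightarrow> real \<Rightarrow> real \<Rightarrow>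
     ('a, 'f) nvec \<Rightarrow> ('a, 'f) tvec \<Rightarrow> ('a, 'e, 'f) nbtvec" where
  "J_ver L M J g K p q z \<xi> = (case z of (x, \<theta>) \<Rightarrow>
     omega g z powr (p / 2) *\<^sub>R
       (hor_lift L M g K z (restrict_tan L M x (J x \<xi>)) +
        (q / (1 + sqrt (1 + q * g x \<theta> \<theta>)) * g x \<xi> \<theta>) *\<^sub>R
          hor_lift L M g K z (restrict_tan L M x (J x \<theta>))))"

definition J_hor ::
  "('a, 'e::euclidean_space) atlas \<Rightarrow> ('a, 'f::euclidean_space) atlas \<Rightarrow> ('a, 'f) endo \<Rightarrow>
     ('a, 'f) metric \<Rightarrow> (('a, 'f) nvec \<Rightarrow> ('a, 'e, 'f) nbtvec \<Rightarrow> ('a, 'f) tvec) \<Rightarrow> real \<Rightarrow> real \<Rightarrow>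
     ('a, 'f) nvec \<Rightarrow> ('a, 'e) tvec \<Rightarrow> ('a, 'e, 'f) nbtvec" where
  "J_hor L M J g K p q z X = (case z of (x, \<theta>) \<Rightarrow>
     omega g z powr (- p / 2) *\<^sub>R
       (ver_lift L M g K z (J x (incl_map L M x X)) -
        (q * g x (J x (incl_map L M x X)) \<theta> /
          (1 + q * g x \<theta> \<theta> + sqrt (1 + q * g x \<theta> \<theta>))) *\<^sub>R ver_lift L M g K z \<theta>))"

definition J_tilde ::
  "('a, 'e::euclidean_space) atlas \<Rightarrow> ('a, 'f::euclidean_space) atlas \<Rightarrow> ('a, 'f) endo \<Rightarrow>
     ('a, 'f) metric \<Rightarrow> (('a, 'f) nvec \<Rightarrow> ('a, 'e, 'f) nbtvec \<Rightarrow> ('a, 'f) tvec) \<Rightarrow> real \<Rightarrow> real \<Rightarrow>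
     (('a, 'f) nvec, 'e \<times> 'e) endo" where
  "J_tilde L M J g K p q z A =
     J_ver L M J g K p q z (K z A) + J_hor L M J g K p q z (proj_map L M g z A)"

end

(* Multiplication by J identifies the normal bundle N of L with TL, so that a chart c of L yields the
   frames E = incl (d/du) of TL and J E of N, and hence a chart (u, w) of the total space of N.  As L is
   totally geodesic and J is parallel, the connections of TL and of N have the same Christoffel symbols
   G in these frames.  In particular G is symmetric, K (a, b) = J E (b + G a w), and the curvature of the
   normal connection is the curvature of G.

   Necessity.  For coordinate fields (a, 0), (0, b), (0, b') closedness of the fundamental form only
   involves derivatives along a fibre.  With t = |w|^2 and an orthogonal pair of vectors, which needs
   DIM >= 2, it says p / (1 + t) = - q / (1 + sqrt (1 + q t)) for all t > 0, whence p = q = 0.  Then the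
   Nijenhuis bracket of (0, a) and (0, b) at w is minus the curvature of G applied to w.

   Sufficiency.  For p = q = 0 the map mu A = incl (proj A) + K A identifies the tangent bundle of N
   isometrically with the pullback of TM and intertwines J_tilde with J.  Transporting the pulled back
   Levi-Civita connection of M along mu gives a metric connection for which J_tilde is parallel, and
   its torsion is the curvature of the normal connection. *)
theory Submission
  imports Defs
begin

section \<open>Smooth maps between normed spaces\<close>

text \<open>Two features of \<open>kaehlerian\<close> shape the proof. It asks for a torsion-free
  metric connection with \<open>J\<close> parallel, so for sufficiency one must be exhibited on the
  total space; a transported pullback connection is automatically metric and makes
  \<open>J_tilde\<close> parallel, and only its torsion needs a computation. Conversely, it only
  says that some Levi-Civita connection makes \<open>J\<close> parallel; uniqueness, by the Koszul
  formula, transfers this to the given \<open>nab\<close>. Origin of the equation in p and q: let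
  e1, e2 be orthogonal and t the squared length of the fibre point e1. Closedness equates the
  derivative along e1 of the form on (0, e2), (e2, 0) with the derivative along e2 of the form on
  (0, e1), (e2, 0). Orthogonality removes the q term from the first and leaves only the q term in
  the second. As functions of t the results can agree only if both vanish. Tangent vectors are
  families of components, so smoothness is always a statement about components in charts. Implicitly
  defined coefficients, such as the Christoffel symbols, are smooth because they solve linear
  systems with smooth matrices.\<close>

lemma Ck_on_cong:
  assumes "open S" "\<And>x. x \<in> S \<Longrightarrow> f x = g x" "Ck_on n S f"
  shows "Ck_on n S g"
  using assms
proof (induction n arbitrary: f g)
  case 0
  then show ?case by (simp cong: continuous_on_cong)
next
  case (Suc n)
  have diff: "g differentiable (at x)" if "x \<in> S" for x
  proof -
    have "f differentiable (at x)" using Suc.prems(3) that by simp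
    then obtain D where "(f has_derivative D) (at x)" by (auto simp: differentiable_def)
    then have "(g has_derivative D) (at x)"
      by (rule has_derivative_transform_within_open[OF _ Suc.prems(1) that Suc.prems(2)])
    then show ?thesis by (auto simp: differentiable_def)
  qed
  have fd: "frechet_derivative f (at x) = frechet_derivative g (at x)" if "x \<in> S" for x
    using Suc.prems that by (intro frechet_derivative_transform_within_open[of f x S g]) auto
  have "Ck_on n S (\<lambda>x. frechet_derivative g (at x) v)" for v
    by (rule Suc.IH[of "\<lambda>x. frechet_derivative f (at x) v"]) (use Suc.prems fd in auto)
  then show ?case using diff by simp
qed

lemma Ck_on_subset: "Ck_on n S f \<Longrightarrow> T \<subseteq> S \<Longrightarrow> Ck_on n T f"
  by (induction n arbitrary: f) (auto intro: continuous_on_subset)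

lemma Ck_on_SucD: "Ck_on (Suc n) S f \<Longrightarrow> Ck_on n S f"
proof (induction n arbitrary: f)
  case 0
  then show ?case
    by (auto intro!: continuous_at_imp_continuous_on differentiable_imp_continuous_within)
next
  case (Suc n)
  then show ?case by (metis Ck_on.simps(2))
qed

lemma Ck_on_imp_continuous_on: "Ck_on n S f \<Longrightarrow> continuous_on S f"
  by (induction n) (use Ck_on_SucD in auto)

text \<open>Continuity and differentiability at a point depend only on a neighbourhood, and the
  local hypothesis for \<open>f\<close> at order \<open>Suc n\<close> contains the one for each
  derivative function at order \<open>n\<close>, so the induction closes.\<close>

lemma Ck_on_local:
  assumes "\<And>x. x \<in> S \<Longrightarrow> \<exists>T. open T \<and> x \<in> T \<and> Ck_on n T f"
  shows "Ck_on n S f"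
  using assms
proof (induction n arbitrary: f)
  case 0
  show ?case
    unfolding Ck_on.simps
  proof (rule continuous_at_imp_continuous_on, rule ballI)
    fix x assume "x \<in> S"
    then obtain T where "open T" "x \<in> T" "continuous_on T f" using 0 by auto
    then show "isCont f x" by (simp add: continuous_on_eq_continuous_at)
  qed
next
  case (Suc n)
  have "Ck_on n S (\<lambda>x. frechet_derivative f (at x) v)" for v
    by (rule Suc.IH) (use Suc.prems in fastforce)
  then show ?case using Suc.prems by fastforce
qed

lemma Ck_on_const [simp]: "Ck_on n S (\<lambda>x. c)"
  by (induction n arbitrary: c) auto

lemma Ck_on_bounded_linear: "bounded_linear h \<Longrightarrow> Ck_on n S h"
proof (cases n)
  case 0
  moreover assume "bounded_linear h"
  ultimately show ?thesis by (simp add: linear_continuous_on)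
next
  case (Suc m)
  assume h: "bounded_linear h"
  then have d: "(h has_derivative h) (at x)" for x by (rule bounded_linear_imp_has_derivative)
  then have "frechet_derivative h (at x) = h" for x by (rule frechet_derivative_at[symmetric])
  then show ?thesis using Suc d by (auto simp: differentiable_def)
qed

lemma Ck_on_bounded_linear_comp:
  assumes "open S" "bounded_linear h" "Ck_on n S f"
  shows "Ck_on n S (\<lambda>x. h (f x))"
  using assms
proof (induction n arbitrary: f)
  case 0
  then show ?case by (simp add: bounded_linear.continuous_on)
next
  case (Suc n)
  have D: "((\<lambda>x. h (f x)) has_derivative (\<lambda>v. h (frechet_derivative f (at x) v))) (at x)"
    if "x \<in> S" for x
    using Suc.prems that frechet_derivative_works
    by (auto intro: bounded_linear.has_derivative[OF \<open>bounded_linear h\<close>])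
  have fd: "frechet_derivative (\<lambda>x. h (f x)) (at x) = (\<lambda>v. h (frechet_derivative f (at x) v))"
    if "x \<in> S" for x using D[OF that] by (rule frechet_derivative_at[symmetric])
  have "Ck_on n S (\<lambda>x. frechet_derivative (\<lambda>x. h (f x)) (at x) v)" for v
    by (rule Ck_on_cong[OF Suc.prems(1) _ Suc.IH[of "\<lambda>x. frechet_derivative f (at x) v"]])
      (use Suc.prems fd in auto)
  then show ?case using D by (auto simp: differentiable_def)
qed

lemma Ck_on_add:
  assumes "open S" "Ck_on n S f" "Ck_on n S g"
  shows "Ck_on n S (\<lambda>x. f x + g x)"
  using assms
proof (induction n arbitrary: f g)
  case 0
  then show ?case by (simp add: continuous_on_add)
next
  case (Suc n)
  have D: "((\<lambda>x. f x + g x) has_derivative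
      (\<lambda>v. frechet_derivative f (at x) v + frechet_derivative g (at x) v)) (at x)"
    if "x \<in> S" for x
    using Suc.prems that by (intro has_derivative_add) (simp_all add: frechet_derivative_works[symmetric])
  have fd: "frechet_derivative (\<lambda>x. f x + g x) (at x) =
      (\<lambda>v. frechet_derivative f (at x) v + frechet_derivative g (at x) v)"
    if "x \<in> S" for x using D[OF that] by (rule frechet_derivative_at[symmetric])
  have "Ck_on n S (\<lambda>x. frechet_derivative (\<lambda>x. f x + g x) (at x) v)" for v
    by (rule Ck_on_cong[OF Suc.prems(1) _ Suc.IH[of "\<lambda>x. frechet_derivative f (at x) v"
            "\<lambda>x. frechet_derivative g (at x) v"]])
      (use Suc.prems fd in auto)
  then show ?case using D by (auto simp: differentiable_def)
qed

lemma Ck_on_sum: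
  assumes "open S" "\<And>i. i \<in> I \<Longrightarrow> Ck_on n S (f i)"
  shows "Ck_on n S (\<lambda>x. \<Sum>i\<in>I. f i x)"
  using assms(2) by (induction I rule: infinite_finite_induct) (auto intro: Ck_on_add[OF assms(1)])

text \<open>By the Leibniz rule the derivative is a sum of two products of the same kind. In each of
  them one factor is a derivative of order \<open>n\<close>, while the other has to be lowered from
  \<open>Suc n\<close> to \<open>n\<close>.\<close>

lemma Ck_on_bilinear:
  assumes "bounded_bilinear prd" "open S" "Ck_on n S f" "Ck_on n S g"
  shows "Ck_on n S (\<lambda>x. prd (f x) (g x))"
  using assms(2-)
proof (induction n arbitrary: f g)
  case 0
  then show ?case by (simp add: bounded_bilinear.continuous_on[OF assms(1)])
next
  case (Suc n)
  have D: "((\<lambda>x. prd (f x) (g x)) has_derivative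
      (\<lambda>v. prd (f x) (frechet_derivative g (at x) v) + prd (frechet_derivative f (at x) v) (g x))) (at x)"
    if "x \<in> S" for x
    using Suc.prems that
    by (intro bounded_bilinear.FDERIV[OF assms(1)]) (simp_all add: frechet_derivative_works[symmetric])
  have fd: "frechet_derivative (\<lambda>x. prd (f x) (g x)) (at x) =
      (\<lambda>v. prd (f x) (frechet_derivative g (at x) v) + prd (frechet_derivative f (at x) v) (g x))"
    if "x \<in> S" for x using D[OF that] by (rule frechet_derivative_at[symmetric])
  have "Ck_on n S (\<lambda>x. frechet_derivative (\<lambda>x. prd (f x) (g x)) (at x) v)" for v
  proof (rule Ck_on_cong[OF Suc.prems(1)])
    show "Ck_on n S (\<lambda>x. prd (f x) (frechet_derivative g (at x) v) +
        prd (frechet_derivative f (at x) v) (g x))"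
      using Suc.prems by (intro Ck_on_add Suc.IH) (auto intro: Ck_on_SucD)
  qed (use fd in auto)
  then show ?case using D by (auto simp: differentiable_def)
qed

text \<open>The expansion through which finite dimension enters most smoothness arguments: a family
  of linear maps is controlled by finitely many of its values, and the argument enters through its
  coordinates only.\<close>

lemma linear_eq_sum_Basis:
  fixes h :: "'a::euclidean_space \<Rightarrow> 'b::real_vector"
  assumes "linear h"
  shows "h v = (\<Sum>b\<in>Basis. (v \<bullet> b) *\<^sub>R h b)"
proof -
  have "h v = h (\<Sum>b\<in>Basis. (v \<bullet> b) *\<^sub>R b)" by (simp add: euclidean_representation)
  then show ?thesis using assms by (simp add: linear_sum linear_scale)
qed

text \<open>In the chain rule the derivative of \<open>f\<close> is taken at a varying point and in
  a varying direction. Expanding the direction in \<open>Basis\<close> gives a finite sum of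
  products in which each derivative of \<open>f\<close> has a fixed direction and falls under the
  induction hypothesis.\<close>

lemma Ck_on_compose:
  fixes f :: "'b::euclidean_space \<Rightarrow> 'c::real_normed_vector"
    and g :: "'a::real_normed_vector \<Rightarrow> 'b"
  assumes "open S" "open T" "g ` S \<subseteq> T" "Ck_on n T f" "Ck_on n S g"
  shows "Ck_on n S (\<lambda>x. f (g x))"
  using assms(4,5)
proof (induction n arbitrary: f)
  case 0
  then show ?case
    using continuous_on_compose2 assms(3) by auto
next
  case (Suc n)
  have D: "((\<lambda>x. f (g x)) has_derivative
      (\<lambda>v. frechet_derivative f (at (g x)) (frechet_derivative g (at x) v))) (at x)"
    if "x \<in> S" for x
    using Suc.prems that assms(3)
    by (intro has_derivative_compose[of g "frechet_derivative g (at x)" x UNIV f])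
      (auto simp: frechet_derivative_works[symmetric])
  have fd: "frechet_derivative (\<lambda>x. f (g x)) (at x) v =
      (\<Sum>b\<in>Basis. (frechet_derivative g (at x) v \<bullet> b) *\<^sub>R frechet_derivative f (at (g x)) b)"
    if "x \<in> S" for x v
  proof -
    have "f differentiable (at (g x))" using Suc.prems that assms(3) by auto
    then have "linear (frechet_derivative f (at (g x)))" by (rule linear_frechet_derivative)
    then show ?thesis
      unfolding frechet_derivative_at[OF D[OF that], symmetric] by (rule linear_eq_sum_Basis)
  qed
  have "Ck_on n S (\<lambda>x. frechet_derivative (\<lambda>x. f (g x)) (at x) v)" for v
  proof (rule Ck_on_cong[OF assms(1)])
    show "Ck_on n S (\<lambda>x. \<Sum>b\<in>Basis.
        (frechet_derivative g (at x) v \<bullet> b) *\<^sub>R frechet_derivative f (at (g x)) b)"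
      using Suc.prems
      by (intro Ck_on_sum Ck_on_bilinear[OF bounded_bilinear_scaleR] assms(1) Suc.IH
          Ck_on_bounded_linear_comp[OF _ bounded_linear_inner_left]) (auto intro: Ck_on_SucD)
  qed (use fd in auto)
  then show ?case using D by (auto simp: differentiable_def)
qed

text \<open>At a zero of \<open>g\<close> the factor \<open>f\<close> only has to be continuous,
  since its increments are multiplied by a quantity of first order. This serves where
  \<open>f\<close> is not yet known to be differentiable, or where differentiating it would be
  laborious.\<close>

lemma continuous_vanishing_product_has_derivative:
  fixes f :: "'a::real_normed_vector \<Rightarrow> real" and g :: "'a \<Rightarrow> 'b::real_normed_vector"
  assumes f: "isCont f x" and g: "(g has_derivative g') (at x)" and 0: "g x = 0"
  shows "((\<lambda>y. f y *\<^sub>R g y) has_derivative (\<lambda>h. f x *\<^sub>R g' h)) (at x)"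
proof -
  have bl: "bounded_linear g'" using g by (rule has_derivative_bounded_linear)
  obtain K where K: "\<And>h. norm (g' h) \<le> norm h * K" using bounded_linear.bounded[OF bl] by blast
  have 1: "(\<lambda>y. (1 / norm (y - x)) *\<^sub>R (g y - g' (y - x))) \<midarrow>x\<rightarrow> 0"
    using g 0 by (simp add: has_derivative_within divide_inverse_commute diff_diff_eq2 algebra_simps)
  have 2: "(\<lambda>y. f y *\<^sub>R ((1 / norm (y - x)) *\<^sub>R (g y - g' (y - x)))) \<midarrow>x\<rightarrow> 0"
    using tendsto_scaleR[OF f[unfolded isCont_def] 1] by simp
  \<comment> \<open>The second part of the error: the difference quotient of the linear map
    \<open>g'\<close> stays bounded while the increment of \<open>f\<close> tends to zero.\<close>
  have 3: "(\<lambda>y. (f y - f x) *\<^sub>R ((1 / norm (y - x)) *\<^sub>R g' (y - x))) \<midarrow>x\<rightarrow> 0"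
  proof (rule Lim_null_comparison)
    show "\<forall>\<^sub>F y in at x. norm ((f y - f x) *\<^sub>R ((1 / norm (y - x)) *\<^sub>R g' (y - x))) \<le> \<bar>f y - f x\<bar> * \<bar>K\<bar>"
    proof (rule eventually_at_topological[THEN iffD2], intro exI[of _ UNIV] conjI ballI impI)
      fix y assume "y \<noteq> x"
      then have "norm (g' (y - x)) / norm (y - x) \<le> \<bar>K\<bar>"
        using K[of "y - x"] order_trans[of "norm (g' (y - x))" "norm (y - x) * K" "norm (y - x) * \<bar>K\<bar>"]
        by (simp add: divide_le_eq mult.commute mult_right_mono)
      then show "norm ((f y - f x) *\<^sub>R ((1 / norm (y - x)) *\<^sub>R g' (y - x))) \<le> \<bar>f y - f x\<bar> * \<bar>K\<bar>"
        using mult_left_mono[of _ _ "\<bar>f y - f x\<bar>"] by fastforce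
    qed auto
    have "(\<lambda>y. \<bar>f y - f x\<bar> * \<bar>K\<bar>) \<midarrow>x\<rightarrow> \<bar>f x - f x\<bar> * \<bar>K\<bar>"
      using f by (intro tendsto_intros) (simp add: isCont_def)
    then show "(\<lambda>y. \<bar>f y - f x\<bar> * \<bar>K\<bar>) \<midarrow>x\<rightarrow> 0" by simp
  qed
  have "(\<lambda>y. (1 / norm (y - x)) *\<^sub>R (f y *\<^sub>R g y - (f x *\<^sub>R g x + f x *\<^sub>R g' (y - x)))) \<midarrow>x\<rightarrow> 0"
  proof -
    have "(\<lambda>y. (1 / norm (y - x)) *\<^sub>R (f y *\<^sub>R g y - (f x *\<^sub>R g x + f x *\<^sub>R g' (y - x)))) =
      (\<lambda>y. f y *\<^sub>R ((1 / norm (y - x)) *\<^sub>R (g y - g' (y - x))) +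
        (f y - f x) *\<^sub>R ((1 / norm (y - x)) *\<^sub>R g' (y - x)))"
      by (simp add: fun_eq_iff 0 algebra_simps diff_divide_distrib)
    then show ?thesis using tendsto_add[OF 2 3] by simp
  qed
  moreover have "bounded_linear (\<lambda>h. f x *\<^sub>R g' h)"
    using bl by (rule bounded_linear_const_scaleR)
  ultimately show ?thesis by (simp add: has_derivative_within)
qed

text \<open>The injective map \<open>A x\<close> is bounded below by some \<open>m\<close>, and
  every nearby \<open>A y\<close> is still bounded below by \<open>m / 2\<close>. Applied to
  \<open>s y - s x\<close> this bounds the increment of \<open>s\<close> by
  \<open>b y - A y (s x)\<close>, which tends to zero.\<close>

lemma Ck_on_solution_0:
  fixes A :: "'a::real_normed_vector \<Rightarrow> 'w::euclidean_space \<Rightarrow> 'w"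
  assumes S: "open S" and lin: "\<And>x. x \<in> S \<Longrightarrow> linear (A x)" and inj: "\<And>x. x \<in> S \<Longrightarrow> inj (A x)"
    and A: "\<And>w. continuous_on S (\<lambda>x. A x w)" and b: "continuous_on S b"
    and eq: "\<And>x. x \<in> S \<Longrightarrow> A x (s x) = b x"
  shows "continuous_on S s"
proof (rule continuous_at_imp_continuous_on, rule ballI)
  fix x assume x: "x \<in> S"
  obtain m where m: "m > 0" "\<And>z. m * norm z \<le> norm (A x z)"
    using linear_inj_bounded_below_pos[OF lin[OF x] inj[OF x]] by blast
  have Acont: "isCont (\<lambda>y. A y w) x" for w using A S x continuous_on_eq_continuous_at by blast
  have bcont: "isCont b x" using b S x continuous_on_eq_continuous_at by blast
  \<comment> \<open>This sum bounds the operator norm of \<open>A y - A x\<close>, and it is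
    continuous because each value on a basis vector is.\<close>
  have "(\<lambda>y. \<Sum>b\<in>Basis. norm (A y b - A x b)) \<midarrow>x\<rightarrow> (\<Sum>b\<in>Basis. norm (A x b - A x b))"
    using Acont by (intro tendsto_intros) (simp add: isCont_def)
  then have "\<forall>\<^sub>F y in at x. (\<Sum>b\<in>Basis. norm (A y b - A x b)) < m / 2"
    using m(1) by (intro order_tendstoD(2)) auto
  moreover have "\<forall>\<^sub>F y in at x. y \<in> S" using S x by (rule eventually_at_in_open')
  ultimately have ev: "\<forall>\<^sub>F y in at x. norm (s y - s x) \<le> 2 / m * norm (b y - A y (s x))"
  proof eventually_elim
    case (elim y)
    have "norm (A y z - A x z) \<le> m / 2 * norm z" for z
    proof -
      have "A y z - A x z = (\<Sum>b\<in>Basis. (z \<bullet> b) *\<^sub>R (A y b - A x b))"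
        using linear_eq_sum_Basis[OF lin[OF elim(2)], of z] linear_eq_sum_Basis[OF lin[OF x], of z]
        by (simp add: scaleR_diff_right sum_subtractf)
      also have "norm \<dots> \<le> (\<Sum>b\<in>Basis. norm z * norm (A y b - A x b))"
        by (rule sum_norm_le) (simp add: Basis_le_norm mult_right_mono)
      also have "\<dots> = norm z * (\<Sum>b\<in>Basis. norm (A y b - A x b))" by (simp add: sum_distrib_left)
      also have "\<dots> \<le> norm z * (m / 2)" using elim(1) by (intro mult_left_mono) auto
      finally show ?thesis by (simp add: mult.commute)
    qed
    then have "m * norm (s y - s x) \<le> norm (A y (s y - s x)) + m / 2 * norm (s y - s x)"
      using m(2)[of "s y - s x"] norm_triangle_sub[of "A x (s y - s x)" "A y (s y - s x)"]
      by (smt (verit) norm_minus_commute)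
    then have "m / 2 * norm (s y - s x) \<le> norm (b y - A y (s x))"
      using eq[OF elim(2)] lin[OF elim(2)] by (simp add: linear_diff)
    then show ?case using m(1) by (simp add: field_simps)
  qed
  have "(\<lambda>y. 2 / m * norm (b y - A y (s x))) \<midarrow>x\<rightarrow> 2 / m * norm (b x - A x (s x))"
    using Acont bcont by (intro tendsto_intros) (auto simp: isCont_def)
  then have "(\<lambda>y. 2 / m * norm (b y - A y (s x))) \<midarrow>x\<rightarrow> 0" using eq[OF x] by simp
  then have "(\<lambda>y. s y - s x) \<midarrow>x\<rightarrow> 0" using ev by (rule Lim_null_comparison[rotated])
  then show "isCont s x" by (simp add: isCont_def LIM_zero_iff)
qed

text \<open>Differentiating \<open>A x (s x) = b x\<close> shows that each directional derivative of
  \<open>s\<close> solves a system with the same matrix and a right-hand side of one order less.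
  Thus the induction runs on the equation and no formula for the inverse matrix is involved.\<close>

lemma Ck_on_solution:
  fixes A :: "'a::real_normed_vector \<Rightarrow> 'w::euclidean_space \<Rightarrow> 'w"
  assumes S: "open S" and lin: "\<And>x. x \<in> S \<Longrightarrow> linear (A x)" and inj: "\<And>x. x \<in> S \<Longrightarrow> inj (A x)"
    and "\<And>w. Ck_on n S (\<lambda>x. A x w)" and "Ck_on n S b"
    and "\<And>x. x \<in> S \<Longrightarrow> A x (s x) = b x"
  shows "Ck_on n S s"
  using assms(4-)
proof (induction n arbitrary: s b)
  case 0
  then show ?case using Ck_on_solution_0[OF S lin inj, where b = b and s = s] by simp
next
  case (Suc n)
  \<comment> \<open>The lower order comes first: continuity of \<open>s\<close> is used to
    differentiate it, and order \<open>n\<close> of \<open>s\<close> is used for the new right-hand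
    side.\<close>
  have s_n: "Ck_on n S s"
    by (rule Suc.IH[OF _ _ Suc.prems(3)]) (use Suc.prems in \<open>auto intro: Ck_on_SucD\<close>)
  define DA where "DA x w = frechet_derivative (\<lambda>y. A y w) (at x)" for x w
  define Db where "Db x = frechet_derivative b (at x)" for x
  have DA: "((\<lambda>y. A y w) has_derivative DA x w) (at x)" if "x \<in> S" for x w
    using Suc.prems(1)[of w] that by (auto simp: DA_def frechet_derivative_works)
  have Db: "(b has_derivative Db x) (at x)" if "x \<in> S" for x
    using Suc.prems(2) that by (auto simp: Db_def frechet_derivative_works)
  have D: "\<exists>D. (s has_derivative D) (at x) \<and>
      (\<forall>v. A x (D v) = Db x v - (\<Sum>e\<in>Basis. (s x \<bullet> e) *\<^sub>R DA x e v))" if x: "x \<in> S" for x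
  proof -
    obtain B where B: "linear B" "\<And>z. B (A x z) = z" "\<And>z. A x (B z) = z"
      using linear_injective_isomorphism[OF lin[OF x] inj[OF x]] by blast
    have blB: "bounded_linear B" using B(1) by (rule linear_conv_bounded_linear[THEN iffD1])
    have scont: "isCont s x" using Ck_on_imp_continuous_on[OF s_n] S x continuous_on_eq_continuous_at by blast
    \<comment> \<open>The system is rewritten with the fixed map \<open>A x\<close> on the left. The
      variation of \<open>A\<close> then sits in products of a component of \<open>s\<close>, known
      only to be continuous, with a function that vanishes at \<open>x\<close>.\<close>
    define R where "R y = b y - (\<Sum>e\<in>Basis. (s y \<bullet> e) *\<^sub>R (A y e - A x e))" for y
    have R: "B (R y) = s y" if "y \<in> S" for y
    proof -
      have "(\<Sum>e\<in>Basis. (s y \<bullet> e) *\<^sub>R (A y e - A x e)) = A y (s y) - A x (s y)"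
        using linear_eq_sum_Basis[OF lin[OF x], of "s y"] linear_eq_sum_Basis[OF lin[OF that], of "s y"]
        by (simp add: scaleR_diff_right sum_subtractf)
      then show ?thesis using Suc.prems(3)[OF that] B(2) by (simp add: R_def)
    qed
    have "(R has_derivative (\<lambda>v. Db x v - (\<Sum>e\<in>Basis. (s x \<bullet> e) *\<^sub>R DA x e v))) (at x)"
      unfolding R_def
    proof (intro has_derivative_diff has_derivative_sum Db x continuous_vanishing_product_has_derivative)
      show "isCont (\<lambda>y. s y \<bullet> e) x" for e using scont by (intro isCont_inner) auto
      show "((\<lambda>y. A y e - A x e) has_derivative DA x e) (at x)" for e
        using has_derivative_diff[OF DA[OF x, of e] has_derivative_const[of "A x e"]] by simp
    qed auto
    then have "((\<lambda>y. B (R y)) has_derivative (\<lambda>v. B (Db x v - (\<Sum>e\<in>Basis. (s x \<bullet> e) *\<^sub>R DA x e v)))) (at x)"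
      by (rule bounded_linear.has_derivative[OF blB])
    then have "(s has_derivative (\<lambda>v. B (Db x v - (\<Sum>e\<in>Basis. (s x \<bullet> e) *\<^sub>R DA x e v)))) (at x)"
      by (rule has_derivative_transform_within_open[OF _ S x R])
    then show ?thesis using B(3) by blast
  qed
  have diff: "s differentiable (at x)" if "x \<in> S" for x
    using D[OF that] by (auto simp: differentiable_def)
  have "Ck_on n S (\<lambda>x. frechet_derivative s (at x) v)" for v
  proof (rule Suc.IH)
    show "Ck_on n S (\<lambda>x. A x w)" for w using Suc.prems(1) by (rule Ck_on_SucD)
    show "Ck_on n S (\<lambda>x. Db x v - (\<Sum>e\<in>Basis. (s x \<bullet> e) *\<^sub>R DA x e v))"
    proof -
      have "Ck_on n S (\<lambda>x. Db x v + (\<Sum>e\<in>Basis. (- (s x \<bullet> e)) *\<^sub>R DA x e v))"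
      proof (intro Ck_on_add Ck_on_sum Ck_on_bilinear[OF bounded_bilinear_scaleR] S)
        show "Ck_on n S (\<lambda>x. - (s x \<bullet> e))" for e
          by (rule Ck_on_bounded_linear_comp[OF S _ s_n, of "\<lambda>z. - (z \<bullet> e)"])
            (intro bounded_linear_minus bounded_linear_inner_left)
        show "Ck_on n S (\<lambda>x. Db x v)" using Suc.prems(2) by (simp add: Db_def)
        show "Ck_on n S (\<lambda>x. DA x e v)" for e using Suc.prems(1) by (simp add: DA_def)
      qed
      then show ?thesis by (simp add: sum_negf)
    qed
    show "A x (frechet_derivative s (at x) v) = Db x v - (\<Sum>e\<in>Basis. (s x \<bullet> e) *\<^sub>R DA x e v)"
      if "x \<in> S" for x
      using D[OF that] frechet_derivative_at by metis
  qed
  then show ?case using diff by simp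
qed

text \<open>Two applications of the mean value theorem turn the second difference quotient over a
  small parallelogram into a value of one mixed derivative near \<open>x\<close>. The quotient
  itself is unchanged when \<open>v\<close> and \<open>w\<close> are exchanged, so both mixed
  derivatives are its limit.\<close>

lemma second_derivative_symmetric_real:
  fixes f :: "'a::real_normed_vector \<Rightarrow> real"
  assumes S: "open S" "x \<in> S" and f: "Ck_on 2 S f"
  shows "frechet_derivative (\<lambda>y. frechet_derivative f (at y) v) (at x) w =
    frechet_derivative (\<lambda>y. frechet_derivative f (at y) w) (at x) v"
proof -
  define D where "D v y = frechet_derivative f (at y) v" for v y
  define H where "H v w y = frechet_derivative (D v) (at y) w" for v w y
  have f2: "Ck_on (Suc (Suc 0)) S f" using f by (simp add: numeral_2_eq_2)
  have Df: "(f has_derivative (\<lambda>v. D v y)) (at y)" if "y \<in> S" for y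
    using f2 that by (simp add: D_def frechet_derivative_works)
  have DD: "(D v has_derivative (\<lambda>w. H v w y)) (at y)" if "y \<in> S" for y v
    using f2 that by (simp add: H_def D_def[abs_def] frechet_derivative_works)
  have Hc: "isCont (H v w) x" for v w
  proof -
    have "continuous_on S (H v w)" using f2 by (simp add: H_def[abs_def] D_def[abs_def])
    then show ?thesis using S continuous_on_eq_continuous_at by blast
  qed
  have key: "\<exists>\<delta>>0. \<forall>h. 0 < h \<and> h < \<delta> \<longrightarrow> \<bar>(f (x + h *\<^sub>R v + h *\<^sub>R w) - f (x + h *\<^sub>R v) - f (x + h *\<^sub>R w) + f x) / h^2 - H v w x\<bar> < e"
    if e: "e > 0" for e v w
  proof -
    have "\<forall>\<^sub>F y in nhds x. y \<in> S" using S by (simp add: eventually_nhds) blast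
    moreover have "\<forall>\<^sub>F y in nhds x. \<bar>H v w y - H v w x\<bar> < e"
      using Hc[of v w] e unfolding isCont_def tendsto_at_iff_tendsto_nhds
      by (auto dest: tendstoD simp: dist_real_def)
    ultimately have "\<forall>\<^sub>F y in nhds x. y \<in> S \<and> \<bar>H v w y - H v w x\<bar> < e" by (rule eventually_conj)
    then obtain r where r: "r > 0" "\<And>y. dist y x < r \<Longrightarrow> y \<in> S \<and> \<bar>H v w y - H v w x\<bar> < e"
      unfolding eventually_nhds_metric by blast
    \<comment> \<open>For steps below this bound the parallelogram spanned by
      \<open>h *\<^sub>R v\<close> and \<open>h *\<^sub>R w\<close> stays within distance
      \<open>r\<close> of \<open>x\<close>. The summand 1 keeps the denominator positive when both
      vectors are zero.\<close>
    define \<delta> where "\<delta> = r / (1 + norm v + norm w)"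
    have den: "1 + norm v + norm w > 0" by (smt (verit) norm_ge_zero)
    then have \<delta>: "\<delta> > 0" using r(1) by (simp add: \<delta>_def)
    have near: "x + s *\<^sub>R v + t *\<^sub>R w \<in> S \<and> \<bar>H v w (x + s *\<^sub>R v + t *\<^sub>R w) - H v w x\<bar> < e"
      if "0 \<le> s" "s \<le> h" "0 \<le> t" "t \<le> h" "h < \<delta>" for s t h
    proof (rule r(2))
      have "norm (s *\<^sub>R v + t *\<^sub>R w) \<le> s * norm v + t * norm w"
        using that norm_triangle_ineq[of "s *\<^sub>R v" "t *\<^sub>R w"] by simp
      also have "\<dots> \<le> h * norm v + h * norm w"
        using that by (intro add_mono mult_right_mono) auto
      also have "\<dots> \<le> h * (1 + norm v + norm w)" using that by (simp add: algebra_simps)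
      also have "\<dots> < \<delta> * (1 + norm v + norm w)" using that den by (intro mult_strict_right_mono) auto
      also have "\<dots> = r" using den by (simp add: \<delta>_def)
      finally show "dist (x + s *\<^sub>R v + t *\<^sub>R w) x < r" by (simp add: dist_norm add.assoc)
    qed
    have "\<bar>(f (x + h *\<^sub>R v + h *\<^sub>R w) - f (x + h *\<^sub>R v) - f (x + h *\<^sub>R w) + f x) / h^2 - H v w x\<bar> < e"
      if h: "0 < h" "h < \<delta>" for h
    proof -
      \<comment> \<open>The increment in direction \<open>w\<close>, as a function of the
        displacement in direction \<open>v\<close>. The second difference is
        \<open>\<phi> h - \<phi> 0\<close>.\<close>
      define \<phi> where "\<phi> s = f (x + s *\<^sub>R v + h *\<^sub>R w) - f (x + s *\<^sub>R v)" for s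
      have d1: "DERIV \<phi> s :> D v (x + s *\<^sub>R v + h *\<^sub>R w) - D v (x + s *\<^sub>R v)"
        if "0 \<le> s" "s \<le> h" for s
      proof -
        have in1: "x + s *\<^sub>R v + h *\<^sub>R w \<in> S" "x + s *\<^sub>R v \<in> S"
          using near[of s h h] near[of s h 0] that h by auto
        have lin: "linear (\<lambda>v. D v y)" if "y \<in> S" for y using Df[OF that] has_derivative_linear by blast
        have "(\<phi> has_derivative (\<lambda>r. D (r *\<^sub>R v) (x + s *\<^sub>R v + h *\<^sub>R w) - D (r *\<^sub>R v) (x + s *\<^sub>R v))) (at s)"
          unfolding \<phi>_def
        proof (rule has_derivative_diff)
          show "((\<lambda>s. f (x + s *\<^sub>R v + h *\<^sub>R w)) has_derivative (\<lambda>r. D (r *\<^sub>R v) (x + s *\<^sub>R v + h *\<^sub>R w))) (at s)"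
            by (rule has_derivative_compose[of "\<lambda>s. x + s *\<^sub>R v + h *\<^sub>R w" "\<lambda>r. r *\<^sub>R v" _ _ f, OF _ Df[OF in1(1)]])
              (auto intro!: derivative_eq_intros)
          show "((\<lambda>s. f (x + s *\<^sub>R v)) has_derivative (\<lambda>r. D (r *\<^sub>R v) (x + s *\<^sub>R v))) (at s)"
            by (rule has_derivative_compose[of "\<lambda>s. x + s *\<^sub>R v" "\<lambda>r. r *\<^sub>R v" _ _ f, OF _ Df[OF in1(2)]])
              (auto intro!: derivative_eq_intros)
        qed
        moreover have "(\<lambda>r. D (r *\<^sub>R v) (x + s *\<^sub>R v + h *\<^sub>R w) - D (r *\<^sub>R v) (x + s *\<^sub>R v)) =
            (*) (D v (x + s *\<^sub>R v + h *\<^sub>R w) - D v (x + s *\<^sub>R v))"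
          using linear_scale[OF lin[OF in1(1)]] linear_scale[OF lin[OF in1(2)]]
          by (simp add: fun_eq_iff) (simp add: algebra_simps)
        ultimately show ?thesis by (simp add: has_field_derivative_def)
      qed
      obtain s where s: "0 < s" "s < h" "\<phi> h - \<phi> 0 = (h - 0) * (D v (x + s *\<^sub>R v + h *\<^sub>R w) - D v (x + s *\<^sub>R v))"
        using MVT2[of 0 h \<phi> "\<lambda>s. D v (x + s *\<^sub>R v + h *\<^sub>R w) - D v (x + s *\<^sub>R v)", OF h(1) d1]
        by blast
      have d2: "DERIV (\<lambda>t. D v (x + s *\<^sub>R v + t *\<^sub>R w)) t :> H v w (x + s *\<^sub>R v + t *\<^sub>R w)"
        if "0 \<le> t" "t \<le> h" for t
      proof -
        have in1: "x + s *\<^sub>R v + t *\<^sub>R w \<in> S" using near[of s h t] that h s by auto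
        have lin: "linear (\<lambda>u. H v u (x + s *\<^sub>R v + t *\<^sub>R w))"
          using DD[OF in1] has_derivative_linear by blast
        have "((\<lambda>t. D v (x + s *\<^sub>R v + t *\<^sub>R w)) has_derivative
            (\<lambda>r. H v (r *\<^sub>R w) (x + s *\<^sub>R v + t *\<^sub>R w))) (at t)"
          by (rule has_derivative_compose[of "\<lambda>t. x + s *\<^sub>R v + t *\<^sub>R w" "\<lambda>r. r *\<^sub>R w" _ _ "D v", OF _ DD[OF in1]])
            (auto intro!: derivative_eq_intros)
        moreover have "(\<lambda>r. H v (r *\<^sub>R w) (x + s *\<^sub>R v + t *\<^sub>R w)) = (*) (H v w (x + s *\<^sub>R v + t *\<^sub>R w))"
          using linear_scale[OF lin] by (simp add: fun_eq_iff mult.commute)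
        ultimately show ?thesis by (simp add: has_field_derivative_def)
      qed
      obtain t where t: "0 < t" "t < h" "D v (x + s *\<^sub>R v + h *\<^sub>R w) - D v (x + s *\<^sub>R v + 0 *\<^sub>R w) = (h - 0) * H v w (x + s *\<^sub>R v + t *\<^sub>R w)"
        using MVT2[of 0 h "\<lambda>t. D v (x + s *\<^sub>R v + t *\<^sub>R w)"
            "\<lambda>t. H v w (x + s *\<^sub>R v + t *\<^sub>R w)", OF h(1) d2] by blast
      have "f (x + h *\<^sub>R v + h *\<^sub>R w) - f (x + h *\<^sub>R v) - f (x + h *\<^sub>R w) + f x = h^2 * H v w (x + s *\<^sub>R v + t *\<^sub>R w)"
        using s(3) t(3) by (simp add: \<phi>_def power2_eq_square algebra_simps)
      then have "(f (x + h *\<^sub>R v + h *\<^sub>R w) - f (x + h *\<^sub>R v) - f (x + h *\<^sub>R w) + f x) / h^2 = H v w (x + s *\<^sub>R v + t *\<^sub>R w)"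
        using h by simp
      then show ?thesis using near[of s h t] s t h by auto
    qed
    then show ?thesis using \<delta> by blast
  qed
  have "H v w x = H w v x"
  proof (rule ccontr)
    assume "H v w x \<noteq> H w v x"
    then have e: "\<bar>H v w x - H w v x\<bar> / 2 > 0" by simp
    obtain \<delta>1 where 1: "\<delta>1 > 0" "\<And>h. 0 < h \<and> h < \<delta>1 \<Longrightarrow> \<bar>(f (x + h *\<^sub>R v + h *\<^sub>R w) - f (x + h *\<^sub>R v) - f (x + h *\<^sub>R w) + f x) / h^2 - H v w x\<bar> < \<bar>H v w x - H w v x\<bar> / 2"
      using key[OF e, of v w] by blast
    obtain \<delta>2 where 2: "\<delta>2 > 0" "\<And>h. 0 < h \<and> h < \<delta>2 \<Longrightarrow> \<bar>(f (x + h *\<^sub>R w + h *\<^sub>R v) - f (x + h *\<^sub>R w) - f (x + h *\<^sub>R v) + f x) / h^2 - H w v x\<bar> < \<bar>H v w x - H w v x\<bar> / 2"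
      using key[OF e, of w v] by blast
    define h where "h = min \<delta>1 \<delta>2 / 2"
    have h: "0 < h" "h < \<delta>1" "h < \<delta>2" using 1 2 by (auto simp: h_def)
    have "f (x + h *\<^sub>R w + h *\<^sub>R v) - f (x + h *\<^sub>R w) - f (x + h *\<^sub>R v) + f x = f (x + h *\<^sub>R v + h *\<^sub>R w) - f (x + h *\<^sub>R v) - f (x + h *\<^sub>R w) + f x"
      by (simp add: algebra_simps)
    moreover have False if "\<bar>Q - a\<bar> < \<bar>a - b\<bar> / 2" "\<bar>Q - b\<bar> < \<bar>a - b\<bar> / 2" for Q a b :: real
      using that by (auto simp: abs_if split: if_splits)
    ultimately show False
      using 1(2)[OF conjI[OF h(1,2)]] 2(2)[OF conjI[OF h(1,3)]] by metis
  qed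
  then show ?thesis by (simp add: H_def D_def[abs_def])
qed

lemma second_derivative_symmetric:
  fixes f :: "'a::real_normed_vector \<Rightarrow> 'b::euclidean_space"
  assumes S: "open S" "x \<in> S" and f: "Ck_on 2 S f"
  shows "frechet_derivative (\<lambda>y. frechet_derivative f (at y) v) (at x) w =
    frechet_derivative (\<lambda>y. frechet_derivative f (at y) w) (at x) v"
proof (rule euclidean_eqI)
  fix b :: 'b assume "b \<in> Basis"
  have f2: "Ck_on (Suc (Suc 0)) S f" using f by (simp add: numeral_2_eq_2)
  have 1: "frechet_derivative (\<lambda>y. f y \<bullet> b) (at y) v = frechet_derivative f (at y) v \<bullet> b" if "y \<in> S" for y v
  proof -
    have "(f has_derivative frechet_derivative f (at y)) (at y)" using f2 that by (simp add: frechet_derivative_works)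
    then have "((\<lambda>y. f y \<bullet> b) has_derivative (\<lambda>v. frechet_derivative f (at y) v \<bullet> b)) (at y)"
      by (rule has_derivative_inner_left)
    from frechet_derivative_at[OF this] show ?thesis by metis
  qed
  have 2: "frechet_derivative (\<lambda>y. frechet_derivative (\<lambda>y. f y \<bullet> b) (at y) v) (at x) w
      = frechet_derivative (\<lambda>y. frechet_derivative f (at y) v) (at x) w \<bullet> b" for v w
  proof -
    have "(\<lambda>y. frechet_derivative f (at y) v) differentiable (at x)" using f2 S by simp
    then have "((\<lambda>y. frechet_derivative f (at y) v) has_derivative frechet_derivative (\<lambda>y. frechet_derivative f (at y) v) (at x)) (at x)"
      by (simp add: frechet_derivative_works)
    then have "((\<lambda>y. frechet_derivative f (at y) v \<bullet> b) has_derivative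
        (\<lambda>w. frechet_derivative (\<lambda>y. frechet_derivative f (at y) v) (at x) w \<bullet> b)) (at x)"
      by (rule has_derivative_inner_left)
    then have "((\<lambda>y. frechet_derivative (\<lambda>y. f y \<bullet> b) (at y) v) has_derivative
        (\<lambda>w. frechet_derivative (\<lambda>y. frechet_derivative f (at y) v) (at x) w \<bullet> b)) (at x)"
      by (rule has_derivative_transform_within_open[OF _ S]) (simp add: 1)
    from frechet_derivative_at[OF this] show ?thesis by metis
  qed
  have "Ck_on 2 S (\<lambda>y. f y \<bullet> b)"
    by (rule Ck_on_bounded_linear_comp[OF S(1) bounded_linear_inner_left f])
  from second_derivative_symmetric_real[OF S this, of v w]
  show "frechet_derivative (\<lambda>y. frechet_derivative f (at y) v) (at x) w \<bullet> b =
    frechet_derivative (\<lambda>y. frechet_derivative f (at y) w) (at x) v \<bullet> b"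
    by (simp add: 2)
qed

section \<open>Smooth functions on a manifold\<close>

lemma smooth_on_cong:
  "open S \<Longrightarrow> (\<And>x. x \<in> S \<Longrightarrow> f x = g x) \<Longrightarrow> smooth_on S f \<Longrightarrow> smooth_on S g"
  unfolding smooth_on_def using Ck_on_cong by blast

lemma smooth_on_subset: "smooth_on S f \<Longrightarrow> T \<subseteq> S \<Longrightarrow> smooth_on T f"
  unfolding smooth_on_def using Ck_on_subset by blast

lemma smooth_on_local:
  "(\<And>x. x \<in> S \<Longrightarrow> \<exists>T. open T \<and> x \<in> T \<and> smooth_on T f) \<Longrightarrow> smooth_on S f"
  unfolding smooth_on_def
proof (intro allI Ck_on_local)
  fix n x
  assume "\<And>x. x \<in> S \<Longrightarrow> \<exists>T. open T \<and> x \<in> T \<and> (\<forall>n. Ck_on n T f)" "x \<in> S"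
  then show "\<exists>T. open T \<and> x \<in> T \<and> Ck_on n T f" by meson
qed

lemma smooth_on_const [simp]: "smooth_on S (\<lambda>x. c)"
  by (simp add: smooth_on_def)

lemma smooth_on_bounded_linear: "bounded_linear h \<Longrightarrow> smooth_on S h"
  by (simp add: smooth_on_def Ck_on_bounded_linear)

lemma smooth_on_bounded_linear_comp:
  "open S \<Longrightarrow> bounded_linear h \<Longrightarrow> smooth_on S f \<Longrightarrow> smooth_on S (\<lambda>x. h (f x))"
  by (simp add: smooth_on_def Ck_on_bounded_linear_comp)

lemma smooth_on_add: "open S \<Longrightarrow> smooth_on S f \<Longrightarrow> smooth_on S g \<Longrightarrow> smooth_on S (\<lambda>x. f x + g x)"
  by (simp add: smooth_on_def Ck_on_add)

lemma smooth_on_sum: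
  "open S \<Longrightarrow> (\<And>i. i \<in> I \<Longrightarrow> smooth_on S (f i)) \<Longrightarrow> smooth_on S (\<lambda>x. \<Sum>i\<in>I. f i x)"
  by (simp add: smooth_on_def Ck_on_sum)

lemma smooth_on_bilinear:
  "bounded_bilinear prd \<Longrightarrow> open S \<Longrightarrow> smooth_on S f \<Longrightarrow> smooth_on S g \<Longrightarrow> smooth_on S (\<lambda>x. prd (f x) (g x))"
  by (simp add: smooth_on_def Ck_on_bilinear)

lemma smooth_on_compose:
  fixes f :: "'b::euclidean_space \<Rightarrow> 'c::real_normed_vector"
  shows "open S \<Longrightarrow> open T \<Longrightarrow> g ` S \<subseteq> T \<Longrightarrow> smooth_on T f \<Longrightarrow> smooth_on S g \<Longrightarrow> smooth_on S (\<lambda>x. f (g x))"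
  unfolding smooth_on_def by (blast intro: Ck_on_compose)

lemma smooth_on_solution:
  fixes A :: "'a::real_normed_vector \<Rightarrow> 'w::euclidean_space \<Rightarrow> 'w"
  assumes "open S" "\<And>x. x \<in> S \<Longrightarrow> linear (A x)" "\<And>x. x \<in> S \<Longrightarrow> inj (A x)"
    and "\<And>w. smooth_on S (\<lambda>x. A x w)" and "smooth_on S b"
    and "\<And>x. x \<in> S \<Longrightarrow> A x (s x) = b x"
  shows "smooth_on S s"
  unfolding smooth_on_def
proof
  fix n
  show "Ck_on n S s"
    by (rule Ck_on_solution[OF assms(1-3) _ _ assms(6)]) (use assms(4,5) in \<open>auto simp: smooth_on_def\<close>)
qed

lemma smooth_on_differentiable: "smooth_on S f \<Longrightarrow> x \<in> S \<Longrightarrow> f differentiable (at x)"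
  unfolding smooth_on_def by (metis Ck_on.simps(2))

lemma smooth_on_has_derivative:
  "smooth_on S f \<Longrightarrow> x \<in> S \<Longrightarrow> (f has_derivative frechet_derivative f (at x)) (at x)"
  using smooth_on_differentiable frechet_derivative_works by blast

lemma smooth_on_frechet_derivative: "smooth_on S f \<Longrightarrow> smooth_on S (\<lambda>x. frechet_derivative f (at x) v)"
  unfolding smooth_on_def by (metis Ck_on.simps(2))

lemma smooth_on_continuous_on: "smooth_on S f \<Longrightarrow> continuous_on S f"
  unfolding smooth_on_def by (metis Ck_on.simps(1))

text \<open>Product rule for a varying linear map applied to a varying vector. The maps are only
  assumed differentiable on each fixed vector, which is the form in which frames and Christoffel
  symbols are given; expansion in \<open>Basis\<close> supplies the rest.\<close>

lemma has_derivative_linear_family: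
  fixes s :: "'a::real_normed_vector \<Rightarrow> 'w::euclidean_space"
    and A :: "'a \<Rightarrow> 'w \<Rightarrow> 'b::real_normed_vector"
  assumes S: "open S" "x \<in> S" and lin: "\<And>y. y \<in> S \<Longrightarrow> linear (A y)"
    and A: "\<And>w. ((\<lambda>y. A y w) has_derivative DA w) (at x)"
    and s: "(s has_derivative Ds) (at x)"
  shows "((\<lambda>y. A y (s y)) has_derivative (\<lambda>h. DA (s x) h + A x (Ds h))) (at x)"
proof -
  have eq: "A y w = (\<Sum>b\<in>Basis. (w \<bullet> b) *\<^sub>R A y b)" if "y \<in> S" for y w
    by (rule linear_eq_sum_Basis[OF lin[OF that]])
  have "((\<lambda>y. \<Sum>b\<in>Basis. (s x \<bullet> b) *\<^sub>R A y b) has_derivative (\<lambda>h. \<Sum>b\<in>Basis. (s x \<bullet> b) *\<^sub>R DA b h)) (at x)"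
    by (intro has_derivative_sum has_derivative_scaleR_right A)
  then have "((\<lambda>y. A y (s x)) has_derivative (\<lambda>h. \<Sum>b\<in>Basis. (s x \<bullet> b) *\<^sub>R DA b h)) (at x)"
    by (rule has_derivative_transform_within_open[OF _ S]) (rule eq[symmetric])
  then have DA: "DA (s x) = (\<lambda>h. \<Sum>b\<in>Basis. (s x \<bullet> b) *\<^sub>R DA b h)"
    using A has_derivative_unique by blast
  have "((\<lambda>y. \<Sum>b\<in>Basis. (s y \<bullet> b) *\<^sub>R A y b) has_derivative
      (\<lambda>h. \<Sum>b\<in>Basis. (s x \<bullet> b) *\<^sub>R DA b h + (Ds h \<bullet> b) *\<^sub>R A x b)) (at x)"
    by (intro has_derivative_sum has_derivative_scaleR has_derivative_inner_left s A)
  then have "((\<lambda>y. A y (s y)) has_derivative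
      (\<lambda>h. \<Sum>b\<in>Basis. (s x \<bullet> b) *\<^sub>R DA b h + (Ds h \<bullet> b) *\<^sub>R A x b)) (at x)"
    by (rule has_derivative_transform_within_open[OF _ S]) (rule eq[symmetric])
  moreover have "A x (Ds h) = (\<Sum>b\<in>Basis. (Ds h \<bullet> b) *\<^sub>R A x b)" for h by (rule eq[OF S(2)])
  ultimately show ?thesis unfolding DA by (simp only: sum.distrib)
qed

text \<open>Components of vector fields and of sections have values in Euclidean spaces, whereas
  \<open>smooth_fun_on\<close> speaks of real functions.\<close>

definition smooth_fn ::
  "('a, 'e::euclidean_space) atlas \<Rightarrow> 'a set \<Rightarrow> ('a \<Rightarrow> 'b::real_normed_vector) \<Rightarrow> bool" where
  "smooth_fn A U f \<longleftrightarrow> (\<forall>c\<in>A. smooth_on (cmap c ` (U \<inter> cdom c)) (\<lambda>u. f (cinv c u)))"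

lemma smooth_fun_on_eq: "smooth_fun_on A U f = smooth_fn A U f"
  by (simp add: smooth_fun_on_def smooth_fn_def o_def)

section \<open>Smooth functions, tangent vectors and directional derivatives in charts\<close>

locale atlas =
  fixes A :: "('a, 'e::euclidean_space) atlas"
  assumes smooth_atlas: "smooth_atlas A"
begin

lemma cinv_cmap [simp]: "c \<in> A \<Longrightarrow> x \<in> cdom c \<Longrightarrow> cinv c (cmap c x) = x"
  using smooth_atlas by (simp add: smooth_atlas_def cinv_def)

lemma cmap_image_iff: "c \<in> A \<Longrightarrow> x \<in> cdom c \<Longrightarrow> U \<subseteq> cdom c \<Longrightarrow> cmap c x \<in> cmap c ` U \<longleftrightarrow> x \<in> U"
  using smooth_atlas by (auto simp: smooth_atlas_def dest: inj_onD)

lemma open_overlap: "c \<in> A \<Longrightarrow> d \<in> A \<Longrightarrow> open (cmap c ` (cdom c \<inter> cdom d))"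
  using smooth_atlas by (simp add: smooth_atlas_def)

lemma smooth_transition:
  "c \<in> A \<Longrightarrow> d \<in> A \<Longrightarrow> smooth_on (cmap c ` (cdom c \<inter> cdom d)) (\<lambda>u. cmap d (cinv c u))"
  using smooth_atlas by (simp add: smooth_atlas_def o_def)

lemma open_in_image: "open_in A U \<Longrightarrow> c \<in> A \<Longrightarrow> open (cmap c ` (U \<inter> cdom c))"
  by (simp add: open_in_def)

lemma open_in_points: "open_in A U \<Longrightarrow> U \<subseteq> points A"
  by (simp add: open_in_def)

lemma cdom_points: "c \<in> A \<Longrightarrow> x \<in> cdom c \<Longrightarrow> x \<in> points A"
  by (auto simp: points_def)

lemma pointsE: "x \<in> points A \<Longrightarrow> (\<And>c. c \<in> A \<Longrightarrow> x \<in> cdom c \<Longrightarrow> thesis) \<Longrightarrow> thesis"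
  by (auto simp: points_def)

lemma open_in_cdom: "c \<in> A \<Longrightarrow> open_in A (cdom c)"
  unfolding open_in_def using open_overlap[of _ c] by (auto simp: points_def Int_commute)

lemma open_in_Int: "open_in A U \<Longrightarrow> open_in A V \<Longrightarrow> open_in A (U \<inter> V)"
  using istopology_open_in[OF smooth_atlas] by (simp add: istopology_def)

lemma open_in_Union: "(\<And>U. U \<in> \<U> \<Longrightarrow> open_in A U) \<Longrightarrow> open_in A (\<Union>\<U>)"
  using istopology_open_in[OF smooth_atlas] by (simp add: istopology_def)

lemma smooth_fn_on_chart:
  "smooth_fn A U f \<Longrightarrow> c \<in> A \<Longrightarrow> U \<subseteq> cdom c \<Longrightarrow> smooth_on (cmap c ` U) (\<lambda>u. f (cinv c u))"
  unfolding smooth_fn_def by (metis inf.absorb1)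

lemma smooth_fn_chartI:
  assumes c: "c \<in> A" "U \<subseteq> cdom c" "open_in A U" and f: "smooth_on (cmap c ` U) (\<lambda>u. f (cinv c u))"
  shows "smooth_fn A U f"
  unfolding smooth_fn_def
proof
  fix d assume d: "d \<in> A"
  have od: "open (cmap d ` (U \<inter> cdom d))" using c(3) d by (rule open_in_image)
  have oc: "open (cmap c ` U)" using open_in_image[OF c(3,1)] c(2) by (simp add: inf.absorb1)
  have "smooth_on (cmap d ` (U \<inter> cdom d)) (\<lambda>u. f (cinv c (cmap c (cinv d u))))"
    by (rule smooth_on_compose[OF od oc _ f smooth_on_subset[OF smooth_transition[OF d c(1)]]])
      (use c d in auto)
  then show "smooth_on (cmap d ` (U \<inter> cdom d)) (\<lambda>u. f (cinv d u))"
    by (rule smooth_on_cong[OF od, rotated]) (use c d in auto)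
qed

lemma smooth_fn_localI:
  assumes "\<And>x. x \<in> U \<Longrightarrow> \<exists>V. open_in A V \<and> x \<in> V \<and> smooth_fn A V f"
  shows "smooth_fn A U f"
  unfolding smooth_fn_def
proof (intro ballI smooth_on_local)
  fix c u assume c: "c \<in> A" and u: "u \<in> cmap c ` (U \<inter> cdom c)"
  then obtain x where x: "x \<in> U" "x \<in> cdom c" "u = cmap c x" by auto
  obtain V where "open_in A V" "x \<in> V" "smooth_fn A V f" using assms[OF x(1)] by auto
  then show "\<exists>T. open T \<and> u \<in> T \<and> smooth_on T (\<lambda>u. f (cinv c u))"
    using c x by (intro exI[of _ "cmap c ` (V \<inter> cdom c)"]) (auto simp: smooth_fn_def open_in_image)
qed

lemma smooth_fn_cong:
  assumes "open_in A U" "\<And>x. x \<in> U \<Longrightarrow> f x = g x" "smooth_fn A U f"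
  shows "smooth_fn A U g"
  unfolding smooth_fn_def
proof
  fix c assume c: "c \<in> A"
  show "smooth_on (cmap c ` (U \<inter> cdom c)) (\<lambda>u. g (cinv c u))"
    by (rule smooth_on_cong[of _ "\<lambda>u. f (cinv c u)"])
      (use assms c in \<open>auto simp: smooth_fn_def open_in_image\<close>)
qed

lemma smooth_fn_subset: "smooth_fn A U f \<Longrightarrow> V \<subseteq> U \<Longrightarrow> smooth_fn A V f"
  unfolding smooth_fn_def by (meson Int_mono image_mono order_refl smooth_on_subset)

lemma smooth_fn_const [simp]: "smooth_fn A U (\<lambda>x. k)"
  by (simp add: smooth_fn_def)

lemma smooth_fn_bounded_linear:
  "open_in A U \<Longrightarrow> bounded_linear h \<Longrightarrow> smooth_fn A U f \<Longrightarrow> smooth_fn A U (\<lambda>x. h (f x))"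
  unfolding smooth_fn_def by (auto intro: smooth_on_bounded_linear_comp[where h = h] open_in_image)

lemma smooth_fn_add:
  "open_in A U \<Longrightarrow> smooth_fn A U f \<Longrightarrow> smooth_fn A U g \<Longrightarrow> smooth_fn A U (\<lambda>x. f x + g x)"
  by (simp add: smooth_fn_def smooth_on_add open_in_image)

lemma smooth_fn_sum:
  "open_in A U \<Longrightarrow> (\<And>i. i \<in> I \<Longrightarrow> smooth_fn A U (f i)) \<Longrightarrow> smooth_fn A U (\<lambda>x. \<Sum>i\<in>I. f i x)"
  by (simp add: smooth_fn_def smooth_on_sum open_in_image)

lemma smooth_fn_bilinear:
  "bounded_bilinear prd \<Longrightarrow> open_in A U \<Longrightarrow> smooth_fn A U f \<Longrightarrow> smooth_fn A U g \<Longrightarrow>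
    smooth_fn A U (\<lambda>x. prd (f x) (g x))"
  unfolding smooth_fn_def by (auto intro: smooth_on_bilinear[where prd = prd] open_in_image)

lemma smooth_fn_scaleR:
  "open_in A U \<Longrightarrow> smooth_fn A U f \<Longrightarrow> smooth_fn A U g \<Longrightarrow> smooth_fn A U (\<lambda>x. f x *\<^sub>R g x)"
  by (rule smooth_fn_bilinear[OF bounded_bilinear_scaleR])

lemma smooth_fn_inner_left: "open_in A U \<Longrightarrow> smooth_fn A U f \<Longrightarrow> smooth_fn A U (\<lambda>x. f x \<bullet> b)"
  by (rule smooth_fn_bounded_linear[OF _ bounded_linear_inner_left])

text \<open>The device by which implicitly defined coefficients become smooth: it is applied to Gram
  matrices of frames.\<close>

lemma smooth_fn_solution:
  fixes F :: "'a \<Rightarrow> 'w::euclidean_space \<Rightarrow> 'w"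
  assumes "open_in A U" "\<And>x. x \<in> U \<Longrightarrow> linear (F x)" "\<And>x. x \<in> U \<Longrightarrow> inj (F x)"
    and "\<And>w. smooth_fn A U (\<lambda>x. F x w)" and "smooth_fn A U b" and "\<And>x. x \<in> U \<Longrightarrow> F x (s x) = b x"
  shows "smooth_fn A U s"
  unfolding smooth_fn_def
proof
  fix c assume c: "c \<in> A"
  show "smooth_on (cmap c ` (U \<inter> cdom c)) (\<lambda>u. s (cinv c u))"
    by (rule smooth_on_solution[where A = "\<lambda>u. F (cinv c u)" and b = "\<lambda>u. b (cinv c u)"])
      (use assms c in \<open>auto simp: smooth_fn_def open_in_image\<close>)
qed

lemma smooth_fn_compose:
  fixes h :: "'w::euclidean_space \<Rightarrow> 'b::real_normed_vector"
  assumes "open_in A U" "open T" "s ` U \<subseteq> T" "smooth_on T h" "smooth_fn A U s"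
  shows "smooth_fn A U (\<lambda>x. h (s x))"
  unfolding smooth_fn_def
proof
  fix c assume c: "c \<in> A"
  show "smooth_on (cmap c ` (U \<inter> cdom c)) (\<lambda>u. h (s (cinv c u)))"
    by (rule smooth_on_compose[OF _ assms(2) _ assms(4)])
      (use assms c in \<open>auto simp: smooth_fn_def open_in_image\<close>)
qed

lemma smooth_fn_cmap: "c \<in> A \<Longrightarrow> smooth_fn A (cdom c) (cmap c)"
proof (rule smooth_fn_chartI[of c])
  assume c: "c \<in> A"
  show "smooth_on (cmap c ` cdom c) (\<lambda>u. cmap c (cinv c u))"
    using smooth_transition[OF c c] by simp
qed (auto intro: open_in_cdom)

lemma smooth_on_chart_comp:
  fixes h :: "'e \<Rightarrow> 'b::real_normed_vector"
  assumes "c \<in> A" "U \<subseteq> cdom c" "open_in A U" "smooth_on (cmap c ` U) h"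
  shows "smooth_fn A U (\<lambda>x. h (cmap c x))"
  by (rule smooth_fn_compose[OF assms(3) _ _ assms(4) smooth_fn_subset[OF smooth_fn_cmap[OF assms(1)] assms(2)]])
    (use open_in_image[OF assms(3,1)] assms(2) in \<open>auto simp: inf.absorb1\<close>)

text \<open>First-order statements at \<open>x\<close> require smoothness on some neighbourhood
  only. Hiding that neighbourhood lets functions with different domains be combined.\<close>

definition smooth_near :: "'a \<Rightarrow> ('a \<Rightarrow> 'b::real_normed_vector) \<Rightarrow> bool" where
  "smooth_near x f \<longleftrightarrow> (\<exists>U. open_in A U \<and> x \<in> U \<and> smooth_fn A U f)"

lemma smooth_nearI: "open_in A U \<Longrightarrow> x \<in> U \<Longrightarrow> smooth_fn A U f \<Longrightarrow> smooth_near x f"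
  by (auto simp: smooth_near_def)

lemma smooth_near_has_derivative:
  assumes "smooth_near x f" "c \<in> A" "x \<in> cdom c"
  shows "((\<lambda>u. f (cinv c u)) has_derivative frechet_derivative (\<lambda>u. f (cinv c u)) (at (cmap c x))) (at (cmap c x))"
proof -
  obtain U where U: "open_in A U" "x \<in> U" "smooth_fn A U f" using assms by (auto simp: smooth_near_def)
  then have "smooth_on (cmap c ` (U \<inter> cdom c)) (\<lambda>u. f (cinv c u))" using assms by (simp add: smooth_fn_def)
  then show ?thesis using U assms by (intro smooth_on_has_derivative) auto
qed

lemma transition_has_derivative:
  assumes "c \<in> A" "d \<in> A" "x \<in> cdom c" "x \<in> cdom d"
  shows "((\<lambda>u. cmap d (cinv c u)) has_derivative
    frechet_derivative (\<lambda>u. cmap d (cinv c u)) (at (cmap c x))) (at (cmap c x))"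
  by (rule smooth_on_has_derivative[OF smooth_transition]) (use assms in auto)

lemma has_derivative_change_chart:
  assumes c: "c \<in> A" "x \<in> cdom c" and d: "d \<in> A" "x \<in> cdom d"
    and D: "((\<lambda>u. f (cinv c u)) has_derivative D) (at (cmap c x))"
  shows "((\<lambda>u. f (cinv d u)) has_derivative
    (\<lambda>w. D (frechet_derivative (\<lambda>u. cmap c (cinv d u)) (at (cmap d x)) w))) (at (cmap d x))"
proof -
  have D': "((\<lambda>u. f (cinv c u)) has_derivative D) (at (cmap c (cinv d (cmap d x))))"
    using D d by simp
  have "((\<lambda>u. f (cinv c (cmap c (cinv d u)))) has_derivative
    (\<lambda>w. D (frechet_derivative (\<lambda>u. cmap c (cinv d u)) (at (cmap d x)) w))) (at (cmap d x))"
    by (rule has_derivative_compose[OF transition_has_derivative D']) (use c d in auto)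
  then show ?thesis
  proof (rule has_derivative_transform_within_open)
    show "open (cmap d ` (cdom d \<inter> cdom c))" using c d by (simp add: open_overlap)
  qed (use c d in auto)
qed

text \<open>The cocycle identity of the transition maps; it is what makes \<open>coord_field\<close>
  satisfy the transformation law of tangent vectors.\<close>

lemma transition_chain:
  assumes "c \<in> A" "d \<in> A" "e \<in> A" "x \<in> cdom c" "x \<in> cdom d" "x \<in> cdom e"
  shows "frechet_derivative (\<lambda>u. cmap e (cinv c u)) (at (cmap c x)) w =
    frechet_derivative (\<lambda>u. cmap e (cinv d u)) (at (cmap d x))
      (frechet_derivative (\<lambda>u. cmap d (cinv c u)) (at (cmap c x)) w)"
  using frechet_derivative_at[OF has_derivative_change_chart[of d x c "cmap e", OF _ _ _ _ transition_has_derivative[of d e]]]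
    assms by metis

lemma transition_self:
  assumes "c \<in> A" "x \<in> cdom c"
  shows "frechet_derivative (\<lambda>u. cmap c (cinv c u)) (at (cmap c x)) w = w"
proof -
  have "((\<lambda>u. u) has_derivative (\<lambda>w. w)) (at (cmap c x))" by simp
  then have "((\<lambda>u. cmap c (cinv c u)) has_derivative (\<lambda>w. w)) (at (cmap c x))"
  proof (rule has_derivative_transform_within_open)
    show "open (cmap c ` (cdom c \<inter> cdom c))" using assms by (intro open_overlap)
  qed (use assms in auto)
  then show ?thesis by (metis frechet_derivative_at)
qed

lemma tangent_space_change:
  "v \<in> tangent_space A x \<Longrightarrow> c \<in> A \<Longrightarrow> d \<in> A \<Longrightarrow> x \<in> cdom c \<Longrightarrow> x \<in> cdom d \<Longrightarrow>
    v d = frechet_derivative (\<lambda>u. cmap d (cinv c u)) (at (cmap c x)) (v c)"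
  unfolding tangent_space_def o_def by blast

lemma tangent_outside: "v \<in> tangent_space A x \<Longrightarrow> c \<notin> A \<or> x \<notin> cdom c \<Longrightarrow> v c = 0"
  unfolding tangent_space_def by blast

text \<open>The transformation law fixes all components at charts around \<open>x\<close> from a
  single one, and the default value zero fixes the others. Most identities between tangent vectors
  are proved in one chart by this rule.\<close>

lemma tangent_eqI:
  assumes "u \<in> tangent_space A x" "v \<in> tangent_space A x" "c \<in> A" "x \<in> cdom c" "u c = v c"
  shows "u = v"
proof
  fix d
  show "u d = v d"
  proof (cases "d \<in> A \<and> x \<in> cdom d")
    case True
    then show ?thesis
      using tangent_space_change[OF assms(1,3)] tangent_space_change[OF assms(2,3)] assms(4,5) by simp
  next
    case False
    then show ?thesis using tangent_outside[OF assms(1)] tangent_outside[OF assms(2)] by metis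
  qed
qed

lemma subspace_tangent: "subspace (tangent_space A x)"
proof -
  have lin: "linear (frechet_derivative (\<lambda>u. cmap d (cinv c u)) (at (cmap c x)))"
    if "c \<in> A" "d \<in> A" "x \<in> cdom c" "x \<in> cdom d" for c d
    using transition_has_derivative[OF that] has_derivative_linear by blast
  have mem: "v \<in> tangent_space A x" if "\<And>c. c \<notin> A \<or> x \<notin> cdom c \<Longrightarrow> v c = 0"
    "\<And>c d. c \<in> A \<Longrightarrow> d \<in> A \<Longrightarrow> x \<in> cdom c \<Longrightarrow> x \<in> cdom d \<Longrightarrow>
      v d = frechet_derivative (\<lambda>u. cmap d (cinv c u)) (at (cmap c x)) (v c)" for v
    unfolding tangent_space_def o_def using that by blast
  show ?thesis
    unfolding subspace_def
  proof (intro conjI ballI allI)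
    show "0 \<in> tangent_space A x" by (rule mem) (auto simp: linear_0 lin)
    fix u v assume u: "u \<in> tangent_space A x"
    show "r *\<^sub>R u \<in> tangent_space A x" for r
    proof (rule mem)
      fix c d assume h: "c \<in> A" "d \<in> A" "x \<in> cdom c" "x \<in> cdom d"
      show "(r *\<^sub>R u) d = frechet_derivative (\<lambda>u. cmap d (cinv c u)) (at (cmap c x)) ((r *\<^sub>R u) c)"
        using tangent_space_change[OF u h] linear_scale[OF lin[OF h]] by simp
    qed (simp add: tangent_outside[OF u])
    assume v: "v \<in> tangent_space A x"
    show "u + v \<in> tangent_space A x"
    proof (rule mem)
      fix c d assume h: "c \<in> A" "d \<in> A" "x \<in> cdom c" "x \<in> cdom d"
      show "(u + v) d = frechet_derivative (\<lambda>u. cmap d (cinv c u)) (at (cmap c x)) ((u + v) c)"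
        using tangent_space_change[OF u h] tangent_space_change[OF v h] linear_add[OF lin[OF h]] by simp
    qed (simp add: tangent_outside[OF u] tangent_outside[OF v])
  qed
qed

lemma tangent_0 [simp]: "0 \<in> tangent_space A x"
  using subspace_tangent by (rule subspace_0)

lemma tangent_add: "u \<in> tangent_space A x \<Longrightarrow> v \<in> tangent_space A x \<Longrightarrow> u + v \<in> tangent_space A x"
  using subspace_tangent by (rule subspace_add)

lemma tangent_diff: "u \<in> tangent_space A x \<Longrightarrow> v \<in> tangent_space A x \<Longrightarrow> u - v \<in> tangent_space A x"
  using subspace_tangent by (rule subspace_diff)

lemma tangent_uminus: "u \<in> tangent_space A x \<Longrightarrow> - u \<in> tangent_space A x"
  using subspace_tangent by (rule subspace_neg)

lemma tangent_scaleR: "u \<in> tangent_space A x \<Longrightarrow> r *\<^sub>R u \<in> tangent_space A x"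
  using subspace_tangent by (rule subspace_scale)

lemma tangent_sum: "(\<And>i. i \<in> I \<Longrightarrow> u i \<in> tangent_space A x) \<Longrightarrow> (\<Sum>i\<in>I. u i) \<in> tangent_space A x"
  using subspace_tangent by (rule subspace_sum)

lemma coord_field_apply:
  "d \<in> A \<Longrightarrow> x \<in> cdom d \<Longrightarrow> coord_field A c w x d = frechet_derivative (\<lambda>u. cmap d (cinv c u)) (at (cmap c x)) w"
  by (simp add: coord_field_def o_def)

lemma coord_field_same [simp]: "c \<in> A \<Longrightarrow> x \<in> cdom c \<Longrightarrow> coord_field A c w x c = w"
  by (simp add: coord_field_apply transition_self)

lemma coord_field_tangent [simp]:
  assumes "c \<in> A" "x \<in> cdom c"
  shows "coord_field A c w x \<in> tangent_space A x"
  unfolding tangent_space_def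
proof (intro CollectI conjI allI ballI impI)
  fix d e assume "d \<in> A" "e \<in> A" "x \<in> cdom d \<and> x \<in> cdom e"
  then show "coord_field A c w x e = frechet_derivative (cmap e \<circ> cinv d) (at (cmap d x)) (coord_field A c w x d)"
    using assms transition_chain[of c d e x w] by (simp add: coord_field_apply o_def)
qed (auto simp: coord_field_def)

lemma coord_field_component:
  assumes "c \<in> A" "x \<in> cdom c" "v \<in> tangent_space A x"
  shows "coord_field A c (v c) x = v"
  by (rule tangent_eqI[OF _ assms(3,1,2)]) (use assms in auto)

lemma linear_coord_field:
  assumes "c \<in> A" "x \<in> cdom c"
  shows "linear (\<lambda>w. coord_field A c w x)"
proof (rule linearI)
  show "coord_field A c (v + w) x = coord_field A c v x + coord_field A c w x" for v w
    by (rule tangent_eqI[of _ x _ c]) (use assms in \<open>auto intro: tangent_add\<close>)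
  show "coord_field A c (r *\<^sub>R w) x = r *\<^sub>R coord_field A c w x" for r w
    by (rule tangent_eqI[of _ x _ c]) (use assms in \<open>auto intro: tangent_scaleR\<close>)
qed

lemma chart_at: "x \<in> points A \<Longrightarrow> chart_at A x \<in> A \<and> x \<in> cdom (chart_at A x)"
  unfolding chart_at_def by (rule someI_ex) (auto simp: points_def)

text \<open>Frees \<open>dir_deriv\<close> from the chart selected by \<open>chart_at\<close>: the
  chain rule for the transition map and the transformation law of \<open>v\<close> compensate each
  other.\<close>

lemma dir_derivI:
  assumes c: "c \<in> A" "x \<in> cdom c" and v: "v \<in> tangent_space A x"
    and D: "((\<lambda>u. f (cinv c u)) has_derivative D) (at (cmap c x))"
  shows "dir_deriv A f x v = D (v c)"
proof -
  let ?d = "chart_at A x"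
  have d: "?d \<in> A" "x \<in> cdom ?d" using chart_at cdom_points c by auto
  have "frechet_derivative (\<lambda>u. f (cinv ?d u)) (at (cmap ?d x)) =
      (\<lambda>w. D (frechet_derivative (\<lambda>u. cmap c (cinv ?d u)) (at (cmap ?d x)) w))"
    using has_derivative_change_chart[OF c d D] by (metis frechet_derivative_at)
  then show ?thesis
    using tangent_space_change[OF v d(1) c(1) d(2) c(2)] by (simp add: dir_deriv_def o_def)
qed

lemma dir_deriv_chart:
  assumes "smooth_near x f" "c \<in> A" "x \<in> cdom c" "v \<in> tangent_space A x"
  shows "dir_deriv A f x v = frechet_derivative (\<lambda>u. f (cinv c u)) (at (cmap c x)) (v c)"
  by (rule dir_derivI[OF assms(2-4) smooth_near_has_derivative[OF assms(1-3)]])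

lemma smooth_near_has_dir_deriv:
  assumes "smooth_near x f" "c \<in> A" "x \<in> cdom c"
  shows "((\<lambda>u. f (cinv c u)) has_derivative (\<lambda>w. dir_deriv A f x (coord_field A c w x))) (at (cmap c x))"
proof -
  have "dir_deriv A f x (coord_field A c w x) = frechet_derivative (\<lambda>u. f (cinv c u)) (at (cmap c x)) w" for w
    using dir_deriv_chart[OF assms, of "coord_field A c w x"] assms by simp
  then show ?thesis using smooth_near_has_derivative[OF assms] by simp
qed

lemma smooth_near_points: "smooth_near x f \<Longrightarrow> x \<in> points A"
  using open_in_points by (auto simp: smooth_near_def)

lemma dir_deriv_add_vec:
  assumes "smooth_near x f" "v \<in> tangent_space A x" "w \<in> tangent_space A x"
  shows "dir_deriv A f x (v + w) = dir_deriv A f x v + dir_deriv A f x w"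
proof -
  obtain c where c: "c \<in> A" "x \<in> cdom c" using smooth_near_points[OF assms(1)] by (rule pointsE)
  then show ?thesis
    using has_derivative_linear[OF smooth_near_has_derivative[OF assms(1) c]]
    by (simp add: dir_deriv_chart[OF assms(1) c] assms tangent_add linear_add)
qed

lemma dir_deriv_scaleR_vec:
  assumes "smooth_near x f" "v \<in> tangent_space A x"
  shows "dir_deriv A f x (r *\<^sub>R v) = r *\<^sub>R dir_deriv A f x v"
proof -
  obtain c where c: "c \<in> A" "x \<in> cdom c" using smooth_near_points[OF assms(1)] by (rule pointsE)
  then show ?thesis
    using has_derivative_linear[OF smooth_near_has_derivative[OF assms(1) c]]
    by (simp add: dir_deriv_chart[OF assms(1) c] assms tangent_scaleR linear_scale)
qed

lemma dir_deriv_const [simp]: "dir_deriv A (\<lambda>y. k) x v = 0"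
  by (simp add: dir_deriv_def o_def)

text \<open>Near \<open>x\<close> the two functions satisfy the same \<open>has_derivative\<close>
  statements, so the choice made by \<open>frechet_derivative\<close> is the same even where no
  derivative exists.\<close>

lemma dir_deriv_cong:
  assumes U: "open_in A U" "x \<in> U" and eq: "\<And>y. y \<in> U \<Longrightarrow> f y = g y"
  shows "dir_deriv A f x v = dir_deriv A g x v"
proof -
  let ?c = "chart_at A x"
  have c: "?c \<in> A" "x \<in> cdom ?c" using chart_at open_in_points U by auto
  have oc: "open (cmap ?c ` (U \<inter> cdom ?c))" using U c by (simp add: open_in_image)
  have eq': "f (cinv ?c u) = g (cinv ?c u)" if "u \<in> cmap ?c ` (U \<inter> cdom ?c)" for u
    using that eq c by auto
  have tr: "(f' has_derivative D) (at (cmap ?c x)) \<Longrightarrow> (\<And>u. u \<in> cmap ?c ` (U \<inter> cdom ?c) \<Longrightarrow> f' u = g' u) \<Longrightarrow>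
      (g' has_derivative D) (at (cmap ?c x))" for f' g' :: "'e \<Rightarrow> 'b" and D
    by (rule has_derivative_transform_within_open[of f' D "cmap ?c x" UNIV "cmap ?c ` (U \<inter> cdom ?c)"])
      (use oc U c in auto)
  have "((\<lambda>u. f (cinv ?c u)) has_derivative D) (at (cmap ?c x)) \<longleftrightarrow>
      ((\<lambda>u. g (cinv ?c u)) has_derivative D) (at (cmap ?c x))" for D
    using tr[of "\<lambda>u. f (cinv ?c u)" D "\<lambda>u. g (cinv ?c u)"] tr[of "\<lambda>u. g (cinv ?c u)" D "\<lambda>u. f (cinv ?c u)"] eq'
    by fastforce
  then show ?thesis by (simp add: dir_deriv_def frechet_derivative_def o_def)
qed

lemma dir_deriv_bounded_linear:
  assumes "smooth_near x f" "v \<in> tangent_space A x" "bounded_linear h"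
  shows "dir_deriv A (\<lambda>y. h (f y)) x v = h (dir_deriv A f x v)"
proof -
  obtain c where c: "c \<in> A" "x \<in> cdom c" using smooth_near_points[OF assms(1)] by (rule pointsE)
  show ?thesis
    using dir_derivI[OF c assms(2) bounded_linear.has_derivative[OF assms(3) smooth_near_has_derivative[OF assms(1) c]]]
    by (simp add: dir_deriv_chart[OF assms(1) c assms(2)])
qed

lemma dir_deriv_bilinear:
  assumes "bounded_bilinear prd" "smooth_near x f" "smooth_near x g" "v \<in> tangent_space A x"
  shows "dir_deriv A (\<lambda>y. prd (f y) (g y)) x v = prd (f x) (dir_deriv A g x v) + prd (dir_deriv A f x v) (g x)"
proof -
  obtain c where c: "c \<in> A" "x \<in> cdom c" using smooth_near_points[OF assms(2)] by (rule pointsE)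
  show ?thesis
    using dir_derivI[OF c assms(4) bounded_bilinear.FDERIV[OF assms(1) smooth_near_has_derivative[OF assms(2) c]
          smooth_near_has_derivative[OF assms(3) c]]] c
    by (simp add: dir_deriv_chart[OF _ c assms(4)] assms)
qed

lemmas dir_deriv_scaleR = dir_deriv_bilinear[OF bounded_bilinear_scaleR]
lemma dir_deriv_add:
  assumes "smooth_near x f" "smooth_near x g" "v \<in> tangent_space A x"
  shows "dir_deriv A (\<lambda>y. f y + g y) x v = dir_deriv A f x v + dir_deriv A g x v"
proof -
  obtain c where c: "c \<in> A" "x \<in> cdom c" using smooth_near_points[OF assms(1)] by (rule pointsE)
  show ?thesis
    using dir_derivI[OF c assms(3) has_derivative_add[OF smooth_near_has_derivative[OF assms(1) c]
          smooth_near_has_derivative[OF assms(2) c]]]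
    by (simp add: dir_deriv_chart[OF _ c assms(3)] assms)
qed

text \<open>The product rule in the form used for all frame computations: the map is differentiated
  with the vector frozen at \<open>s x\<close>, and the vector with the map frozen at
  \<open>x\<close>.\<close>

lemma dir_deriv_linear_family:
  fixes s :: "'a \<Rightarrow> 'w::euclidean_space" and F :: "'a \<Rightarrow> 'w \<Rightarrow> 'b::real_normed_vector"
  assumes U: "open_in A U" "x \<in> U" and lin: "\<And>y. y \<in> U \<Longrightarrow> linear (F y)"
    and F: "\<And>w. smooth_fn A U (\<lambda>y. F y w)" and s: "smooth_near x s" and v: "v \<in> tangent_space A x"
  shows "dir_deriv A (\<lambda>y. F y (s y)) x v = dir_deriv A (\<lambda>y. F y (s x)) x v + F x (dir_deriv A s x v)"
proof -
  obtain c where c: "c \<in> A" "x \<in> cdom c" using smooth_near_points[OF s] by (rule pointsE)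
  have Fn: "smooth_near x (\<lambda>y. F y w)" for w using U F by (rule smooth_nearI)
  have "((\<lambda>u. F (cinv c u) (s (cinv c u))) has_derivative
     (\<lambda>h. frechet_derivative (\<lambda>u. F (cinv c u) (s (cinv c (cmap c x)))) (at (cmap c x)) h +
          F (cinv c (cmap c x)) (frechet_derivative (\<lambda>u. s (cinv c u)) (at (cmap c x)) h))) (at (cmap c x))"
  proof (rule has_derivative_linear_family[where A = "\<lambda>u. F (cinv c u)" and s = "\<lambda>u. s (cinv c u)"
        and DA = "\<lambda>w. frechet_derivative (\<lambda>u. F (cinv c u) w) (at (cmap c x))"])
    show "((\<lambda>u. F (cinv c u) w) has_derivative
        frechet_derivative (\<lambda>u. F (cinv c u) w) (at (cmap c x))) (at (cmap c x))" for w
      by (rule smooth_near_has_derivative[OF Fn c])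
    show "((\<lambda>u. s (cinv c u)) has_derivative
        frechet_derivative (\<lambda>u. s (cinv c u)) (at (cmap c x))) (at (cmap c x))"
      by (rule smooth_near_has_derivative[OF s c])
    show "open (cmap c ` (U \<inter> cdom c))" "cmap c x \<in> cmap c ` (U \<inter> cdom c)"
      using U c by (auto simp: open_in_image)
    show "linear (F (cinv c u))" if "u \<in> cmap c ` (U \<inter> cdom c)" for u using that c lin by auto
  qed
  from dir_derivI[where f = "\<lambda>y. F y (s y)", OF c v this] show ?thesis
    unfolding dir_deriv_chart[OF Fn c v] dir_deriv_chart[OF s c v] using c by simp
qed

lemma smooth_fn_linear_family:
  fixes s :: "'a \<Rightarrow> 'w::euclidean_space" and F :: "'a \<Rightarrow> 'w \<Rightarrow> 'b::real_normed_vector"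
  assumes U: "open_in A U" and lin: "\<And>y. y \<in> U \<Longrightarrow> linear (F y)"
    and F: "\<And>w. smooth_fn A U (\<lambda>y. F y w)" and s: "smooth_fn A U s"
  shows "smooth_fn A U (\<lambda>y. F y (s y))"
proof (rule smooth_fn_cong[OF U])
  show "smooth_fn A U (\<lambda>y. \<Sum>b\<in>Basis. (s y \<bullet> b) *\<^sub>R F y b)"
    by (intro smooth_fn_sum smooth_fn_scaleR smooth_fn_inner_left U F s)
  show "(\<Sum>b\<in>Basis. (s y \<bullet> b) *\<^sub>R F y b) = F y (s y)" if "y \<in> U" for y
    by (rule linear_eq_sum_Basis[OF lin[OF that], symmetric])
qed

lemma smooth_fn_transition:
  assumes "c \<in> A" "d \<in> A"
  shows "smooth_fn A (cdom c \<inter> cdom d) (\<lambda>x. coord_field A c w x d)"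
proof (rule smooth_fn_cong)
  show o: "open_in A (cdom c \<inter> cdom d)" using assms by (intro open_in_Int open_in_cdom)
  show "smooth_fn A (cdom c \<inter> cdom d) (\<lambda>x. frechet_derivative (\<lambda>u. cmap d (cinv c u)) (at (cmap c x)) w)"
    by (rule smooth_on_chart_comp[OF assms(1) _ o smooth_on_frechet_derivative[OF smooth_transition[OF assms]]]) auto
qed (use assms in \<open>auto simp: coord_field_apply\<close>)

lemma vector_field_tangent: "vector_field_on A U X \<Longrightarrow> x \<in> U \<Longrightarrow> X x \<in> tangent_space A x"
  by (simp add: vector_field_on_def)

lemma vector_field_component:
  "vector_field_on A U X \<Longrightarrow> open_in A U \<Longrightarrow> c \<in> A \<Longrightarrow> smooth_fn A (U \<inter> cdom c) (\<lambda>x. X x c)"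
  by (rule smooth_fn_chartI[of c]) (auto simp: vector_field_on_def intro: open_in_Int open_in_cdom)

text \<open>Around each point one chart is enough: the component in another chart is the derivative
  of the transition map, a smooth family of linear maps, applied to the component already known to
  be smooth.\<close>

lemma vector_field_onI:
  assumes U: "open_in A U" and tan: "\<And>x. x \<in> U \<Longrightarrow> X x \<in> tangent_space A x"
    and loc: "\<And>x. x \<in> U \<Longrightarrow> \<exists>c\<in>A. \<exists>V. x \<in> V \<and> V \<subseteq> U \<inter> cdom c \<and> open_in A V \<and> smooth_fn A V (\<lambda>x. X x c)"
  shows "vector_field_on A U X"
  unfolding vector_field_on_def
proof (intro conjI ballI tan)
  fix d assume d: "d \<in> A"
  have "smooth_fn A (U \<inter> cdom d) (\<lambda>x. X x d)"
  proof (rule smooth_fn_localI)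
    fix x assume x: "x \<in> U \<inter> cdom d"
    then obtain c V where c: "c \<in> A" and V: "x \<in> V" "V \<subseteq> U \<inter> cdom c" "open_in A V" "smooth_fn A V (\<lambda>x. X x c)"
      using loc[of x] by auto
    let ?W = "V \<inter> cdom d"
    have W: "open_in A ?W" using V d by (intro open_in_Int open_in_cdom)
    have "smooth_fn A ?W (\<lambda>x. X x d)"
    proof (rule smooth_fn_cong[OF W])
      show "smooth_fn A ?W (\<lambda>x. coord_field A c (X x c) x d)"
      proof (rule smooth_fn_linear_family[where F = "\<lambda>y w. coord_field A c w y d" and s = "\<lambda>x. X x c", OF W])
        show "linear (\<lambda>w. coord_field A c w y d)" if "y \<in> ?W" for y
          using linear_coord_field[of c y] that c V by (auto simp: linear_iff)
        show "smooth_fn A ?W (\<lambda>y. coord_field A c w y d)" for w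
          by (rule smooth_fn_subset[OF smooth_fn_transition[OF c d]]) (use V in auto)
        show "smooth_fn A ?W (\<lambda>x. X x c)" by (rule smooth_fn_subset[OF V(4)]) auto
      qed
      show "coord_field A c (X y c) y d = X y d" if "y \<in> ?W" for y
      proof -
        have "coord_field A c (X y c) y = X y"
          using that V c tan by (intro coord_field_component) auto
        then show ?thesis by simp
      qed
    qed
    then show "\<exists>V. open_in A V \<and> x \<in> V \<and> smooth_fn A V (\<lambda>x. X x d)" using W V x by auto
  qed
  then show "smooth_on (cmap d ` (U \<inter> cdom d)) (\<lambda>u. X (cinv d u) d)"
    using smooth_fn_on_chart[of "U \<inter> cdom d" "\<lambda>x. X x d" d] d by auto
qed

lemma vector_field_coord_field: "c \<in> A \<Longrightarrow> vector_field_on A (cdom c) (coord_field A c w)"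
proof (rule vector_field_onI)
  assume c: "c \<in> A"
  fix x assume x: "x \<in> cdom c"
  have "smooth_fn A (cdom c) (\<lambda>x. coord_field A c w x c)"
    by (rule smooth_fn_cong[OF open_in_cdom[OF c] _ smooth_fn_const[of _ w]]) (use c in auto)
  then show "\<exists>c'\<in>A. \<exists>V. x \<in> V \<and> V \<subseteq> cdom c \<inter> cdom c' \<and> open_in A V \<and> smooth_fn A V (\<lambda>x. coord_field A c w x c')"
    using c x open_in_cdom[OF c] by auto
qed (auto intro: open_in_cdom)

lemma vector_field_subset: "vector_field_on A U X \<Longrightarrow> V \<subseteq> U \<Longrightarrow> vector_field_on A V X"
  unfolding vector_field_on_def by (meson Int_mono image_mono order_refl smooth_on_subset subsetD)

lemma smooth_fn_dir_deriv:
  assumes U: "open_in A U" and f: "smooth_fn A U f" and X: "vector_field_on A U X"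
  shows "smooth_fn A U (\<lambda>x. dir_deriv A f x (X x))"
proof (rule smooth_fn_localI)
  fix x assume x: "x \<in> U"
  then obtain c where c: "c \<in> A" "x \<in> cdom c" using open_in_points[OF U] pointsE by blast
  let ?V = "U \<inter> cdom c"
  have V: "open_in A ?V" using U c by (intro open_in_Int open_in_cdom)
  have near: "smooth_near y f" if "y \<in> U" for y using U that f by (rule smooth_nearI)
  have fs: "smooth_on (cmap c ` ?V) (\<lambda>u. f (cinv c u))" using f c by (simp add: smooth_fn_def)
  have "smooth_fn A ?V (\<lambda>x. frechet_derivative (\<lambda>u. f (cinv c u)) (at (cmap c x)) (X x c))"
  proof (rule smooth_fn_linear_family[where s = "\<lambda>x. X x c"
        and F = "\<lambda>x. frechet_derivative (\<lambda>u. f (cinv c u)) (at (cmap c x))", OF V])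
    show "linear (frechet_derivative (\<lambda>u. f (cinv c u)) (at (cmap c y)))" if "y \<in> ?V" for y
      using smooth_near_has_derivative[OF near c(1)] has_derivative_linear that by blast
    show "smooth_fn A ?V (\<lambda>y. frechet_derivative (\<lambda>u. f (cinv c u)) (at (cmap c y)) w)" for w
      by (rule smooth_on_chart_comp[OF c(1) _ V smooth_on_frechet_derivative[OF fs]]) auto
    show "smooth_fn A ?V (\<lambda>x. X x c)" by (rule vector_field_component[OF X U c(1)])
  qed
  then have "smooth_fn A ?V (\<lambda>x. dir_deriv A f x (X x))"
    by (rule smooth_fn_cong[OF V, rotated])
      (use dir_deriv_chart[OF near c(1)] vector_field_tangent[OF X] in auto)
  then show "\<exists>V. open_in A V \<and> x \<in> V \<and> smooth_fn A V (\<lambda>x. dir_deriv A f x (X x))"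
    using V x c by blast
qed

text \<open>The terms that violate the transformation law are second derivatives of a transition
  map. They are symmetric in the two fields and cancel in the difference.\<close>

lemma lie_bracket_tangent:
  assumes U: "open_in A U" and X: "vector_field_on A U X" and Y: "vector_field_on A U Y" and x: "x \<in> U"
  shows "lie_bracket A X Y x \<in> tangent_space A x"
  unfolding tangent_space_def
proof (intro CollectI conjI allI ballI impI)
  fix c d assume c: "c \<in> A" and d: "d \<in> A" and "x \<in> cdom c \<and> x \<in> cdom d"
  then have xc: "x \<in> cdom c" and xd: "x \<in> cdom d" by auto
  let ?V = "U \<inter> (cdom c \<inter> cdom d)"
  let ?W = "cdom c \<inter> cdom d"
  let ?\<tau> = "\<lambda>u. cmap d (cinv c u)"
  have W: "open_in A ?W" "x \<in> ?W" using c d xc xd by (auto intro: open_in_Int open_in_cdom)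
  have V: "open_in A ?V" "x \<in> ?V" using U x W by (auto intro: open_in_Int)
  have comp: "smooth_near x (\<lambda>y. X y c)" if X: "vector_field_on A U X" for X
    using vector_field_component[OF X U c] U x xc c by (intro smooth_nearI[of "U \<inter> cdom c"] open_in_Int open_in_cdom) auto
  \<comment> \<open>The derivative of the transformation law of a vector field. The first summand is
    the second derivative of the transition map, the second is what a tangent vector would
    give.\<close>
  have key: "dir_deriv A (\<lambda>y. X y d) x v =
      frechet_derivative (\<lambda>u. frechet_derivative ?\<tau> (at u) (X x c)) (at (cmap c x)) (v c) +
      frechet_derivative ?\<tau> (at (cmap c x)) (dir_deriv A (\<lambda>y. X y c) x v)"
    if X: "vector_field_on A U X" and v: "v \<in> tangent_space A x" for X v
  proof -
    have "dir_deriv A (\<lambda>y. X y d) x v = dir_deriv A (\<lambda>y. coord_field A c (X y c) y d) x v"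
      by (rule dir_deriv_cong[OF V]) (use c vector_field_tangent[OF X] coord_field_component in auto)
    also have "\<dots> = dir_deriv A (\<lambda>y. coord_field A c (X x c) y d) x v + coord_field A c (dir_deriv A (\<lambda>y. X y c) x v) x d"
    proof (rule dir_deriv_linear_family[where F = "\<lambda>y w. coord_field A c w y d", OF W _ _ comp[OF X] v])
      show "linear (\<lambda>w. coord_field A c w y d)" if "y \<in> ?W" for y
        using linear_coord_field[of c y] that c by (auto simp: linear_iff)
    qed (rule smooth_fn_transition[OF c d])
    also have "dir_deriv A (\<lambda>y. coord_field A c (X x c) y d) x v =
        dir_deriv A (\<lambda>y. frechet_derivative ?\<tau> (at (cmap c y)) (X x c)) x v"
      by (rule dir_deriv_cong[OF W]) (use d in \<open>auto simp: coord_field_apply\<close>)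
    also have "\<dots> = frechet_derivative (\<lambda>u. frechet_derivative ?\<tau> (at u) (X x c)) (at (cmap c x)) (v c)"
    proof (rule dir_derivI[OF c xc v])
      have "((\<lambda>u. frechet_derivative ?\<tau> (at u) (X x c)) has_derivative
        frechet_derivative (\<lambda>u. frechet_derivative ?\<tau> (at u) (X x c)) (at (cmap c x))) (at (cmap c x))"
        by (rule smooth_on_has_derivative[OF smooth_on_frechet_derivative[OF smooth_transition[OF c d]]])
          (use xc xd in auto)
      then show "((\<lambda>u. frechet_derivative ?\<tau> (at (cmap c (cinv c u))) (X x c)) has_derivative
        frechet_derivative (\<lambda>u. frechet_derivative ?\<tau> (at u) (X x c)) (at (cmap c x))) (at (cmap c x))"
        by (rule has_derivative_transform_within_open[OF _ open_overlap[OF c d]]) (use c xc xd in auto)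
    qed
    finally show ?thesis using d xd by (simp add: coord_field_apply)
  qed
  have lin: "linear (frechet_derivative ?\<tau> (at (cmap c x)))"
    using transition_has_derivative[OF c d xc xd] has_derivative_linear by blast
  have sym: "frechet_derivative (\<lambda>u. frechet_derivative ?\<tau> (at u) v) (at (cmap c x)) w =
      frechet_derivative (\<lambda>u. frechet_derivative ?\<tau> (at u) w) (at (cmap c x)) v" for v w
    by (rule second_derivative_symmetric[OF open_overlap[OF c d]])
      (use smooth_transition[OF c d] xc xd in \<open>auto simp: smooth_on_def\<close>)
  show "lie_bracket A X Y x d = frechet_derivative (cmap d \<circ> cinv c) (at (cmap c x)) (lie_bracket A X Y x c)"
    using c d xc xd key[OF X vector_field_tangent[OF Y x]] key[OF Y vector_field_tangent[OF X x]] sym[of "X x c" "Y x c"]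
    by (simp add: lie_bracket_def o_def linear_diff[OF lin])
qed (auto simp: lie_bracket_def)

end

section \<open>Smooth maps, connections and their pullbacks\<close>

context atlas
begin

lemma linear_coord_field_apply: "c \<in> A \<Longrightarrow> y \<in> cdom c \<Longrightarrow> linear (\<lambda>w. coord_field A c w y d)"
  using linear_coord_field[of c y] by (auto simp: linear_iff)

lemma smooth_fn_openD: "smooth_fn A U f \<Longrightarrow> open_in A U \<Longrightarrow> x \<in> U \<Longrightarrow> smooth_near x f"
  by (auto simp: smooth_near_def)

lemma vector_field_add:
  assumes "open_in A U" "vector_field_on A U X" "vector_field_on A U Y"
  shows "vector_field_on A U (\<lambda>x. X x + Y x)"
  using assms open_in_image[OF assms(1)] unfolding vector_field_on_def
  by (auto intro: tangent_add smooth_on_add)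

lemma vector_field_scaleR:
  assumes "open_in A U" "smooth_fn A U s" "vector_field_on A U X"
  shows "vector_field_on A U (\<lambda>x. s x *\<^sub>R X x)"
  unfolding vector_field_on_def
proof (intro conjI ballI)
  show "s x *\<^sub>R X x \<in> tangent_space A x" if "x \<in> U" for x
    using assms that by (auto intro: tangent_scaleR vector_field_tangent)
  show "smooth_on (cmap c ` (U \<inter> cdom c)) (\<lambda>u. (s (cinv c u) *\<^sub>R X (cinv c u)) c)" if "c \<in> A" for c
    using assms(2,3) that
    by (auto simp: vector_field_on_def smooth_fn_def intro: smooth_on_bilinear[OF bounded_bilinear_scaleR open_in_image[OF assms(1)]])
qed

lemma vector_field_zero: "vector_field_on A U (\<lambda>x. 0)"
  by (simp add: vector_field_on_def)

lemma vector_field_sum: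
  assumes "open_in A U" "\<And>i. i \<in> I \<Longrightarrow> vector_field_on A U (X i)"
  shows "vector_field_on A U (\<lambda>x. \<Sum>i\<in>I. X i x)"
  using assms(2)
  by (induction I rule: infinite_finite_induct) (auto simp: vector_field_zero intro: vector_field_add[OF assms(1)])

lemma coord_field_sum:
  "c \<in> A \<Longrightarrow> x \<in> cdom c \<Longrightarrow> coord_field A c w x = (\<Sum>b\<in>Basis. (w \<bullet> b) *\<^sub>R coord_field A c b x)"
  by (rule linear_eq_sum_Basis[OF linear_coord_field])

end

section \<open>Smooth maps and their tangent maps\<close>

locale smooth_mapping = A: atlas A + B: atlas B
  for A :: "('a, 'e::euclidean_space) atlas" and B :: "('b, 'f::euclidean_space) atlas" +
  fixes f :: "'a \<Rightarrow> 'b"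
  assumes smooth: "smooth_map A B f"
begin

lemma maps: "x \<in> points A \<Longrightarrow> f x \<in> points B"
  using smooth by (auto simp: smooth_map_def)

lemma smooth_chart:
  "c \<in> A \<Longrightarrow> d \<in> B \<Longrightarrow> open (cmap c ` (cdom c \<inter> f -` cdom d))"
  "c \<in> A \<Longrightarrow> d \<in> B \<Longrightarrow> smooth_on (cmap c ` (cdom c \<inter> f -` cdom d)) (\<lambda>u. cmap d (f (cinv c u)))"
  using smooth by (auto simp: smooth_map_def o_def)

lemma points_vimage_chart: "c \<in> A \<Longrightarrow> (points A \<inter> f -` V) \<inter> cdom c = cdom c \<inter> f -` V"
  by (auto simp: points_def)

lemma open_vimage_cdom: "d \<in> B \<Longrightarrow> open_in A (points A \<inter> f -` cdom d)"
  unfolding open_in_def using smooth_chart(1) by (auto simp: points_vimage_chart)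

lemma smooth_cmap: "d \<in> B \<Longrightarrow> smooth_fn A (points A \<inter> f -` cdom d) (\<lambda>x. cmap d (f x))"
  unfolding smooth_fn_def using smooth_chart(2) by (auto simp: points_vimage_chart)

lemma open_vimage:
  assumes V: "open_in B V"
  shows "open_in A (points A \<inter> f -` V)"
proof -
  have "open_in A (points A \<inter> f -` (V \<inter> cdom d))" if d: "d \<in> B" for d
    unfolding open_in_def
  proof (intro conjI ballI)
    fix c assume c: "c \<in> A"
    have "cmap c ` (points A \<inter> f -` (V \<inter> cdom d) \<inter> cdom c) =
        cmap c ` (cdom c \<inter> f -` cdom d) \<inter> (\<lambda>u. cmap d (f (cinv c u))) -` (cmap d ` (V \<inter> cdom d))"
    proof (intro equalityI subsetI)
      fix u assume "u \<in> cmap c ` (cdom c \<inter> f -` cdom d) \<inter> (\<lambda>u. cmap d (f (cinv c u))) -` (cmap d ` (V \<inter> cdom d))"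
      then obtain x where x: "x \<in> cdom c" "f x \<in> cdom d" "u = cmap c x" "cmap d (f x) \<in> cmap d ` (V \<inter> cdom d)"
        using c by auto
      then have "f x \<in> V \<inter> cdom d" using B.cmap_image_iff[of d "f x" "V \<inter> cdom d"] d by simp
      then show "u \<in> cmap c ` (points A \<inter> f -` (V \<inter> cdom d) \<inter> cdom c)" using x c by (auto simp: points_def)
    qed (use c in auto)
    moreover have "open (cmap c ` (cdom c \<inter> f -` cdom d) \<inter> (\<lambda>u. cmap d (f (cinv c u))) -` (cmap d ` (V \<inter> cdom d)))"
      using smooth_on_continuous_on[OF smooth_chart(2)[OF c d]] smooth_chart(1)[OF c d] B.open_in_image[OF V d]
      by (rule continuous_open_preimage)
    ultimately show "open (cmap c ` (points A \<inter> f -` (V \<inter> cdom d) \<inter> cdom c))" by simp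
  qed auto
  then have "open_in A (\<Union>d\<in>B. points A \<inter> f -` (V \<inter> cdom d))" by (intro A.open_in_Union) auto
  moreover have "(\<Union>d\<in>B. points A \<inter> f -` (V \<inter> cdom d)) = points A \<inter> f -` V"
    using B.open_in_points[OF V] by (fastforce simp: points_def)
  ultimately show ?thesis by simp
qed

lemma open_Int_vimage: "open_in A U \<Longrightarrow> open_in B V \<Longrightarrow> open_in A (U \<inter> f -` V)"
  using A.open_in_Int[OF _ open_vimage, of U V] A.open_in_points[of U]
  by (metis (no_types, lifting) inf.absorb_iff1 inf_assoc)

lemma smooth_fn_comp:
  fixes h :: "'b \<Rightarrow> 'c::real_normed_vector"
  assumes V: "open_in B V" and h: "smooth_fn B V h"
  shows "smooth_fn A (points A \<inter> f -` V) (\<lambda>x. h (f x))"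
proof (rule A.smooth_fn_localI)
  fix x assume x: "x \<in> points A \<inter> f -` V"
  obtain d where d: "d \<in> B" "f x \<in> cdom d" using maps x B.pointsE by blast
  let ?W = "points A \<inter> f -` (V \<inter> cdom d)"
  have W: "open_in A ?W" using V d by (intro open_vimage B.open_in_Int B.open_in_cdom)
  have "smooth_fn A ?W (\<lambda>x. h (cinv d (cmap d (f x))))"
  proof (rule A.smooth_fn_compose[OF W B.open_in_image[OF V d(1)]])
    show "smooth_on (cmap d ` (V \<inter> cdom d)) (\<lambda>u. h (cinv d u))" using h d by (simp add: smooth_fn_def)
    show "smooth_fn A ?W (\<lambda>x. cmap d (f x))" by (rule A.smooth_fn_subset[OF smooth_cmap[OF d(1)]]) auto
  qed auto
  then have "smooth_fn A ?W (\<lambda>x. h (f x))"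
    by (rule A.smooth_fn_cong[OF W, rotated]) (use d in auto)
  then show "\<exists>V. open_in A V \<and> x \<in> V \<and> smooth_fn A V (\<lambda>x. h (f x))" using W x d by auto
qed

lemma tangent_map_apply:
  "d \<in> B \<Longrightarrow> f x \<in> cdom d \<Longrightarrow> tangent_map A B f x v d = dir_deriv A (\<lambda>y. cmap d (f y)) x v"
  by (simp add: tangent_map_def o_def)

lemma smooth_near_cmap: "x \<in> points A \<Longrightarrow> d \<in> B \<Longrightarrow> f x \<in> cdom d \<Longrightarrow> A.smooth_near x (\<lambda>y. cmap d (f y))"
  by (rule A.smooth_nearI[OF open_vimage_cdom _ smooth_cmap]) auto

lemma dir_deriv_comp_chart:
  assumes x: "x \<in> points A" and d: "d \<in> B" "f x \<in> cdom d" and v: "v \<in> tangent_space A x"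
    and D: "((\<lambda>u. h (cinv d u)) has_derivative D) (at (cmap d (f x)))"
  shows "dir_deriv A (\<lambda>y. h (f y)) x v = D (tangent_map A B f x v d)"
proof -
  obtain c where c: "c \<in> A" "x \<in> cdom c" using x by (rule A.pointsE)
  let ?D = "frechet_derivative (\<lambda>u. cmap d (f (cinv c u))) (at (cmap c x))"
  have 1: "((\<lambda>u. cmap d (f (cinv c u))) has_derivative ?D) (at (cmap c x))"
    by (rule A.smooth_near_has_derivative[OF smooth_near_cmap[OF x d] c])
  have D': "((\<lambda>u. h (cinv d u)) has_derivative D) (at (cmap d (f (cinv c (cmap c x)))))" using D c by simp
  have "((\<lambda>u. h (cinv d (cmap d (f (cinv c u))))) has_derivative (\<lambda>w. D (?D w))) (at (cmap c x))"
    by (rule has_derivative_compose[OF 1 D'])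
  then have "((\<lambda>u. h (f (cinv c u))) has_derivative (\<lambda>w. D (?D w))) (at (cmap c x))"
    by (rule has_derivative_transform_within_open[OF _ smooth_chart(1)[OF c(1) d(1)]]) (use c d in auto)
  from A.dir_derivI[where f = "\<lambda>y. h (f y)", OF c v this] show ?thesis
    by (simp add: tangent_map_apply[OF d] A.dir_derivI[where f = "\<lambda>y. cmap d (f y)", OF c v 1])
qed

lemma tangent_map_tangent:
  assumes "x \<in> points A" "v \<in> tangent_space A x"
  shows "tangent_map A B f x v \<in> tangent_space B (f x)"
  unfolding tangent_space_def
proof (intro CollectI conjI allI ballI impI)
  fix d e assume "d \<in> B" "e \<in> B" "f x \<in> cdom d \<and> f x \<in> cdom e"
  then show "tangent_map A B f x v e = frechet_derivative (cmap e \<circ> cinv d) (at (cmap d (f x))) (tangent_map A B f x v d)"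
    using dir_deriv_comp_chart[OF assms(1) _ _ assms(2) B.transition_has_derivative[of d e "f x"]]
    by (simp add: tangent_map_apply o_def)
qed (auto simp: tangent_map_def)

lemma tangent_map_add:
  assumes "x \<in> points A" "v \<in> tangent_space A x" "w \<in> tangent_space A x"
  shows "tangent_map A B f x (v + w) = tangent_map A B f x v + tangent_map A B f x w"
proof
  fix d
  show "tangent_map A B f x (v + w) d = (tangent_map A B f x v + tangent_map A B f x w) d"
    using A.dir_deriv_add_vec[OF smooth_near_cmap[OF assms(1)] assms(2,3)]
    by (simp add: tangent_map_def o_def)
qed

lemma tangent_map_scaleR:
  assumes "x \<in> points A" "v \<in> tangent_space A x"
  shows "tangent_map A B f x (r *\<^sub>R v) = r *\<^sub>R tangent_map A B f x v"
proof
  fix d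
  show "tangent_map A B f x (r *\<^sub>R v) d = (r *\<^sub>R tangent_map A B f x v) d"
    using A.dir_deriv_scaleR_vec[OF smooth_near_cmap[OF assms(1)] assms(2)]
    by (simp add: tangent_map_def o_def)
qed

lemma dir_deriv_comp:
  assumes x: "x \<in> points A" and h: "B.smooth_near (f x) h" and v: "v \<in> tangent_space A x"
  shows "dir_deriv A (\<lambda>y. h (f y)) x v = dir_deriv B h (f x) (tangent_map A B f x v)"
proof -
  obtain d where d: "d \<in> B" "f x \<in> cdom d" using maps[OF x] by (rule B.pointsE)
  show ?thesis
    using dir_deriv_comp_chart[OF x d v B.smooth_near_has_derivative[OF h d]]
      B.dir_deriv_chart[OF h d tangent_map_tangent[OF x v]] by simp
qed

end

section \<open>Affine connections: locality and coordinate expression\<close>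

locale connection = atlas M for M :: "('b, 'f::euclidean_space) atlas" +
  fixes nab :: "('b, 'f) conn"
  assumes connection: "affine_connection M nab"
begin

context
  fixes U x
  assumes U: "open_in M U" "x \<in> U"
begin

lemma nab_linear_vec:
  "vector_field_on M U Y \<Longrightarrow> linear_between (tangent_space M x) (tangent_space M x) (\<lambda>v. nab x v Y)"
  using connection U unfolding affine_connection_def by blast

lemma nab_add:
  "v \<in> tangent_space M x \<Longrightarrow> vector_field_on M U Y \<Longrightarrow> vector_field_on M U Z \<Longrightarrow>
    nab x v (\<lambda>y. Y y + Z y) = nab x v Y + nab x v Z"
  using connection U unfolding affine_connection_def by blast

lemma nab_leibniz:
  "v \<in> tangent_space M x \<Longrightarrow> smooth_fn M U s \<Longrightarrow> vector_field_on M U Y \<Longrightarrow>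
    nab x v (\<lambda>y. s y *\<^sub>R Y y) = dir_deriv M s x v *\<^sub>R Y x + s x *\<^sub>R nab x v Y"
  using connection U unfolding affine_connection_def smooth_fun_on_eq by blast

lemma nab_tangent: "v \<in> tangent_space M x \<Longrightarrow> vector_field_on M U Y \<Longrightarrow> nab x v Y \<in> tangent_space M x"
  using nab_linear_vec[of Y] unfolding linear_between_def by blast

lemma nab_vec_add:
  "v \<in> tangent_space M x \<Longrightarrow> w \<in> tangent_space M x \<Longrightarrow> vector_field_on M U Y \<Longrightarrow>
    nab x (v + w) Y = nab x v Y + nab x w Y"
  using nab_linear_vec by (auto simp: linear_between_def)

lemma nab_vec_scaleR:
  "v \<in> tangent_space M x \<Longrightarrow> vector_field_on M U Y \<Longrightarrow> nab x (r *\<^sub>R v) Y = r *\<^sub>R nab x v Y"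
  using nab_linear_vec by (auto simp: linear_between_def)

text \<open>Multiplication by the indicator function of \<open>U\<close> makes the two fields globally equal.\<close>

lemma nab_cong:
  assumes v: "v \<in> tangent_space M x" and Y: "vector_field_on M U Y"
    and eq: "\<And>y. y \<in> U \<Longrightarrow> Y y = Z y"
  shows "nab x v Y = nab x v Z"
proof -
  have Z: "vector_field_on M U Z"
    unfolding vector_field_on_def
  proof (intro conjI ballI)
    show "Z y \<in> tangent_space M y" if "y \<in> U" for y using that eq vector_field_tangent[OF Y] by metis
    show "smooth_on (cmap c ` (U \<inter> cdom c)) (\<lambda>u. Z (cinv c u) c)" if "c \<in> M" for c
      by (rule smooth_on_cong[of _ "\<lambda>u. Y (cinv c u) c"])
        (use that eq U Y in \<open>auto simp: open_in_image vector_field_on_def\<close>)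
  qed
  let ?i = "\<lambda>y. if y \<in> U then 1 else 0 :: real"
  have i: "smooth_fn M U ?i" by (rule smooth_fn_cong[OF U(1) _ smooth_fn_const[of U 1]]) auto
  have d: "dir_deriv M ?i x v = 0"
    using dir_deriv_cong[OF U, of ?i "\<lambda>_. 1" v] by simp
  have "nab x v (\<lambda>y. ?i y *\<^sub>R W y) = nab x v W" if "vector_field_on M U W" for W
    using nab_leibniz[OF v i that] d U by simp
  note * = this
  have "(\<lambda>y. ?i y *\<^sub>R Y y) = (\<lambda>y. ?i y *\<^sub>R Z y)" using eq by auto
  then show ?thesis using *[OF Y] *[OF Z] by simp
qed

lemma nab_zero: "v \<in> tangent_space M x \<Longrightarrow> nab x v (\<lambda>y. 0) = 0"
  using nab_add[of v "\<lambda>y. 0" "\<lambda>y. 0"] by (simp add: vector_field_zero)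

lemma nab_expand:
  assumes v: "v \<in> tangent_space M x" and "finite I"
    and "\<And>i. i \<in> I \<Longrightarrow> smooth_fn M U (s i)" "\<And>i. i \<in> I \<Longrightarrow> vector_field_on M U (E i)"
  shows "nab x v (\<lambda>y. \<Sum>i\<in>I. s i y *\<^sub>R E i y) =
    (\<Sum>i\<in>I. dir_deriv M (s i) x v *\<^sub>R E i x + s i x *\<^sub>R nab x v (E i))"
  using assms(2-)
proof (induction I rule: finite_induct)
  case empty
  show ?case unfolding sum.empty by (rule nab_zero[OF v])
next
  case (insert i I)
  have f: "vector_field_on M U (\<lambda>y. s j y *\<^sub>R E j y)" if "j \<in> insert i I" for j
    using insert.prems that U by (intro vector_field_scaleR) auto
  have "nab x v (\<lambda>y. s i y *\<^sub>R E i y + (\<Sum>j\<in>I. s j y *\<^sub>R E j y)) =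
      nab x v (\<lambda>y. s i y *\<^sub>R E i y) + nab x v (\<lambda>y. \<Sum>j\<in>I. s j y *\<^sub>R E j y)"
    using f by (intro nab_add[OF v] vector_field_sum U) auto
  moreover have "nab x v (\<lambda>y. s i y *\<^sub>R E i y) = dir_deriv M (s i) x v *\<^sub>R E i x + s i x *\<^sub>R nab x v (E i)"
    using insert.prems by (intro nab_leibniz[OF v]) auto
  moreover have "nab x v (\<lambda>y. \<Sum>j\<in>I. s j y *\<^sub>R E j y) =
      (\<Sum>i\<in>I. dir_deriv M (s i) x v *\<^sub>R E i x + s i x *\<^sub>R nab x v (E i))"
    using insert.prems by (intro insert.IH) auto
  ultimately show ?case unfolding sum.insert[OF insert.hyps] by (simp only:)
qed

end

lemma nab_coord_sum:
  assumes d: "d \<in> M" "x \<in> cdom d" and v: "v \<in> tangent_space M x"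
  shows "nab x v (coord_field M d w) = (\<Sum>b\<in>Basis. (w \<bullet> b) *\<^sub>R nab x v (coord_field M d b))"
proof -
  have U: "open_in M (cdom d)" using d by (simp add: open_in_cdom)
  have "nab x v (coord_field M d w) = nab x v (\<lambda>y. \<Sum>b\<in>Basis. (w \<bullet> b) *\<^sub>R coord_field M d b y)"
    by (rule nab_cong[OF U d(2) v vector_field_coord_field[OF d(1)] coord_field_sum[OF d(1)]])
  also have "\<dots> = (\<Sum>b\<in>Basis. dir_deriv M (\<lambda>y. w \<bullet> b) x v *\<^sub>R coord_field M d b x +
      (w \<bullet> b) *\<^sub>R nab x v (coord_field M d b))"
    by (rule nab_expand[OF U d(2) v]) (auto intro: vector_field_coord_field d)
  finally show ?thesis by simp
qed

lemma linear_nab_coord: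
  assumes "d \<in> M" "x \<in> cdom d" "v \<in> tangent_space M x"
  shows "linear (\<lambda>w. nab x v (coord_field M d w))"
proof (rule linearI)
  show "nab x v (coord_field M d (a + b)) = nab x v (coord_field M d a) + nab x v (coord_field M d b)" for a b
    by (simp only: nab_coord_sum[OF assms, of "a + b"] nab_coord_sum[OF assms, of a] nab_coord_sum[OF assms, of b]
        inner_add_left scaleR_add_left sum.distrib)
  show "nab x v (coord_field M d (r *\<^sub>R a)) = r *\<^sub>R nab x v (coord_field M d a)" for r a
    by (simp only: nab_coord_sum[OF assms, of "r *\<^sub>R a"] nab_coord_sum[OF assms, of a]
        inner_scaleR_left scaleR_sum_right scaleR_scaleR)
qed

lemma nab_vector_field:
  assumes "open_in M U" "vector_field_on M U X" "vector_field_on M U Y"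
  shows "vector_field_on M U (\<lambda>x. nab x (X x) Y)"
proof -
  have "\<forall>X Y. vector_field_on M U X \<and> vector_field_on M U Y \<longrightarrow> vector_field_on M U (\<lambda>x. nab x (X x) Y)"
    using connection assms(1) by (simp add: affine_connection_def)
  then show ?thesis using assms by blast
qed

text \<open>Expanding \<open>Y\<close> in the coordinate frame and applying the Leibniz rule
  separates the derivative of the components from the derivative of the coordinate field that agrees
  with \<open>Y\<close> at \<open>x\<close>. These are the two terms from which
  \<open>induced_conn\<close> and \<open>pull_conn\<close> are built.\<close>

lemma nab_coord:
  assumes U: "open_in M U" "x \<in> U" and d: "d \<in> M" "x \<in> cdom d" and v: "v \<in> tangent_space M x"
    and Y: "vector_field_on M U Y"
  shows "nab x v Y = coord_field M d (dir_deriv M (\<lambda>y. Y y d) x v) x + nab x v (coord_field M d (Y x d))"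
proof -
  let ?V = "U \<inter> cdom d"
  have V: "open_in M ?V" "x \<in> ?V" using U d by (auto intro: open_in_Int open_in_cdom)
  have Yd: "smooth_fn M ?V (\<lambda>y. Y y d)" by (rule vector_field_component[OF Y U(1) d(1)])
  have near: "smooth_near x (\<lambda>y. Y y d)" using V Yd by (rule smooth_nearI)
  have Yb: "smooth_fn M ?V (\<lambda>y. Y y d \<bullet> b)" for b by (rule smooth_fn_inner_left[OF V(1) Yd])
  have D: "dir_deriv M (\<lambda>y. Y y d \<bullet> b) x v = dir_deriv M (\<lambda>y. Y y d) x v \<bullet> b" for b
    by (rule dir_deriv_bounded_linear[OF near v bounded_linear_inner_left])
  have "nab x v Y = nab x v (\<lambda>y. \<Sum>b\<in>Basis. (Y y d \<bullet> b) *\<^sub>R coord_field M d b y)"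
  proof (rule nab_cong[OF V v vector_field_subset[OF Y]])
    fix y assume "y \<in> ?V"
    then show "Y y = (\<Sum>b\<in>Basis. (Y y d \<bullet> b) *\<^sub>R coord_field M d b y)"
      using coord_field_sum[OF d(1), of y "Y y d"] coord_field_component[OF d(1), of y "Y y"]
        vector_field_tangent[OF Y] by simp
  qed auto
  also have "\<dots> = (\<Sum>b\<in>Basis. dir_deriv M (\<lambda>y. Y y d \<bullet> b) x v *\<^sub>R coord_field M d b x +
      (Y x d \<bullet> b) *\<^sub>R nab x v (coord_field M d b))"
    by (rule nab_expand[OF V v]) (auto intro: Yb vector_field_subset[OF vector_field_coord_field] d)
  finally show ?thesis
    unfolding D sum.distrib nab_coord_sum[OF d v, of "Y x d"] coord_field_sum[OF d, of "dir_deriv M (\<lambda>y. Y y d) x v"] .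
qed

end

text \<open>The pullback connection for sections along an arbitrary smooth map. For the inclusion of
  \<open>L\<close> into \<open>M\<close> it is \<open>induced_conn\<close>; for the projection of
  the normal bundle, regarded as a map into \<open>M\<close>, it is the connection that is later
  transported.\<close>

definition pull_conn ::
  "('a, 'e::euclidean_space) atlas \<Rightarrow> ('b, 'f::euclidean_space) atlas \<Rightarrow> ('b, 'f) conn \<Rightarrow>
     ('a \<Rightarrow> 'b) \<Rightarrow> 'a \<Rightarrow> ('a, 'e) tvec \<Rightarrow> ('a \<Rightarrow> ('b, 'f) tvec) \<Rightarrow> ('b, 'f) tvec" where
  "pull_conn B M nab f z v \<sigma> = (\<lambda>d. if d \<in> M \<and> f z \<in> cdom d
     then dir_deriv B (\<lambda>y. \<sigma> y d) z v +
       nab (f z) (tangent_map B M f z v) (coord_field M d (\<sigma> z d)) d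
     else 0)"

definition section_along ::
  "('a, 'e::euclidean_space) atlas \<Rightarrow> ('b, 'f::euclidean_space) atlas \<Rightarrow> ('a \<Rightarrow> 'b) \<Rightarrow> 'a set \<Rightarrow>
     ('a \<Rightarrow> ('b, 'f) tvec) \<Rightarrow> bool" where
  "section_along B M f U \<sigma> \<longleftrightarrow> (\<forall>z\<in>U. \<sigma> z \<in> tangent_space M (f z)) \<and>
     (\<forall>d\<in>M. smooth_fn B (U \<inter> f -` cdom d) (\<lambda>z. \<sigma> z d))"

section \<open>Pullback of a connection along a smooth map\<close>

locale pullback = smooth_mapping B M f + M: connection M nab
  for B :: "('a, 'e::euclidean_space) atlas" and M :: "('b, 'f::euclidean_space) atlas"
    and f :: "'a \<Rightarrow> 'b" and nab :: "('b, 'f) conn"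
begin

abbreviation "sec \<equiv> section_along B M f"
abbreviation "pc \<equiv> pull_conn B M nab f"
abbreviation "push \<equiv> tangent_map B M f"

lemma sec_tangent: "sec U \<sigma> \<Longrightarrow> z \<in> U \<Longrightarrow> \<sigma> z \<in> tangent_space M (f z)"
  by (simp add: section_along_def)

lemma sec_component: "sec U \<sigma> \<Longrightarrow> d \<in> M \<Longrightarrow> smooth_fn B (U \<inter> f -` cdom d) (\<lambda>z. \<sigma> z d)"
  by (simp add: section_along_def)

lemma sec_subset: "sec U \<sigma> \<Longrightarrow> V \<subseteq> U \<Longrightarrow> sec V \<sigma>"
  unfolding section_along_def by (blast intro: A.smooth_fn_subset)

lemma open_chart: "open_in B U \<Longrightarrow> d \<in> M \<Longrightarrow> open_in B (U \<inter> f -` cdom d)"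
  by (rule open_Int_vimage[OF _ B.open_in_cdom])

lemma sec_near: "sec U \<sigma> \<Longrightarrow> open_in B U \<Longrightarrow> z \<in> U \<Longrightarrow> d \<in> M \<Longrightarrow> f z \<in> cdom d \<Longrightarrow> A.smooth_near z (\<lambda>y. \<sigma> y d)"
  using sec_component open_chart by (intro A.smooth_nearI[of "U \<inter> f -` cdom d"]) auto

lemma secI:
  assumes U: "open_in B U" and tan: "\<And>z. z \<in> U \<Longrightarrow> \<sigma> z \<in> tangent_space M (f z)"
    and loc: "\<And>z. z \<in> U \<Longrightarrow> \<exists>d\<in>M. \<exists>V. z \<in> V \<and> V \<subseteq> U \<inter> f -` cdom d \<and> open_in B V \<and> smooth_fn B V (\<lambda>z. \<sigma> z d)"
  shows "sec U \<sigma>"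
  unfolding section_along_def
proof (intro conjI ballI tan)
  fix e assume e: "e \<in> M"
  show "smooth_fn B (U \<inter> f -` cdom e) (\<lambda>z. \<sigma> z e)"
  proof (rule A.smooth_fn_localI)
    fix z assume z: "z \<in> U \<inter> f -` cdom e"
    then obtain d V where d: "d \<in> M" and V: "z \<in> V" "V \<subseteq> U \<inter> f -` cdom d" "open_in B V" "smooth_fn B V (\<lambda>z. \<sigma> z d)"
      using loc[of z] by auto
    let ?W = "V \<inter> f -` cdom e"
    have W: "open_in B ?W" using V e by (intro open_chart)
    have "smooth_fn B ?W (\<lambda>z. \<sigma> z e)"
    proof (rule A.smooth_fn_cong[OF W])
      show "smooth_fn B ?W (\<lambda>z. coord_field M d (\<sigma> z d) (f z) e)"
      proof (rule A.smooth_fn_linear_family[where F = "\<lambda>y w. coord_field M d w (f y) e" and s = "\<lambda>z. \<sigma> z d", OF W])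
        show "linear (\<lambda>w. coord_field M d w (f y) e)" if "y \<in> ?W" for y
          using d that V by (intro B.linear_coord_field_apply) auto
        show "smooth_fn B ?W (\<lambda>y. coord_field M d w (f y) e)" for w
          by (rule A.smooth_fn_subset[OF smooth_fn_comp[OF _ B.smooth_fn_transition[OF d e]]])
            (use V d e A.open_in_points in \<open>auto intro: B.open_in_Int B.open_in_cdom\<close>)
        show "smooth_fn B ?W (\<lambda>z. \<sigma> z d)" by (rule A.smooth_fn_subset[OF V(4)]) auto
      qed
      show "coord_field M d (\<sigma> y d) (f y) e = \<sigma> y e" if "y \<in> ?W" for y
      proof -
        have "coord_field M d (\<sigma> y d) (f y) = \<sigma> y"
          using that V d tan by (intro B.coord_field_component) auto
        then show ?thesis by simp
      qed
    qed
    then show "\<exists>V. open_in B V \<and> z \<in> V \<and> smooth_fn B V (\<lambda>z. \<sigma> z e)" using W V z by auto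
  qed
qed

lemma sec_comp:
  assumes "open_in M V" "vector_field_on M V E" "U \<subseteq> points B \<inter> f -` V"
  shows "sec U (\<lambda>z. E (f z))"
  unfolding section_along_def
proof (intro conjI ballI)
  show "E (f z) \<in> tangent_space M (f z)" if "z \<in> U" for z
    using B.vector_field_tangent[OF assms(2)] assms(3) that by auto
  show "smooth_fn B (U \<inter> f -` cdom d) (\<lambda>z. E (f z) d)" if "d \<in> M" for d
    by (rule A.smooth_fn_subset[OF smooth_fn_comp[OF _ B.vector_field_component[OF assms(2,1) that]]])
      (use assms that in \<open>auto intro: B.open_in_Int B.open_in_cdom\<close>)
qed

lemma sec_add: "open_in B U \<Longrightarrow> sec U \<sigma> \<Longrightarrow> sec U \<tau> \<Longrightarrow> sec U (\<lambda>z. \<sigma> z + \<tau> z)"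
  unfolding section_along_def by (auto intro: B.tangent_add A.smooth_fn_add open_chart)

lemma sec_scaleR: "open_in B U \<Longrightarrow> smooth_fn B U s \<Longrightarrow> sec U \<sigma> \<Longrightarrow> sec U (\<lambda>z. s z *\<^sub>R \<sigma> z)"
  unfolding section_along_def
  by (auto intro: B.tangent_scaleR A.smooth_fn_scaleR open_chart A.smooth_fn_subset)

lemma sec_zero: "sec U (\<lambda>z. 0)"
  by (simp add: section_along_def)

lemma sec_sum: "open_in B U \<Longrightarrow> (\<And>i. i \<in> I \<Longrightarrow> sec U (\<sigma> i)) \<Longrightarrow> sec U (\<lambda>z. \<Sum>i\<in>I. \<sigma> i z)"
  by (induction I rule: infinite_finite_induct) (auto simp: sec_zero intro: sec_add)

lemma sec_cong:
  assumes "open_in B U" "sec U \<sigma>" "\<And>z. z \<in> U \<Longrightarrow> \<sigma> z = \<tau> z"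
  shows "sec U \<tau>"
  unfolding section_along_def
proof (intro conjI ballI)
  show "\<tau> z \<in> tangent_space M (f z)" if "z \<in> U" for z using assms that sec_tangent by metis
  show "smooth_fn B (U \<inter> f -` cdom d) (\<lambda>z. \<tau> z d)" if "d \<in> M" for d
    by (rule A.smooth_fn_cong[OF open_chart[OF assms(1) that] _ sec_component[OF assms(2) that]])
      (use assms in auto)
qed

lemma sec_push:
  assumes "open_in B U" "vector_field_on B U X"
  shows "sec U (\<lambda>z. push z (X z))"
proof (rule secI[OF assms(1)])
  fix z assume z: "z \<in> U"
  then have zp: "z \<in> points B" using A.open_in_points[OF assms(1)] by auto
  show "push z (X z) \<in> tangent_space M (f z)"
    by (rule tangent_map_tangent[OF zp A.vector_field_tangent[OF assms(2) z]])
  obtain d where d: "d \<in> M" "f z \<in> cdom d" using maps[OF zp] by (rule B.pointsE)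
  let ?V = "U \<inter> f -` cdom d"
  have V: "open_in B ?V" by (rule open_chart[OF assms(1) d(1)])
  have "smooth_fn B ?V (\<lambda>z. dir_deriv B (\<lambda>y. cmap d (f y)) z (X z))"
    by (rule A.smooth_fn_dir_deriv[OF V A.smooth_fn_subset[OF smooth_cmap[OF d(1)]] A.vector_field_subset[OF assms(2)]])
      (use A.open_in_points[OF assms(1)] in auto)
  then have "smooth_fn B ?V (\<lambda>z. push z (X z) d)"
    by (rule A.smooth_fn_cong[OF V, rotated]) (use d in \<open>auto simp: tangent_map_apply\<close>)
  then show "\<exists>d\<in>M. \<exists>V. z \<in> V \<and> V \<subseteq> U \<inter> f -` cdom d \<and> open_in B V \<and> smooth_fn B V (\<lambda>z. push z (X z) d)"
    using V d z by (intro bexI[of _ d] exI[of _ ?V]) auto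
qed

text \<open>The definition computes each component in its own chart, and here all of them come from
  one chart \<open>d\<close>. On passing from \<open>d\<close> to \<open>e\<close>, the derivative
  of the components and the derivative of the coordinate field change by the same inhomogeneous term
  with opposite signs; for the latter this is \<open>nab_coord\<close>.\<close>

lemma pull_conn_coord:
  assumes U: "open_in B U" "z \<in> U" and \<sigma>: "sec U \<sigma>" and v: "v \<in> tangent_space B z"
    and d: "d \<in> M" "f z \<in> cdom d"
  shows "pc z v \<sigma> = coord_field M d (dir_deriv B (\<lambda>y. \<sigma> y d) z v) (f z) +
    nab (f z) (push z v) (coord_field M d (\<sigma> z d))"
proof
  fix e
  have zp: "z \<in> points B" using A.open_in_points U by auto
  let ?V = "push z v" and ?w = "\<sigma> z d"
  have V: "?V \<in> tangent_space M (f z)" by (rule tangent_map_tangent[OF zp v])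
  have nt: "nab (f z) ?V (coord_field M d ?w) \<in> tangent_space M (f z)"
    by (rule M.nab_tangent[OF B.open_in_cdom[OF d(1)] d(2) V B.vector_field_coord_field[OF d(1)]])
  show "pc z v \<sigma> e = (coord_field M d (dir_deriv B (\<lambda>y. \<sigma> y d) z v) (f z) +
    nab (f z) ?V (coord_field M d ?w)) e"
  proof (cases "e \<in> M \<and> f z \<in> cdom e")
    case False
    then show ?thesis
      using B.tangent_outside[OF nt, of e] B.tangent_outside[OF B.coord_field_tangent[OF d], of e]
      by (auto simp: pull_conn_def)
  next
    case True
    then have e: "e \<in> M" "f z \<in> cdom e" by auto
    let ?W = "U \<inter> f -` (cdom d \<inter> cdom e)"
    have oM: "open_in M (cdom d \<inter> cdom e)" using d e by (intro B.open_in_Int B.open_in_cdom)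
    have W: "open_in B ?W" "z \<in> ?W" using U d e by (auto simp only: intro: open_Int_vimage[OF U(1) oM])
    have sm: "smooth_fn M (cdom d \<inter> cdom e) (\<lambda>x. coord_field M d w x e)" for w
      by (rule B.smooth_fn_transition[OF d(1) e(1)])
    have "dir_deriv B (\<lambda>y. \<sigma> y e) z v = dir_deriv B (\<lambda>y. coord_field M d (\<sigma> y d) (f y) e) z v"
    proof (rule A.dir_deriv_cong[OF W])
      fix y assume y: "y \<in> ?W"
      have "coord_field M d (\<sigma> y d) (f y) = \<sigma> y"
        using y d sec_tangent[OF \<sigma>] by (intro B.coord_field_component) auto
      then show "\<sigma> y e = coord_field M d (\<sigma> y d) (f y) e" by simp
    qed
    also have "\<dots> = dir_deriv B (\<lambda>y. coord_field M d ?w (f y) e) z v +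
        coord_field M d (dir_deriv B (\<lambda>y. \<sigma> y d) z v) (f z) e"
    proof (rule A.dir_deriv_linear_family[where F = "\<lambda>y w. coord_field M d w (f y) e", OF W _ _ _ v])
      show "linear (\<lambda>w. coord_field M d w (f y) e)" if "y \<in> ?W" for y
        using d that by (intro B.linear_coord_field_apply) auto
      show "smooth_fn B ?W (\<lambda>y. coord_field M d w (f y) e)" for w
        by (rule A.smooth_fn_subset[OF smooth_fn_comp[OF oM sm]]) (use A.open_in_points[OF U(1)] in auto)
      show "A.smooth_near z (\<lambda>y. \<sigma> y d)" by (rule sec_near[OF \<sigma> U d])
    qed
    also have "dir_deriv B (\<lambda>y. coord_field M d ?w (f y) e) z v =
        dir_deriv M (\<lambda>x. coord_field M d ?w x e) (f z) ?V"
      by (rule dir_deriv_comp[OF zp B.smooth_nearI[OF oM _ sm] v]) (use d e in auto)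
    finally have 1: "dir_deriv B (\<lambda>y. \<sigma> y e) z v = dir_deriv M (\<lambda>x. coord_field M d ?w x e) (f z) ?V +
        coord_field M d (dir_deriv B (\<lambda>y. \<sigma> y d) z v) (f z) e" .
    have "coord_field M d ?w (f z) = \<sigma> z"
      using d sec_tangent[OF \<sigma> U(2)] by (intro B.coord_field_component) auto
    then have "nab (f z) ?V (coord_field M d ?w) e =
        dir_deriv M (\<lambda>x. coord_field M d ?w x e) (f z) ?V + nab (f z) ?V (coord_field M e (\<sigma> z e)) e"
      using M.nab_coord[OF B.open_in_cdom[OF d(1)] d(2) e V B.vector_field_coord_field[OF d(1)], of ?w] e by simp
    then show ?thesis using e 1 by (simp add: pull_conn_def)
  qed
qed

context
  fixes U z
  assumes U: "open_in B U" "z \<in> U"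
begin

lemma z_points: "z \<in> points B"
  using A.open_in_points U by auto

lemma chart_exists: "(\<And>d. d \<in> M \<Longrightarrow> f z \<in> cdom d \<Longrightarrow> thesis) \<Longrightarrow> thesis"
  using maps[OF z_points] B.pointsE by blast

lemma pull_conn_tangent:
  assumes "sec U \<sigma>" "v \<in> tangent_space B z"
  shows "pc z v \<sigma> \<in> tangent_space M (f z)"
proof -
  obtain d where d: "d \<in> M" "f z \<in> cdom d" by (rule chart_exists)
  show ?thesis
    unfolding pull_conn_coord[OF U assms d]
    by (rule B.tangent_add[OF B.coord_field_tangent[OF d] M.nab_tangent[OF B.open_in_cdom[OF d(1)] d(2)
        tangent_map_tangent[OF z_points assms(2)] B.vector_field_coord_field[OF d(1)]]])
qed

lemma pull_conn_vec_add:
  assumes \<sigma>: "sec U \<sigma>" and v: "v \<in> tangent_space B z" "w \<in> tangent_space B z"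
  shows "pc z (v + w) \<sigma> = pc z v \<sigma> + pc z w \<sigma>"
proof -
  obtain d where d: "d \<in> M" "f z \<in> cdom d" by (rule chart_exists)
  have n: "A.smooth_near z (\<lambda>y. \<sigma> y d)" by (rule sec_near[OF \<sigma> U d])
  show ?thesis
    unfolding pull_conn_coord[OF U \<sigma> v(1) d] pull_conn_coord[OF U \<sigma> v(2) d]
      pull_conn_coord[OF U \<sigma> A.tangent_add[OF v] d] A.dir_deriv_add_vec[OF n v]
      linear_add[OF B.linear_coord_field[OF d]] tangent_map_add[OF z_points v]
      M.nab_vec_add[OF B.open_in_cdom[OF d(1)] d(2) tangent_map_tangent[OF z_points v(1)]
        tangent_map_tangent[OF z_points v(2)] B.vector_field_coord_field[OF d(1)]]
    by simp
qed

lemma pull_conn_vec_scaleR: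
  assumes \<sigma>: "sec U \<sigma>" and v: "v \<in> tangent_space B z"
  shows "pc z (r *\<^sub>R v) \<sigma> = r *\<^sub>R pc z v \<sigma>"
proof -
  obtain d where d: "d \<in> M" "f z \<in> cdom d" by (rule chart_exists)
  have n: "A.smooth_near z (\<lambda>y. \<sigma> y d)" by (rule sec_near[OF \<sigma> U d])
  show ?thesis
    unfolding pull_conn_coord[OF U \<sigma> v d]
      pull_conn_coord[OF U \<sigma> A.tangent_scaleR[OF v] d] A.dir_deriv_scaleR_vec[OF n v]
      linear_scale[OF B.linear_coord_field[OF d]] tangent_map_scaleR[OF z_points v]
      M.nab_vec_scaleR[OF B.open_in_cdom[OF d(1)] d(2) tangent_map_tangent[OF z_points v]
        B.vector_field_coord_field[OF d(1)]]
    by (simp add: scaleR_add_right)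
qed

lemma pull_conn_add:
  assumes \<sigma>: "sec U \<sigma>" and \<tau>: "sec U \<tau>" and v: "v \<in> tangent_space B z"
  shows "pc z v (\<lambda>y. \<sigma> y + \<tau> y) = pc z v \<sigma> + pc z v \<tau>"
proof -
  obtain d where d: "d \<in> M" "f z \<in> cdom d" by (rule chart_exists)
  have n: "A.smooth_near z (\<lambda>y. \<sigma> y d)" "A.smooth_near z (\<lambda>y. \<tau> y d)"
    by (rule sec_near[OF \<sigma> U d]) (rule sec_near[OF \<tau> U d])
  have "dir_deriv B (\<lambda>y. (\<sigma> y + \<tau> y) d) z v = dir_deriv B (\<lambda>y. \<sigma> y d) z v + dir_deriv B (\<lambda>y. \<tau> y d) z v"
    using A.dir_deriv_add[OF n v] by simp
  then show ?thesis
    using linear_add[OF M.linear_nab_coord[OF d tangent_map_tangent[OF z_points v]], of "\<sigma> z d" "\<tau> z d"]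
      linear_add[OF B.linear_coord_field[OF d]]
    by (simp add: pull_conn_coord[OF U \<sigma> v d] pull_conn_coord[OF U \<tau> v d]
        pull_conn_coord[OF U sec_add[OF U(1) \<sigma> \<tau>] v d])
qed

lemma pull_conn_leibniz:
  assumes s: "smooth_fn B U s" and \<sigma>: "sec U \<sigma>" and v: "v \<in> tangent_space B z"
  shows "pc z v (\<lambda>y. s y *\<^sub>R \<sigma> y) = dir_deriv B s z v *\<^sub>R \<sigma> z + s z *\<^sub>R pc z v \<sigma>"
proof -
  obtain d where d: "d \<in> M" "f z \<in> cdom d" by (rule chart_exists)
  have n: "A.smooth_near z (\<lambda>y. \<sigma> y d)" by (rule sec_near[OF \<sigma> U d])
  have "dir_deriv B (\<lambda>y. (s y *\<^sub>R \<sigma> y) d) z v = s z *\<^sub>R dir_deriv B (\<lambda>y. \<sigma> y d) z v + dir_deriv B s z v *\<^sub>R \<sigma> z d"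
    using A.dir_deriv_scaleR[OF A.smooth_nearI[OF U s] n v] by simp
  moreover have "coord_field M d (\<sigma> z d) (f z) = \<sigma> z"
    by (rule B.coord_field_component[OF d sec_tangent[OF \<sigma> U(2)]])
  ultimately show ?thesis
    using linear_scale[OF M.linear_nab_coord[OF d tangent_map_tangent[OF z_points v]], of "s z" "\<sigma> z d"]
      linear_scale[OF B.linear_coord_field[OF d]] linear_add[OF B.linear_coord_field[OF d]]
    by (simp add: pull_conn_coord[OF U \<sigma> v d] pull_conn_coord[OF U sec_scaleR[OF U(1) s \<sigma>] v d]
        scaleR_add_right)
qed

lemma pull_conn_cong:
  assumes "\<And>y. y \<in> U \<Longrightarrow> \<sigma> y = \<tau> y"
  shows "pc z v \<sigma> = pc z v \<tau>"
proof -
  have "dir_deriv B (\<lambda>y. \<sigma> y d) z v = dir_deriv B (\<lambda>y. \<tau> y d) z v" for d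
    by (rule A.dir_deriv_cong[OF U]) (use assms in auto)
  then show ?thesis using assms[OF U(2)] by (intro ext) (simp add: pull_conn_def)
qed

lemma pull_conn_zero: "v \<in> tangent_space B z \<Longrightarrow> pc z v (\<lambda>y. 0) = 0"
  using pull_conn_add[OF sec_zero sec_zero] by simp

lemma pull_conn_sum:
  assumes "finite I" "\<And>i. i \<in> I \<Longrightarrow> sec U (\<sigma> i)" and v: "v \<in> tangent_space B z"
  shows "pc z v (\<lambda>y. \<Sum>i\<in>I. \<sigma> i y) = (\<Sum>i\<in>I. pc z v (\<sigma> i))"
  using assms(1,2)
proof (induction I rule: finite_induct)
  case empty
  show ?case unfolding sum.empty by (rule pull_conn_zero[OF v])
next
  case (insert i I)
  have "pc z v (\<lambda>y. \<sigma> i y + (\<Sum>j\<in>I. \<sigma> j y)) = pc z v (\<sigma> i) + pc z v (\<lambda>y. \<Sum>j\<in>I. \<sigma> j y)"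
    using insert.prems by (intro pull_conn_add v sec_sum U) auto
  moreover have "pc z v (\<lambda>y. \<Sum>i\<in>I. \<sigma> i y) = (\<Sum>i\<in>I. pc z v (\<sigma> i))"
    using insert.prems by (intro insert.IH) auto
  ultimately show ?case unfolding sum.insert[OF insert.hyps] by (simp only:)
qed

text \<open>For a section that factors through \<open>f\<close>, the chain rule turns the coordinate
  formula of the pullback into that of \<open>nab\<close>.\<close>

lemma pull_conn_comp:
  assumes V: "open_in M V" "f z \<in> V" and E: "vector_field_on M V E" and v: "v \<in> tangent_space B z"
  shows "pc z v (\<lambda>y. E (f y)) = nab (f z) (push z v) E"
proof -
  obtain d where d: "d \<in> M" "f z \<in> cdom d" by (rule chart_exists)
  let ?W = "points B \<inter> f -` V"
  have W: "open_in B ?W" "z \<in> ?W" using V z_points by (auto intro: open_vimage)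
  have near: "B.smooth_near (f z) (\<lambda>x. E x d)"
    by (rule B.smooth_nearI[OF _ _ B.vector_field_component[OF E V(1) d(1)]])
      (use V d in \<open>auto intro: B.open_in_Int B.open_in_cdom\<close>)
  have "pc z v (\<lambda>y. E (f y)) = coord_field M d (dir_deriv B (\<lambda>y. E (f y) d) z v) (f z) +
    nab (f z) (push z v) (coord_field M d (E (f z) d))"
    by (rule pull_conn_coord[OF W sec_comp[OF V(1) E] v d]) auto
  also have "\<dots> = nab (f z) (push z v) E"
    unfolding dir_deriv_comp[OF z_points near v]
    by (rule M.nab_coord[OF V d tangent_map_tangent[OF z_points v] E, symmetric])
  finally show ?thesis .
qed

end

text \<open>In a chart the connection term is linear both in the components of the pushed vector and
  in those of the section. With both frozen it is the pullback of a covariant derivative of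
  coordinate fields, whose smoothness belongs to \<open>affine_connection\<close>.\<close>

lemma sec_pull_conn:
  assumes U: "open_in B U" and X: "vector_field_on B U X" and \<sigma>: "sec U \<sigma>"
  shows "sec U (\<lambda>z. pc z (X z) \<sigma>)"
proof (rule secI[OF U])
  fix z assume z: "z \<in> U"
  then have zp: "z \<in> points B" using A.open_in_points[OF U] by auto
  show "pc z (X z) \<sigma> \<in> tangent_space M (f z)"
    by (rule pull_conn_tangent[OF U z \<sigma> A.vector_field_tangent[OF X z]])
  obtain d where d: "d \<in> M" "f z \<in> cdom d" by (rule chart_exists[OF U z])
  let ?V = "U \<inter> f -` cdom d"
  have V: "open_in B ?V" by (rule open_chart[OF U d(1)])
  have Vp: "?V \<subseteq> points B" using A.open_in_points[OF U] by auto
  have XV: "vector_field_on B ?V X" by (rule A.vector_field_subset[OF X]) auto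
  have Xt: "X y \<in> tangent_space B y" if "y \<in> ?V" for y using A.vector_field_tangent[OF XV that] .
  have pt: "push y (X y) \<in> tangent_space M (f y)" if "y \<in> ?V" for y
    using tangent_map_tangent[OF _ Xt[OF that]] Vp that by auto
  have 1: "smooth_fn B ?V (\<lambda>y. dir_deriv B (\<lambda>y. \<sigma> y d) y (X y))"
    by (rule A.smooth_fn_dir_deriv[OF V sec_component[OF \<sigma> d(1)] XV])
  have 3: "smooth_fn B ?V (\<lambda>y. nab (f y) (push y (X y)) (coord_field M d w) d)" for w
  proof (rule A.smooth_fn_cong[OF V])
    show "smooth_fn B ?V (\<lambda>y. nab (f y) (coord_field M d (push y (X y) d) (f y)) (coord_field M d w) d)"
    proof (rule A.smooth_fn_linear_family[where F = "\<lambda>y u. nab (f y) (coord_field M d u (f y)) (coord_field M d w) d"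
          and s = "\<lambda>y. push y (X y) d", OF V])
      fix y assume y: "y \<in> ?V"
      show "linear (\<lambda>u. nab (f y) (coord_field M d u (f y)) (coord_field M d w) d)"
      proof (rule linearI)
        have y': "f y \<in> cdom d" using y by auto
        show "nab (f y) (coord_field M d (a + b) (f y)) (coord_field M d w) d =
          nab (f y) (coord_field M d a (f y)) (coord_field M d w) d + nab (f y) (coord_field M d b (f y)) (coord_field M d w) d" for a b
          using linear_add[OF B.linear_coord_field[OF d(1) y']]
            M.nab_vec_add[OF B.open_in_cdom[OF d(1)] y' B.coord_field_tangent[OF d(1) y'] B.coord_field_tangent[OF d(1) y'] B.vector_field_coord_field[OF d(1)]]
          by simp
        show "nab (f y) (coord_field M d (r *\<^sub>R a) (f y)) (coord_field M d w) d =
          r *\<^sub>R nab (f y) (coord_field M d a (f y)) (coord_field M d w) d" for r a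
          using linear_scale[OF B.linear_coord_field[OF d(1) y']]
            M.nab_vec_scaleR[OF B.open_in_cdom[OF d(1)] y' B.coord_field_tangent[OF d(1) y'] B.vector_field_coord_field[OF d(1)]]
          by simp
      qed
    next
      fix u
      have "vector_field_on M (cdom d) (\<lambda>x. nab x (coord_field M d u x) (coord_field M d w))"
        by (rule M.nab_vector_field[OF B.open_in_cdom[OF d(1)] B.vector_field_coord_field[OF d(1)]
              B.vector_field_coord_field[OF d(1)]])
      then have "smooth_fn M (cdom d) (\<lambda>x. nab x (coord_field M d u x) (coord_field M d w) d)"
        using B.vector_field_component[OF _ B.open_in_cdom[OF d(1)] d(1)] by fastforce
      then have "smooth_fn B (points B \<inter> f -` cdom d) (\<lambda>y. nab (f y) (coord_field M d u (f y)) (coord_field M d w) d)"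
        by (rule smooth_fn_comp[OF B.open_in_cdom[OF d(1)]])
      then show "smooth_fn B ?V (\<lambda>y. nab (f y) (coord_field M d u (f y)) (coord_field M d w) d)"
        by (rule A.smooth_fn_subset) (use Vp in auto)
    next
      show "smooth_fn B ?V (\<lambda>y. push y (X y) d)"
        using sec_component[OF sec_push[OF U X] d(1)] .
    qed
    show "nab (f y) (coord_field M d (push y (X y) d) (f y)) (coord_field M d w) d =
        nab (f y) (push y (X y)) (coord_field M d w) d" if "y \<in> ?V" for y
      using B.coord_field_component[OF d(1) _ pt[OF that]] that by simp
  qed
  have 2: "smooth_fn B ?V (\<lambda>y. nab (f y) (push y (X y)) (coord_field M d (\<sigma> y d)) d)"
  proof (rule A.smooth_fn_linear_family[where F = "\<lambda>y w. nab (f y) (push y (X y)) (coord_field M d w) d"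
        and s = "\<lambda>y. \<sigma> y d", OF V _ 3 sec_component[OF \<sigma> d(1)]])
    fix y assume y: "y \<in> ?V"
    show "linear (\<lambda>w. nab (f y) (push y (X y)) (coord_field M d w) d)"
      using M.linear_nab_coord[OF d(1) _ pt[OF y]] y by (auto simp: linear_iff)
  qed
  have "smooth_fn B ?V (\<lambda>y. pc y (X y) \<sigma> d)"
    by (rule A.smooth_fn_cong[OF V _ A.smooth_fn_add[OF V 1 2]]) (use d in \<open>auto simp: pull_conn_def\<close>)
  then show "\<exists>d\<in>M. \<exists>V. z \<in> V \<and> V \<subseteq> U \<inter> f -` cdom d \<and> open_in B V \<and> smooth_fn B V (\<lambda>z. pc z (X z) \<sigma> d)"
    using V d z by (intro bexI[of _ d] exI[of _ ?V]) auto
qed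

end

section \<open>Riemannian and Kaehler manifolds\<close>

locale riemannian = atlas M for M :: "('b, 'f::euclidean_space) atlas" +
  fixes g :: "('b, 'f) metric"
  assumes riemannian: "riemannian_metric M g"
begin

context
  fixes x assumes x: "x \<in> points M"
begin

lemma g_linear: "u \<in> tangent_space M x \<Longrightarrow> linear_between (tangent_space M x) UNIV (g x u)"
  using riemannian x unfolding riemannian_metric_def by blast

lemma g_sym: "u \<in> tangent_space M x \<Longrightarrow> v \<in> tangent_space M x \<Longrightarrow> g x u v = g x v u"
  using riemannian x unfolding riemannian_metric_def by blast

lemma g_pos: "v \<in> tangent_space M x \<Longrightarrow> v \<noteq> 0 \<Longrightarrow> g x v v > 0"
  using riemannian x unfolding riemannian_metric_def by blast

lemma g_add_right:
  "u \<in> tangent_space M x \<Longrightarrow> v \<in> tangent_space M x \<Longrightarrow> w \<in> tangent_space M x \<Longrightarrow>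
    g x u (v + w) = g x u v + g x u w"
  using g_linear[of u] unfolding linear_between_def by blast

lemma g_scaleR_right:
  "u \<in> tangent_space M x \<Longrightarrow> v \<in> tangent_space M x \<Longrightarrow> g x u (r *\<^sub>R v) = r * g x u v"
  using g_linear[of u] unfolding linear_between_def by simp

lemma g_add_left:
  "u \<in> tangent_space M x \<Longrightarrow> v \<in> tangent_space M x \<Longrightarrow> w \<in> tangent_space M x \<Longrightarrow>
    g x (v + w) u = g x v u + g x w u"
  using g_add_right[of u v w] g_sym[of _ u] tangent_add[of v x w] by metis

lemma g_scaleR_left:
  "u \<in> tangent_space M x \<Longrightarrow> v \<in> tangent_space M x \<Longrightarrow> g x (r *\<^sub>R v) u = r * g x v u"
  using g_scaleR_right[of u v r] g_sym[of _ u] tangent_scaleR[of v x r] by metis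

lemma g_zero_right: "u \<in> tangent_space M x \<Longrightarrow> g x u 0 = 0"
  using g_scaleR_right[of u 0 0] by simp

lemma g_zero_left: "u \<in> tangent_space M x \<Longrightarrow> g x 0 u = 0"
  using g_scaleR_left[of u 0 0] by simp

lemma g_minus_left: "u \<in> tangent_space M x \<Longrightarrow> v \<in> tangent_space M x \<Longrightarrow> g x (- v) u = - g x v u"
  using g_scaleR_left[of u v "-1"] by simp

lemma g_diff_left:
  "u \<in> tangent_space M x \<Longrightarrow> v \<in> tangent_space M x \<Longrightarrow> w \<in> tangent_space M x \<Longrightarrow>
    g x (v - w) u = g x v u - g x w u"
  using g_add_left[of u v "- w"] g_minus_left[of u w] tangent_uminus[of w x] by simp

lemma g_sum_right:
  assumes u: "u \<in> tangent_space M x" and "\<And>i. i \<in> I \<Longrightarrow> v i \<in> tangent_space M x"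
  shows "g x u (\<Sum>i\<in>I. v i) = (\<Sum>i\<in>I. g x u (v i))"
  using assms(2)
proof (induction I rule: infinite_finite_induct)
  case (insert i I)
  have "g x u (v i + (\<Sum>i\<in>I. v i)) = g x u (v i) + g x u (\<Sum>i\<in>I. v i)"
    using insert.prems by (intro g_add_right u tangent_sum) auto
  moreover have "g x u (\<Sum>i\<in>I. v i) = (\<Sum>i\<in>I. g x u (v i))" using insert.prems by (intro insert.IH) auto
  ultimately show ?case unfolding sum.insert[OF insert.hyps] by (simp only:)
qed (use g_zero_right[OF u] in \<open>simp_all only: sum.infinite sum.empty not_False_eq_True\<close>)

lemma g_nondegenerate:
  assumes "u \<in> tangent_space M x" "\<And>w. w \<in> tangent_space M x \<Longrightarrow> g x u w = 0"
  shows "u = 0"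
  using g_pos[OF assms(1)] assms(2)[OF assms(1)] by linarith

end

lemma smooth_fn_g:
  "open_in M U \<Longrightarrow> vector_field_on M U X \<Longrightarrow> vector_field_on M U Y \<Longrightarrow> smooth_fn M U (\<lambda>x. g x (X x) (Y x))"
proof -
  assume *: "open_in M U" "vector_field_on M U X" "vector_field_on M U Y"
  have "\<forall>U X Y. open_in M U \<and> vector_field_on M U X \<and> vector_field_on M U Y \<longrightarrow>
      smooth_fun_on M U (\<lambda>x. g x (X x) (Y x))"
    using riemannian unfolding riemannian_metric_def by (elim conjE)
  then show ?thesis using * by (simp add: smooth_fun_on_eq)
qed

lemma levi_civita_torsion:
  assumes "levi_civita M g n" "open_in M U" "x \<in> U" "vector_field_on M U X" "vector_field_on M U Y"
  shows "n x (X x) Y - n x (Y x) X = lie_bracket M X Y x"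
  using assms unfolding levi_civita_def by blast

lemma levi_civita_metric:
  assumes "levi_civita M g n" "open_in M U" "x \<in> U" "vector_field_on M U X" "vector_field_on M U Y"
    and "v \<in> tangent_space M x"
  shows "dir_deriv M (\<lambda>y. g y (X y) (Y y)) x v = g x (n x v X) (Y x) + g x (X x) (n x v Y)"
  using assms unfolding levi_civita_def by blast

text \<open>Metricity expands the three derivatives and vanishing torsion the three brackets; by
  symmetry of \<open>g\<close> all terms but two equal ones cancel. The right-hand side contains no
  trace of \<open>n\<close>, whence uniqueness.\<close>

lemma koszul_formula:
  assumes n: "levi_civita M g n" and U: "open_in M U" "x \<in> U"
    and X: "vector_field_on M U X" and Y: "vector_field_on M U Y" and Z: "vector_field_on M U Z"
  shows "2 * g x (n x (X x) Y) (Z x) =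
    dir_deriv M (\<lambda>y. g y (Y y) (Z y)) x (X x) + dir_deriv M (\<lambda>y. g y (Z y) (X y)) x (Y x)
    - dir_deriv M (\<lambda>y. g y (X y) (Y y)) x (Z x) + g x (lie_bracket M X Y x) (Z x)
    - g x (lie_bracket M X Z x) (Y x) - g x (lie_bracket M Y Z x) (X x)"
proof -
  interpret connection M n using n by unfold_locales (simp add: levi_civita_def)
  have xp: "x \<in> points M" using U open_in_points by auto
  note t = vector_field_tangent[OF _ U(2)]
  have nt: "n x (V x) W \<in> tangent_space M x" if "vector_field_on M U V" "vector_field_on M U W" for V W
    by (rule nab_tangent[OF U t[OF that(1)] that(2)])
  have L: "lie_bracket M V W x = n x (V x) W - n x (W x) V" if "vector_field_on M U V" "vector_field_on M U W" for V W
    using levi_civita_torsion[OF n U that] by simp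
  note D = levi_civita_metric[OF n U _ _ t]
  show ?thesis
    unfolding L[OF X Y] L[OF X Z] L[OF Y Z] D[OF Y Z X] D[OF Z X Y] D[OF X Y Z]
      g_diff_left[OF xp t[OF Z] nt[OF X Y] nt[OF Y X]] g_diff_left[OF xp t[OF Y] nt[OF X Z] nt[OF Z X]]
      g_diff_left[OF xp t[OF X] nt[OF Y Z] nt[OF Z Y]]
    using g_sym[OF xp t[OF Y] nt[OF X Z]] g_sym[OF xp t[OF Z] nt[OF Y X]] g_sym[OF xp t[OF X] nt[OF Z Y]]
    by simp
qed

text \<open>The vectors \<open>v\<close> and \<open>w\<close> are extended by coordinate fields, the
  Koszul formula gives the same scalar product with \<open>w\<close> for both connections, and the
  metric is nondegenerate.\<close>

lemma levi_civita_unique: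
  assumes n: "levi_civita M g n1" "levi_civita M g n2" and U: "open_in M U" "x \<in> U"
    and Y: "vector_field_on M U Y" and v: "v \<in> tangent_space M x"
  shows "n1 x v Y = n2 x v Y"
proof -
  interpret n1: connection M n1 using n by unfold_locales (simp add: levi_civita_def)
  interpret n2: connection M n2 using n by unfold_locales (simp add: levi_civita_def)
  have xp: "x \<in> points M" using U open_in_points by auto
  then obtain c where c: "c \<in> M" "x \<in> cdom c" by (rule pointsE)
  let ?V = "U \<inter> cdom c"
  have V: "open_in M ?V" "x \<in> ?V" using U c by (auto intro: open_in_Int open_in_cdom)
  have cf: "vector_field_on M ?V (coord_field M c w)" for w
    by (rule vector_field_subset[OF vector_field_coord_field[OF c(1)]]) auto
  have Y': "vector_field_on M ?V Y" by (rule vector_field_subset[OF Y]) auto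
  have t: "n1 x v Y \<in> tangent_space M x" "n2 x v Y \<in> tangent_space M x"
    using n1.nab_tangent[OF U v Y] n2.nab_tangent[OF U v Y] .
  have "g x (n1 x v Y - n2 x v Y) w = 0" if w: "w \<in> tangent_space M x" for w
    using koszul_formula[OF n(1) V cf[of "v c"] Y' cf[of "w c"]] koszul_formula[OF n(2) V cf[of "v c"] Y' cf[of "w c"]]
    unfolding coord_field_component[OF c v] coord_field_component[OF c w] g_diff_left[OF xp w t] by simp
  from g_nondegenerate[OF xp tangent_diff[OF t] this] show ?thesis by simp
qed

end

context atlas
begin

lemma lie_bracket_coord_field:
  assumes c: "c \<in> A" "x \<in> cdom c"
  shows "lie_bracket A (coord_field A c v) (coord_field A c w) x = 0"
proof (rule tangent_eqI[OF _ _ c])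
  show "lie_bracket A (coord_field A c v) (coord_field A c w) x \<in> tangent_space A x"
    using c by (intro lie_bracket_tangent[OF open_in_cdom vector_field_coord_field vector_field_coord_field])
  have "dir_deriv A (\<lambda>y. coord_field A c w y c) x u = 0" for u w
    using dir_deriv_cong[OF open_in_cdom[OF c(1)] c(2), of "\<lambda>y. coord_field A c w y c" "\<lambda>_. w" u] c by simp
  then show "lie_bracket A (coord_field A c v) (coord_field A c w) x c = (0 :: ('a, 'e) tvec) c"
    by (simp add: lie_bracket_def)
qed simp

end

section \<open>Kaehler manifolds with a chosen Levi-Civita connection\<close>

locale kaehler_manifold = connection M nab for M :: "('b, 'f::euclidean_space) atlas" and nab +
  fixes g :: "('b, 'f) metric" and J :: "('b, 'f) endo"
  assumes metric: "riemannian_metric M g"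
    and acs: "almost_complex_structure M J"
    and hermitian: "\<And>x u v. x \<in> points M \<Longrightarrow> u \<in> tangent_space M x \<Longrightarrow> v \<in> tangent_space M x \<Longrightarrow>
      g x (J x u) (J x v) = g x u v"
    and levi_civita: "levi_civita M g nab"
    and parallel: "parallel M nab J"

sublocale kaehler_manifold \<subseteq> riemannian M g
  by unfold_locales (rule metric)

text \<open>The connection hidden in \<open>kaehlerian\<close> may be any Levi-Civita connection
  with \<open>J\<close> parallel; by uniqueness it agrees with the given one on vector fields, so
  \<open>J\<close> is parallel for that one as well.\<close>

lemma (in atlas) kaehler_manifoldI:
  assumes k: "kaehlerian A J g" and n: "levi_civita A g nab"
  shows "kaehler_manifold A nab g J"
proof -
  interpret riemannian A g by unfold_locales (use k in \<open>simp add: kaehlerian_def\<close>)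
  obtain n' where n': "levi_civita A g n'" "parallel A n' J" using k by (auto simp: kaehlerian_def)
  have acs: "almost_complex_structure A J" using k by (simp add: kaehlerian_def)
  have "parallel A nab J"
    unfolding parallel_def
  proof (intro allI impI ballI)
    fix U Y x v assume a: "open_in A U \<and> vector_field_on A U Y" and x: "x \<in> U" and v: "v \<in> tangent_space A x"
    have JY: "vector_field_on A U (\<lambda>y. J y (Y y))"
      using a acs unfolding almost_complex_structure_def by blast
    have "n' x v (\<lambda>y. J y (Y y)) = J x (n' x v Y)" using n'(2) a x v unfolding parallel_def by blast
    then show "nab x v (\<lambda>y. J y (Y y)) = J x (nab x v Y)"
      using levi_civita_unique[OF n n'(1) _ x JY v] levi_civita_unique[OF n n'(1) _ x _ v, of Y] a by simp
  qed
  then show ?thesis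
    using k n by unfold_locales (auto simp: kaehlerian_def levi_civita_def)
qed

context kaehler_manifold
begin

lemma J_linear: "x \<in> points M \<Longrightarrow> linear_between (tangent_space M x) (tangent_space M x) (J x)"
  using acs unfolding almost_complex_structure_def by blast

lemma J_J: "x \<in> points M \<Longrightarrow> v \<in> tangent_space M x \<Longrightarrow> J x (J x v) = - v"
  using acs unfolding almost_complex_structure_def by blast

lemma J_vector_field: "open_in M U \<Longrightarrow> vector_field_on M U X \<Longrightarrow> vector_field_on M U (\<lambda>x. J x (X x))"
  using acs unfolding almost_complex_structure_def by blast

lemma J_tangent: "x \<in> points M \<Longrightarrow> v \<in> tangent_space M x \<Longrightarrow> J x v \<in> tangent_space M x"
  using J_linear[of x] unfolding linear_between_def by blast

lemma J_add: "x \<in> points M \<Longrightarrow> u \<in> tangent_space M x \<Longrightarrow> v \<in> tangent_space M x \<Longrightarrow> J x (u + v) = J x u + J x v"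
  using J_linear[of x] unfolding linear_between_def by blast

lemma J_scaleR: "x \<in> points M \<Longrightarrow> v \<in> tangent_space M x \<Longrightarrow> J x (r *\<^sub>R v) = r *\<^sub>R J x v"
  using J_linear[of x] unfolding linear_between_def by blast

lemma J_zero: "x \<in> points M \<Longrightarrow> J x 0 = 0"
  using J_scaleR[of x 0 0] by simp

lemma J_minus: "x \<in> points M \<Longrightarrow> v \<in> tangent_space M x \<Longrightarrow> J x (- v) = - J x v"
  using J_scaleR[of x v "-1"] by simp

lemma J_sum:
  assumes x: "x \<in> points M" and "\<And>i. i \<in> I \<Longrightarrow> v i \<in> tangent_space M x"
  shows "J x (\<Sum>i\<in>I. v i) = (\<Sum>i\<in>I. J x (v i))"
  using assms(2)
proof (induction I rule: infinite_finite_induct)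
  case (insert i I)
  have "J x (v i + (\<Sum>i\<in>I. v i)) = J x (v i) + J x (\<Sum>i\<in>I. v i)"
    using insert.prems by (intro J_add x tangent_sum) auto
  moreover have "J x (\<Sum>i\<in>I. v i) = (\<Sum>i\<in>I. J x (v i))" using insert.prems by (intro insert.IH) auto
  ultimately show ?case unfolding sum.insert[OF insert.hyps] by (simp only:)
qed (use J_zero[OF x] in \<open>simp_all only: sum.infinite sum.empty not_False_eq_True\<close>)

lemma nab_coord_symmetric:
  assumes d: "d \<in> M" "x \<in> cdom d"
  shows "nab x (coord_field M d v x) (coord_field M d w) = nab x (coord_field M d w x) (coord_field M d v)"
  using levi_civita_torsion[OF levi_civita open_in_cdom[OF d(1)] d(2) vector_field_coord_field[OF d(1)]
      vector_field_coord_field[OF d(1)], of v w] lie_bracket_coord_field[OF d, of v w] by simp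

end

section \<open>Metric, complex structure and frames along a smooth map\<close>

locale kaehler_pullback = pullback B M f nab + M: kaehler_manifold M nab g J
  for B :: "('a, 'e::euclidean_space) atlas" and M :: "('b, 'f::euclidean_space) atlas"
    and f :: "'a \<Rightarrow> 'b" and nab :: "('b, 'f) conn" and g :: "('b, 'f) metric" and J :: "('b, 'f) endo"
begin

lemma linear_g_coord_right:
  assumes "x \<in> cdom d" "d \<in> M" "u \<in> tangent_space M x"
  shows "linear (\<lambda>w. g x u (coord_field M d w x))"
proof (rule linearI)
  have x: "x \<in> points M" by (rule B.cdom_points[OF assms(2,1)])
  note t = B.coord_field_tangent[OF assms(2,1)] and l = B.linear_coord_field[OF assms(2,1)]
  show "g x u (coord_field M d (a + b) x) = g x u (coord_field M d a x) + g x u (coord_field M d b x)" for a b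
    using M.g_add_right[OF x assms(3) t t] linear_add[OF l] by simp
  show "g x u (coord_field M d (r *\<^sub>R a) x) = r *\<^sub>R g x u (coord_field M d a x)" for r a
    using M.g_scaleR_right[OF x assms(3) t] linear_scale[OF l] by simp
qed

lemma linear_g_coord_left:
  assumes "x \<in> cdom d" "d \<in> M" "u \<in> tangent_space M x"
  shows "linear (\<lambda>w. g x (coord_field M d w x) u)"
  using linear_g_coord_right[OF assms]
    M.g_sym[OF B.cdom_points[OF assms(2,1)] B.coord_field_tangent[OF assms(2,1)] assms(3)] by simp

lemma smooth_fn_g_coord:
  assumes "d \<in> M"
  shows "smooth_fn B (points B \<inter> f -` cdom d) (\<lambda>z. g (f z) (coord_field M d v (f z)) (coord_field M d w (f z)))"
  by (rule smooth_fn_comp[OF B.open_in_cdom[OF assms] M.smooth_fn_g[OF B.open_in_cdom[OF assms]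
        B.vector_field_coord_field[OF assms] B.vector_field_coord_field[OF assms]]])

lemma smooth_fn_g_coord_sec:
  assumes U: "open_in B U" and \<tau>: "sec U \<tau>" and d: "d \<in> M"
  shows "smooth_fn B (U \<inter> f -` cdom d) (\<lambda>z. g (f z) (coord_field M d v (f z)) (\<tau> z))"
proof (rule A.smooth_fn_cong)
  let ?V = "U \<inter> f -` cdom d"
  show V: "open_in B ?V" by (rule open_chart[OF U d])
  show "smooth_fn B ?V (\<lambda>z. g (f z) (coord_field M d v (f z)) (coord_field M d (\<tau> z d) (f z)))"
  proof (rule A.smooth_fn_linear_family[where s = "\<lambda>z. \<tau> z d"
        and F = "\<lambda>z w. g (f z) (coord_field M d v (f z)) (coord_field M d w (f z))", OF V _ _ sec_component[OF \<tau> d]])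
    show "linear (\<lambda>w. g (f z) (coord_field M d v (f z)) (coord_field M d w (f z)))" if "z \<in> ?V" for z
      using that d by (intro linear_g_coord_right B.coord_field_tangent) auto
    show "smooth_fn B ?V (\<lambda>z. g (f z) (coord_field M d v (f z)) (coord_field M d w (f z)))" for w
      by (rule A.smooth_fn_subset[OF smooth_fn_g_coord[OF d]]) (use A.open_in_points[OF U] in auto)
  qed
  show "g (f z) (coord_field M d v (f z)) (coord_field M d (\<tau> z d) (f z)) = g (f z) (coord_field M d v (f z)) (\<tau> z)"
    if "z \<in> ?V" for z
    using B.coord_field_component[OF d _ sec_tangent[OF \<tau>]] that by simp
qed

text \<open>Smoothness of the metric is given for vector fields of the target. Sections along
  \<open>f\<close> are reduced to coordinate fields by freezing the components of one argument after
  the other.\<close>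

lemma smooth_fn_g_sec:
  assumes U: "open_in B U" and \<sigma>: "sec U \<sigma>" and \<tau>: "sec U \<tau>"
  shows "smooth_fn B U (\<lambda>z. g (f z) (\<sigma> z) (\<tau> z))"
proof (rule A.smooth_fn_localI)
  fix z assume z: "z \<in> U"
  obtain d where d: "d \<in> M" "f z \<in> cdom d" by (rule chart_exists[OF U z])
  let ?V = "U \<inter> f -` cdom d"
  have V: "open_in B ?V" by (rule open_chart[OF U d(1)])
  have "smooth_fn B ?V (\<lambda>z. g (f z) (coord_field M d (\<sigma> z d) (f z)) (\<tau> z))"
  proof (rule A.smooth_fn_linear_family[where s = "\<lambda>z. \<sigma> z d"
        and F = "\<lambda>z w. g (f z) (coord_field M d w (f z)) (\<tau> z)", OF V _ _ sec_component[OF \<sigma> d(1)]])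
    show "linear (\<lambda>w. g (f z) (coord_field M d w (f z)) (\<tau> z))" if "z \<in> ?V" for z
      using that d sec_tangent[OF \<tau>] by (intro linear_g_coord_left) auto
  qed (rule smooth_fn_g_coord_sec[OF U \<tau> d(1)])
  then have "smooth_fn B ?V (\<lambda>z. g (f z) (\<sigma> z) (\<tau> z))"
    by (rule A.smooth_fn_cong[OF V, rotated]) (use B.coord_field_component[OF d(1) _ sec_tangent[OF \<sigma>]] in simp)
  then show "\<exists>V. open_in B V \<and> z \<in> V \<and> smooth_fn B V (\<lambda>z. g (f z) (\<sigma> z) (\<tau> z))"
    using V z d by blast
qed

text \<open>Freezing the components of both sections leaves the metricity of \<open>nab\<close> on
  coordinate fields; the derivatives of the components give the two remaining terms.\<close>

lemma pull_conn_metric: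
  assumes U: "open_in B U" "z \<in> U" and \<sigma>: "sec U \<sigma>" and \<tau>: "sec U \<tau>" and v: "v \<in> tangent_space B z"
  shows "dir_deriv B (\<lambda>y. g (f y) (\<sigma> y) (\<tau> y)) z v = g (f z) (pc z v \<sigma>) (\<tau> z) + g (f z) (\<sigma> z) (pc z v \<tau>)"
proof -
  obtain d where d: "d \<in> M" "f z \<in> cdom d" by (rule chart_exists[OF U])
  let ?V = "U \<inter> f -` cdom d"
  have V: "open_in B ?V" "z \<in> ?V" using open_chart[OF U(1) d(1)] U d by auto
  have zp: "z \<in> points B" and fp: "f z \<in> points M" using A.open_in_points U maps by auto
  let ?E = "coord_field M d" and ?x = "f z" and ?W = "push z v"
  have W: "?W \<in> tangent_space M ?x" by (rule tangent_map_tangent[OF zp v])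
  have t: "?E w ?x \<in> tangent_space M ?x" for w by (rule B.coord_field_tangent[OF d])
  have nt: "nab ?x ?W (?E w) \<in> tangent_space M ?x" for w
    by (rule M.nab_tangent[OF B.open_in_cdom[OF d(1)] d(2) W B.vector_field_coord_field[OF d(1)]])
  have s\<sigma>: "?E (\<sigma> y d) (f y) = \<sigma> y" and s\<tau>: "?E (\<tau> y d) (f y) = \<tau> y" if "y \<in> ?V" for y
    using that d sec_tangent[OF \<sigma>] sec_tangent[OF \<tau>] by (auto intro: B.coord_field_component)
  have "dir_deriv B (\<lambda>y. g (f y) (\<sigma> y) (\<tau> y)) z v = dir_deriv B (\<lambda>y. g (f y) (?E (\<sigma> y d) (f y)) (\<tau> y)) z v"
    by (rule A.dir_deriv_cong[OF V]) (simp add: s\<sigma>)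
  also have "\<dots> = dir_deriv B (\<lambda>y. g (f y) (?E (\<sigma> z d) (f y)) (\<tau> y)) z v +
      g ?x (?E (dir_deriv B (\<lambda>y. \<sigma> y d) z v) ?x) (\<tau> z)"
  proof (rule A.dir_deriv_linear_family[where s = "\<lambda>z. \<sigma> z d"
        and F = "\<lambda>z w. g (f z) (?E w (f z)) (\<tau> z)", OF V _ _ sec_near[OF \<sigma> U d] v])
    show "linear (\<lambda>w. g (f z) (coord_field M d w (f z)) (\<tau> z))" if "z \<in> ?V" for z
      using that d sec_tangent[OF \<tau>] by (intro linear_g_coord_left) auto
  qed (rule smooth_fn_g_coord_sec[OF U(1) \<tau> d(1)])
  also have "dir_deriv B (\<lambda>y. g (f y) (?E (\<sigma> z d) (f y)) (\<tau> y)) z v =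
      dir_deriv B (\<lambda>y. g (f y) (?E (\<sigma> z d) (f y)) (?E (\<tau> y d) (f y))) z v"
    by (rule A.dir_deriv_cong[OF V]) (simp add: s\<tau>)
  also have "\<dots> = dir_deriv B (\<lambda>y. g (f y) (?E (\<sigma> z d) (f y)) (?E (\<tau> z d) (f y))) z v +
      g ?x (?E (\<sigma> z d) ?x) (?E (dir_deriv B (\<lambda>y. \<tau> y d) z v) ?x)"
  proof (rule A.dir_deriv_linear_family[where s = "\<lambda>z. \<tau> z d"
        and F = "\<lambda>y w. g (f y) (?E (\<sigma> z d) (f y)) (?E w (f y))", OF V _ _ sec_near[OF \<tau> U d] v])
    show "linear (\<lambda>w. g (f y) (?E (\<sigma> z d) (f y)) (?E w (f y)))" if "y \<in> ?V" for y
      using that d by (intro linear_g_coord_right B.coord_field_tangent) auto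
    show "smooth_fn B ?V (\<lambda>y. g (f y) (?E (\<sigma> z d) (f y)) (?E w (f y)))" for w
      by (rule A.smooth_fn_subset[OF smooth_fn_g_coord[OF d(1)]]) (use A.open_in_points[OF U(1)] in auto)
  qed
  also have "dir_deriv B (\<lambda>y. g (f y) (?E (\<sigma> z d) (f y)) (?E (\<tau> z d) (f y))) z v =
      dir_deriv M (\<lambda>x. g x (?E (\<sigma> z d) x) (?E (\<tau> z d) x)) ?x ?W"
    by (rule dir_deriv_comp[OF zp B.smooth_nearI[OF B.open_in_cdom[OF d(1)] d(2)
            M.smooth_fn_g[OF B.open_in_cdom[OF d(1)] B.vector_field_coord_field[OF d(1)]
              B.vector_field_coord_field[OF d(1)]]] v])
  also have "\<dots> = g ?x (nab ?x ?W (?E (\<sigma> z d))) (?E (\<tau> z d) ?x) + g ?x (?E (\<sigma> z d) ?x) (nab ?x ?W (?E (\<tau> z d)))"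
    by (rule M.levi_civita_metric[OF M.levi_civita B.open_in_cdom[OF d(1)] d(2)
          B.vector_field_coord_field[OF d(1)] B.vector_field_coord_field[OF d(1)] W])
  finally have eq: "dir_deriv B (\<lambda>y. g (f y) (\<sigma> y) (\<tau> y)) z v =
      g ?x (nab ?x ?W (?E (\<sigma> z d))) (\<tau> z) + g ?x (\<sigma> z) (nab ?x ?W (?E (\<tau> z d))) +
      g ?x (\<sigma> z) (?E (dir_deriv B (\<lambda>y. \<tau> y d) z v) ?x) + g ?x (?E (dir_deriv B (\<lambda>y. \<sigma> y d) z v) ?x) (\<tau> z)"
    unfolding s\<sigma>[OF V(2)] s\<tau>[OF V(2)] .
  show ?thesis
    unfolding eq pull_conn_coord[OF U \<sigma> v d] pull_conn_coord[OF U \<tau> v d]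
      M.g_add_left[OF fp sec_tangent[OF \<tau> U(2)] t nt] M.g_add_right[OF fp sec_tangent[OF \<sigma> U(2)] t nt]
    by simp
qed

lemma sec_expand:
  assumes "sec U \<sigma>" "d \<in> M" "y \<in> U \<inter> f -` cdom d"
  shows "\<sigma> y = (\<Sum>b\<in>Basis. (\<sigma> y d \<bullet> b) *\<^sub>R coord_field M d b (f y))"
  using B.coord_field_sum[OF assms(2), of "f y" "\<sigma> y d"] B.coord_field_component[OF assms(2) _ sec_tangent[OF assms(1)]] assms(3)
  by simp

lemma J_sec_expand:
  assumes "sec U \<sigma>" "d \<in> M" "y \<in> U \<inter> f -` cdom d"
  shows "J (f y) (\<sigma> y) = (\<Sum>b\<in>Basis. (\<sigma> y d \<bullet> b) *\<^sub>R J (f y) (coord_field M d b (f y)))"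
proof -
  have y: "f y \<in> points M" "f y \<in> cdom d" using assms B.cdom_points by auto
  note t = B.coord_field_tangent[OF assms(2) y(2)]
  have "J (f y) (\<sigma> y) = J (f y) (\<Sum>b\<in>Basis. (\<sigma> y d \<bullet> b) *\<^sub>R coord_field M d b (f y))"
    using sec_expand[OF assms] by simp
  also have "\<dots> = (\<Sum>b\<in>Basis. J (f y) ((\<sigma> y d \<bullet> b) *\<^sub>R coord_field M d b (f y)))"
    by (intro M.J_sum y B.tangent_scaleR t)
  also have "\<dots> = (\<Sum>b\<in>Basis. (\<sigma> y d \<bullet> b) *\<^sub>R J (f y) (coord_field M d b (f y)))"
    by (intro sum.cong refl M.J_scaleR y t)
  finally show ?thesis .
qed

lemma sec_J_coord:
  assumes "open_in B U" "d \<in> M"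
  shows "sec (U \<inter> f -` cdom d) (\<lambda>z. J (f z) (coord_field M d b (f z)))"
  by (rule sec_comp[OF B.open_in_cdom[OF assms(2)] M.J_vector_field[OF B.open_in_cdom[OF assms(2)] B.vector_field_coord_field[OF assms(2)]]])
    (use A.open_in_points[OF assms(1)] in auto)

lemma sec_J:
  assumes U: "open_in B U" and \<sigma>: "sec U \<sigma>"
  shows "sec U (\<lambda>z. J (f z) (\<sigma> z))"
proof (rule secI[OF U])
  fix z assume z: "z \<in> U"
  have fp: "f z \<in> points M" using z A.open_in_points[OF U] maps by auto
  show "J (f z) (\<sigma> z) \<in> tangent_space M (f z)" by (rule M.J_tangent[OF fp sec_tangent[OF \<sigma> z]])
  obtain d where d: "d \<in> M" "f z \<in> cdom d" by (rule chart_exists[OF U z])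
  let ?V = "U \<inter> f -` cdom d"
  have V: "open_in B ?V" by (rule open_chart[OF U d(1)])
  have "sec ?V (\<lambda>y. \<Sum>b\<in>Basis. (\<sigma> y d \<bullet> b) *\<^sub>R J (f y) (coord_field M d b (f y)))"
    by (intro sec_sum sec_scaleR V A.smooth_fn_inner_left sec_component[OF \<sigma> d(1)] sec_J_coord[OF U d(1)])
  then have "sec ?V (\<lambda>z. J (f z) (\<sigma> z))"
    by (rule sec_cong[OF V]) (rule J_sec_expand[OF \<sigma> d(1), symmetric])
  from sec_component[OF this d(1)]
  have "smooth_fn B ?V (\<lambda>z. J (f z) (\<sigma> z) d)" by (simp add: Int_assoc)
  then show "\<exists>d\<in>M. \<exists>V. z \<in> V \<and> V \<subseteq> U \<inter> f -` cdom d \<and> open_in B V \<and> smooth_fn B V (\<lambda>z. J (f z) (\<sigma> z) d)"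
    using V d z by (intro bexI[of _ d] exI[of _ ?V]) auto
qed

text \<open>Covers two expansions at once: the fields \<open>E i\<close> are the coordinate fields
  for a section, and their images under \<open>J\<close> for its image.\<close>

lemma pull_conn_expand:
  fixes s :: "'i \<Rightarrow> 'a \<Rightarrow> real"
  assumes V: "open_in B V" "z \<in> V" and W: "open_in M W" "f z \<in> W" "f ` V \<subseteq> W" and v: "v \<in> tangent_space B z"
    and I: "finite I" and s: "\<And>i. i \<in> I \<Longrightarrow> smooth_fn B V (s i)" and E: "\<And>i. i \<in> I \<Longrightarrow> vector_field_on M W (E i)"
  shows "pc z v (\<lambda>y. \<Sum>i\<in>I. s i y *\<^sub>R E i (f y)) =
    (\<Sum>i\<in>I. dir_deriv B (s i) z v *\<^sub>R E i (f z) + s i z *\<^sub>R nab (f z) (push z v) (E i))"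
proof -
  have Es: "sec V (\<lambda>y. E i (f y))" if "i \<in> I" for i
    by (rule sec_comp[OF W(1) E[OF that]]) (use A.open_in_points[OF V(1)] W in auto)
  have "pc z v (\<lambda>y. \<Sum>i\<in>I. s i y *\<^sub>R E i (f y)) = (\<Sum>i\<in>I. pc z v (\<lambda>y. s i y *\<^sub>R E i (f y)))"
    by (rule pull_conn_sum[OF V I sec_scaleR[OF V(1) s Es] v])
  also have "\<dots> = (\<Sum>i\<in>I. dir_deriv B (s i) z v *\<^sub>R E i (f z) + s i z *\<^sub>R nab (f z) (push z v) (E i))"
    using pull_conn_leibniz[OF V s Es v] pull_conn_comp[OF V W(1,2) E v] by (intro sum.cong refl) simp
  finally show ?thesis .
qed

text \<open>Parallelism of \<open>J\<close> is known for fields on the target, in particular for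
  coordinate fields. The expansion of \<open>\<sigma>\<close> and that of \<open>J \<sigma>\<close>
  have the same coefficients, so linearity and the Leibniz rule extend it to sections along
  \<open>f\<close>.\<close>

lemma pull_conn_J:
  assumes U: "open_in B U" "z \<in> U" and \<sigma>: "sec U \<sigma>" and v: "v \<in> tangent_space B z"
  shows "pc z v (\<lambda>y. J (f y) (\<sigma> y)) = J (f z) (pc z v \<sigma>)"
proof -
  obtain d where d: "d \<in> M" "f z \<in> cdom d" by (rule chart_exists[OF U])
  let ?V = "U \<inter> f -` cdom d"
  have V: "open_in B ?V" "z \<in> ?V" using open_chart[OF U(1) d(1)] U d by auto
  have zp: "z \<in> points B" and fp: "f z \<in> points M" using A.open_in_points U maps by auto
  let ?s = "\<lambda>b y. \<sigma> y d \<bullet> b" and ?W = "push z v"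
  have W: "?W \<in> tangent_space M (f z)" by (rule tangent_map_tangent[OF zp v])
  have s: "smooth_fn B ?V (?s b)" for b by (rule A.smooth_fn_inner_left[OF V(1) sec_component[OF \<sigma> d(1)]])
  note o = B.open_in_cdom[OF d(1)] and cf = B.vector_field_coord_field[OF d(1)] and t = B.coord_field_tangent[OF d]
  have nt: "nab (f z) ?W (coord_field M d b) \<in> tangent_space M (f z)" for b
    by (rule M.nab_tangent[OF o d(2) W cf])
  have par: "nab (f z) ?W (\<lambda>y. J y (coord_field M d b y)) = J (f z) (nab (f z) ?W (coord_field M d b))" for b
    using M.parallel o cf d(2) W unfolding parallel_def by blast
  have sub: "f ` ?V \<subseteq> cdom d" by auto
  have "pc z v (\<lambda>y. J (f y) (\<sigma> y)) = pc z v (\<lambda>y. \<Sum>b\<in>Basis. ?s b y *\<^sub>R J (f y) (coord_field M d b (f y)))"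
    by (rule pull_conn_cong[OF V J_sec_expand[OF \<sigma> d(1)]])
  also have "\<dots> = (\<Sum>b\<in>Basis. dir_deriv B (?s b) z v *\<^sub>R J (f z) (coord_field M d b (f z)) +
      ?s b z *\<^sub>R nab (f z) ?W (\<lambda>y. J y (coord_field M d b y)))"
    by (rule pull_conn_expand[where E = "\<lambda>b y. J y (coord_field M d b y)", OF V o d(2) sub v finite_Basis s M.J_vector_field[OF o cf]])
  also have "\<dots> = (\<Sum>b\<in>Basis. J (f z) (dir_deriv B (?s b) z v *\<^sub>R coord_field M d b (f z) +
      ?s b z *\<^sub>R nab (f z) ?W (coord_field M d b)))"
    using M.J_add[OF fp B.tangent_scaleR[OF t] B.tangent_scaleR[OF nt]] M.J_scaleR[OF fp t] M.J_scaleR[OF fp nt] par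
    by (intro sum.cong refl) simp
  also have "\<dots> = J (f z) (\<Sum>b\<in>Basis. dir_deriv B (?s b) z v *\<^sub>R coord_field M d b (f z) +
      ?s b z *\<^sub>R nab (f z) ?W (coord_field M d b))"
    by (intro M.J_sum[symmetric] fp B.tangent_add B.tangent_scaleR t nt)
  also have "(\<Sum>b\<in>Basis. dir_deriv B (?s b) z v *\<^sub>R coord_field M d b (f z) +
      ?s b z *\<^sub>R nab (f z) ?W (coord_field M d b)) = pc z v (\<lambda>y. \<Sum>b\<in>Basis. ?s b y *\<^sub>R coord_field M d b (f y))"
    by (rule pull_conn_expand[where E = "\<lambda>b. coord_field M d b", OF V o d(2) sub v finite_Basis s cf, symmetric])
  also have "\<dots> = pc z v \<sigma>" by (rule pull_conn_cong[OF V sec_expand[OF \<sigma> d(1), symmetric]])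
  finally show ?thesis .
qed

text \<open>Coefficients with respect to a smooth frame are obtained by inverting its Gram matrix.\<close>

lemma smooth_fn_frame_coefficients:
  fixes \<Phi> :: "'a \<Rightarrow> 'w::euclidean_space \<Rightarrow> ('b, 'f) tvec"
  assumes U: "open_in B U" and lin: "\<And>z. z \<in> U \<Longrightarrow> linear (\<Phi> z)" and inj: "\<And>z. z \<in> U \<Longrightarrow> inj (\<Phi> z)"
    and \<Phi>: "\<And>w. sec U (\<lambda>z. \<Phi> z w)" and \<sigma>: "sec U \<sigma>" and eq: "\<And>z. z \<in> U \<Longrightarrow> \<Phi> z (s z) = \<sigma> z"
  shows "smooth_fn B U s"
proof (rule A.smooth_fn_solution[where F = "\<lambda>z w. \<Sum>b\<in>Basis. g (f z) (\<Phi> z w) (\<Phi> z b) *\<^sub>R b"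
      and b = "\<lambda>z. \<Sum>b\<in>Basis. g (f z) (\<sigma> z) (\<Phi> z b) *\<^sub>R b", OF U])
  fix z assume z: "z \<in> U"
  have fp: "f z \<in> points M" using z A.open_in_points[OF U] maps by auto
  have t: "\<Phi> z w \<in> tangent_space M (f z)" for w by (rule sec_tangent[OF \<Phi> z])
  show L: "linear (\<lambda>w. \<Sum>b\<in>Basis. g (f z) (\<Phi> z w) (\<Phi> z b) *\<^sub>R b)"
  proof (rule linearI)
    show "(\<Sum>b\<in>Basis. g (f z) (\<Phi> z (v + w)) (\<Phi> z b) *\<^sub>R b) =
      (\<Sum>b\<in>Basis. g (f z) (\<Phi> z v) (\<Phi> z b) *\<^sub>R b) + (\<Sum>b\<in>Basis. g (f z) (\<Phi> z w) (\<Phi> z b) *\<^sub>R b)" for v w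
      using M.g_add_left[OF fp t t t] linear_add[OF lin[OF z]] by (simp add: scaleR_add_left sum.distrib)
    show "(\<Sum>b\<in>Basis. g (f z) (\<Phi> z (r *\<^sub>R w)) (\<Phi> z b) *\<^sub>R b) = r *\<^sub>R (\<Sum>b\<in>Basis. g (f z) (\<Phi> z w) (\<Phi> z b) *\<^sub>R b)" for r w
      using M.g_scaleR_left[OF fp t t] linear_scale[OF lin[OF z]] by (simp add: scaleR_sum_right)
  qed
  show "inj (\<lambda>w. \<Sum>b\<in>Basis. g (f z) (\<Phi> z w) (\<Phi> z b) *\<^sub>R b)"
    unfolding linear_injective_0[OF L]
  proof (intro allI impI)
    fix w assume 0: "(\<Sum>b\<in>Basis. g (f z) (\<Phi> z w) (\<Phi> z b) *\<^sub>R b) = 0"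
    have "g (f z) (\<Phi> z w) (\<Phi> z b) = 0" if "b \<in> Basis" for b
      using arg_cong[OF 0, of "\<lambda>v. v \<bullet> b"] that by simp
    then have "g (f z) (\<Phi> z w) (\<Sum>b\<in>Basis. (w \<bullet> b) *\<^sub>R \<Phi> z b) = 0"
      using M.g_sum_right[OF fp t, of Basis "\<lambda>b. (w \<bullet> b) *\<^sub>R \<Phi> z b"] M.g_scaleR_right[OF fp t t] B.tangent_scaleR[OF t]
      by simp
    then have "g (f z) (\<Phi> z w) (\<Phi> z w) = 0" using linear_eq_sum_Basis[OF lin[OF z], of w] by simp
    then have "\<Phi> z w = 0" using M.g_pos[OF fp t, of w] by force
    then show "w = 0" using inj[OF z] linear_injective_0[OF lin[OF z]] by blast
  qed
  show "(\<Sum>b\<in>Basis. g (f z) (\<Phi> z (s z)) (\<Phi> z b) *\<^sub>R b) = (\<Sum>b\<in>Basis. g (f z) (\<sigma> z) (\<Phi> z b) *\<^sub>R b)"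
    by (simp add: eq[OF z])
next
  show "smooth_fn B U (\<lambda>z. \<Sum>b\<in>Basis. g (f z) (\<Phi> z w) (\<Phi> z b) *\<^sub>R b)" for w
    by (intro A.smooth_fn_sum A.smooth_fn_scaleR A.smooth_fn_const smooth_fn_g_sec U \<Phi>)
  show "smooth_fn B U (\<lambda>z. \<Sum>b\<in>Basis. g (f z) (\<sigma> z) (\<Phi> z b) *\<^sub>R b)"
    by (intro A.smooth_fn_sum A.smooth_fn_scaleR A.smooth_fn_const smooth_fn_g_sec U \<Phi> \<sigma>)
qed

end

section \<open>Totally geodesic totally real submanifolds\<close>

context atlas
begin

lemma smooth_fn_bilinear_family:
  fixes r :: "'a \<Rightarrow> 'u::euclidean_space" and s :: "'a \<Rightarrow> 'w::euclidean_space"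
    and F :: "'a \<Rightarrow> 'u \<Rightarrow> 'w \<Rightarrow> 'b::real_normed_vector"
  assumes U: "open_in A U" and l: "\<And>y b. y \<in> U \<Longrightarrow> linear (\<lambda>a. F y a b)"
    and r: "\<And>y a. y \<in> U \<Longrightarrow> linear (F y a)"
    and F: "\<And>a b. smooth_fn A U (\<lambda>y. F y a b)" and rs: "smooth_fn A U r" "smooth_fn A U s"
  shows "smooth_fn A U (\<lambda>y. F y (r y) (s y))"
  by (rule smooth_fn_linear_family[where F = "\<lambda>y b. F y (r y) b", OF U r
        smooth_fn_linear_family[where F = "\<lambda>y a. F y a b" for b, OF U l F rs(1)] rs(2)])

lemma dir_deriv_bilinear_family:
  fixes r :: "'a \<Rightarrow> 'u::euclidean_space" and s :: "'a \<Rightarrow> 'w::euclidean_space"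
    and F :: "'a \<Rightarrow> 'u \<Rightarrow> 'w \<Rightarrow> 'b::real_normed_vector"
  assumes U: "open_in A U" "x \<in> U" and l: "\<And>y b. y \<in> U \<Longrightarrow> linear (\<lambda>a. F y a b)"
    and r: "\<And>y a. y \<in> U \<Longrightarrow> linear (F y a)"
    and F: "\<And>a b. smooth_fn A U (\<lambda>y. F y a b)" and rs: "smooth_fn A U r" "smooth_fn A U s"
    and v: "v \<in> tangent_space A x"
  shows "dir_deriv A (\<lambda>y. F y (r y) (s y)) x v =
    dir_deriv A (\<lambda>y. F y (r x) (s x)) x v + F x (dir_deriv A r x v) (s x) + F x (r x) (dir_deriv A s x v)"
proof -
  have "dir_deriv A (\<lambda>y. F y (r y) (s y)) x v =
      dir_deriv A (\<lambda>y. F y (r y) (s x)) x v + F x (r x) (dir_deriv A s x v)"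
    by (rule dir_deriv_linear_family[where F = "\<lambda>y b. F y (r y) b", OF U r
          smooth_fn_linear_family[where F = "\<lambda>y a. F y a b" for b, OF U(1) l F rs(1)] smooth_nearI[OF U rs(2)] v])
  also have "dir_deriv A (\<lambda>y. F y (r y) (s x)) x v =
      dir_deriv A (\<lambda>y. F y (r x) (s x)) x v + F x (dir_deriv A r x v) (s x)"
    by (rule dir_deriv_linear_family[where F = "\<lambda>y a. F y a (s x)", OF U l F smooth_nearI[OF U rs(1)] v])
  finally show ?thesis by simp
qed

text \<open>Splits an iterated derivative into the Hessian in a chart and a first derivative. The
  Hessian depends on the chart but is symmetric, so it disappears from commutators.\<close>

lemma dir_deriv_dir_deriv:
  assumes U: "open_in A U" "x \<in> U" and s: "smooth_fn A U s" and Y: "vector_field_on A U Y"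
    and c: "c \<in> A" "x \<in> cdom c" and v: "v \<in> tangent_space A x"
  shows "dir_deriv A (\<lambda>y. dir_deriv A s y (Y y)) x v =
    frechet_derivative (\<lambda>u. frechet_derivative (\<lambda>u. s (cinv c u)) (at u) (Y x c)) (at (cmap c x)) (v c) +
    dir_deriv A s x (coord_field A c (dir_deriv A (\<lambda>y. Y y c) x v) x)"
proof -
  let ?V = "U \<inter> cdom c" and ?s = "\<lambda>u. s (cinv c u)"
  have V: "open_in A ?V" "x \<in> ?V" using U c by (auto intro: open_in_Int open_in_cdom)
  have near: "smooth_near y s" if "y \<in> U" for y by (rule smooth_fn_openD[OF s U(1) that])
  have ss: "smooth_on (cmap c ` ?V) ?s" using s c by (simp add: smooth_fn_def)
  have Yc: "smooth_near x (\<lambda>y. Y y c)"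
    by (rule smooth_fn_openD[OF vector_field_component[OF Y U(1) c(1)] V])
  have D: "smooth_on (cmap c ` ?V) (\<lambda>u. frechet_derivative ?s (at u) w)" for w
    by (rule smooth_on_frechet_derivative[OF ss])
  have "dir_deriv A (\<lambda>y. dir_deriv A s y (Y y)) x v =
      dir_deriv A (\<lambda>y. frechet_derivative ?s (at (cmap c y)) (Y y c)) x v"
    by (rule dir_deriv_cong[OF V]) (use dir_deriv_chart[OF near c(1)] vector_field_tangent[OF Y] in auto)
  also have "\<dots> = dir_deriv A (\<lambda>y. frechet_derivative ?s (at (cmap c y)) (Y x c)) x v +
      frechet_derivative ?s (at (cmap c x)) (dir_deriv A (\<lambda>y. Y y c) x v)"
  proof (rule dir_deriv_linear_family[where F = "\<lambda>y. frechet_derivative ?s (at (cmap c y))", OF V _ _ Yc v])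
    show "linear (frechet_derivative ?s (at (cmap c y)))" if "y \<in> ?V" for y
      using smooth_near_has_derivative[OF near c(1)] has_derivative_linear that by blast
    show "smooth_fn A ?V (\<lambda>y. frechet_derivative ?s (at (cmap c y)) w)" for w
      by (rule smooth_on_chart_comp[OF c(1) _ V(1) D]) auto
  qed
  also have "dir_deriv A (\<lambda>y. frechet_derivative ?s (at (cmap c y)) (Y x c)) x v =
      frechet_derivative (\<lambda>u. frechet_derivative ?s (at u) (Y x c)) (at (cmap c x)) (v c)"
  proof (rule dir_derivI[OF c v])
    have "((\<lambda>u. frechet_derivative ?s (at u) (Y x c)) has_derivative
      frechet_derivative (\<lambda>u. frechet_derivative ?s (at u) (Y x c)) (at (cmap c x))) (at (cmap c x))"
      by (rule smooth_on_has_derivative[OF D]) (use V in auto)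
    then show "((\<lambda>u. frechet_derivative ?s (at (cmap c (cinv c u))) (Y x c)) has_derivative
      frechet_derivative (\<lambda>u. frechet_derivative ?s (at u) (Y x c)) (at (cmap c x))) (at (cmap c x))"
      by (rule has_derivative_transform_within_open[where s = "cmap c ` ?V"])
        (use V open_in_image[OF U(1) c(1)] c in auto)
  qed
  finally show ?thesis
    using dir_deriv_chart[OF near[OF U(2)] c coord_field_tangent[OF c]] c by simp
qed

lemma dir_deriv_lie_bracket:
  fixes s :: "'a \<Rightarrow> 'b::euclidean_space"
  assumes U: "open_in A U" "x \<in> U" and s: "smooth_fn A U s"
    and X: "vector_field_on A U X" and Y: "vector_field_on A U Y"
  shows "dir_deriv A (\<lambda>y. dir_deriv A s y (Y y)) x (X x) - dir_deriv A (\<lambda>y. dir_deriv A s y (X y)) x (Y x) =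
    dir_deriv A s x (lie_bracket A X Y x)"
proof -
  have "x \<in> points A" using U open_in_points by auto
  then obtain c where c: "c \<in> A" "x \<in> cdom c" by (rule pointsE)
  have near: "smooth_near x s" by (rule smooth_fn_openD[OF s U])
  note Xt = vector_field_tangent[OF X U(2)] and Yt = vector_field_tangent[OF Y U(2)]
  have ss: "smooth_on (cmap c ` (U \<inter> cdom c)) (\<lambda>u. s (cinv c u))" using s c by (simp add: smooth_fn_def)
  have sym: "frechet_derivative (\<lambda>u. frechet_derivative (\<lambda>u. s (cinv c u)) (at u) v) (at (cmap c x)) w =
      frechet_derivative (\<lambda>u. frechet_derivative (\<lambda>u. s (cinv c u)) (at u) w) (at (cmap c x)) v" for v w
    by (rule second_derivative_symmetric[OF open_in_image[OF U(1) c(1)]])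
      (use U c ss in \<open>auto simp: smooth_on_def\<close>)
  have L: "linear (frechet_derivative (\<lambda>u. s (cinv c u)) (at (cmap c x)))"
    using smooth_near_has_derivative[OF near c] by (rule has_derivative_linear)
  note cc = dir_deriv_chart[OF near c coord_field_tangent[OF c]]
  show ?thesis
    unfolding dir_deriv_dir_deriv[OF U s Y c Xt] dir_deriv_dir_deriv[OF U s X c Yt]
      dir_deriv_chart[OF near c lie_bracket_tangent[OF U(1) X Y U(2)]] cc coord_field_same[OF c]
    using sym[of "X x c" "Y x c"] c linear_diff[OF L] by (simp add: lie_bracket_def)
qed

end

context pullback
begin

text \<open>The Leibniz rule for a section given by coefficients in a frame: the coefficients are
  differentiated, or they are frozen and the frame is differentiated.\<close>

lemma pull_conn_linear_family:
  fixes s :: "'a \<Rightarrow> 'w::euclidean_space" and \<Phi> :: "'a \<Rightarrow> 'w \<Rightarrow> ('b, 'f) tvec"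
  assumes U: "open_in B U" "z \<in> U" and lin: "\<And>y. y \<in> U \<Longrightarrow> linear (\<Phi> y)"
    and \<Phi>: "\<And>w. sec U (\<lambda>y. \<Phi> y w)" and s: "smooth_fn B U s" and v: "v \<in> tangent_space B z"
  shows "pc z v (\<lambda>y. \<Phi> y (s y)) = \<Phi> z (dir_deriv B s z v) + pc z v (\<lambda>y. \<Phi> y (s z))"
proof -
  have eq: "\<Phi> y w = (\<Sum>b\<in>Basis. (w \<bullet> b) *\<^sub>R \<Phi> y b)" if "y \<in> U" for y w
    by (rule linear_eq_sum_Basis[OF lin[OF that]])
  have sb: "smooth_fn B U (\<lambda>y. s y \<bullet> b)" for b by (rule A.smooth_fn_inner_left[OF U(1) s])
  have D: "dir_deriv B (\<lambda>y. s y \<bullet> b) z v = dir_deriv B s z v \<bullet> b" for b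
    by (rule A.dir_deriv_bounded_linear[OF A.smooth_nearI[OF U s] v bounded_linear_inner_left])
  have "pc z v (\<lambda>y. \<Phi> y (s y)) = pc z v (\<lambda>y. \<Sum>b\<in>Basis. (s y \<bullet> b) *\<^sub>R \<Phi> y b)"
    by (rule pull_conn_cong[OF U eq])
  also have "\<dots> = (\<Sum>b\<in>Basis. pc z v (\<lambda>y. (s y \<bullet> b) *\<^sub>R \<Phi> y b))"
    by (intro pull_conn_sum[OF U] finite_Basis sec_scaleR U sb \<Phi> v)
  also have "\<dots> = (\<Sum>b\<in>Basis. (dir_deriv B s z v \<bullet> b) *\<^sub>R \<Phi> z b + (s z \<bullet> b) *\<^sub>R pc z v (\<lambda>y. \<Phi> y b))"
    using pull_conn_leibniz[OF U sb \<Phi> v] by (intro sum.cong refl) (simp add: D)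
  also have "\<dots> = \<Phi> z (dir_deriv B s z v) + (\<Sum>b\<in>Basis. (s z \<bullet> b) *\<^sub>R pc z v (\<lambda>y. \<Phi> y b))"
    using eq[OF U(2), of "dir_deriv B s z v"] by (simp only: sum.distrib)
  also have "(\<Sum>b\<in>Basis. (s z \<bullet> b) *\<^sub>R pc z v (\<lambda>y. \<Phi> y b)) = (\<Sum>b\<in>Basis. pc z v (\<lambda>y. (s z \<bullet> b) *\<^sub>R \<Phi> y b))"
    using pull_conn_leibniz[OF U A.smooth_fn_const \<Phi> v] by (intro sum.cong refl) simp
  also have "\<dots> = pc z v (\<lambda>y. \<Sum>b\<in>Basis. (s z \<bullet> b) *\<^sub>R \<Phi> y b)"
    by (intro pull_conn_sum[OF U, symmetric] finite_Basis sec_scaleR U A.smooth_fn_const \<Phi> v)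
  also have "\<dots> = pc z v (\<lambda>y. \<Phi> y (s z))" by (rule pull_conn_cong[OF U eq[symmetric]])
  finally show ?thesis .
qed

lemma sec_linear_family:
  fixes s :: "'a \<Rightarrow> 'w::euclidean_space" and \<Phi> :: "'a \<Rightarrow> 'w \<Rightarrow> ('b, 'f) tvec"
  assumes U: "open_in B U" and lin: "\<And>y. y \<in> U \<Longrightarrow> linear (\<Phi> y)"
    and \<Phi>: "\<And>w. sec U (\<lambda>y. \<Phi> y w)" and s: "smooth_fn B U s"
  shows "sec U (\<lambda>y. \<Phi> y (s y))"
proof (rule sec_cong[OF U])
  show "sec U (\<lambda>y. \<Sum>b\<in>Basis. (s y \<bullet> b) *\<^sub>R \<Phi> y b)"
    by (intro sec_sum sec_scaleR A.smooth_fn_inner_left U s \<Phi>)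
  show "(\<Sum>b\<in>Basis. (s y \<bullet> b) *\<^sub>R \<Phi> y b) = \<Phi> y (s y)" if "y \<in> U" for y
    by (rule linear_eq_sum_Basis[OF lin[OF that], symmetric])
qed

end

section \<open>Adapted frames, Christoffel symbols and curvature of the normal connection\<close>

locale real_submanifold = I: kaehler_pullback L M "\<lambda>x. x" nab g J
  for L :: "('a, 'e::euclidean_space) atlas" and M :: "('a, 'f::euclidean_space) atlas"
    and nab :: "('a, 'f) conn" and g :: "('a, 'f) metric" and J :: "('a, 'f) endo" +
  assumes inj_incl: "\<And>x. x \<in> points L \<Longrightarrow> inj_on (incl_map L M x) (tangent_space L x)"
    and real: "totally_real L M J g"
    and geodesic: "totally_geodesic L M g nab"
begin

abbreviation "incl \<equiv> incl_map L M"
abbreviation "T \<equiv> tangent_space L"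
abbreviation "TM \<equiv> tangent_space M"

text \<open>A frame is encoded as a linear map from the model space at each point, as in
  \<open>normal_frame_on\<close>; the values on \<open>Basis\<close> are the usual frame
  fields.\<close>

definition tangent_frame :: "('a, 'e) chart \<Rightarrow> 'a \<Rightarrow> 'e \<Rightarrow> ('a, 'f) tvec" where
  "tangent_frame c x w = incl x (coord_field L c w x)"

definition normal_frame :: "('a, 'e) chart \<Rightarrow> 'a \<Rightarrow> 'e \<Rightarrow> ('a, 'f) tvec" where
  "normal_frame c x w = J x (tangent_frame c x w)"

lemma incl_push: "incl = I.push"
  by (simp add: incl_map_def fun_eq_iff)

lemma points_M: "x \<in> points L \<Longrightarrow> x \<in> points M"
  by (rule I.maps)

context
  fixes x assumes x: "x \<in> points L"
begin

lemma incl_tangent: "v \<in> T x \<Longrightarrow> incl x v \<in> TM x"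
  unfolding incl_push by (rule I.tangent_map_tangent[OF x])

lemma incl_add: "u \<in> T x \<Longrightarrow> v \<in> T x \<Longrightarrow> incl x (u + v) = incl x u + incl x v"
  unfolding incl_push by (rule I.tangent_map_add[OF x])

lemma incl_scaleR: "u \<in> T x \<Longrightarrow> incl x (r *\<^sub>R u) = r *\<^sub>R incl x u"
  unfolding incl_push by (rule I.tangent_map_scaleR[OF x])

lemma incl_zero: "incl x 0 = 0"
  using incl_scaleR[OF I.A.tangent_0, of 0] by simp

lemma incl_eq_iff: "u \<in> T x \<Longrightarrow> v \<in> T x \<Longrightarrow> incl x u = incl x v \<longleftrightarrow> u = v"
  using inj_incl[OF x] by (auto dest: inj_onD)

lemma incl_eq_0: "u \<in> T x \<Longrightarrow> incl x u = 0 \<Longrightarrow> u = 0"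
  using incl_eq_iff[of u 0] incl_zero by simp

lemma restrict_tan_incl: "v \<in> T x \<Longrightarrow> restrict_tan L M x (incl x v) = v"
  unfolding restrict_tan_def by (rule inv_into_f_f[OF inj_incl[OF x]])

lemma incl_J_orthogonal: "u \<in> T x \<Longrightarrow> v \<in> T x \<Longrightarrow> g x (incl x u) (J x (incl x v)) = 0"
  using real x unfolding totally_real_def tan_space_def by blast

lemma J_incl_normal: "v \<in> T x \<Longrightarrow> J x (incl x v) \<in> normal_space L M g x"
  unfolding normal_space_def tan_space_def
  using I.M.J_tangent[OF points_M[OF x] incl_tangent[of v]] incl_J_orthogonal[of _ v]
    I.M.g_sym[OF points_M[OF x] _ incl_tangent] by auto

lemma tangent_decomposition:
  assumes "w \<in> TM x"
  obtains u v where "u \<in> T x" "v \<in> T x" "w = incl x u + J x (incl x v)"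
proof -
  have "TM x = {u + J x v |u v. u \<in> tan_space L M x \<and> v \<in> tan_space L M x}"
    using real x unfolding totally_real_def by blast
  then obtain u' v' where "u' \<in> tan_space L M x" "v' \<in> tan_space L M x" "w = u' + J x v'"
    using assms by auto
  then show ?thesis using that unfolding tan_space_def by auto
qed

lemma normal_tangent: "w \<in> normal_space L M g x \<Longrightarrow> w \<in> TM x"
  by (simp add: normal_space_def)

text \<open>The tangential part of a normal vector is orthogonal to that vector and to its
  \<open>J\<close> part, hence to itself.\<close>

lemma normal_J_incl:
  assumes "w \<in> normal_space L M g x"
  obtains v where "v \<in> T x" "w = J x (incl x v)"
proof -
  obtain u v where uv: "u \<in> T x" "v \<in> T x" "w = incl x u + J x (incl x v)"
    using normal_tangent[OF assms] by (rule tangent_decomposition)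
  have t: "incl x u \<in> TM x" "J x (incl x v) \<in> TM x"
    using incl_tangent uv I.M.J_tangent[OF points_M[OF x]] by auto
  have "g x w (incl x u) = 0" using assms uv(1) by (auto simp: normal_space_def tan_space_def)
  then have "g x (incl x u) (incl x u) = 0"
    using I.M.g_add_left[OF points_M[OF x] t(1) t] incl_J_orthogonal[OF uv(1,2)]
      I.M.g_sym[OF points_M[OF x] t] uv(3) by simp
  then have "incl x u = 0" using I.M.g_pos[OF points_M[OF x] t(1)] by force
  then show ?thesis using that uv by simp
qed

lemma subspace_normal: "subspace (normal_space L M g x)"
  unfolding subspace_def normal_space_def tan_space_def
  using I.M.g_add_left[OF points_M[OF x] incl_tangent] I.M.g_scaleR_left[OF points_M[OF x] incl_tangent]
    I.M.g_zero_left[OF points_M[OF x] incl_tangent] I.B.tangent_add I.B.tangent_scaleR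
  by auto

lemma incl_J_incl_eq_0:
  assumes uv: "u \<in> T x" "v \<in> T x" and eq: "incl x u + J x (incl x v) = 0"
  shows "u = 0" "v = 0"
proof -
  have t: "incl x u \<in> TM x" "incl x v \<in> TM x" "J x (incl x v) \<in> TM x"
    using incl_tangent uv I.M.J_tangent[OF points_M[OF x]] by auto
  have "g x (incl x u) (incl x u + J x (incl x v)) = 0" using eq I.M.g_zero_right[OF points_M[OF x] t(1)] by simp
  then have "g x (incl x u) (incl x u) = 0"
    using I.M.g_add_right[OF points_M[OF x] t(1) t(1) t(3)] incl_J_orthogonal[OF uv] by simp
  then have u: "incl x u = 0" using I.M.g_pos[OF points_M[OF x] t(1)] by force
  then show "u = 0" by (rule incl_eq_0[OF uv(1)])
  have "J x (J x (incl x v)) = 0" using eq u I.M.J_zero[OF points_M[OF x]] by simp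
  then have "incl x v = 0" using I.M.J_J[OF points_M[OF x] t(2)] by simp
  then show "v = 0" by (rule incl_eq_0[OF uv(2)])
qed

text \<open>Two candidates for the normal part differ by a vector that is both normal and tangent,
  hence zero. This evaluates the \<open>THE\<close> in \<open>normal_part\<close>.\<close>

lemma normal_part_decomposition:
  assumes "u \<in> T x" "n \<in> normal_space L M g x"
  shows "normal_part L M g x (incl x u + n) = n"
  unfolding normal_part_def
proof (rule the_equality)
  show "n \<in> normal_space L M g x \<and> incl x u + n - n \<in> tan_space L M x"
    using assms by (auto simp: tan_space_def)
  fix m assume m: "m \<in> normal_space L M g x \<and> incl x u + n - m \<in> tan_space L M x"
  then obtain u' where u': "u' \<in> T x" "incl x u + n - m = incl x u'" by (auto simp: tan_space_def)
  have "n - m \<in> normal_space L M g x" using assms m subspace_diff[OF subspace_normal] by blast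
  then obtain v where v: "v \<in> T x" "n - m = J x (incl x v)" by (rule normal_J_incl)
  have "incl x (u - u') + J x (incl x v) = 0"
    using incl_add[of "u - u'" u'] I.A.tangent_diff[OF assms(1) u'(1)] u' v(2) by (simp add: algebra_simps)
  from incl_J_incl_eq_0(2)[OF I.A.tangent_diff[OF assms(1) u'(1)] v(1) this]
  show "m = n" using v I.M.J_zero[OF points_M[OF x]] incl_zero by simp
qed

end

context
  fixes c x assumes c: "c \<in> L" "x \<in> cdom c"
begin

lemma x_points: "x \<in> points L"
  by (rule I.A.cdom_points[OF c])

lemma linear_tangent_frame: "linear (tangent_frame c x)"
proof (rule linearI)
  show "tangent_frame c x (v + w) = tangent_frame c x v + tangent_frame c x w" for v w
    using linear_add[OF I.A.linear_coord_field[OF c]] incl_add[OF x_points I.A.coord_field_tangent[OF c] I.A.coord_field_tangent[OF c]]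
    by (simp add: tangent_frame_def)
  show "tangent_frame c x (r *\<^sub>R w) = r *\<^sub>R tangent_frame c x w" for r w
    using linear_scale[OF I.A.linear_coord_field[OF c]] incl_scaleR[OF x_points I.A.coord_field_tangent[OF c]]
    by (simp add: tangent_frame_def)
qed

lemma tangent_frame_tangent: "tangent_frame c x w \<in> TM x"
  unfolding tangent_frame_def by (rule incl_tangent[OF x_points I.A.coord_field_tangent[OF c]])

lemma linear_normal_frame: "linear (normal_frame c x)"
proof (rule linearI)
  show "normal_frame c x (v + w) = normal_frame c x v + normal_frame c x w" for v w
    using linear_add[OF linear_tangent_frame] I.M.J_add[OF points_M[OF x_points] tangent_frame_tangent tangent_frame_tangent]
    by (simp add: normal_frame_def)
  show "normal_frame c x (r *\<^sub>R w) = r *\<^sub>R normal_frame c x w" for r w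
    using linear_scale[OF linear_tangent_frame] I.M.J_scaleR[OF points_M[OF x_points] tangent_frame_tangent]
    by (simp add: normal_frame_def)
qed

lemma normal_frame_normal: "normal_frame c x w \<in> normal_space L M g x"
  unfolding normal_frame_def tangent_frame_def by (rule J_incl_normal[OF x_points I.A.coord_field_tangent[OF c]])

lemma normal_frame_tangent: "normal_frame c x w \<in> TM x"
  by (rule normal_tangent[OF x_points normal_frame_normal])

lemma J_normal_frame: "J x (normal_frame c x w) = - tangent_frame c x w"
  unfolding normal_frame_def by (rule I.M.J_J[OF points_M[OF x_points] tangent_frame_tangent])

lemma incl_tangent_frame: "v \<in> T x \<Longrightarrow> incl x v = tangent_frame c x (v c)"
  by (simp add: tangent_frame_def I.A.coord_field_component[OF c])

lemma frames_eq_0: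
  assumes "tangent_frame c x v + normal_frame c x w = 0"
  shows "v = 0" "w = 0"
proof -
  note t = I.A.coord_field_tangent[OF c]
  have "coord_field L c v x = 0" "coord_field L c w x = 0"
    using incl_J_incl_eq_0[OF x_points t t, of v w] assms by (auto simp: normal_frame_def tangent_frame_def)
  then show "v = 0" "w = 0"
    using I.A.coord_field_same[OF c, of v] I.A.coord_field_same[OF c, of w] by auto
qed

lemma inj_tangent_frame: "inj (tangent_frame c x)"
  unfolding linear_injective_0[OF linear_tangent_frame]
  using frames_eq_0(1)[of _ 0] linear_0[OF linear_normal_frame] by simp

lemma inj_normal_frame: "inj (normal_frame c x)"
  unfolding linear_injective_0[OF linear_normal_frame]
  using frames_eq_0(2)[of 0] linear_0[OF linear_tangent_frame] by simp

lemma normal_frameE: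
  assumes "n \<in> normal_space L M g x"
  obtains w where "n = normal_frame c x w"
  using normal_J_incl[OF x_points assms] incl_tangent_frame by (metis normal_frame_def)

lemma bij_normal_frame: "bij_betw (normal_frame c x) UNIV (normal_space L M g x)"
  unfolding bij_betw_def using inj_normal_frame normal_frame_normal normal_frameE by blast

lemma g_frames: "g x (normal_frame c x v) (normal_frame c x w) = g x (tangent_frame c x v) (tangent_frame c x w)"
  unfolding normal_frame_def by (rule I.M.hermitian[OF points_M[OF x_points] tangent_frame_tangent tangent_frame_tangent])

lemma normal_part_frames: "normal_part L M g x (tangent_frame c x v + normal_frame c x w) = normal_frame c x w"
  using normal_part_decomposition[OF x_points I.A.coord_field_tangent[OF c] normal_frame_normal]
  by (simp add: tangent_frame_def)

end

lemma section_on_eq: "section_on L M U \<xi> \<longleftrightarrow> I.sec U \<xi>"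
  unfolding section_on_def section_along_def smooth_fn_def by (auto simp: Int_ac vimage_def)

lemma induced_conn_eq: "induced_conn L M nab = I.pc"
  by (intro ext) (simp add: induced_conn_def pull_conn_def incl_map_def)

lemma sec_tangent_frame: "c \<in> L \<Longrightarrow> I.sec (cdom c) (\<lambda>x. tangent_frame c x w)"
  unfolding tangent_frame_def incl_push
  by (rule I.sec_push[OF I.A.open_in_cdom I.A.vector_field_coord_field])

lemma sec_normal_frame: "c \<in> L \<Longrightarrow> I.sec (cdom c) (\<lambda>x. normal_frame c x w)"
  unfolding normal_frame_def by (rule I.sec_J[OF I.A.open_in_cdom sec_tangent_frame])

lemma normal_frame_on: "c \<in> L \<Longrightarrow> normal_frame_on L M g (cdom c) (normal_frame c)"
  unfolding normal_frame_on_def normal_section_on_def section_on_eq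
  by (auto intro: linear_normal_frame bij_normal_frame sec_normal_frame normal_frame_normal)

text \<open>The derivative of the tangent frame is tangent to \<open>L\<close> by
  \<open>geodesic\<close>, so \<open>restrict_tan\<close> can pull it back and its component in
  \<open>c\<close> can be read off.\<close>

definition christoffel :: "('a, 'e) chart \<Rightarrow> 'a \<Rightarrow> 'e \<Rightarrow> 'e \<Rightarrow> 'e" where
  "christoffel c x v w = restrict_tan L M x (I.pc x (coord_field L c v x) (\<lambda>y. tangent_frame c y w)) c"

lemma pull_conn_tangent_frame:
  assumes c: "c \<in> L" "x \<in> cdom c" and v: "v \<in> T x"
  shows "I.pc x v (\<lambda>y. tangent_frame c y w) = tangent_frame c x (christoffel c x (v c) w)"
proof -
  let ?D = "I.pc x v (\<lambda>y. tangent_frame c y w)"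
  note xp = I.A.cdom_points[OF c]
  have "?D \<in> TM x" by (rule I.pull_conn_tangent[OF I.A.open_in_cdom[OF c(1)] c(2) sec_tangent_frame[OF c(1)] v])
  then obtain a b where ab: "a \<in> T x" "b \<in> T x" "?D = incl x a + J x (incl x b)"
    by (rule tangent_decomposition[OF xp])
  \<comment> \<open>Total geodesy is applied to a coordinate field of \<open>c\<close>, whose image
    under the inclusion is the frame section.\<close>
  have "normal_part L M g x ?D = 0"
    using geodesic I.A.open_in_cdom[OF c(1)] I.A.vector_field_coord_field[OF c(1)] c(2) v
    unfolding totally_geodesic_def induced_conn_eq tangent_frame_def by blast
  then have "J x (incl x b) = 0"
    using normal_part_decomposition[OF xp ab(1) J_incl_normal[OF xp ab(2)]] ab(3) by simp
  then have D: "?D = incl x a" using ab by simp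
  then have "christoffel c x (v c) w = a c"
    by (simp add: christoffel_def I.A.coord_field_component[OF c v] restrict_tan_incl[OF xp ab(1)])
  then show ?thesis using D incl_tangent_frame[OF c ab(1)] by simp
qed

lemma pull_conn_normal_frame:
  assumes c: "c \<in> L" "x \<in> cdom c" and v: "v \<in> T x"
  shows "I.pc x v (\<lambda>y. normal_frame c y w) = normal_frame c x (christoffel c x (v c) w)"
  unfolding normal_frame_def
    I.pull_conn_J[OF I.A.open_in_cdom[OF c(1)] c(2) sec_tangent_frame[OF c(1)] v]
    pull_conn_tangent_frame[OF assms] ..

lemma linear_christoffel_left:
  assumes c: "c \<in> L" "x \<in> cdom c"
  shows "linear (\<lambda>v. christoffel c x v w)"
proof (rule linearI)
  note t = I.A.coord_field_tangent[OF c]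
  have eq: "tangent_frame c x (christoffel c x v w) = I.pc x (coord_field L c v x) (\<lambda>y. tangent_frame c y w)" for v
    using pull_conn_tangent_frame[OF c t, of v w] c by simp
  note o = I.A.open_in_cdom[OF c(1)] c(2) sec_tangent_frame[OF c(1)]
  have "tangent_frame c x (christoffel c x (u + v) w) =
      tangent_frame c x (christoffel c x u w + christoffel c x v w)" for u v
    unfolding linear_add[OF linear_tangent_frame[OF c]] eq
    using I.pull_conn_vec_add[OF o t t] linear_add[OF I.A.linear_coord_field[OF c]] by simp
  then show "christoffel c x (u + v) w = christoffel c x u w + christoffel c x v w" for u v
    using inj_tangent_frame[OF c] by (meson injD)
  have "tangent_frame c x (christoffel c x (r *\<^sub>R v) w) = tangent_frame c x (r *\<^sub>R christoffel c x v w)" for r v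
    unfolding linear_scale[OF linear_tangent_frame[OF c]] eq
    using I.pull_conn_vec_scaleR[OF o t] linear_scale[OF I.A.linear_coord_field[OF c]] by simp
  then show "christoffel c x (r *\<^sub>R v) w = r *\<^sub>R christoffel c x v w" for r v
    using inj_tangent_frame[OF c] by (meson injD)
qed

text \<open>In coordinates of \<open>M\<close> the frame is a first derivative of the inclusion, so
  the derivative of the frame is a second derivative and symmetric. The connection term is symmetric
  because \<open>nab\<close> has no torsion.\<close>

lemma christoffel_symmetric:
  assumes c: "c \<in> L" "x \<in> cdom c"
  shows "christoffel c x v w = christoffel c x w v"
proof -
  note xp = I.A.cdom_points[OF c]
  obtain d where d: "d \<in> M" "x \<in> cdom d" using points_M[OF xp] by (rule I.B.pointsE)
  note o = I.A.open_in_cdom[OF c(1)] c(2) and t = I.A.coord_field_tangent[OF c]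
  let ?\<phi> = "\<lambda>u. cmap d (cinv c u)" and ?S = "cmap c ` (cdom c \<inter> cdom d)"
  have oS: "open ?S" and sS: "smooth_on ?S ?\<phi>"
    using I.smooth_chart[OF c(1) d(1)] by (auto simp: vimage_def Int_def)
  have xS: "cmap c x \<in> ?S" using c d by auto
  have comp: "tangent_frame c y w d = frechet_derivative ?\<phi> (at (cmap c y)) w" if y: "y \<in> cdom c \<inter> cdom d" for y w
    using I.tangent_map_apply[OF d(1), of y "coord_field L c w y"]
      I.A.dir_deriv_chart[OF I.smooth_near_cmap[of y d] c(1) _ I.A.coord_field_tangent[OF c(1)]] y c d I.A.cdom_points[OF c(1)]
    by (auto simp: tangent_frame_def incl_push)
  have oL: "open_in L (cdom c \<inter> cdom d)"
    using I.open_chart[OF o(1) d(1)] by (simp add: vimage_def)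
  have D: "dir_deriv L (\<lambda>y. tangent_frame c y w d) x (coord_field L c v x) =
      frechet_derivative (\<lambda>u. frechet_derivative ?\<phi> (at u) w) (at (cmap c x)) v" for v w
  proof -
    have 1: "((\<lambda>u. frechet_derivative ?\<phi> (at u) w) has_derivative
        frechet_derivative (\<lambda>u. frechet_derivative ?\<phi> (at u) w) (at (cmap c x))) (at (cmap c x))"
      by (rule smooth_on_has_derivative[OF smooth_on_frechet_derivative[OF sS] xS])
    have "((\<lambda>u. tangent_frame c (cinv c u) w d) has_derivative
        frechet_derivative (\<lambda>u. frechet_derivative ?\<phi> (at u) w) (at (cmap c x))) (at (cmap c x))"
      by (rule has_derivative_transform_within_open[OF 1 oS xS]) (use comp c in auto)
    from I.A.dir_derivI[where f = "\<lambda>y. tangent_frame c y w d", OF c t[of v] this] show ?thesis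
      using c by simp
  qed
  have inc: "I.push x (coord_field L c v x) = coord_field M d (tangent_frame c x v d) x" for v
    using I.B.coord_field_component[OF d tangent_frame_tangent[OF c]] by (simp add: tangent_frame_def incl_push)
  have "I.pc x (coord_field L c v x) (\<lambda>y. tangent_frame c y w) = I.pc x (coord_field L c w x) (\<lambda>y. tangent_frame c y v)"
    unfolding I.pull_conn_coord[OF o sec_tangent_frame[OF c(1)] t d] D inc
      second_derivative_symmetric[OF oS xS sS[unfolded smooth_on_def, rule_format], of w v]
      I.M.nab_coord_symmetric[OF d, of "tangent_frame c x v d" "tangent_frame c x w d"] ..
  then have "tangent_frame c x (christoffel c x v w) = tangent_frame c x (christoffel c x w v)"
    using pull_conn_tangent_frame[OF c t] c by simp
  then show ?thesis using inj_tangent_frame[OF c] by (meson injD)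
qed

lemma linear_christoffel_right:
  "c \<in> L \<Longrightarrow> x \<in> cdom c \<Longrightarrow> linear (\<lambda>w. christoffel c x v w)"
  using linear_christoffel_left[of c x v] christoffel_symmetric[of c x v] by simp

lemma smooth_christoffel:
  assumes c: "c \<in> L"
  shows "smooth_fn L (cdom c) (\<lambda>x. christoffel c x v w)"
proof (rule I.smooth_fn_frame_coefficients[where \<Phi> = "tangent_frame c", OF I.A.open_in_cdom[OF c]])
  show "I.sec (cdom c) (\<lambda>x. I.pc x (coord_field L c v x) (\<lambda>y. tangent_frame c y w))"
    by (rule I.sec_pull_conn[OF I.A.open_in_cdom[OF c] I.A.vector_field_coord_field[OF c] sec_tangent_frame[OF c]])
  show "tangent_frame c x (christoffel c x v w) = I.pc x (coord_field L c v x) (\<lambda>y. tangent_frame c y w)"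
    if "x \<in> cdom c" for x
    using pull_conn_tangent_frame[OF c that I.A.coord_field_tangent[OF c that], of v w] c that by simp
qed (auto intro: c linear_tangent_frame inj_tangent_frame sec_tangent_frame)

lemma normal_conn_eq: "normal_conn L M g nab x v \<xi> = normal_part L M g x (I.pc x v \<xi>)"
  by (simp add: normal_conn_def induced_conn_eq)

text \<open>Both terms of the ambient derivative lie in the span of the normal frame, so the
  projection \<open>normal_part\<close> changes nothing.\<close>

lemma normal_conn_normal_frame:
  assumes c: "c \<in> L" and U: "open_in L U" "x \<in> U" "U \<subseteq> cdom c" and v: "v \<in> T x"
    and s: "smooth_fn L U s" and eq: "\<And>y. y \<in> U \<Longrightarrow> \<xi> y = normal_frame c y (s y)"
  shows "normal_conn L M g nab x v \<xi> =
    normal_frame c x (dir_deriv L s x v + christoffel c x (v c) (s x))"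
proof -
  have xc: "x \<in> cdom c" using U by auto
  have "I.pc x v \<xi> = I.pc x v (\<lambda>y. normal_frame c y (s y))" by (rule I.pull_conn_cong[OF U(1,2) eq])
  also have "\<dots> = normal_frame c x (dir_deriv L s x v) + I.pc x v (\<lambda>y. normal_frame c y (s x))"
    by (rule I.pull_conn_linear_family[OF U(1,2) linear_normal_frame[OF c] I.sec_subset[OF sec_normal_frame[OF c]] s v])
      (use U in auto)
  also have "\<dots> = normal_frame c x (dir_deriv L s x v + christoffel c x (v c) (s x))"
    unfolding pull_conn_normal_frame[OF c xc v] linear_add[OF linear_normal_frame[OF c xc]] ..
  finally show ?thesis
    using normal_part_frames[OF c xc, of 0] linear_0[OF linear_tangent_frame[OF c xc]] by (simp add: normal_conn_eq)
qed

text \<open>The curvature tensor of the connection with symbols \<open>christoffel\<close>,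
  evaluated on coordinate fields \<open>a\<close> and \<open>b\<close>; these commute, so there is
  no bracket term.\<close>

definition curvature :: "('a, 'e) chart \<Rightarrow> 'a \<Rightarrow> 'e \<Rightarrow> 'e \<Rightarrow> 'e \<Rightarrow> 'e" where
  "curvature c x a b w =
    dir_deriv L (\<lambda>y. christoffel c y b w) x (coord_field L c a x)
    - dir_deriv L (\<lambda>y. christoffel c y a w) x (coord_field L c b x)
    + christoffel c x a (christoffel c x b w) - christoffel c x b (christoffel c x a w)"

lemma normal_section_component:
  assumes c: "c \<in> L" and U: "open_in L U" "U \<subseteq> cdom c" and \<xi>: "normal_section_on L M g U \<xi>"
  obtains s where "smooth_fn L U s" "\<And>y. y \<in> U \<Longrightarrow> \<xi> y = normal_frame c y (s y)"
proof -
  have "\<exists>w. \<xi> y = normal_frame c y w" if "y \<in> U" for y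
  proof -
    have "y \<in> cdom c" "\<xi> y \<in> normal_space L M g y" using U \<xi> that by (auto simp: normal_section_on_def)
    then show ?thesis using normal_frameE[OF c] by blast
  qed
  then obtain s where s: "\<xi> y = normal_frame c y (s y)" if "y \<in> U" for y by metis
  have "smooth_fn L U s"
    by (rule I.smooth_fn_frame_coefficients[where \<Phi> = "normal_frame c" and \<sigma> = \<xi>, OF U(1)])
      (use U \<xi> s c in \<open>auto intro: linear_normal_frame inj_normal_frame I.sec_subset[OF sec_normal_frame[OF c]]
        simp: normal_section_on_def section_on_eq\<close>)
  then show ?thesis using that s by blast
qed

lemma dir_deriv_christoffel:
  assumes c: "c \<in> L" and U: "open_in L U" "x \<in> U" "U \<subseteq> cdom c" and v: "v \<in> T x"
    and r: "smooth_fn L U r" and s: "smooth_fn L U s"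
  shows "dir_deriv L (\<lambda>y. christoffel c y (r y) (s y)) x v =
    dir_deriv L (\<lambda>y. christoffel c y (r x) (s x)) x v +
    christoffel c x (dir_deriv L r x v) (s x) + christoffel c x (r x) (dir_deriv L s x v)"
  by (rule I.A.dir_deriv_bilinear_family[where F = "christoffel c", OF U(1,2) linear_christoffel_left[OF c]
        linear_christoffel_right[OF c] I.A.smooth_fn_subset[OF smooth_christoffel[OF c] U(3)] r s v]) (use U(3) in auto)

lemma smooth_christoffel_comp:
  assumes c: "c \<in> L" and U: "open_in L U" "U \<subseteq> cdom c"
    and r: "smooth_fn L U r" and s: "smooth_fn L U s"
  shows "smooth_fn L U (\<lambda>y. christoffel c y (r y) (s y))"
  by (rule I.A.smooth_fn_bilinear_family[where F = "christoffel c", OF U(1) linear_christoffel_left[OF c]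
        linear_christoffel_right[OF c] I.A.smooth_fn_subset[OF smooth_christoffel[OF c] U(2)] r s]) (use U(2) in auto)

text \<open>Tensoriality of the curvature: second derivatives of the coefficients \<open>s\<close>
  combine to the derivative along the bracket, products of a Christoffel symbol with a first
  derivative of \<open>s\<close> cancel, and the derivatives of the components of \<open>X\<close>
  and \<open>Y\<close> are absorbed by the bracket term.\<close>

lemma curvature_normal_conn:
  assumes c: "c \<in> L" and U: "open_in L U" "x \<in> U" "U \<subseteq> cdom c"
    and X: "vector_field_on L U X" and Y: "vector_field_on L U Y"
    and s: "smooth_fn L U s" and eq: "\<And>y. y \<in> U \<Longrightarrow> \<xi> y = normal_frame c y (s y)"
  shows "normal_conn L M g nab x (X x) (\<lambda>y. normal_conn L M g nab y (Y y) \<xi>)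
        - normal_conn L M g nab x (Y x) (\<lambda>y. normal_conn L M g nab y (X y) \<xi>)
        - normal_conn L M g nab x (lie_bracket L X Y x) \<xi> =
      normal_frame c x (curvature c x (X x c) (Y x c) (s x))"
proof -
  have xc: "x \<in> cdom c" using U by auto
  note Xt = I.A.vector_field_tangent[OF X] and Yt = I.A.vector_field_tangent[OF Y]
  let ?t = "\<lambda>Y y. dir_deriv L s y (Y y) + christoffel c y (Y y c) (s y)"
  have comp: "smooth_fn L U (\<lambda>y. Y y c)" if "vector_field_on L U Y" for Y
    using I.A.vector_field_component[OF that U(1) c] U(3) by (simp add: inf.absorb1)
  have nearU: "I.A.smooth_near x f" if "smooth_fn L U f" for f :: "'a \<Rightarrow> 'e" by (rule I.A.smooth_nearI[OF U(1,2) that])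
  have 1: "smooth_fn L U (\<lambda>y. dir_deriv L s y (Y y))" "smooth_fn L U (\<lambda>y. christoffel c y (Y y c) (s y))"
    if "vector_field_on L U Y" for Y
    by (rule I.A.smooth_fn_dir_deriv[OF U(1) s that]) (rule smooth_christoffel_comp[OF c U(1,3) comp[OF that] s])
  have t: "smooth_fn L U (?t Y)" if "vector_field_on L U Y" for Y
    by (rule I.A.smooth_fn_add[OF U(1) 1[OF that]])
  have N: "normal_conn L M g nab y (Y y) \<xi> = normal_frame c y (?t Y y)" if "vector_field_on L U Y" "y \<in> U" for Y y
    by (rule normal_conn_normal_frame[OF c U(1) that(2) U(3) I.A.vector_field_tangent[OF that] s eq])
  have NN: "normal_conn L M g nab x v (\<lambda>y. normal_conn L M g nab y (Y y) \<xi>) =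
      normal_frame c x (dir_deriv L (?t Y) x v + christoffel c x (v c) (?t Y x))"
    if "vector_field_on L U Y" "v \<in> T x" for Y v
    by (rule normal_conn_normal_frame[OF c U that(2) t[OF that(1)] N[OF that(1)]])
  have D: "dir_deriv L (?t Y) x v = dir_deriv L (\<lambda>y. dir_deriv L s y (Y y)) x v +
      (dir_deriv L (\<lambda>y. christoffel c y (Y x c) (s x)) x v +
       christoffel c x (dir_deriv L (\<lambda>y. Y y c) x v) (s x) + christoffel c x (Y x c) (dir_deriv L s x v))"
    if Y: "vector_field_on L U Y" and v: "v \<in> T x" for Y v
    unfolding I.A.dir_deriv_add[OF nearU[OF 1(1)[OF Y]] nearU[OF 1(2)[OF Y]] v]
      dir_deriv_christoffel[OF c U v comp[OF Y] s] ..
  note lb = I.A.lie_bracket_tangent[OF U(1) X Y U(2)]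
  have lbc: "lie_bracket L X Y x c = dir_deriv L (\<lambda>y. Y y c) x (X x) - dir_deriv L (\<lambda>y. X y c) x (Y x)"
    using c xc by (simp add: lie_bracket_def)
  note lin = linear_add[OF linear_christoffel_right[OF c xc]] linear_diff[OF linear_christoffel_left[OF c xc]]
  have cf: "coord_field L c (X x c) x = X x" "coord_field L c (Y x c) x = Y x"
    using I.A.coord_field_component[OF c xc] Xt Yt U(2) by auto
  have "dir_deriv L (?t Y) x (X x) + christoffel c x (X x c) (?t Y x)
      - (dir_deriv L (?t X) x (Y x) + christoffel c x (Y x c) (?t X x))
      - (dir_deriv L s x (lie_bracket L X Y x) + christoffel c x (lie_bracket L X Y x c) (s x)) =
      curvature c x (X x c) (Y x c) (s x)"
    unfolding D[OF Y Xt[OF U(2)]] D[OF X Yt[OF U(2)]] lbc lin curvature_def cf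
      I.A.dir_deriv_lie_bracket[OF U(1,2) s X Y, symmetric]
    by (simp add: algebra_simps)
  moreover have "normal_conn L M g nab x (lie_bracket L X Y x) \<xi> =
      normal_frame c x (dir_deriv L s x (lie_bracket L X Y x) + christoffel c x (lie_bracket L X Y x c) (s x))"
    by (rule normal_conn_normal_frame[OF c U lb s eq])
  ultimately show ?thesis
    unfolding NN[OF Y Xt[OF U(2)]] NN[OF X Yt[OF U(2)]]
    by (simp only: linear_diff[OF linear_normal_frame[OF c xc], symmetric])
qed

text \<open>One direction tests flatness on coordinate fields and a normal section with constant
  coefficients, where the curvature appears directly. The other is tensoriality, applied near each
  point after restriction to a chart.\<close>

lemma flat_iff_curvature:
  "flat_normal_conn L M g nab \<longleftrightarrow> (\<forall>c\<in>L. \<forall>x\<in>cdom c. \<forall>a b w. curvature c x a b w = 0)"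
proof
  assume flat: "flat_normal_conn L M g nab"
  show "\<forall>c\<in>L. \<forall>x\<in>cdom c. \<forall>a b w. curvature c x a b w = 0"
  proof (intro ballI allI)
    fix c x a b w assume c: "c \<in> L" "x \<in> cdom c"
    have ns: "normal_section_on L M g (cdom c) (\<lambda>y. normal_frame c y w)"
      using normal_frame_on[OF c(1)] by (simp add: normal_frame_on_def)
    note o = I.A.open_in_cdom[OF c(1)] and cf = I.A.vector_field_coord_field[OF c(1)]
    have "normal_frame c x (curvature c x (coord_field L c a x c) (coord_field L c b x c) w) = 0"
      using curvature_normal_conn[OF c(1) o c(2) order_refl cf cf I.A.smooth_fn_const[of _ w] refl, of a b]
        flat[unfolded flat_normal_conn_def, rule_format, of "cdom c" "coord_field L c a" "coord_field L c b" "\<lambda>y. normal_frame c y w" x]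
        o cf ns c by simp
    then have "normal_frame c x (curvature c x a b w) = 0" using c by simp
    then show "curvature c x a b w = 0"
      using inj_normal_frame[OF c] linear_injective_0[OF linear_normal_frame[OF c]] by blast
  qed
next
  assume R: "\<forall>c\<in>L. \<forall>x\<in>cdom c. \<forall>a b w. curvature c x a b w = 0"
  show "flat_normal_conn L M g nab"
    unfolding flat_normal_conn_def
  proof (intro allI impI ballI, elim conjE)
    fix U X Y \<xi> x
    assume U: "open_in L U" and X: "vector_field_on L U X" and Y: "vector_field_on L U Y"
      and \<xi>: "normal_section_on L M g U \<xi>" and x: "x \<in> U"
    obtain c where c: "c \<in> L" "x \<in> cdom c" using I.A.open_in_points[OF U] x I.A.pointsE by blast
    let ?V = "U \<inter> cdom c"
    have V: "open_in L ?V" "x \<in> ?V" "?V \<subseteq> cdom c" using U x c by (auto intro: I.A.open_in_Int I.A.open_in_cdom)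
    have "normal_section_on L M g ?V \<xi>"
      using \<xi> I.sec_subset[of U \<xi> ?V] by (auto simp: normal_section_on_def section_on_eq)
    then obtain s where s: "smooth_fn L ?V s" "\<And>y. y \<in> ?V \<Longrightarrow> \<xi> y = normal_frame c y (s y)"
      using normal_section_component[OF c(1) V(1,3)] by blast
    have XY: "vector_field_on L ?V X" "vector_field_on L ?V Y"
      using I.A.vector_field_subset[OF X, of ?V] I.A.vector_field_subset[OF Y, of ?V] by auto
    have "curvature c x (X x c) (Y x c) (s x) = 0" using R c by blast
    with curvature_normal_conn[OF c(1) V XY s]
    show "normal_conn L M g nab x (X x) (\<lambda>y. normal_conn L M g nab y (Y y) \<xi>)
        - normal_conn L M g nab x (Y x) (\<lambda>y. normal_conn L M g nab y (X y) \<xi>)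
        - normal_conn L M g nab x (lie_bracket L X Y x) \<xi> = 0"
      using linear_0[OF linear_normal_frame[OF c]] by simp
  qed
qed

end

section \<open>The normal bundle\<close>

lemma smooth_on_Pair:
  assumes "open S" "smooth_on S f" "smooth_on S g"
  shows "smooth_on S (\<lambda>x. (f x, g x))"
proof -
  have 1: "bounded_linear (\<lambda>x. (x, 0))" by (intro bounded_linear_Pair bounded_linear_ident bounded_linear_zero)
  have 2: "bounded_linear (\<lambda>x. (0, x))" by (intro bounded_linear_Pair bounded_linear_ident bounded_linear_zero)
  have "smooth_on S (\<lambda>x. (f x, 0) + (0, g x))"
    by (intro smooth_on_add smooth_on_bounded_linear_comp[OF assms(1) 1] smooth_on_bounded_linear_comp[OF assms(1) 2] assms)
  then show ?thesis by simp
qed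

lemma smooth_on_fst_comp:
  fixes h :: "'u::euclidean_space \<Rightarrow> 'k::real_normed_vector"
  assumes "open S" "smooth_on S h"
  shows "smooth_on (S \<times> (UNIV :: 'w::real_normed_vector set)) (\<lambda>q. h (fst q))"
  by (rule smooth_on_compose[OF open_Times[OF assms(1) open_UNIV] assms(1) _ assms(2)
        smooth_on_bounded_linear[OF bounded_linear_fst]]) auto

text \<open>Joint smoothness in base point and fibre vector follows from smoothness in the base
  point alone, because the fibre vector enters through its coordinates.\<close>

lemma smooth_on_linear_family_prod:
  fixes F :: "'u::euclidean_space \<Rightarrow> 'w::euclidean_space \<Rightarrow> 'k::real_normed_vector"
  assumes S: "open S" and lin: "\<And>u. u \<in> S \<Longrightarrow> linear (F u)" and F: "\<And>w. smooth_on S (\<lambda>u. F u w)"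
  shows "smooth_on (S \<times> UNIV) (\<lambda>q. F (fst q) (snd q))"
proof (rule smooth_on_cong)
  show o: "open (S \<times> (UNIV :: 'w set))" using S by (intro open_Times) auto
  show "smooth_on (S \<times> UNIV) (\<lambda>q. \<Sum>b\<in>Basis. (snd q \<bullet> b) *\<^sub>R F (fst q) b)"
  proof (rule smooth_on_sum[OF o])
    fix b :: 'w
    have 1: "smooth_on (S \<times> UNIV) (\<lambda>q::'u \<times> 'w. snd q \<bullet> b)"
      by (rule smooth_on_bounded_linear_comp[OF o bounded_linear_inner_left smooth_on_bounded_linear[OF bounded_linear_snd]])
    show "smooth_on (S \<times> UNIV) (\<lambda>q. (snd q \<bullet> b) *\<^sub>R F (fst q) b)"
      by (rule smooth_on_bilinear[OF bounded_bilinear_scaleR o 1 smooth_on_fst_comp[OF S F]])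
  qed
  show "(\<Sum>b\<in>Basis. (snd q \<bullet> b) *\<^sub>R F (fst q) b) = F (fst q) (snd q)" if "q \<in> S \<times> UNIV" for q
    by (rule linear_eq_sum_Basis[OF lin, symmetric]) (use that in auto)
qed

section \<open>The smooth atlas of the total space and its projections\<close>

context real_submanifold
begin

abbreviation NB :: "(('a, 'f) nvec, 'e \<times> 'e) atlas" where "NB \<equiv> normal_bundle L M g"

text \<open>The atlas \<open>NB\<close> has a chart for every smooth normal frame. Computations use
  only these ones, whose frame comes from \<open>J\<close>; they cover the total space.\<close>

definition nchart :: "('a, 'e) chart \<Rightarrow> (('a, 'f) nvec, 'e \<times> 'e) chart" where
  "nchart c = bundle_chart L M g c (cdom c) (normal_frame c)"

lemma nchart_NB: "c \<in> L \<Longrightarrow> nchart c \<in> NB"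
  unfolding normal_bundle_def nchart_def using normal_frame_on I.A.open_in_cdom by blast

lemma NB_E:
  assumes "e \<in> NB"
  obtains c V F where "e = bundle_chart L M g c V F" "c \<in> L" "open_in L V" "V \<subseteq> cdom c"
    "normal_frame_on L M g V F"
  using assms unfolding normal_bundle_def by blast

lemma cdom_bundle_chart: "cdom (bundle_chart L M g c V F) = {(x, \<theta>). x \<in> V \<and> \<theta> \<in> normal_space L M g x}"
  by (simp add: bundle_chart_def)

lemma cmap_bundle_chart: "cmap (bundle_chart L M g c V F) (x, \<theta>) = (cmap c x, inv (F x) \<theta>)"
  by (simp add: bundle_chart_def)

lemma cdom_nchart [simp]: "z \<in> cdom (nchart c) \<longleftrightarrow> fst z \<in> cdom c \<and> snd z \<in> normal_space L M g (fst z)"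
  by (auto simp: nchart_def cdom_bundle_chart)

context
  fixes V and F :: "'a \<Rightarrow> 'e \<Rightarrow> ('a, 'f) tvec" and x
  assumes F: "normal_frame_on L M g V F" and x: "x \<in> V"
begin

lemma frame_linear: "linear (F x)"
  using F x by (simp add: normal_frame_on_def)

lemma frame_normal: "F x w \<in> normal_space L M g x"
  using F x by (auto simp: normal_frame_on_def bij_betw_def)

lemma frame_inv: "inv (F x) (F x w) = w"
  using F x by (auto simp: normal_frame_on_def bij_betw_def)

lemma frame_inj: "inj (F x)"
  using F x by (auto simp: normal_frame_on_def bij_betw_def)

lemma inv_frame: "\<theta> \<in> normal_space L M g x \<Longrightarrow> F x (inv (F x) \<theta>) = \<theta>"
  using F x by (auto simp: normal_frame_on_def bij_betw_def f_inv_into_f)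

end

lemma normal_frame_on_sec: "normal_frame_on L M g V F \<Longrightarrow> I.sec V (\<lambda>x. F x w)"
  by (simp add: normal_frame_on_def normal_section_on_def section_on_eq)

text \<open>The part of a bundle chart over a set of base points is a full product with the model
  fibre, so openness of overlaps and of preimages becomes a question about the base.\<close>

lemma bundle_chart_image:
  fixes F :: "'a \<Rightarrow> 'e \<Rightarrow> ('a, 'f) tvec"
  assumes "normal_frame_on L M g V F"
  shows "cmap (bundle_chart L M g c V F) ` {z. fst z \<in> W \<and> fst z \<in> V \<and> snd z \<in> normal_space L M g (fst z)}
    = cmap c ` (V \<inter> W) \<times> UNIV"
proof (intro equalityI subsetI)
  fix q assume "q \<in> cmap c ` (V \<inter> W) \<times> (UNIV :: 'e set)"
  then obtain x where x: "x \<in> V" "x \<in> W" "q = (cmap c x, snd q)" by (cases q) auto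
  then have "q = cmap (bundle_chart L M g c V F) (x, F x (snd q))"
    by (simp add: cmap_bundle_chart frame_inv[OF assms])
  moreover have "(x, F x (snd q)) \<in> {z. fst z \<in> W \<and> fst z \<in> V \<and> snd z \<in> normal_space L M g (fst z)}"
    using x by (simp add: frame_normal[OF assms])
  ultimately show "q \<in> cmap (bundle_chart L M g c V F) ` {z. fst z \<in> W \<and> fst z \<in> V \<and> snd z \<in> normal_space L M g (fst z)}"
    by (rule image_eqI)
qed (auto simp: cmap_bundle_chart)

lemma bundle_chart_inj:
  fixes F :: "'a \<Rightarrow> 'e \<Rightarrow> ('a, 'f) tvec"
  assumes c: "c \<in> L" "V \<subseteq> cdom c" and F: "normal_frame_on L M g V F"
  shows "inj_on (cmap (bundle_chart L M g c V F)) (cdom (bundle_chart L M g c V F))"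
proof (rule inj_onI, clarsimp simp: cdom_bundle_chart cmap_bundle_chart)
  fix x \<theta> x' \<theta>'
  assume h: "x \<in> V" "\<theta> \<in> normal_space L M g x" "x' \<in> V" "\<theta>' \<in> normal_space L M g x'"
    "cmap c x = cmap c x'" "inv (F x) \<theta> = inv (F x') \<theta>'"
  then have "x = x'" using I.A.cinv_cmap[OF c(1)] c(2) by (metis subsetD)
  then show "x = x' \<and> \<theta> = \<theta>'" using h inv_frame[OF F] by metis
qed

lemma cinv_bundle_chart:
  fixes F :: "'a \<Rightarrow> 'e \<Rightarrow> ('a, 'f) tvec"
  assumes c: "c \<in> L" "V \<subseteq> cdom c" and F: "normal_frame_on L M g V F" and u: "u \<in> cmap c ` V"
  shows "cinv (bundle_chart L M g c V F) (u, w) = (cinv c u, F (cinv c u) w)"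
proof -
  have x: "cinv c u \<in> V" "cmap c (cinv c u) = u" using u c by auto
  have "(cinv c u, F (cinv c u) w) \<in> cdom (bundle_chart L M g c V F)"
    using x by (simp add: cdom_bundle_chart frame_normal[OF F])
  from inv_into_f_f[OF bundle_chart_inj[OF c F] this] show ?thesis
    using x by (simp add: cinv_def[of "bundle_chart L M g c V F"] cmap_bundle_chart frame_inv[OF F])
qed

text \<open>The columns of the change-of-frame matrix are the coefficients, in the second frame, of
  the smooth sections that form the first.\<close>

lemma smooth_frame_change:
  fixes F F' :: "'a \<Rightarrow> 'e \<Rightarrow> ('a, 'f) tvec"
  assumes F: "normal_frame_on L M g V F" and F': "normal_frame_on L M g V' F'"
    and W: "open_in L W" "W \<subseteq> V" "W \<subseteq> V'"
  shows "smooth_fn L W (\<lambda>x. inv (F' x) (F x w))"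
proof (rule I.smooth_fn_frame_coefficients[where \<Phi> = F' and \<sigma> = "\<lambda>x. F x w", OF W(1)])
  show "I.sec W (\<lambda>x. F' x w)" for w by (rule I.sec_subset[OF normal_frame_on_sec[OF F'] W(3)])
  show "I.sec W (\<lambda>x. F x w)" by (rule I.sec_subset[OF normal_frame_on_sec[OF F] W(2)])
  show "F' x (inv (F' x) (F x w)) = F x w" if "x \<in> W" for x
    using inv_frame[OF F' _ frame_normal[OF F]] that W by blast
qed (use W frame_linear[OF F'] frame_inj[OF F'] in auto)

lemma linear_frame_change:
  fixes F F' :: "'a \<Rightarrow> 'e \<Rightarrow> ('a, 'f) tvec"
  assumes F: "normal_frame_on L M g V F" "x \<in> V" and F': "normal_frame_on L M g V' F'" "x \<in> V'"
  shows "linear (\<lambda>w. inv (F' x) (F x w))"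
proof (rule linearI)
  note i = inv_frame[OF F' frame_normal[OF F]] and l = frame_linear[OF F'] and j = frame_inj[OF F']
  show "inv (F' x) (F x (v + w)) = inv (F' x) (F x v) + inv (F' x) (F x w)" for v w
    by (rule injD[OF j]) (simp only: i linear_add[OF l], rule linear_add[OF frame_linear[OF F]])
  show "inv (F' x) (F x (r *\<^sub>R w)) = r *\<^sub>R inv (F' x) (F x w)" for r w
    by (rule injD[OF j]) (simp only: i linear_scale[OF l], rule linear_scale[OF frame_linear[OF F]])
qed

text \<open>A transition map consists of a transition map of \<open>L\<close> and a change of frame,
  which is smooth in the base point and linear in the fibre.\<close>

lemma smooth_atlas_NB: "smooth_atlas NB"
  unfolding smooth_atlas_def
proof (intro conjI ballI)
  fix e assume "e \<in> NB"
  then obtain c V F where e: "e = bundle_chart L M g c V F" "c \<in> L" "open_in L V" "V \<subseteq> cdom c"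
    "normal_frame_on L M g V F" by (rule NB_E)
  show "inj_on (cmap e) (cdom e)" unfolding e(1) by (rule bundle_chart_inj[OF e(2,4,5)])
  fix e' assume "e' \<in> NB"
  then obtain c' V' F' where e': "e' = bundle_chart L M g c' V' F'" "c' \<in> L" "open_in L V'" "V' \<subseteq> cdom c'"
    "normal_frame_on L M g V' F'" by (rule NB_E)
  let ?W = "V \<inter> V'"
  have W: "open_in L ?W" "?W \<subseteq> cdom c" using e e' I.A.open_in_Int by auto
  have S: "open (cmap c ` ?W)" using I.A.open_in_image[OF W(1) e(2)] W(2) by (simp add: inf.absorb1)
  have "cdom e \<inter> cdom e' = {z. fst z \<in> V' \<and> fst z \<in> V \<and> snd z \<in> normal_space L M g (fst z)}"
    unfolding e(1) e'(1) cdom_bundle_chart by auto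
  then have im: "cmap e ` (cdom e \<inter> cdom e') = cmap c ` ?W \<times> UNIV"
    using bundle_chart_image[OF e(5), of c V'] by (simp add: e(1))
  show o: "open (cmap e ` (cdom e \<inter> cdom e'))" unfolding im using S by (intro open_Times) auto
  have T: "smooth_on (cmap c ` ?W) (\<lambda>u. inv (F' (cinv c u)) (F (cinv c u) w))" for w
    by (rule I.A.smooth_fn_on_chart[OF smooth_frame_change[OF e(5) e'(5) W(1)] e(2) W(2)]) auto
  show "smooth_on (cmap e ` (cdom e \<inter> cdom e')) (cmap e' \<circ> cinv e)"
  proof (rule smooth_on_cong[OF o])
    show "smooth_on (cmap e ` (cdom e \<inter> cdom e'))
        (\<lambda>q. (cmap c' (cinv c (fst q)), inv (F' (cinv c (fst q))) (F (cinv c (fst q)) (snd q))))"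
      unfolding im
    proof (rule smooth_on_Pair)
      show "open (cmap c ` ?W \<times> (UNIV :: 'e set))" using o im by simp
      show "smooth_on (cmap c ` ?W \<times> UNIV) (\<lambda>q. cmap c' (cinv c (fst q)))"
        by (rule smooth_on_fst_comp[OF S smooth_on_subset[OF I.A.smooth_transition[OF e(2) e'(2)]]]) (use e e' in auto)
      show "smooth_on (cmap c ` ?W \<times> UNIV) (\<lambda>q. inv (F' (cinv c (fst q))) (F (cinv c (fst q)) (snd q)))"
        by (rule smooth_on_linear_family_prod[where F = "\<lambda>u w. inv (F' (cinv c u)) (F (cinv c u) w)", OF S _ T])
          (use linear_frame_change[OF e(5) _ e'(5)] e(2) W(2) I.A.cinv_cmap in \<open>auto simp: subset_iff\<close>)
    qed
    show "(cmap c' (cinv c (fst q)), inv (F' (cinv c (fst q))) (F (cinv c (fst q)) (snd q))) = (cmap e' \<circ> cinv e) q"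
      if "q \<in> cmap e ` (cdom e \<inter> cdom e')" for q
    proof -
      have q: "fst q \<in> cmap c ` V" using that unfolding im by auto
      then show ?thesis
        using cinv_bundle_chart[OF e(2,4,5), of "fst q" "snd q"]
        by (simp add: e(1) e'(1) cmap_bundle_chart)
    qed
  qed
qed

lemma points_NB: "z \<in> points NB \<longleftrightarrow> fst z \<in> points L \<and> snd z \<in> normal_space L M g (fst z)"
proof
  assume "z \<in> points NB"
  then obtain e where "e \<in> NB" "z \<in> cdom e" by (auto simp: points_def)
  then show "fst z \<in> points L \<and> snd z \<in> normal_space L M g (fst z)"
    using I.A.cdom_points by (elim NB_E) (auto simp: cdom_bundle_chart)
next
  assume z: "fst z \<in> points L \<and> snd z \<in> normal_space L M g (fst z)"
  then obtain c where "c \<in> L" "fst z \<in> cdom c" using I.A.pointsE by blast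
  then have "nchart c \<in> NB" "z \<in> cdom (nchart c)" using z nchart_NB[of c] by auto
  then show "z \<in> points NB" unfolding points_def by (rule UN_I)
qed

text \<open>The map \<open>h\<close> on the base is kept general in order to obtain at once the
  projection to \<open>L\<close> and its composite with the inclusion into \<open>M\<close>.\<close>

lemma smooth_map_fst_comp:
  fixes X :: "('c, 'k::euclidean_space) atlas"
  assumes "smooth_mapping L X h"
  shows "smooth_map NB X (\<lambda>z. h (fst z))"
proof -
  interpret H: smooth_mapping L X h by (rule assms)
  show ?thesis
    unfolding smooth_map_def
  proof (intro conjI ballI)
    show "(\<lambda>z. h (fst z)) ` points NB \<subseteq> points X" using H.maps by (auto simp: points_NB)
    fix e d assume "e \<in> NB" and d: "d \<in> X"
    then obtain c V F where e: "e = bundle_chart L M g c V F" "c \<in> L" "open_in L V" "V \<subseteq> cdom c"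
      "normal_frame_on L M g V F" by (elim NB_E)
    let ?W = "V \<inter> h -` cdom d"
    have W: "open_in L ?W" "?W \<subseteq> cdom c" using e H.open_Int_vimage[OF e(3) H.B.open_in_cdom[OF d]] by auto
    have S: "open (cmap c ` ?W)" using I.A.open_in_image[OF W(1) e(2)] W(2) by (simp add: inf.absorb1)
    have "cdom e \<inter> (\<lambda>z. h (fst z)) -` cdom d = {z. fst z \<in> h -` cdom d \<and> fst z \<in> V \<and> snd z \<in> normal_space L M g (fst z)}"
      unfolding e(1) cdom_bundle_chart by auto
    then have im: "cmap e ` (cdom e \<inter> (\<lambda>z. h (fst z)) -` cdom d) = cmap c ` ?W \<times> UNIV"
      using bundle_chart_image[OF e(5), of c "h -` cdom d"] by (simp add: e(1))
    show o: "open (cmap e ` (cdom e \<inter> (\<lambda>z. h (fst z)) -` cdom d))" unfolding im using S by (intro open_Times) auto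
    show "smooth_on (cmap e ` (cdom e \<inter> (\<lambda>z. h (fst z)) -` cdom d)) (cmap d \<circ> (\<lambda>z. h (fst z)) \<circ> cinv e)"
    proof (rule smooth_on_cong[OF o])
      show "smooth_on (cmap e ` (cdom e \<inter> (\<lambda>z. h (fst z)) -` cdom d)) (\<lambda>q. cmap d (h (cinv c (fst q))))"
        unfolding im
        by (rule smooth_on_fst_comp[OF S smooth_on_subset[OF H.smooth_chart(2)[OF e(2) d]]]) (use W e in auto)
      show "cmap d (h (cinv c (fst q))) = (cmap d \<circ> (\<lambda>z. h (fst z)) \<circ> cinv e) q"
        if "q \<in> cmap e ` (cdom e \<inter> (\<lambda>z. h (fst z)) -` cdom d)" for q
      proof -
        have q: "fst q \<in> cmap c ` V" using that unfolding im by auto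
        then show ?thesis using cinv_bundle_chart[OF e(2,4,5), of "fst q" "snd q"] by (simp add: e(1))
      qed
    qed
  qed
qed

lemma smooth_map_id: "smooth_map L L (\<lambda>x. x)"
  unfolding smooth_map_def using I.A.open_overlap I.A.smooth_transition
  by (auto simp: vimage_def Int_def o_def)

end

sublocale real_submanifold \<subseteq> P: smooth_mapping "normal_bundle L M g :: (('a, 'f) nvec, 'e \<times> 'e) atlas" L fst
proof (unfold_locales)
  show "smooth_atlas (normal_bundle L M g :: (('a, 'f) nvec, 'e \<times> 'e) atlas)" by (rule smooth_atlas_NB)
  have "smooth_mapping L L (\<lambda>x. x)" by unfold_locales (rule smooth_map_id)
  from smooth_map_fst_comp[OF this]
  show "smooth_map (normal_bundle L M g :: (('a, 'f) nvec, 'e \<times> 'e) atlas) L fst" by simp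
qed

text \<open>This is the pullback of the tangent bundle of \<open>M\<close> to the total space, the
  target of the bundle isomorphism \<open>mu\<close>.\<close>

sublocale real_submanifold \<subseteq> Q: kaehler_pullback "normal_bundle L M g :: (('a, 'f) nvec, 'e \<times> 'e) atlas" M fst nab g J
proof (unfold_locales)
  have "smooth_mapping L M (\<lambda>x. x)" by unfold_locales
  from smooth_map_fst_comp[OF this]
  show "smooth_map (normal_bundle L M g :: (('a, 'f) nvec, 'e \<times> 'e) atlas) M fst" by simp
qed

section \<open>Projection, fibre coordinate and test vectors in the charts of the total
  space\<close>

context real_submanifold
begin

abbreviation "TN \<equiv> tangent_space NB"
abbreviation "proj \<equiv> proj_map L M g :: ('a, 'f) nvec \<Rightarrow> ('a, 'e, 'f) nbtvec \<Rightarrow> ('a, 'e) tvec"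

lemma proj_push: "proj = tangent_map NB L fst"
  by (simp add: proj_map_def)

lemma push_proj:
  assumes z: "z \<in> points NB" and A: "A \<in> TN z"
  shows "Q.push z A = incl (fst z) (proj z A)"
proof
  fix d
  show "Q.push z A d = incl (fst z) (proj z A) d"
  proof (cases "d \<in> M \<and> fst z \<in> cdom d")
    case True
    have x: "fst z \<in> points L" using z by (simp add: points_NB)
    have n: "I.A.smooth_near (fst z) (cmap d)" using I.smooth_near_cmap[OF x] True by simp
    have "Q.push z A d = dir_deriv NB (\<lambda>y. cmap d (fst y)) z A" using True by (simp add: Q.tangent_map_apply)
    also have "\<dots> = dir_deriv L (cmap d) (fst z) (tangent_map NB L fst z A)" by (rule P.dir_deriv_comp[OF z n A])
    also have "\<dots> = incl (fst z) (proj z A) d" using True by (simp add: incl_push I.tangent_map_apply proj_push)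
    finally show ?thesis .
  next
    case False
    then show ?thesis by (auto simp: tangent_map_def incl_map_def)
  qed
qed

text \<open>Sections that depend on the base point only, such as the two frames, can be
  differentiated on \<open>L\<close>. In this way the Christoffel symbols of \<open>L\<close> govern
  the pullback connection on the total space.\<close>

lemma pull_conn_fst:
  assumes U: "open_in L U" "fst z \<in> U" and z: "z \<in> points NB" and \<sigma>: "I.sec U \<sigma>" and A: "A \<in> TN z"
  shows "Q.pc z A (\<lambda>y. \<sigma> (fst y)) = I.pc (fst z) (proj z A) \<sigma>"
proof
  fix d
  show "Q.pc z A (\<lambda>y. \<sigma> (fst y)) d = I.pc (fst z) (proj z A) \<sigma> d"
  proof (cases "d \<in> M \<and> fst z \<in> cdom d")
    case True
    have n: "I.A.smooth_near (fst z) (\<lambda>y. \<sigma> y d)" using I.sec_near[OF \<sigma> U] True by simp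
    have "I.push (fst z) (proj z A) = Q.push z A" using push_proj[OF z A] by (simp add: incl_push)
    then show ?thesis
      using P.dir_deriv_comp[OF z n A] True by (simp add: pull_conn_def proj_push)
  next
    case False
    then show ?thesis by (auto simp: pull_conn_def)
  qed
qed

definition fibre_coord :: "('a, 'e) chart \<Rightarrow> ('a, 'f) nvec \<Rightarrow> 'e" where
  "fibre_coord c z = snd (cmap (nchart c) z)"

lemma cmap_nchart: "cmap (nchart c) z = (cmap c (fst z), fibre_coord c z)"
  by (cases z) (simp add: nchart_def cmap_bundle_chart fibre_coord_def)

context
  fixes c assumes c: "c \<in> L"
begin

lemma normal_frame_fibre_coord:
  assumes "z \<in> cdom (nchart c)"
  shows "normal_frame c (fst z) (fibre_coord c z) = snd z"
  using inv_frame[OF normal_frame_on[OF c], of "fst z" "snd z"] assms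
  by (cases z) (auto simp: fibre_coord_def nchart_def cmap_bundle_chart cdom_bundle_chart)

lemma fibre_coord_normal_frame: "x \<in> cdom c \<Longrightarrow> fibre_coord c (x, normal_frame c x w) = w"
  using frame_inv[OF normal_frame_on[OF c]] by (simp add: fibre_coord_def nchart_def cmap_bundle_chart)

lemma cinv_nchart: "u \<in> cmap c ` cdom c \<Longrightarrow> cinv (nchart c) (u, w) = (cinv c u, normal_frame c (cinv c u) w)"
  unfolding nchart_def by (rule cinv_bundle_chart[OF c order_refl normal_frame_on[OF c]])

lemma open_nchart: "open_in NB (cdom (nchart c))"
  by (rule P.A.open_in_cdom[OF nchart_NB[OF c]])

lemma smooth_fibre_coord: "smooth_fn NB (cdom (nchart c)) (fibre_coord c)"
  unfolding fibre_coord_def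
  by (rule P.A.smooth_fn_bounded_linear[OF open_nchart bounded_linear_snd P.A.smooth_fn_cmap[OF nchart_NB[OF c]]])

context
  fixes z assumes z: "z \<in> cdom (nchart c)"
begin

lemma z_points: "z \<in> points NB" "fst z \<in> points L" "fst z \<in> cdom c" "fst z \<in> points M"
  using z points_NB[of z] I.A.cdom_points[OF c] points_M by auto

lemma cmap_nchart_derivative: "((\<lambda>q. cmap (nchart c) (cinv (nchart c) q)) has_derivative (\<lambda>h. h)) (at (cmap (nchart c) z))"
proof -
  have "frechet_derivative (\<lambda>q. cmap (nchart c) (cinv (nchart c) q)) (at (cmap (nchart c) z)) = (\<lambda>h. h)"
    by (rule ext) (rule P.A.transition_self[OF nchart_NB[OF c] z])
  then show ?thesis using P.A.transition_has_derivative[OF nchart_NB[OF c] nchart_NB[OF c] z z] by simp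
qed

lemma dir_deriv_fibre_coord:
  assumes A: "A \<in> TN z"
  shows "dir_deriv NB (fibre_coord c) z A = snd (A (nchart c))"
  using P.A.dir_derivI[where f = "fibre_coord c", OF nchart_NB[OF c] z A, of snd]
    bounded_linear.has_derivative[OF bounded_linear_snd cmap_nchart_derivative] by (simp add: fibre_coord_def)

lemma proj_chart:
  assumes A: "A \<in> TN z"
  shows "proj z A c = fst (A (nchart c))"
proof -
  have "((\<lambda>q. cmap c (fst (cinv (nchart c) q))) has_derivative fst) (at (cmap (nchart c) z))"
    using bounded_linear.has_derivative[OF bounded_linear_fst cmap_nchart_derivative] by (simp add: cmap_nchart)
  from P.A.dir_derivI[where f = "\<lambda>y. cmap c (fst y)", OF nchart_NB[OF c] z A this]
  show ?thesis by (simp add: proj_push P.tangent_map_apply[OF c z_points(3)])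
qed

lemma proj_tangent: "A \<in> TN z \<Longrightarrow> proj z A \<in> T (fst z)"
  unfolding proj_push by (rule P.tangent_map_tangent[OF z_points(1)])

lemma incl_proj: "A \<in> TN z \<Longrightarrow> incl (fst z) (proj z A) = tangent_frame c (fst z) (fst (A (nchart c)))"
  using incl_tangent_frame[OF c z_points(3) proj_tangent] by (simp add: proj_chart)

lemma coord_NB: "coord_field NB (nchart c) q z \<in> TN z" "coord_field NB (nchart c) q z (nchart c) = q"
  using P.A.coord_field_tangent[OF nchart_NB[OF c] z] P.A.coord_field_same[OF nchart_NB[OF c] z] by auto

lemma coord_NB_component: "A \<in> TN z \<Longrightarrow> coord_field NB (nchart c) (A (nchart c)) z = A"
  by (rule P.A.coord_field_component[OF nchart_NB[OF c] z])

text \<open>The frame section through \<open>z\<close> has constant fibre coordinate. Its tangent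
  vectors are the first kind on which \<open>connection_map\<close> prescribes \<open>K\<close>; in
  general they are not horizontal for the connection.\<close>

lemma tangent_map_section:
  assumes v: "v \<in> T (fst z)"
  shows "tangent_map L NB (\<lambda>y. (y, normal_frame c y (fibre_coord c z))) (fst z) v = coord_field NB (nchart c) (v c, 0) z"
proof
  fix d
  let ?w = "fibre_coord c z"
  have zz: "(fst z, normal_frame c (fst z) ?w) = z" using normal_frame_fibre_coord[OF z] by simp
  show "tangent_map L NB (\<lambda>y. (y, normal_frame c y ?w)) (fst z) v d = coord_field NB (nchart c) (v c, 0) z d"
  proof (cases "d \<in> NB \<and> z \<in> cdom d")
    case True
    then have d: "d \<in> NB" "z \<in> cdom d" by auto
    let ?D = "frechet_derivative (\<lambda>q. cmap d (cinv (nchart c) q)) (at (cmap (nchart c) z))"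
    have t: "((\<lambda>q. cmap d (cinv (nchart c) q)) has_derivative ?D) (at (cmap c (fst z), ?w))"
      using P.A.transition_has_derivative[OF nchart_NB[OF c] d(1) z d(2)] by (simp add: cmap_nchart)
    have "((\<lambda>u. cmap d (cinv (nchart c) (u, ?w))) has_derivative (\<lambda>h. ?D (h, 0))) (at (cmap c (fst z)))"
      by (rule has_derivative_compose[where g = "\<lambda>q. cmap d (cinv (nchart c) q)" and f = "\<lambda>u. (u, ?w)"
            and f' = "\<lambda>h. (h, 0)", OF _ t]) (auto intro!: derivative_eq_intros)
    then have "((\<lambda>u. cmap d (cinv c u, normal_frame c (cinv c u) ?w)) has_derivative (\<lambda>h. ?D (h, 0))) (at (cmap c (fst z)))"
      by (rule has_derivative_transform_within_open[where s = "cmap c ` cdom c"])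
        (use cinv_nchart I.A.open_overlap[OF c c] z_points in auto)
    from I.A.dir_derivI[where f = "\<lambda>y. cmap d (y, normal_frame c y ?w)", OF c z_points(3) v this]
    show ?thesis using True by (simp add: tangent_map_def P.A.coord_field_apply o_def zz)
  next
    case False
    then show ?thesis by (auto simp: tangent_map_def zz coord_field_def)
  qed
qed

text \<open>The second kind of test vector in \<open>connection_map\<close>. A straight line in the
  fibre is a straight line in the chart because the frame is linear.\<close>

lemma velocity_fibre:
  "velocity NB (\<lambda>t. (fst z, snd z + t *\<^sub>R normal_frame c (fst z) b)) 0 = coord_field NB (nchart c) (0, b) z"
proof
  fix d
  let ?w = "fibre_coord c z" and ?x = "fst z"
  have zz: "normal_frame c ?x ?w = snd z" by (rule normal_frame_fibre_coord[OF z])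
  have line: "(?x, snd z + t *\<^sub>R normal_frame c ?x b) = cinv (nchart c) (cmap c ?x, ?w + t *\<^sub>R b)" for t
    using cinv_nchart[of "cmap c ?x"] z_points c linear_add[OF linear_normal_frame[OF c z_points(3)]]
      linear_scale[OF linear_normal_frame[OF c z_points(3)]] by (simp add: zz)
  show "velocity NB (\<lambda>t. (?x, snd z + t *\<^sub>R normal_frame c ?x b)) 0 d = coord_field NB (nchart c) (0, b) z d"
  proof (cases "d \<in> NB \<and> z \<in> cdom d")
    case True
    then have d: "d \<in> NB" "z \<in> cdom d" by auto
    let ?D = "frechet_derivative (\<lambda>q. cmap d (cinv (nchart c) q)) (at (cmap (nchart c) z))"
    have t: "((\<lambda>q. cmap d (cinv (nchart c) q)) has_derivative ?D) (at (cmap c ?x, ?w + 0 *\<^sub>R b))"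
      using P.A.transition_has_derivative[OF nchart_NB[OF c] d(1) z d(2)] by (simp add: cmap_nchart)
    have "((\<lambda>t. cmap d (cinv (nchart c) (cmap c ?x, ?w + t *\<^sub>R b))) has_derivative (\<lambda>h. ?D (0, h *\<^sub>R b))) (at 0)"
      by (rule has_derivative_compose[where g = "\<lambda>q. cmap d (cinv (nchart c) q)" and f = "\<lambda>t. (cmap c ?x, ?w + t *\<^sub>R b)"
            and f' = "\<lambda>h. (0, h *\<^sub>R b)", OF _ t]) (auto intro!: derivative_eq_intros)
    moreover have "?D (0, h *\<^sub>R b) = h *\<^sub>R ?D (0, b)" for h
      using linear_scale[OF has_derivative_linear[OF t], of h "(0, b)"] by simp
    ultimately have "((\<lambda>t. cmap d (?x, snd z + t *\<^sub>R normal_frame c ?x b)) has_vector_derivative ?D (0, b)) (at 0)"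
      by (simp add: has_vector_derivative_def line)
    then show ?thesis using True by (simp add: velocity_def P.A.coord_field_apply o_def vector_derivative_at)
  next
    case False
    then show ?thesis by (auto simp: velocity_def coord_field_def)
  qed
qed

end

end

end

section \<open>The connection map, the lifts and the complex structure in coordinates\<close>

locale normal_bundle_connection = real_submanifold L M nab g J
  for L :: "('a, 'e::euclidean_space) atlas" and M :: "('a, 'f::euclidean_space) atlas"
    and nab :: "('a, 'f) conn" and g :: "('a, 'f) metric" and J :: "('a, 'f) endo" +
  fixes K :: "('a, 'f) nvec \<Rightarrow> ('a, 'e, 'f) nbtvec \<Rightarrow> ('a, 'f) tvec"
  assumes connection_map: "connection_map L M g nab K"
begin

context
  fixes c z assumes c: "c \<in> L" and z: "z \<in> cdom (nchart c)"
begin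

lemma K_linear: "linear_between (TN z) (normal_space L M g (fst z)) (K z)"
  using connection_map z_points(2)[OF c z] z unfolding connection_map_def by (cases z) auto

text \<open>Linearity of \<open>K\<close> joins the two kinds of test vectors: (0, b) is the
  velocity of a line in the fibre, and (a, 0) is tangent to a section with constant coefficients,
  whose normal derivative is the Christoffel term.\<close>

lemma K_coord:
  "K z (coord_field NB (nchart c) (a, b) z) =
    normal_frame c (fst z) (b + christoffel c (fst z) a (fibre_coord c z))"
proof -
  let ?x = "fst z" and ?w = "fibre_coord c z"
  note zp = z_points[OF c z]
  have th: "snd z \<in> normal_space L M g ?x" using z by simp
  have cm: "(\<forall>\<eta>\<in>normal_space L M g ?x. K (?x, snd z) (velocity NB (\<lambda>t. (?x, snd z + t *\<^sub>R \<eta>)) 0) = \<eta>)"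
    "(\<forall>U \<xi>. open_in L U \<and> ?x \<in> U \<and> normal_section_on L M g U \<xi> \<and> \<xi> ?x = snd z \<longrightarrow>
        (\<forall>v\<in>T ?x. K (?x, snd z) (tangent_map L NB (\<lambda>y. (y, \<xi> y)) ?x v) = normal_conn L M g nab ?x v \<xi>))"
    using connection_map zp(2) th unfolding connection_map_def by blast+
  have 1: "K z (coord_field NB (nchart c) (0, b) z) = normal_frame c ?x b"
    using cm(1)[rule_format, OF normal_frame_normal[OF c zp(3), of b]] velocity_fibre[OF c z, of b] by simp
  let ?v = "coord_field L c a ?x"
  have v: "?v \<in> T ?x" by (rule I.A.coord_field_tangent[OF c zp(3)])
  have ns: "normal_section_on L M g (cdom c) (\<lambda>y. normal_frame c y ?w)"
    using normal_frame_on[OF c] by (simp add: normal_frame_on_def)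
  have "K (?x, snd z) (tangent_map L NB (\<lambda>y. (y, normal_frame c y ?w)) ?x ?v) =
      normal_conn L M g nab ?x ?v (\<lambda>y. normal_frame c y ?w)"
    using cm(2)[rule_format, of "cdom c" "\<lambda>y. normal_frame c y ?w" ?v] I.A.open_in_cdom[OF c] zp(3) ns
      normal_frame_fibre_coord[OF c z] v by simp
  also have "\<dots> = normal_frame c ?x (christoffel c ?x a ?w)"
    using normal_conn_normal_frame[OF c I.A.open_in_cdom[OF c] zp(3) order_refl v I.A.smooth_fn_const[of _ ?w] refl] c zp(3)
    by simp
  finally have 2: "K z (coord_field NB (nchart c) (a, 0) z) = normal_frame c ?x (christoffel c ?x a ?w)"
    using tangent_map_section[OF c z v] c zp(3) by simp
  have "coord_field NB (nchart c) (a, b) z = coord_field NB (nchart c) (a, 0) z + coord_field NB (nchart c) (0, b) z"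
    using linear_add[OF P.A.linear_coord_field[OF nchart_NB[OF c] z], of "(a, 0)" "(0, b)"] by simp
  then show ?thesis
    using K_linear coord_NB(1)[OF c z] 1 2 linear_add[OF linear_normal_frame[OF c zp(3)]]
    unfolding linear_between_def by (simp add: add.commute)
qed

lemma K_chart:
  assumes "A \<in> TN z"
  shows "K z A = normal_frame c (fst z) (snd (A (nchart c)) +
    christoffel c (fst z) (fst (A (nchart c))) (fibre_coord c z))"
  using K_coord[of "fst (A (nchart c))" "snd (A (nchart c))"] coord_NB_component[OF c z assms] by simp

text \<open>In the chart \<open>proj\<close> determines the first component and \<open>K\<close>
  then the second. This gives the uniqueness demanded by the \<open>THE\<close> in
  \<open>hor_lift\<close> and \<open>ver_lift\<close>.\<close>

lemma NB_tangent_eqI: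
  assumes A: "A \<in> TN z" and B: "B \<in> TN z" and "proj z A = proj z B" "K z A = K z B"
  shows "A = B"
proof (rule P.A.tangent_eqI[OF A B nchart_NB[OF c] z])
  have 1: "fst (A (nchart c)) = fst (B (nchart c))"
    using assms(3) proj_chart[OF c z A] proj_chart[OF c z B] by simp
  have "snd (A (nchart c)) + christoffel c (fst z) (fst (A (nchart c))) (fibre_coord c z) =
      snd (B (nchart c)) + christoffel c (fst z) (fst (B (nchart c))) (fibre_coord c z)"
    by (rule injD[OF inj_normal_frame[OF c z_points(3)[OF c z]]]) (use assms(4) in \<open>simp add: K_chart[OF A] K_chart[OF B]\<close>)
  then have "snd (A (nchart c)) = snd (B (nchart c))" using 1 by simp
  then show "A (nchart c) = B (nchart c)" using 1 by (rule prod_eqI[rotated])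
qed

lemma proj_coord: "proj z (coord_field NB (nchart c) (a, b) z) = coord_field L c a (fst z)"
  by (rule I.A.tangent_eqI[OF proj_tangent[OF c z coord_NB(1)[OF c z]] I.A.coord_field_tangent[OF c z_points(3)[OF c z]] c z_points(3)[OF c z]])
    (simp add: proj_chart[OF c z coord_NB(1)[OF c z]] coord_NB(2)[OF c z] I.A.coord_field_same[OF c z_points(3)[OF c z]])

lemma hor_lift_coord:
  "hor_lift L M g K z (coord_field L c a (fst z)) =
    coord_field NB (nchart c) (a, - christoffel c (fst z) a (fibre_coord c z)) z"
  unfolding hor_lift_def
proof (rule the_equality)
  let ?A = "coord_field NB (nchart c) (a, - christoffel c (fst z) a (fibre_coord c z)) z"
  show *: "?A \<in> TN z \<and> proj z ?A = coord_field L c a (fst z) \<and> K z ?A = 0"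
    using coord_NB(1)[OF c z] linear_0[OF linear_normal_frame[OF c z_points(3)[OF c z]]] by (simp add: proj_coord K_coord)
  show "A = ?A" if "A \<in> TN z \<and> proj z A = coord_field L c a (fst z) \<and> K z A = 0" for A
    using that * by (intro NB_tangent_eqI) auto
qed

lemma ver_lift_coord: "ver_lift L M g K z (normal_frame c (fst z) b) = coord_field NB (nchart c) (0, b) z"
  unfolding ver_lift_def
proof (rule the_equality)
  let ?A = "coord_field NB (nchart c) (0, b) z"
  show *: "?A \<in> TN z \<and> proj z ?A = 0 \<and> K z ?A = normal_frame c (fst z) b"
    using coord_NB(1)[OF c z] linear_0[OF I.A.linear_coord_field[OF c z_points(3)[OF c z]]]
      linear_0[OF linear_christoffel_left[OF c z_points(3)[OF c z]]] by (simp add: proj_coord K_coord)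
  show "A = ?A" if "A \<in> TN z \<and> proj z A = 0 \<and> K z A = normal_frame c (fst z) b" for A
    using that * by (intro NB_tangent_eqI) auto
qed

lemma restrict_J_normal_frame: "restrict_tan L M (fst z) (J (fst z) (normal_frame c (fst z) b)) = coord_field L c (- b) (fst z)"
proof -
  have "J (fst z) (normal_frame c (fst z) b) = incl (fst z) (coord_field L c (- b) (fst z))"
    using J_normal_frame[OF c z_points(3)[OF c z], of b] linear_neg[OF linear_tangent_frame[OF c z_points(3)[OF c z]], of b]
    by (simp add: tangent_frame_def)
  then show ?thesis
    using restrict_tan_incl[OF z_points(2)[OF c z] I.A.coord_field_tangent[OF c z_points(3)[OF c z]]] by simp
qed

text \<open>Here \<open>k\<close> is the fibre coordinate of the \<open>K\<close> part. The
  structure sends this part to the horizontal lift of \<open>- k\<close>, which brings in the second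
  Christoffel term, and sends the horizontal part to the vertical vector with coordinate
  \<open>a\<close>.\<close>

lemma J_tilde_coord_0:
  "J_tilde L M J g K 0 0 z (coord_field NB (nchart c) (a, b) z) =
    (let k = b + christoffel c (fst z) a (fibre_coord c z) in
      coord_field NB (nchart c) (- k, a + christoffel c (fst z) k (fibre_coord c z)) z)"
proof -
  note zp = z_points[OF c z]
  have th: "snd z \<in> TM (fst z)" using normal_tangent[OF zp(2)] z by simp
  then have "0 \<le> g (fst z) (snd z) (snd z)"
    using I.M.g_pos[OF zp(4) th] I.M.g_zero_left[OF zp(4) th] by (cases "snd z = 0") auto
  \<comment> \<open>The exponent zero gives the factor 1 only for a nonzero base, since
    \<open>0 powr 0\<close> is 0.\<close>
  then have om: "omega g z \<noteq> 0" by (cases z) (simp add: omega_def)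
  let ?k = "b + christoffel c (fst z) a (fibre_coord c z)"
  have "J_ver L M J g K 0 0 z (normal_frame c (fst z) ?k) =
      coord_field NB (nchart c) (- ?k, christoffel c (fst z) ?k (fibre_coord c z)) z"
    using om restrict_J_normal_frame[of ?k] hor_lift_coord[of "- ?k"]
      linear_neg[OF linear_christoffel_left[OF c zp(3)], of ?k "fibre_coord c z"]
    by (cases z) (simp add: J_ver_def)
  moreover have "J_hor L M J g K 0 0 z (coord_field L c a (fst z)) = coord_field NB (nchart c) (0, a) z"
    using om ver_lift_coord[of a] by (cases z) (simp add: J_hor_def normal_frame_def tangent_frame_def)
  ultimately show ?thesis
    using linear_add[OF P.A.linear_coord_field[OF nchart_NB[OF c] z], of "(- ?k, christoffel c (fst z) ?k (fibre_coord c z))" "(0, a)"]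
    by (simp add: J_tilde_def K_coord proj_coord Let_def add.commute)
qed

end

end

section \<open>From a flat normal connection to a Kaehler structure\<close>

context pullback
begin

lemma sec_localI:
  assumes "\<And>z. z \<in> U \<Longrightarrow> \<exists>V. open_in B V \<and> z \<in> V \<and> sec V \<sigma>"
  shows "sec U \<sigma>"
  unfolding section_along_def
proof (intro conjI ballI)
  show "\<sigma> z \<in> tangent_space M (f z)" if "z \<in> U" for z using assms[OF that] sec_tangent by blast
  fix d assume d: "d \<in> M"
  show "smooth_fn B (U \<inter> f -` cdom d) (\<lambda>z. \<sigma> z d)"
  proof (rule A.smooth_fn_localI)
    fix z assume z: "z \<in> U \<inter> f -` cdom d"
    then obtain V where "open_in B V" "z \<in> V" "sec V \<sigma>" using assms[of z] by blast
    then show "\<exists>W. open_in B W \<and> z \<in> W \<and> smooth_fn B W (\<lambda>z. \<sigma> z d)"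
      using open_chart[of V d] sec_component[of V \<sigma> d] d z by (intro exI[of _ "V \<inter> f -` cdom d"]) auto
  qed
qed

end

section \<open>Transport of a Kaehler structure along a bundle isomorphism\<close>

context kaehler_pullback
begin

text \<open>An isomorphism from the tangent bundle of \<open>B\<close> onto the pullback of the
  tangent bundle of \<open>M\<close> carries over the metric, the complex structure and the pullback
  connection. Metricity and parallelism are inherited from \<open>M\<close>; the torsion compares
  \<open>\<mu>\<close> with the bracket of \<open>B\<close> and therefore has to be assumed to
  vanish.\<close>

theorem kaehlerian_transport:
  fixes \<mu> :: "'a \<Rightarrow> ('a, 'e) tvec \<Rightarrow> ('b, 'f) tvec" and J' :: "('a, 'e) endo" and h :: "('a, 'e) metric"
  assumes lin: "\<And>z. z \<in> points B \<Longrightarrow> linear_between (tangent_space B z) (tangent_space M (f z)) (\<mu> z)"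
    and bij: "\<And>z. z \<in> points B \<Longrightarrow> bij_betw (\<mu> z) (tangent_space B z) (tangent_space M (f z))"
    and sm: "\<And>U X. open_in B U \<Longrightarrow> vector_field_on B U X \<Longrightarrow> sec U (\<lambda>z. \<mu> z (X z))"
    and J't: "\<And>z A. z \<in> points B \<Longrightarrow> A \<in> tangent_space B z \<Longrightarrow> J' z A \<in> tangent_space B z"
    and J'\<mu>: "\<And>z A. z \<in> points B \<Longrightarrow> A \<in> tangent_space B z \<Longrightarrow> \<mu> z (J' z A) = J (f z) (\<mu> z A)"
    and h: "\<And>z A C. z \<in> points B \<Longrightarrow> A \<in> tangent_space B z \<Longrightarrow> C \<in> tangent_space B z \<Longrightarrow>
      h z A C = g (f z) (\<mu> z A) (\<mu> z C)"
    and torsion: "\<And>U X Y z. open_in B U \<Longrightarrow> vector_field_on B U X \<Longrightarrow> vector_field_on B U Y \<Longrightarrow> z \<in> U \<Longrightarrow>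
      \<mu> z (lie_bracket B X Y z) = pc z (X z) (\<lambda>y. \<mu> y (Y y)) - pc z (Y z) (\<lambda>y. \<mu> y (X y))"
  shows "kaehlerian B J' h"
proof -
  note At = A.vector_field_tangent
  have \<mu>t: "\<mu> z A \<in> tangent_space M (f z)" if "z \<in> points B" "A \<in> tangent_space B z" for z A
    using lin[OF that(1)] that(2) by (auto simp: linear_between_def)
  have \<mu>add: "\<mu> z (A + C) = \<mu> z A + \<mu> z C" if "z \<in> points B" "A \<in> tangent_space B z" "C \<in> tangent_space B z" for z A C
    using lin[OF that(1)] that(2,3) unfolding linear_between_def by blast
  have \<mu>scale: "\<mu> z (r *\<^sub>R A) = r *\<^sub>R \<mu> z A" if "z \<in> points B" "A \<in> tangent_space B z" for z A r
    using lin[OF that(1)] that(2) unfolding linear_between_def by blast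
  have \<mu>diff: "\<mu> z (A - C) = \<mu> z A - \<mu> z C" if "z \<in> points B" "A \<in> tangent_space B z" "C \<in> tangent_space B z" for z A C
    using \<mu>add[OF that(1,2) A.tangent_scaleR[OF that(3)], of "-1"] \<mu>scale[OF that(1,3), of "-1"] by simp
  have \<mu>eq: "A = C" if "z \<in> points B" "A \<in> tangent_space B z" "C \<in> tangent_space B z" "\<mu> z A = \<mu> z C" for z A C
    using bij[OF that(1)] that(2-4) by (auto simp: bij_betw_def dest: inj_onD)
  have \<mu>0: "A = 0" if "z \<in> points B" "A \<in> tangent_space B z" "\<mu> z A = 0" for z A
    using \<mu>eq[OF that(1,2) A.tangent_0] that \<mu>scale[OF that(1) A.tangent_0, of 0] by simp
  have fp: "f z \<in> points M" if "z \<in> points B" for z using that by (rule maps)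
  have Up: "z \<in> points B" if "open_in B U" "z \<in> U" for U z using A.open_in_points that by auto

  \<comment> \<open>A converse of \<open>sm\<close>: the components of \<open>X\<close> are the
    coefficients of its image with respect to the images of coordinate fields, which form a smooth
    injective frame.\<close>
  have vf: "vector_field_on B U X" if U: "open_in B U" and X: "\<And>z. z \<in> U \<Longrightarrow> X z \<in> tangent_space B z"
    and s: "sec U (\<lambda>z. \<mu> z (X z))" for U X
  proof (rule A.vector_field_onI[OF U X])
    fix z assume z: "z \<in> U"
    obtain e where e: "e \<in> B" "z \<in> cdom e" using Up[OF U z] by (rule A.pointsE)
    let ?V = "U \<inter> cdom e"
    have V: "open_in B ?V" using U e by (intro A.open_in_Int A.open_in_cdom)
    have "smooth_fn B ?V (\<lambda>z. X z e)"
    proof (rule smooth_fn_frame_coefficients[where \<Phi> = "\<lambda>z w. \<mu> z (coord_field B e w z)" and \<sigma> = "\<lambda>z. \<mu> z (X z)", OF V])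
      fix y assume y: "y \<in> ?V"
      then have yp: "y \<in> points B" using Up[OF U] by auto
      have ye: "y \<in> cdom e" using y by auto
      note t = A.coord_field_tangent[OF e(1) ye] and l = A.linear_coord_field[OF e(1) ye]
      show L: "linear (\<lambda>w. \<mu> y (coord_field B e w y))"
        by (rule linearI) (simp_all add: linear_add[OF l] linear_scale[OF l] \<mu>add[OF yp t t] \<mu>scale[OF yp t])
      show "inj (\<lambda>w. \<mu> y (coord_field B e w y))"
        unfolding linear_injective_0[OF L]
      proof (intro allI impI)
        fix w assume "\<mu> y (coord_field B e w y) = 0"
        then have "coord_field B e w y = 0" by (rule \<mu>0[OF yp t])
        then show "w = 0" using A.coord_field_same[OF e(1) ye, of w] by simp
      qed
      show "\<mu> y (coord_field B e (X y e) y) = \<mu> y (X y)"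
        using A.coord_field_component[OF e(1) ye X] y by simp
    next
      show "sec ?V (\<lambda>z. \<mu> z (coord_field B e w z))" for w
        by (rule sm[OF V A.vector_field_subset[OF A.vector_field_coord_field[OF e(1)]]]) auto
      show "sec ?V (\<lambda>z. \<mu> z (X z))" by (rule sec_subset[OF s]) auto
    qed
    then show "\<exists>c\<in>B. \<exists>V. z \<in> V \<and> V \<subseteq> U \<inter> cdom c \<and> open_in B V \<and> smooth_fn B V (\<lambda>x. X x c)"
      using V e z by (intro bexI[of _ e] exI[of _ ?V]) auto
  qed

  have metric: "riemannian_metric B h"
    unfolding riemannian_metric_def
  proof (intro conjI ballI allI impI)
    fix z u assume z: "z \<in> points B" and u: "u \<in> tangent_space B z"
    show "linear_between (tangent_space B z) UNIV (h z u)"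
      unfolding linear_between_def
      using h[OF z u] A.tangent_add A.tangent_scaleR \<mu>add[OF z] \<mu>scale[OF z] \<mu>t[OF z]
        M.g_add_right[OF fp[OF z] \<mu>t[OF z u]] M.g_scaleR_right[OF fp[OF z] \<mu>t[OF z u]] by simp
    show "h z u v = h z v u" if "v \<in> tangent_space B z" for v
      using h[OF z] u that M.g_sym[OF fp[OF z] \<mu>t[OF z u] \<mu>t[OF z that]] by simp
    show "0 < h z u u" if "u \<noteq> 0"
      using h[OF z u u] M.g_pos[OF fp[OF z] \<mu>t[OF z u]] \<mu>0[OF z u] that by auto
  next
    fix U X Y assume a: "open_in B U \<and> vector_field_on B U X \<and> vector_field_on B U Y"
    have "smooth_fn B U (\<lambda>z. g (f z) (\<mu> z (X z)) (\<mu> z (Y z)))"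
      using a by (intro smooth_fn_g_sec sm) auto
    then show "smooth_fun_on B U (\<lambda>x. h x (X x) (Y x))"
      unfolding smooth_fun_on_eq using a
      by (elim A.smooth_fn_cong[rotated 2]) (auto simp: h At Up)
  qed

  have acs: "almost_complex_structure B J'"
    unfolding almost_complex_structure_def
  proof (intro conjI ballI allI impI)
    fix z assume z: "z \<in> points B"
    note t = J't[OF z]
    have "J' z (u + v) = J' z u + J' z v" if "u \<in> tangent_space B z" "v \<in> tangent_space B z" for u v
      using that \<mu>t[OF z] fp[OF z]
      by (intro \<mu>eq[OF z t A.tangent_add[OF t t]] A.tangent_add)
        (simp_all add: J'\<mu>[OF z] A.tangent_add \<mu>add[OF z] M.J_add t)
    moreover have "J' z (r *\<^sub>R u) = r *\<^sub>R J' z u" if "u \<in> tangent_space B z" for r u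
      using that \<mu>t[OF z] fp[OF z]
      by (intro \<mu>eq[OF z t A.tangent_scaleR[OF t]] A.tangent_scaleR)
        (simp_all add: J'\<mu>[OF z] A.tangent_scaleR \<mu>scale[OF z] M.J_scaleR t)
    ultimately show "linear_between (tangent_space B z) (tangent_space B z) (J' z)"
      using t by (auto simp: linear_between_def)
    show "J' z (J' z v) = - v" if v: "v \<in> tangent_space B z" for v
    proof (rule \<mu>eq[OF z t[OF t[OF v]] A.tangent_uminus[OF v]])
      show "\<mu> z (J' z (J' z v)) = \<mu> z (- v)"
        using J'\<mu>[OF z t[OF v]] J'\<mu>[OF z v] M.J_J[OF fp[OF z] \<mu>t[OF z v]] \<mu>scale[OF z v, of "-1"] by simp
    qed
  next
    fix U X assume a: "open_in B U \<and> vector_field_on B U X"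
    show "vector_field_on B U (\<lambda>x. J' x (X x))"
    proof (rule vf)
      have "sec U (\<lambda>z. J (f z) (\<mu> z (X z)))" using a by (intro sec_J sm) auto
      then show "sec U (\<lambda>z. \<mu> z (J' z (X z)))"
        using a by (elim sec_cong[rotated]) (auto simp: J'\<mu> At Up)
    qed (use a J't Up At in auto)
  qed

  \<comment> \<open>The transported connection: take the image of the field under
    \<open>\<mu>\<close>, differentiate it along the map, and go back.\<close>
  define nab' where "nab' z v Y = inv_into (tangent_space B z) (\<mu> z) (pc z v (\<lambda>y. \<mu> y (Y y)))" for z v Y
  have nab': "nab' z v Y \<in> tangent_space B z" "\<mu> z (nab' z v Y) = pc z v (\<lambda>y. \<mu> y (Y y))"
    if U: "open_in B U" "z \<in> U" and Y: "vector_field_on B U Y" and v: "v \<in> tangent_space B z" for U z v Y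
  proof -
    have "pc z v (\<lambda>y. \<mu> y (Y y)) \<in> \<mu> z ` tangent_space B z"
      using pull_conn_tangent[OF U sm[OF U(1) Y] v] bij[OF Up[OF U]] by (simp add: bij_betw_def)
    then show "nab' z v Y \<in> tangent_space B z" "\<mu> z (nab' z v Y) = pc z v (\<lambda>y. \<mu> y (Y y))"
      unfolding nab'_def by (rule inv_into_into) (rule f_inv_into_f[OF \<open>pc z v (\<lambda>y. \<mu> y (Y y)) \<in> \<mu> z ` tangent_space B z\<close>])
  qed

  have conn: "affine_connection B nab'"
    unfolding affine_connection_def
  proof (intro allI impI conjI ballI)
    fix U assume U: "open_in B U"
    {
      fix z Y assume z: "z \<in> U" and Y: "vector_field_on B U Y"
      note zp = Up[OF U z] and s = sm[OF U Y] and n = nab'[OF U z Y]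
      have "nab' z (u + v) Y = nab' z u Y + nab' z v Y" if "u \<in> tangent_space B z" "v \<in> tangent_space B z" for u v
        using that by (intro \<mu>eq[OF zp n(1) A.tangent_add[OF n(1) n(1)]])
          (simp_all add: A.tangent_add n \<mu>add[OF zp] pull_conn_vec_add[OF U z s])
      moreover have "nab' z (r *\<^sub>R u) Y = r *\<^sub>R nab' z u Y" if "u \<in> tangent_space B z" for r u
        using that by (intro \<mu>eq[OF zp n(1) A.tangent_scaleR[OF n(1)]])
          (simp_all add: A.tangent_scaleR n \<mu>scale[OF zp] pull_conn_vec_scaleR[OF U z s])
      ultimately show "linear_between (tangent_space B z) (tangent_space B z) (\<lambda>v. nab' z v Y)"
        using n(1) by (auto simp: linear_between_def)
    next
      fix z v Y Z assume z: "z \<in> U" and v: "v \<in> tangent_space B z" and a: "vector_field_on B U Y \<and> vector_field_on B U Z"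
      then have Y: "vector_field_on B U Y" and Z: "vector_field_on B U Z" by auto
      note zp = Up[OF U z]
      have "pc z v (\<lambda>y. \<mu> y (Y y + Z y)) = pc z v (\<lambda>y. \<mu> y (Y y) + \<mu> y (Z y))"
        by (rule pull_conn_cong[OF U z]) (rule \<mu>add[OF Up[OF U] At[OF Y] At[OF Z]])
      also have "\<dots> = pc z v (\<lambda>y. \<mu> y (Y y)) + pc z v (\<lambda>y. \<mu> y (Z y))"
        by (rule pull_conn_add[OF U z sm[OF U Y] sm[OF U Z] v])
      finally have "\<mu> z (nab' z v (\<lambda>y. Y y + Z y)) = \<mu> z (nab' z v Y + nab' z v Z)"
        using nab'(2)[OF U z A.vector_field_add[OF U Y Z] v] nab'[OF U z Y v] nab'[OF U z Z v] \<mu>add[OF zp] by simp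
      then show "nab' z v (\<lambda>y. Y y + Z y) = nab' z v Y + nab' z v Z"
        by (rule \<mu>eq[OF zp nab'(1)[OF U z A.vector_field_add[OF U Y Z] v] A.tangent_add[OF nab'(1)[OF U z Y v] nab'(1)[OF U z Z v]]])
    next
      fix z v s Y assume z: "z \<in> U" and v: "v \<in> tangent_space B z" and a: "smooth_fun_on B U s \<and> vector_field_on B U Y"
      then have Y: "vector_field_on B U Y" and s: "smooth_fn B U s" by (auto simp: smooth_fun_on_eq)
      note zp = Up[OF U z] and sY = A.vector_field_scaleR[OF U s Y] and n = nab'[OF U z Y v]
      have "pc z v (\<lambda>y. \<mu> y (s y *\<^sub>R Y y)) = pc z v (\<lambda>y. s y *\<^sub>R \<mu> y (Y y))"
        by (rule pull_conn_cong[OF U z]) (rule \<mu>scale[OF Up[OF U] At[OF Y]])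
      also have "\<dots> = dir_deriv B s z v *\<^sub>R \<mu> z (Y z) + s z *\<^sub>R pc z v (\<lambda>y. \<mu> y (Y y))"
        by (rule pull_conn_leibniz[OF U z s sm[OF U Y] v])
      finally have "\<mu> z (nab' z v (\<lambda>y. s y *\<^sub>R Y y)) = \<mu> z (dir_deriv B s z v *\<^sub>R Y z + s z *\<^sub>R nab' z v Y)"
        using nab'(2)[OF U z sY v] n \<mu>add[OF zp A.tangent_scaleR[OF At[OF Y z]] A.tangent_scaleR[OF n(1)]]
          \<mu>scale[OF zp At[OF Y z]] \<mu>scale[OF zp n(1)] by simp
      then show "nab' z v (\<lambda>y. s y *\<^sub>R Y y) = dir_deriv B s z v *\<^sub>R Y z + s z *\<^sub>R nab' z v Y"
        by (rule \<mu>eq[OF zp nab'(1)[OF U z sY v] A.tangent_add[OF A.tangent_scaleR[OF At[OF Y z]] A.tangent_scaleR[OF n(1)]]])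
    next
      fix X Y assume a: "vector_field_on B U X \<and> vector_field_on B U Y"
      then have X: "vector_field_on B U X" and Y: "vector_field_on B U Y" by auto
      show "vector_field_on B U (\<lambda>x. nab' x (X x) Y)"
      proof (rule vf[OF U])
        show "nab' z (X z) Y \<in> tangent_space B z" if "z \<in> U" for z by (rule nab'(1)[OF U that Y At[OF X that]])
        show "sec U (\<lambda>z. \<mu> z (nab' z (X z) Y))"
          by (rule sec_cong[OF U sec_pull_conn[OF U X sm[OF U Y]]]) (rule nab'(2)[OF U _ Y At[OF X], symmetric])
      qed
    }
  qed

  have lc: "levi_civita B h nab'"
    unfolding levi_civita_def
  proof (intro conjI conn allI impI ballI)
    fix U X Y z assume a: "open_in B U \<and> vector_field_on B U X \<and> vector_field_on B U Y" and z: "z \<in> U"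
    then have U: "open_in B U" and X: "vector_field_on B U X" and Y: "vector_field_on B U Y" by auto
    note zp = Up[OF U z]
    note nX = nab'[OF U z Y At[OF X z]] and nY = nab'[OF U z X At[OF Y z]]
    \<comment> \<open>The only use of the hypothesis \<open>torsion\<close>.\<close>
    show "nab' z (X z) Y - nab' z (Y z) X = lie_bracket B X Y z"
      by (rule \<mu>eq[OF zp A.tangent_diff[OF nX(1) nY(1)] A.lie_bracket_tangent[OF U X Y z]])
        (simp add: \<mu>diff[OF zp nX(1) nY(1)] torsion[OF U X Y z] nX nY)
    fix v assume v: "v \<in> tangent_space B z"
    have "dir_deriv B (\<lambda>y. h y (X y) (Y y)) z v = dir_deriv B (\<lambda>y. g (f y) (\<mu> y (X y)) (\<mu> y (Y y))) z v"
      by (rule A.dir_deriv_cong[OF U z]) (rule h[OF Up[OF U] At[OF X] At[OF Y]])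
    also have "\<dots> = g (f z) (pc z v (\<lambda>y. \<mu> y (X y))) (\<mu> z (Y z)) + g (f z) (\<mu> z (X z)) (pc z v (\<lambda>y. \<mu> y (Y y)))"
      by (rule pull_conn_metric[OF U z sm[OF U X] sm[OF U Y] v])
    finally show "dir_deriv B (\<lambda>y. h y (X y) (Y y)) z v = h z (nab' z v X) (Y z) + h z (X z) (nab' z v Y)"
      using h[OF zp nab'(1)[OF U z X v] At[OF Y z]] h[OF zp At[OF X z] nab'(1)[OF U z Y v]]
        nab'(2)[OF U z X v] nab'(2)[OF U z Y v] by simp
  qed

  have par: "parallel B nab' J'"
    unfolding parallel_def
  proof (intro allI impI ballI)
    fix U Y z v assume a: "open_in B U \<and> vector_field_on B U Y" and z: "z \<in> U" and v: "v \<in> tangent_space B z"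
    then have U: "open_in B U" and Y: "vector_field_on B U Y" by auto
    note zp = Up[OF U z] and n = nab'[OF U z Y v]
    have JY: "vector_field_on B U (\<lambda>y. J' y (Y y))" using acs U Y unfolding almost_complex_structure_def by blast
    have "pc z v (\<lambda>y. \<mu> y (J' y (Y y))) = pc z v (\<lambda>y. J (f y) (\<mu> y (Y y)))"
      by (rule pull_conn_cong[OF U z]) (rule J'\<mu>[OF Up[OF U] At[OF Y]])
    also have "\<dots> = J (f z) (pc z v (\<lambda>y. \<mu> y (Y y)))" by (rule pull_conn_J[OF U z sm[OF U Y] v])
    finally have "\<mu> z (nab' z v (\<lambda>y. J' y (Y y))) = \<mu> z (J' z (nab' z v Y))"
      using nab'(2)[OF U z JY v] n J'\<mu>[OF zp n(1)] by simp
    then show "nab' z v (\<lambda>y. J' y (Y y)) = J' z (nab' z v Y)"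
      by (rule \<mu>eq[OF zp nab'(1)[OF U z JY v] J't[OF zp n(1)]])
  qed

  show ?thesis
    unfolding kaehlerian_def
    using metric acs lc par h J'\<mu> J't \<mu>t M.hermitian fp by auto
qed

end

section \<open>The isomorphism onto the pullback of the ambient tangent bundle, and its
  torsion\<close>

context normal_bundle_connection
begin

definition mu :: "('a, 'f) nvec \<Rightarrow> ('a, 'e, 'f) nbtvec \<Rightarrow> ('a, 'f) tvec" where
  "mu z A = incl (fst z) (proj z A) + K z A"

text \<open>The coefficient of \<open>K z A\<close> in the normal frame: the fibre component of
  \<open>A\<close>, corrected by the connection.\<close>

definition kappa :: "('a, 'e) chart \<Rightarrow> ('a, 'f) nvec \<Rightarrow> ('a, 'e, 'f) nbtvec \<Rightarrow> 'e" where
  "kappa c z A = snd (A (nchart c)) + christoffel c (fst z) (fst (A (nchart c))) (fibre_coord c z)"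

lemma NB_chartE:
  assumes "z \<in> points NB"
  obtains c where "c \<in> L" "z \<in> cdom (nchart c)"
  using assms points_NB[of z] I.A.pointsE by auto

context
  fixes c z assumes c: "c \<in> L" and z: "z \<in> cdom (nchart c)"
begin

lemma mu_chart:
  "A \<in> TN z \<Longrightarrow> mu z A = tangent_frame c (fst z) (fst (A (nchart c))) + normal_frame c (fst z) (kappa c z A)"
  by (simp add: mu_def incl_proj[OF c z] K_chart[OF c z] kappa_def)

lemma mu_linear: "linear_between (TN z) (TM (fst z)) (mu z)"
  unfolding linear_between_def
proof (intro conjI ballI allI)
  note x = z_points(3)[OF c z]
  note l = linear_add[OF linear_tangent_frame[OF c x]] linear_add[OF linear_normal_frame[OF c x]]
    linear_scale[OF linear_tangent_frame[OF c x]] linear_scale[OF linear_normal_frame[OF c x]]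
    linear_add[OF linear_christoffel_left[OF c x]] linear_scale[OF linear_christoffel_left[OF c x]]
  show "mu z ` TN z \<subseteq> TM (fst z)"
    using I.B.tangent_add[OF tangent_frame_tangent[OF c x] normal_frame_tangent[OF c x]] mu_chart by auto
  show "mu z (u + v) = mu z u + mu z v" if "u \<in> TN z" "v \<in> TN z" for u v
    using that by (simp add: mu_chart P.A.tangent_add kappa_def l)
  show "mu z (r *\<^sub>R u) = r *\<^sub>R mu z u" if "u \<in> TN z" for r u
    using that by (simp add: mu_chart P.A.tangent_scaleR kappa_def l scaleR_add_right)
qed

lemma mu_bij: "bij_betw (mu z) (TN z) (TM (fst z))"
proof (rule bij_betw_imageI)
  note x = z_points(3)[OF c z]
  show "inj_on (mu z) (TN z)"
  proof (rule inj_onI)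
    fix u v assume u: "u \<in> TN z" and v: "v \<in> TN z" and eq: "mu z u = mu z v"
    have "tangent_frame c (fst z) (fst (u (nchart c)) - fst (v (nchart c))) +
        normal_frame c (fst z) (kappa c z u - kappa c z v) = 0"
      using eq unfolding mu_chart[OF u] mu_chart[OF v] linear_diff[OF linear_tangent_frame[OF c x]]
        linear_diff[OF linear_normal_frame[OF c x]] by (simp add: algebra_simps)
    from frames_eq_0[OF c x this] have "u (nchart c) = v (nchart c)"
      by (simp add: kappa_def prod_eq_iff)
    then show "u = v" by (rule P.A.tangent_eqI[OF u v nchart_NB[OF c] z])
  qed
  show "mu z ` TN z = TM (fst z)"
  proof (intro equalityI subsetI)
    fix w assume "w \<in> TM (fst z)"
    then obtain u v where uv: "u \<in> T (fst z)" "v \<in> T (fst z)" "w = incl (fst z) u + J (fst z) (incl (fst z) v)"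
      by (rule tangent_decomposition[OF z_points(2)[OF c z]])
    \<comment> \<open>The preimage with tangential part \<open>u\<close> and normal part
      \<open>J v\<close>: subtracting the Christoffel term makes \<open>kappa\<close> equal to
      \<open>v c\<close>.\<close>
    let ?A = "coord_field NB (nchart c) (u c, v c - christoffel c (fst z) (u c) (fibre_coord c z)) z"
    have "mu z ?A = w"
      using uv incl_tangent_frame[OF c x]
      by (simp add: mu_chart[OF coord_NB(1)[OF c z]] coord_NB(2)[OF c z] kappa_def normal_frame_def)
    then show "w \<in> mu z ` TN z" using coord_NB(1)[OF c z] by blast
  qed (use mu_linear in \<open>auto simp: linear_between_def\<close>)
qed

lemma J_tilde_0:
  assumes A: "A \<in> TN z"
  shows "J_tilde L M J g K 0 0 z A \<in> TN z" "mu z (J_tilde L M J g K 0 0 z A) = J (fst z) (mu z A)"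
proof -
  note x = z_points(3)[OF c z] and Mp = z_points(4)[OF c z]
  let ?J = "J_tilde L M J g K 0 0 z A" and ?a = "fst (A (nchart c))"
  define k where "k = kappa c z A"
  have eq: "?J = coord_field NB (nchart c) (- k, ?a + christoffel c (fst z) k (fibre_coord c z)) z"
    using J_tilde_coord_0[OF c z, of ?a "snd (A (nchart c))"] coord_NB_component[OF c z A]
    by (simp add: k_def kappa_def Let_def)
  show t: "?J \<in> TN z" unfolding eq by (rule coord_NB(1)[OF c z])
  have "mu z ?J = - tangent_frame c (fst z) k + normal_frame c (fst z) ?a"
    unfolding mu_chart[OF t] unfolding eq
    by (simp add: coord_NB(2)[OF c z] kappa_def linear_neg[OF linear_tangent_frame[OF c x]]
        linear_neg[OF linear_christoffel_left[OF c x]])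
  also have "\<dots> = J (fst z) (mu z A)"
    unfolding mu_chart[OF A] I.M.J_add[OF Mp tangent_frame_tangent[OF c x] normal_frame_tangent[OF c x]]
      J_normal_frame[OF c x] k_def by (simp add: normal_frame_def)
  finally show "mu z ?J = J (fst z) (mu z A)" .
qed

lemma omega_pos: "omega g z > 0"
proof -
  have th: "snd z \<in> TM (fst z)" using normal_tangent[OF z_points(2)[OF c z]] z by simp
  then have "0 \<le> g (fst z) (snd z) (snd z)"
    using I.M.g_pos[OF z_points(4)[OF c z] th] I.M.g_zero_left[OF z_points(4)[OF c z] th]
    by (cases "snd z = 0") auto
  then show ?thesis by (cases z) (simp add: omega_def)
qed

text \<open>The cross terms vanish because \<open>K\<close> has normal values and
  \<open>incl\<close> has tangent ones, while for exponent zero the weight is 1.\<close>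

lemma pq_metric_0:
  assumes A: "A \<in> TN z" and C: "C \<in> TN z"
  shows "pq_metric L M g K 0 0 z A C = g (fst z) (mu z A) (mu z C)"
proof -
  note x = z_points(3)[OF c z] and Lp = z_points(2)[OF c z] and Mp = z_points(4)[OF c z]
  have i: "incl (fst z) (proj z B) \<in> TM (fst z)" if "B \<in> TN z" for B
    using incl_tangent[OF Lp proj_tangent[OF c z that]] .
  have k: "K z B \<in> normal_space L M g (fst z)" if "B \<in> TN z" for B
    using K_linear[OF c z] that by (auto simp: linear_between_def)
  have o: "g (fst z) (K z B) (incl (fst z) (proj z D)) = 0" if "B \<in> TN z" "D \<in> TN z" for B D
    using k[OF that(1)] proj_tangent[OF c z that(2)] by (auto simp: normal_space_def tan_space_def)
  note kt = normal_tangent[OF Lp k]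
  have "g (fst z) (mu z A) (mu z C) = g (fst z) (incl (fst z) (proj z A)) (incl (fst z) (proj z C)) + g (fst z) (K z A) (K z C)"
    unfolding mu_def
    using I.M.g_add_left[OF Mp I.B.tangent_add[OF i[OF C] kt[OF C]] i[OF A] kt[OF A]]
      I.M.g_add_right[OF Mp i[OF A] i[OF C] kt[OF C]] I.M.g_add_right[OF Mp kt[OF A] i[OF C] kt[OF C]]
      o[OF A C] o[OF C A] I.M.g_sym[OF Mp i[OF A] kt[OF C]] by simp
  then show ?thesis using omega_pos by (cases z) (simp add: pq_metric_def)
qed

end

lemma Q_sec_fst:
  assumes U: "open_in L U" and \<sigma>: "I.sec U \<sigma>" and V: "V \<subseteq> points NB \<inter> fst -` U"
  shows "Q.sec V (\<lambda>z. \<sigma> (fst z))"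
  unfolding section_along_def
proof (intro conjI ballI)
  show "\<sigma> (fst z) \<in> TM (fst z)" if "z \<in> V" for z using I.sec_tangent[OF \<sigma>] V that by auto
  show "smooth_fn NB (V \<inter> fst -` cdom d) (\<lambda>z. \<sigma> (fst z) d)" if d: "d \<in> M" for d
    by (rule P.A.smooth_fn_subset[OF P.smooth_fn_comp[OF I.open_chart[OF U d] I.sec_component[OF \<sigma> d]]]) (use V in auto)
qed

lemma smooth_christoffel_fst:
  assumes c: "c \<in> L" and V: "V \<subseteq> cdom (nchart c)"
  shows "smooth_fn NB V (\<lambda>z. christoffel c (fst z) a b)"
  by (rule P.A.smooth_fn_subset[OF P.smooth_fn_comp[OF I.A.open_in_cdom[OF c] smooth_christoffel[OF c]]])
    (use V z_points(1,3)[OF c] in blast)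

context
  fixes c V X
  assumes c: "c \<in> L" and V: "open_in NB V" "V \<subseteq> cdom (nchart c)" and X: "vector_field_on NB V X"
begin

lemma field_components:
  "smooth_fn NB V (\<lambda>z. X z (nchart c))" "smooth_fn NB V (\<lambda>z. fst (X z (nchart c)))"
  "smooth_fn NB V (\<lambda>z. snd (X z (nchart c)))" "smooth_fn NB V (fibre_coord c)"
proof -
  show 1: "smooth_fn NB V (\<lambda>z. X z (nchart c))"
    using P.A.vector_field_component[OF X V(1) nchart_NB[OF c]] V(2) by (simp add: inf.absorb1)
  show "smooth_fn NB V (\<lambda>z. fst (X z (nchart c)))" by (rule P.A.smooth_fn_bounded_linear[OF V(1) bounded_linear_fst 1])
  show "smooth_fn NB V (\<lambda>z. snd (X z (nchart c)))" by (rule P.A.smooth_fn_bounded_linear[OF V(1) bounded_linear_snd 1])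
  show "smooth_fn NB V (fibre_coord c)" by (rule P.A.smooth_fn_subset[OF smooth_fibre_coord[OF c] V(2)])
qed

lemma V_chart: "y \<in> V \<Longrightarrow> fst y \<in> cdom c"
  using z_points(3)[OF c] V by blast

lemmas christoffel_linear_V = linear_christoffel_left[OF c V_chart] linear_christoffel_right[OF c V_chart]

lemma smooth_christoffel_field: "smooth_fn NB V (\<lambda>z. christoffel c (fst z) (fst (X z (nchart c))) (fibre_coord c z))"
  by (rule P.A.smooth_fn_bilinear_family[where F = "\<lambda>z. christoffel c (fst z)", OF V(1) christoffel_linear_V
        smooth_christoffel_fst[OF c V(2)] field_components(2,4)])

lemma smooth_kappa: "smooth_fn NB V (\<lambda>z. kappa c z (X z))"
  unfolding kappa_def by (rule P.A.smooth_fn_add[OF V(1) field_components(3) smooth_christoffel_field])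

lemma sec_frames_V:
  "Q.sec V (\<lambda>z. tangent_frame c (fst z) w)" "Q.sec V (\<lambda>z. normal_frame c (fst z) w)"
  by (rule Q_sec_fst[OF I.A.open_in_cdom[OF c] sec_tangent_frame[OF c]] Q_sec_fst[OF I.A.open_in_cdom[OF c] sec_normal_frame[OF c]],
      use z_points(1)[OF c] V_chart V(2) in blast)+

lemmas linear_frames_V = linear_tangent_frame[OF c V_chart] linear_normal_frame[OF c V_chart]

lemma sec_mu_parts:
  "Q.sec V (\<lambda>z. tangent_frame c (fst z) (fst (X z (nchart c))))"
  "Q.sec V (\<lambda>z. normal_frame c (fst z) (kappa c z (X z)))"
proof -
  show "Q.sec V (\<lambda>z. tangent_frame c (fst z) (fst (X z (nchart c))))"
    by (rule Q.sec_linear_family[where \<Phi> = "\<lambda>z. tangent_frame c (fst z)", OF V(1) linear_frames_V(1) sec_frames_V(1) field_components(2)])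
  show "Q.sec V (\<lambda>z. normal_frame c (fst z) (kappa c z (X z)))"
    by (rule Q.sec_linear_family[where \<Phi> = "\<lambda>z. normal_frame c (fst z)", OF V(1) linear_frames_V(2) sec_frames_V(2) smooth_kappa])
qed

lemma mu_eq_V:
  "z \<in> V \<Longrightarrow> mu z (X z) =
    tangent_frame c (fst z) (fst (X z (nchart c))) + normal_frame c (fst z) (kappa c z (X z))"
  using mu_chart[OF c _ P.A.vector_field_tangent[OF X]] V(2) by blast

lemma sec_mu_V: "Q.sec V (\<lambda>z. mu z (X z))"
  by (rule Q.sec_cong[OF V(1) Q.sec_add[OF V(1) sec_mu_parts]]) (rule mu_eq_V[symmetric])

text \<open>Both frames are differentiated on the base, with the same symbols. The Christoffel term
  inside \<open>kappa\<close> depends on the base point, on the horizontal component of the field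
  and on the fibre coordinate; each dependence contributes one of the three extra terms of the
  normal part.\<close>

lemma pull_conn_mu:
  assumes z: "z \<in> V" and v: "v \<in> TN z"
  defines "D \<equiv> dir_deriv NB (\<lambda>y. X y (nchart c)) z v"
    and "w \<equiv> fibre_coord c z" and "x \<equiv> fst z"
    and "a \<equiv> fst (X z (nchart c))" and "b \<equiv> snd (X z (nchart c))"
    and "v1 \<equiv> fst (v (nchart c))" and "v2 \<equiv> snd (v (nchart c))"
  shows "Q.pc z v (\<lambda>y. mu y (X y)) = tangent_frame c x (fst D + christoffel c x v1 a) +
    normal_frame c x (snd D + dir_deriv L (\<lambda>y. christoffel c y a w) x (coord_field L c v1 x)
      + christoffel c x (fst D) w + christoffel c x a v2
      + christoffel c x v1 (b + christoffel c x a w))"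
proof -
  have zc: "z \<in> cdom (nchart c)" using z V by auto
  note zp = z_points[OF c zc]
  have near: "P.A.smooth_near z (\<lambda>y. X y (nchart c))" by (rule P.A.smooth_nearI[OF V(1) z field_components(1)])
  have Df: "dir_deriv NB (\<lambda>y. fst (X y (nchart c))) z v = fst D" "dir_deriv NB (\<lambda>y. snd (X y (nchart c))) z v = snd D"
    using P.A.dir_deriv_bounded_linear[OF near v bounded_linear_fst] P.A.dir_deriv_bounded_linear[OF near v bounded_linear_snd]
    by (simp_all add: D_def)
  have pv: "proj z v = coord_field L c v1 x"
    using I.A.coord_field_component[OF c zp(3) proj_tangent[OF c zc v]] proj_chart[OF c zc v] by (simp add: v1_def x_def)
  have "I.A.smooth_near x (\<lambda>y. christoffel c y a w)"
    unfolding x_def by (rule I.A.smooth_nearI[OF I.A.open_in_cdom[OF c] zp(3) smooth_christoffel[OF c]])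
  \<comment> \<open>With both arguments frozen the symbol depends on the base point only, so it is
    differentiated along the projection of \<open>v\<close>.\<close>
  then have Dc: "dir_deriv NB (\<lambda>y. christoffel c (fst y) a w) z v = dir_deriv L (\<lambda>y. christoffel c y a w) x (coord_field L c v1 x)"
    using P.dir_deriv_comp[OF zp(1) _ v] pv by (simp add: x_def proj_push)
  have "dir_deriv NB (\<lambda>y. christoffel c (fst y) (fst (X y (nchart c))) (fibre_coord c y)) z v =
      dir_deriv NB (\<lambda>y. christoffel c (fst y) a w) z v + christoffel c x (fst D) w + christoffel c x a v2"
    using P.A.dir_deriv_bilinear_family[where F = "\<lambda>z. christoffel c (fst z)", OF V(1) z christoffel_linear_V
        smooth_christoffel_fst[OF c V(2)] field_components(2,4) v]
    by (simp add: Df dir_deriv_fibre_coord[OF c zc v] v2_def a_def w_def x_def)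
  then have Dk: "dir_deriv NB (\<lambda>y. kappa c y (X y)) z v = snd D +
      dir_deriv L (\<lambda>y. christoffel c y a w) x (coord_field L c v1 x) + christoffel c x (fst D) w + christoffel c x a v2"
    unfolding kappa_def
    using P.A.dir_deriv_add[OF P.A.smooth_nearI[OF V(1) z field_components(3)] P.A.smooth_nearI[OF V(1) z smooth_christoffel_field] v]
    by (simp add: Df Dc add.assoc)
  have "Q.pc z v (\<lambda>y. mu y (X y)) = Q.pc z v (\<lambda>y. tangent_frame c (fst y) (fst (X y (nchart c))) + normal_frame c (fst y) (kappa c y (X y)))"
    by (rule Q.pull_conn_cong[OF V(1) z mu_eq_V])
  also have "\<dots> = Q.pc z v (\<lambda>y. tangent_frame c (fst y) (fst (X y (nchart c)))) + Q.pc z v (\<lambda>y. normal_frame c (fst y) (kappa c y (X y)))"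
    by (rule Q.pull_conn_add[OF V(1) z sec_mu_parts v])
  also have "Q.pc z v (\<lambda>y. tangent_frame c (fst y) (fst (X y (nchart c)))) =
      tangent_frame c x (fst D) + Q.pc z v (\<lambda>y. tangent_frame c (fst y) a)"
    using Q.pull_conn_linear_family[where \<Phi> = "\<lambda>z. tangent_frame c (fst z)", OF V(1) z linear_frames_V(1) sec_frames_V(1) field_components(2) v]
    by (simp add: Df x_def a_def)
  also have "Q.pc z v (\<lambda>y. tangent_frame c (fst y) a) = tangent_frame c x (christoffel c x v1 a)"
    unfolding pull_conn_fst[OF I.A.open_in_cdom[OF c] zp(3,1) sec_tangent_frame[OF c] v]
      pull_conn_tangent_frame[OF c zp(3) proj_tangent[OF c zc v]] proj_chart[OF c zc v] by (simp add: x_def v1_def)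
  also have "Q.pc z v (\<lambda>y. normal_frame c (fst y) (kappa c y (X y))) =
      normal_frame c x (dir_deriv NB (\<lambda>y. kappa c y (X y)) z v) + Q.pc z v (\<lambda>y. normal_frame c (fst y) (kappa c z (X z)))"
    using Q.pull_conn_linear_family[where \<Phi> = "\<lambda>z. normal_frame c (fst z)", OF V(1) z linear_frames_V(2) sec_frames_V(2) smooth_kappa v]
    by (simp add: x_def)
  also have "Q.pc z v (\<lambda>y. normal_frame c (fst y) (kappa c z (X z))) = normal_frame c x (christoffel c x v1 (kappa c z (X z)))"
    unfolding pull_conn_fst[OF I.A.open_in_cdom[OF c] zp(3,1) sec_normal_frame[OF c] v]
      pull_conn_normal_frame[OF c zp(3) proj_tangent[OF c zc v]] proj_chart[OF c zc v] by (simp add: x_def v1_def)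
  finally show ?thesis
    unfolding Dk linear_add[OF linear_tangent_frame[OF c zp(3)], folded x_def] linear_add[OF linear_normal_frame[OF c zp(3)], folded x_def]
    by (simp only: kappa_def a_def b_def w_def x_def add.assoc)
qed

end

lemma sec_mu:
  assumes U: "open_in NB U" and X: "vector_field_on NB U X"
  shows "Q.sec U (\<lambda>z. mu z (X z))"
proof (rule Q.sec_localI)
  fix z assume z: "z \<in> U"
  then have "z \<in> points NB" using P.A.open_in_points[OF U] by auto
  then obtain c where c: "c \<in> L" "z \<in> cdom (nchart c)" by (rule NB_chartE)
  let ?V = "U \<inter> cdom (nchart c)"
  have V: "open_in NB ?V" "?V \<subseteq> cdom (nchart c)" using U open_nchart[OF c(1)] by (auto intro: P.A.open_in_Int)
  have "Q.sec ?V (\<lambda>z. mu z (X z))"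
    by (rule sec_mu_V[OF c(1) V P.A.vector_field_subset[OF X]]) auto
  then show "\<exists>V. open_in NB V \<and> z \<in> V \<and> Q.sec V (\<lambda>z. mu z (X z))" using V z c by blast
qed

text \<open>Comparing coefficients in the two frames, the defect of the tangential part vanishes by
  symmetry of the symbols and that of the normal part is the curvature applied to the fibre
  coordinate.\<close>

lemma mu_torsion:
  assumes flat: "flat_normal_conn L M g nab"
    and U: "open_in NB U" and X: "vector_field_on NB U X" and Y: "vector_field_on NB U Y" and z: "z \<in> U"
  shows "mu z (lie_bracket NB X Y z) = Q.pc z (X z) (\<lambda>y. mu y (Y y)) - Q.pc z (Y z) (\<lambda>y. mu y (X y))"
proof -
  have "z \<in> points NB" using P.A.open_in_points[OF U] z by auto
  then obtain c where c: "c \<in> L" "z \<in> cdom (nchart c)" by (rule NB_chartE)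
  note x = z_points(3)[OF c]
  let ?V = "U \<inter> cdom (nchart c)" and ?e = "nchart c"
  have V: "open_in NB ?V" "?V \<subseteq> cdom ?e" and zV: "z \<in> ?V"
    using U open_nchart[OF c(1)] z c by (auto intro: P.A.open_in_Int)
  have XV: "vector_field_on NB ?V X" and YV: "vector_field_on NB ?V Y"
    using P.A.vector_field_subset[OF X, of ?V] P.A.vector_field_subset[OF Y, of ?V] by auto
  note Xt = P.A.vector_field_tangent[OF X z] and Yt = P.A.vector_field_tangent[OF Y z]
  have lbt: "lie_bracket NB X Y z \<in> TN z" by (rule P.A.lie_bracket_tangent[OF U X Y z])
  have lb: "lie_bracket NB X Y z ?e = dir_deriv NB (\<lambda>y. Y y ?e) z (X z) - dir_deriv NB (\<lambda>y. X y ?e) z (Y z)"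
    using c nchart_NB[OF c(1)] by (simp add: lie_bracket_def)
  let ?a = "fst (X z ?e)" and ?b = "fst (Y z ?e)" and ?w = "fibre_coord c z" and ?x = "fst z"
  have R: "curvature c ?x ?a ?b ?w = 0" using flat x c(1) by (simp add: flat_iff_curvature)
  note sym = christoffel_symmetric[OF c(1) x]
  note lr = linear_add[OF linear_christoffel_right[OF c(1) x]] and ll = linear_diff[OF linear_christoffel_left[OF c(1) x]]
  let ?DY = "dir_deriv NB (\<lambda>y. Y y ?e) z (X z)" and ?DX = "dir_deriv NB (\<lambda>y. X y ?e) z (Y z)"
    and ?G = "christoffel c ?x" and ?a2 = "snd (X z ?e)" and ?b2 = "snd (Y z ?e)"
    and ?d = "\<lambda>v u. dir_deriv L (\<lambda>y. christoffel c y u ?w) ?x (coord_field L c v ?x)"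
  have gen: "tangent_frame c ?x p + normal_frame c ?x q - (tangent_frame c ?x p' + normal_frame c ?x q') =
      tangent_frame c ?x (p - p') + normal_frame c ?x (q - q')" for p q p' q'
    unfolding linear_diff[OF linear_tangent_frame[OF c(1) x]] linear_diff[OF linear_normal_frame[OF c(1) x]]
    by (simp add: algebra_simps)
  have 1: "fst ?DY + ?G ?a ?b - (fst ?DX + ?G ?b ?a) = fst (?DY - ?DX)"
    using sym[of ?a ?b] by simp
  \<comment> \<open>The terms that apply a symbol to \<open>?a2\<close> or \<open>?b2\<close> cancel
    in pairs. Besides the bracket only the curvature remains, which is zero by
    \<open>R\<close>.\<close>
  have 2: "snd ?DY + ?d ?a ?b + ?G (fst ?DY) ?w + ?G ?b ?a2 + ?G ?a (?b2 + ?G ?b ?w) -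
      (snd ?DX + ?d ?b ?a + ?G (fst ?DX) ?w + ?G ?a ?b2 + ?G ?b (?a2 + ?G ?a ?w)) =
      snd (?DY - ?DX) + ?G (fst (?DY - ?DX)) ?w"
    using R by (simp add: curvature_def lr ll algebra_simps)
  show ?thesis
    unfolding pull_conn_mu[OF c(1) V YV zV Xt] pull_conn_mu[OF c(1) V XV zV Yt] mu_chart[OF c lbt] kappa_def lb
      gen 1 2 ..
qed

theorem kaehlerian_0_0:
  assumes flat: "flat_normal_conn L M g nab"
  shows "kaehlerian NB (J_tilde L M J g K 0 0) (pq_metric L M g K 0 0)"
proof (rule Q.kaehlerian_transport[where \<mu> = mu])
  fix z assume z: "z \<in> points NB"
  then obtain c where c: "c \<in> L" "z \<in> cdom (nchart c)" by (rule NB_chartE)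
  show "linear_between (TN z) (TM (fst z)) (mu z)" by (rule mu_linear[OF c])
  show "bij_betw (mu z) (TN z) (TM (fst z))" by (rule mu_bij[OF c])
  fix A assume A: "A \<in> TN z"
  show "J_tilde L M J g K 0 0 z A \<in> TN z" "mu z (J_tilde L M J g K 0 0 z A) = J (fst z) (mu z A)"
    by (rule J_tilde_0[OF c A])+
  show "pq_metric L M g K 0 0 z A C = g (fst z) (mu z A) (mu z C)" if "C \<in> TN z" for C
    by (rule pq_metric_0[OF c A that])
qed (rule sec_mu mu_torsion[OF flat]; assumption)+

end

section \<open>The necessary conditions\<close>

context kaehler_manifold
begin

lemma J_skew:
  assumes "x \<in> points M" "u \<in> tangent_space M x" "v \<in> tangent_space M x"
  shows "g x (J x u) v = - g x (J x v) u"
proof -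
  note t = J_tangent[OF assms(1)]
  have "g x (J x u) v = g x (J x (J x u)) (J x v)" using hermitian[OF assms(1) t[OF assms(2)] assms(3)] by simp
  then show ?thesis
    using J_J[OF assms(1,2)] g_minus_left[OF assms(1) t[OF assms(3)] assms(2)] g_sym[OF assms(1,2) t[OF assms(3)]] by simp
qed

lemma nab_J: "open_in M U \<Longrightarrow> x \<in> U \<Longrightarrow> vector_field_on M U Y \<Longrightarrow> v \<in> tangent_space M x \<Longrightarrow>
    nab x v (\<lambda>y. J y (Y y)) = J x (nab x v Y)"
  using parallel unfolding parallel_def by blast

text \<open>Coordinate fields commute, so the exterior derivative of the fundamental form is this
  cyclic sum. As \<open>J\<close> is parallel, each derivative splits into two terms, and the six
  cancel by skew-symmetry of the form and the absence of torsion.\<close>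

lemma fundamental_form_closed:
  assumes d: "d \<in> M" "x \<in> cdom d"
  defines "W \<equiv> \<lambda>u v y. g y (J y (coord_field M d u y)) (coord_field M d v y)"
  shows "dir_deriv M (W v w) x (coord_field M d u x) + dir_deriv M (W w u) x (coord_field M d v x) +
    dir_deriv M (W u v) x (coord_field M d w x) = 0"
proof -
  note o = open_in_cdom[OF d(1)] d(2) and cf = vector_field_coord_field[OF d(1)]
    and t = coord_field_tangent[OF d] and xp = cdom_points[OF d]
  note Jf = J_vector_field[OF o(1) cf]
  let ?n = "\<lambda>u v. nab x (coord_field M d u x) (coord_field M d v)"
  have nt: "?n u v \<in> tangent_space M x" for u v by (rule nab_tangent[OF o t cf])
  have D: "dir_deriv M (W v w) x (coord_field M d u x) =
      g x (J x (?n u v)) (coord_field M d w x) + g x (J x (coord_field M d v x)) (?n u w)" for u v w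
    unfolding W_def using levi_civita_metric[OF levi_civita o Jf cf t, of v w u] nab_J[OF o cf t, of u v] by simp
  show ?thesis
    unfolding D
    using J_skew[OF xp nt t, of u v w] J_skew[OF xp nt t, of v w u] J_skew[OF xp nt t, of w u v]
      nab_coord_symmetric[OF d, of u v] nab_coord_symmetric[OF d, of v w] nab_coord_symmetric[OF d, of w u] by simp
qed

text \<open>The Nijenhuis tensor vanishes: without torsion the brackets are differences of covariant
  derivatives, and parallelism moves \<open>J\<close> out of them, after which the terms
  cancel.\<close>

lemma nijenhuis_zero:
  assumes U: "open_in M U" "x \<in> U" and X: "vector_field_on M U X" and Y: "vector_field_on M U Y"
  shows "lie_bracket M (\<lambda>y. J y (X y)) (\<lambda>y. J y (Y y)) x =
    J x (lie_bracket M (\<lambda>y. J y (X y)) Y x + lie_bracket M X (\<lambda>y. J y (Y y)) x) + lie_bracket M X Y x"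
proof -
  have xp: "x \<in> points M" using U open_in_points by auto
  note JX = J_vector_field[OF U(1) X] and JY = J_vector_field[OF U(1) Y]
  note L = levi_civita_torsion[OF levi_civita U, symmetric]
  note Xt = vector_field_tangent[OF X U(2)] and Yt = vector_field_tangent[OF Y U(2)]
  note JXt = vector_field_tangent[OF JX U(2)] and JYt = vector_field_tangent[OF JY U(2)]
  note nt = nab_tangent[OF U]
  note jt = J_tangent[OF xp]
  note nJ = nab_J[OF U]
  have "J x (nab x (J x (X x)) Y - J x (nab x (Y x) X) + (J x (nab x (X x) Y) - nab x (J x (Y x)) X)) =
    J x (nab x (J x (X x)) Y) + nab x (Y x) X - nab x (X x) Y - J x (nab x (J x (Y x)) X)"
  proof -
    let ?a = "nab x (J x (X x)) Y" and ?b = "nab x (Y x) X" and ?c = "nab x (X x) Y" and ?d = "nab x (J x (Y x)) X"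
    have t: "?a \<in> tangent_space M x" "?b \<in> tangent_space M x" "?c \<in> tangent_space M x" "?d \<in> tangent_space M x"
      using nt[OF JXt Y] nt[OF Yt X] nt[OF Xt Y] nt[OF JYt X] by auto
    have jd: "J x (p - r) = J x p - J x r" if "p \<in> tangent_space M x" "r \<in> tangent_space M x" for p r
      using J_add[OF xp that(1) tangent_uminus[OF that(2)]] J_minus[OF xp that(2)] by simp
    show ?thesis
      using t jt by (simp add: J_add[OF xp] jd tangent_diff J_J[OF xp])
  qed
  then show ?thesis
    unfolding L[OF JX JY] L[OF JX Y] L[OF X JY] L[OF X Y] nJ[OF Y JXt] nJ[OF X JYt] nJ[OF X Yt] nJ[OF Y Xt]
    by simp
qed

end

text \<open>Clearing denominators and isolating the square root before squaring leaves a polynomial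
  identity in \<open>t\<close>, of which finitely many instances suffice.\<close>

lemma exponent_equation:
  fixes p q :: real
  assumes q: "q \<ge> 0" and eq: "\<And>t. t > 0 \<Longrightarrow> p / (1 + t) = - (q / (1 + sqrt (1 + q * t)))"
  shows "p = 0 \<and> q = 0"
proof -
  have *: "p\<^sup>2 * (1 + q * t) = (q + p + q * t)\<^sup>2" if t: "t > 0" for t
  proof -
    have S: "sqrt (1 + q * t) \<ge> 0" "(sqrt (1 + q * t))\<^sup>2 = 1 + q * t"
      using q t by auto
    have "p * (1 + sqrt (1 + q * t)) = - (q * (1 + t))"
      using eq[OF t] t S(1) by (simp add: field_simps)
    then have "p * sqrt (1 + q * t) = - (q + p + q * t)" by (simp add: algebra_simps)
    then have "(p * sqrt (1 + q * t))\<^sup>2 = (q + p + q * t)\<^sup>2" by (simp only: power2_minus)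
    then show ?thesis by (simp add: power_mult_distrib S(2))
  qed
  \<comment> \<open>The left side is affine in \<open>t\<close> and the right side is quadratic with
    leading coefficient \<open>q\<^sup>2\<close>; the second difference over 1, 2, 3 isolates that
    coefficient.\<close>
  have "p\<^sup>2 * (1 + q * 1) = (q + p + q * 1)\<^sup>2" "p\<^sup>2 * (1 + q * 2) = (q + p + q * 2)\<^sup>2"
    "p\<^sup>2 * (1 + q * 3) = (q + p + q * 3)\<^sup>2" by (rule *; simp)+
  then have "q\<^sup>2 = 0" by algebra
  then have "q = 0" by simp
  then show ?thesis using eq[of 1] by simp
qed

text \<open>The radial case: the fibre point is a vector of squared length \<open>t\<close> scaled
  by \<open>1 + s\<close>, and \<open>G\<close> is the squared length of an orthogonal vector. Only
  the weight varies with \<open>s\<close>.\<close>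

lemma profile_derivative:
  fixes t p :: real
  assumes "t > 0"
  shows "((\<lambda>s. - ((1 / (1 + (1 + s)\<^sup>2 * t)) powr (p / 2) * G)) has_real_derivative
    (1 / (1 + t)) powr (p / 2) * (p * t / (1 + t)) * G) (at 0)"
proof -
  have 1: "1 + t \<noteq> 0" using assms by simp
  have "((\<lambda>s. 1 / (1 + (1 + s)\<^sup>2 * t)) has_real_derivative - (2 * t / (1 + t)\<^sup>2)) (at 0)"
    using 1 by (auto intro!: derivative_eq_intros simp: power2_eq_square)
  moreover have "1 / (1 + (1 + 0)\<^sup>2 * t) > 0" using assms by simp
  ultimately have "((\<lambda>s. (1 / (1 + (1 + s)\<^sup>2 * t)) powr (p / 2)) has_real_derivative
      p / 2 * (1 / (1 + (1 + 0)\<^sup>2 * t)) powr (p / 2 - 1) * - (2 * t / (1 + t)\<^sup>2)) (at 0)"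
    using DERIV_fun_powr[of "\<lambda>s. 1 / (1 + (1 + s)\<^sup>2 * t)" "- (2 * t / (1 + t)\<^sup>2)" 0 "p / 2"] by simp
  moreover have "p / 2 * (1 / (1 + (1 + 0)\<^sup>2 * t)) powr (p / 2 - 1) * - (2 * t / (1 + t)\<^sup>2) =
      - ((1 / (1 + t)) powr (p / 2) * (p * t / (1 + t)))"
  proof -
    have *: "(1 / (1 + t)) powr (p / 2 - 1) = (1 / (1 + t)) powr (p / 2) * (1 + t)"
      using assms by (simp add: powr_diff)
    have "p / 2 * (F * u) * - (2 * t / u\<^sup>2) = - (F * (p * t / u))" if "u \<noteq> 0" for F u :: real
      using that by (simp add: power2_eq_square)
    from this[OF 1] show ?thesis by (simp add: *)
  qed
  ultimately have "((\<lambda>s. (1 / (1 + (1 + s)\<^sup>2 * t)) powr (p / 2)) has_real_derivative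
      - ((1 / (1 + t)) powr (p / 2) * (p * t / (1 + t)))) (at 0)" by simp
  from DERIV_minus[OF DERIV_cmult_right[OF this, of G]] show ?thesis by simp
qed

text \<open>The fibre point moves orthogonally, with squared length
  \<open>t + s\<^sup>2 * a\<close>. The expression is \<open>s\<close> times a continuous function,
  so its derivative at 0 is the value of that function, without differentiating the weight or the
  root.\<close>

lemma transverse_derivative:
  fixes t p q a :: real
  assumes t: "t > 0" and q: "q \<ge> 0"
  shows "((\<lambda>s. - ((1 / (1 + (t + s\<^sup>2 * a))) powr (p / 2) *
      (q / (1 + sqrt (1 + q * (t + s\<^sup>2 * a))) * t * (s * a)))) has_real_derivative
    - ((1 / (1 + t)) powr (p / 2) * (q / (1 + sqrt (1 + q * t)) * t * a))) (at 0)"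
proof -
  define \<phi> where "\<phi> s = - ((1 / (1 + (t + s\<^sup>2 * a))) powr (p / 2) * (q / (1 + sqrt (1 + q * (t + s\<^sup>2 * a))) * t * a))" for s
  have "1 + q * t > 0" using assms by (smt (verit) mult_nonneg_nonneg)
  then have "isCont \<phi> 0"
    unfolding \<phi>_def using t
    by (intro continuous_intros) (auto, smt (verit) real_sqrt_ge_zero)
  then have "((\<lambda>s. \<phi> s *\<^sub>R s) has_derivative (\<lambda>h. \<phi> 0 *\<^sub>R h)) (at 0)"
    by (rule continuous_vanishing_product_has_derivative) auto
  then have "((\<lambda>s. \<phi> s * s) has_real_derivative \<phi> 0) (at 0)"
    by (simp add: has_field_derivative_def)
  then show ?thesis by (simp add: \<phi>_def mult.assoc mult.left_commute mult.commute)
qed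

section \<open>Necessity of p = q = 0 and of flatness\<close>

context normal_bundle_connection
begin

definition gram :: "('a, 'e) chart \<Rightarrow> 'a \<Rightarrow> 'e \<Rightarrow> 'e \<Rightarrow> real" where
  "gram c x v w = g x (tangent_frame c x v) (tangent_frame c x w)"

context
  fixes c x assumes c: "c \<in> L" "x \<in> cdom c"
begin

lemma gram_sym: "gram c x v w = gram c x w v"
  unfolding gram_def
  by (rule I.M.g_sym[OF points_M[OF I.A.cdom_points[OF c]] tangent_frame_tangent[OF c] tangent_frame_tangent[OF c]])

lemma gram_add_left: "gram c x (u + v) w = gram c x u w + gram c x v w"
  unfolding gram_def linear_add[OF linear_tangent_frame[OF c]]
  by (rule I.M.g_add_left[OF points_M[OF I.A.cdom_points[OF c]] tangent_frame_tangent[OF c] tangent_frame_tangent[OF c] tangent_frame_tangent[OF c]])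

lemma gram_scaleR_left: "gram c x (r *\<^sub>R v) w = r * gram c x v w"
  unfolding gram_def linear_scale[OF linear_tangent_frame[OF c]]
  by (rule I.M.g_scaleR_left[OF points_M[OF I.A.cdom_points[OF c]] tangent_frame_tangent[OF c] tangent_frame_tangent[OF c]])

lemma gram_add_right: "gram c x w (u + v) = gram c x w u + gram c x w v"
  using gram_add_left[of u v w] gram_sym by simp

lemma gram_scaleR_right: "gram c x w (r *\<^sub>R v) = r * gram c x w v"
  using gram_scaleR_left[of r v w] gram_sym by simp

lemma gram_pos: "v \<noteq> 0 \<Longrightarrow> gram c x v v > 0"
  unfolding gram_def
  using I.M.g_pos[OF points_M[OF I.A.cdom_points[OF c]] tangent_frame_tangent[OF c]]
    linear_injective_0[OF linear_tangent_frame[OF c]] inj_tangent_frame[OF c] by blast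

lemma gram_minus_left: "gram c x (- v) w = - gram c x v w"
  using gram_scaleR_left[of "-1" v w] by simp

end

context
  fixes c z assumes c: "c \<in> L" and z: "z \<in> cdom (nchart c)"
begin

lemma omega_gram: "omega g z = 1 / (1 + gram c (fst z) (fibre_coord c z) (fibre_coord c z))"
proof -
  have "g (fst z) (snd z) (snd z) = gram c (fst z) (fibre_coord c z) (fibre_coord c z)"
    using normal_frame_fibre_coord[OF c z] g_frames[OF c z_points(3)[OF c z]] by (metis gram_def)
  then show ?thesis by (cases z) (simp add: omega_def)
qed

text \<open>The image of a vertical vector is horizontal: the pair on the right is the horizontal
  lift of minus \<open>r *\<^sub>R (b + s *\<^sub>R w)\<close>, where \<open>s\<close> collects the
  correction due to \<open>q\<close>.\<close>

lemma J_tilde_vertical: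
  fixes p q :: real and b :: 'e
  defines "w \<equiv> fibre_coord c z" and "x \<equiv> fst z"
  defines "r \<equiv> omega g z powr (p / 2)" and "s \<equiv> q / (1 + sqrt (1 + q * gram c x w w)) * gram c x b w"
  shows "J_tilde L M J g K p q z (coord_field NB (nchart c) (0, b) z) =
    coord_field NB (nchart c) (- (r *\<^sub>R (b + s *\<^sub>R w)), christoffel c x (r *\<^sub>R (b + s *\<^sub>R w)) w) z"
proof -
  note zp = z_points[OF c z]
  have xw: "normal_frame c x w = snd z" using normal_frame_fibre_coord[OF c z] by (simp add: x_def w_def)

  note l = linear_christoffel_left[OF c zp(3)]
  note lN = P.A.linear_coord_field[OF nchart_NB[OF c] z]
  have g1: "g x (snd z) (snd z) = gram c x w w" "g x (normal_frame c x b) (snd z) = gram c x b w"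
    using g_frames[OF c zp(3)] by (simp_all add: gram_def xw[symmetric] x_def)
  have hl: "hor_lift L M g K z (restrict_tan L M x (J x (normal_frame c x v))) =
      coord_field NB (nchart c) (- v, christoffel c x v w) z" for v
    using restrict_J_normal_frame[OF c z, of v] hor_lift_coord[OF c z, of "- v"] linear_neg[OF l, of v w]
    by (simp add: x_def w_def)
  have K0: "K z (coord_field NB (nchart c) (0, b) z) = normal_frame c x b"
    using K_coord[OF c z, of 0 b] linear_0[OF l] by (simp add: x_def)
  have p0: "proj z (coord_field NB (nchart c) (0, b) z) = 0"
    using proj_coord[OF c z, of 0 b] linear_0[OF I.A.linear_coord_field[OF c zp(3)]] by simp
  have v0: "ver_lift L M g K z 0 = 0"
    using ver_lift_coord[OF c z, of 0] linear_0[OF linear_normal_frame[OF c zp(3)]] linear_0[OF lN]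
    by (simp add: zero_prod_def)
  have "J_hor L M J g K p q z 0 = 0"
    using v0 incl_zero[OF zp(2)] I.M.J_zero[OF zp(4)] I.M.g_zero_left[OF zp(4) normal_tangent[OF zp(2)], of "snd z"] z
    by (cases z) (simp add: J_hor_def)
  moreover have "J_ver L M J g K p q z (normal_frame c x b) =
      r *\<^sub>R (coord_field NB (nchart c) (- b, christoffel c x b w) z +
        s *\<^sub>R coord_field NB (nchart c) (- w, christoffel c x w w) z)"
  proof -
    have "J_ver L M J g K p q z (normal_frame c x b) =
      omega g z powr (p / 2) *\<^sub>R
       (hor_lift L M g K z (restrict_tan L M x (J x (normal_frame c x b))) +
        (q / (1 + sqrt (1 + q * g x (snd z) (snd z))) * g x (normal_frame c x b) (snd z)) *\<^sub>R
          hor_lift L M g K z (restrict_tan L M x (J x (snd z))))"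
      unfolding J_ver_def x_def by (simp add: case_prod_unfold)
    then show ?thesis using hl[of b] hl[of w] g1 by (simp add: r_def s_def xw)
  qed
  ultimately have "J_tilde L M J g K p q z (coord_field NB (nchart c) (0, b) z) =
      coord_field NB (nchart c) (r *\<^sub>R ((- b, christoffel c x b w) + s *\<^sub>R (- w, christoffel c x w w))) z"
    unfolding J_tilde_def K0 p0 linear_scale[OF lN] linear_add[OF lN] by simp
  also have "r *\<^sub>R ((- b, christoffel c x b w) + s *\<^sub>R (- w, christoffel c x w w)) =
      (- (r *\<^sub>R (b + s *\<^sub>R w)), christoffel c x (r *\<^sub>R (b + s *\<^sub>R w)) w)"
    using linear_add[OF l] linear_scale[OF l] by (simp add: x_def scaleR_add_right scaleR_diff_right)
  finally show ?thesis .
qed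

text \<open>The first argument is a horizontal lift, so \<open>K\<close> annihilates it and only the
  unweighted base part of the metric is left.\<close>

lemma pq_metric_horizontal:
  assumes A: "A \<in> TN z"
  shows "pq_metric L M g K p q z (coord_field NB (nchart c) (- v, christoffel c (fst z) v (fibre_coord c z)) z) A =
    - gram c (fst z) v (fst (A (nchart c)))"
proof -
  note zp = z_points[OF c z]
  let ?H = "coord_field NB (nchart c) (- v, christoffel c (fst z) v (fibre_coord c z)) z"
  have K: "K z ?H = 0"
    using K_coord[OF c z, of "- v"] linear_neg[OF linear_christoffel_left[OF c zp(3)]] linear_0[OF linear_normal_frame[OF c zp(3)]]
    by simp
  have i: "incl (fst z) (proj z ?H) = tangent_frame c (fst z) (- v)"
    using incl_proj[OF c z coord_NB(1)[OF c z]] coord_NB(2)[OF c z] by simp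
  have th: "snd z \<in> TM (fst z)" using normal_tangent[OF zp(2)] z by simp
  have KA: "K z A \<in> TM (fst z)"
    using K_linear[OF c z] A normal_tangent[OF zp(2)] by (auto simp: linear_between_def)
  have zero: "g (fst z) 0 (K z A) = 0" "g (fst z) 0 (snd z) = 0"
    using I.M.g_zero_left[OF zp(4) KA] I.M.g_zero_left[OF zp(4) th] .
  have "pq_metric L M g K p q z ?H A = g (fst z) (incl (fst z) (proj z ?H)) (incl (fst z) (proj z A))"
    using K zero by (cases z) (simp add: pq_metric_def)
  then show ?thesis
    using incl_proj[OF c z A] gram_minus_left[OF c zp(3), of v] by (simp add: i gram_def)
qed

end

text \<open>One Gram-Schmidt step on two different elements of \<open>Basis\<close>; the first is
  then rescaled to the prescribed squared length.\<close>

lemma gram_orthogonal_pair: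
  assumes c: "c \<in> L" "x \<in> cdom c" and dim: "DIM('e) \<ge> 2" and t: "t > 0"
  obtains e1 e2 where "gram c x e1 e1 = t" "gram c x e1 e2 = 0" "e2 \<noteq> 0"
proof -
  obtain b1 b2 :: 'e where b: "b1 \<in> Basis" "b2 \<in> Basis" "b1 \<noteq> b2"
  proof -
    have "\<not> card (Basis :: 'e set) \<le> Suc 0" using dim by simp
    then show ?thesis using that card_le_Suc0_iff_eq[OF finite_Basis[where 'a = 'e]] by blast
  qed
  define e2 where "e2 = b2 - (gram c x b1 b2 / gram c x b1 b1) *\<^sub>R b1"
  have p: "gram c x b1 b1 > 0" using b by (intro gram_pos[OF c]) auto
  have s: "sqrt (t / gram c x b1 b1) * (sqrt (t / gram c x b1 b1) * gram c x b1 b1) = t"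
    using p t by (simp flip: mult.assoc)
  have "gram c x b1 e2 = 0"
    using gram_add_right[OF c, of b1 b2 "- ((gram c x b1 b2 / gram c x b1 b1) *\<^sub>R b1)"]
      gram_scaleR_right[OF c, of b1 "- (gram c x b1 b2 / gram c x b1 b1)" b1] p
    by (simp add: e2_def)
  moreover have "e2 \<noteq> 0"
  proof
    assume "e2 = 0"
    then have "b2 \<bullet> b2 = ((gram c x b1 b2 / gram c x b1 b1) *\<^sub>R b1) \<bullet> b2" by (simp add: e2_def)
    then show False using b by (simp add: inner_Basis)
  qed
  ultimately show ?thesis
    using that[of "sqrt (t / gram c x b1 b1) *\<^sub>R b1" e2] s
    by (simp add: gram_scaleR_left[OF c] gram_scaleR_right[OF c])
qed

context
  fixes p q :: real
  assumes kaehler: "kaehlerian NB (J_tilde L M J g K p q) (pq_metric L M g K p q)"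
begin

abbreviation "Jt \<equiv> J_tilde L M J g K p q"
abbreviation "h \<equiv> pq_metric L M g K p q"

text \<open>Names the connection whose existence \<open>kaehlerian\<close> asserts, so that the
  identities of \<open>kaehler_manifold\<close> become available on the total space.\<close>

lemma kaehler_NB: obtains nab' where "kaehler_manifold NB nab' h Jt"
  using kaehler P.A.kaehler_manifoldI[OF kaehler] unfolding kaehlerian_def by blast

text \<open>The mixed components of the fundamental form of the total space, on a vertical and a
  base coordinate field.\<close>

definition psi :: "('a, 'e) chart \<Rightarrow> 'e \<Rightarrow> 'e \<Rightarrow> ('a, 'f) nvec \<Rightarrow> real" where
  "psi c b a z = h z (Jt z (coord_field NB (nchart c) (0, b) z)) (coord_field NB (nchart c) (a, 0) z)"

text \<open>The weight with exponent \<open>p / 2\<close> stems from \<open>J_tilde\<close> alone: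
  the image of a vertical vector is horizontal, and there the metric carries no weight.\<close>

lemma psi_eq:
  assumes c: "c \<in> L" and z: "z \<in> cdom (nchart c)"
  shows "psi c b a z = - ((1 / (1 + gram c (fst z) (fibre_coord c z) (fibre_coord c z))) powr (p / 2) *
    (gram c (fst z) b a + q / (1 + sqrt (1 + q * gram c (fst z) (fibre_coord c z) (fibre_coord c z))) *
      gram c (fst z) b (fibre_coord c z) * gram c (fst z) (fibre_coord c z) a))"
  unfolding psi_def J_tilde_vertical[OF c z] pq_metric_horizontal[OF c z coord_NB(1)[OF c z]] omega_gram[OF c z]
  by (simp add: coord_NB(2)[OF c z] gram_add_left[OF c z_points(3)[OF c z]] gram_scaleR_left[OF c z_points(3)[OF c z]])

lemma fundamental_form_vertical:
  assumes c: "c \<in> L" and z: "z \<in> cdom (nchart c)"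
  shows "h z (Jt z (coord_field NB (nchart c) (0, b) z)) (coord_field NB (nchart c) (0, b') z) = 0"
  unfolding J_tilde_vertical[OF c z] pq_metric_horizontal[OF c z coord_NB(1)[OF c z]]
  using gram_scaleR_right[OF c z_points(3)[OF c z], of _ 0 0] by (simp add: coord_NB(2)[OF c z])

lemma smooth_psi:
  assumes c: "c \<in> L"
  shows "smooth_fn NB (cdom (nchart c)) (psi c b a)"
proof -
  obtain nab' where "kaehler_manifold NB nab' h Jt" by (rule kaehler_NB)
  then interpret N: kaehler_manifold NB nab' h Jt .
  note e = nchart_NB[OF c]
  show ?thesis
    unfolding psi_def[abs_def]
    by (rule N.smooth_fn_g[OF P.A.open_in_cdom[OF e] N.J_vector_field[OF P.A.open_in_cdom[OF e] P.A.vector_field_coord_field[OF e]]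
          P.A.vector_field_coord_field[OF e]])
qed

text \<open>The cyclic identity for the fields (0, b'), (0, b), (a, 0). The form vanishes on pairs
  of vertical fields, which removes the derivative in the base direction, and skew-symmetry supplies
  the sign that makes the other two terms an equation.\<close>

lemma psi_symmetric:
  assumes c: "c \<in> L" and z: "z \<in> cdom (nchart c)"
  shows "dir_deriv NB (psi c b a) z (coord_field NB (nchart c) (0, b') z) =
    dir_deriv NB (psi c b' a) z (coord_field NB (nchart c) (0, b) z)"
proof -
  obtain nab' where "kaehler_manifold NB nab' h Jt" by (rule kaehler_NB)
  then interpret N: kaehler_manifold NB nab' h Jt .
  note e = nchart_NB[OF c] and o = open_nchart[OF c] z
  let ?W = "\<lambda>u v y. h y (Jt y (coord_field NB (nchart c) u y)) (coord_field NB (nchart c) v y)"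
  have 1: "dir_deriv NB (?W (0, b') (0, b)) z (coord_field NB (nchart c) (a, 0) z) = 0"
    using P.A.dir_deriv_cong[OF o, of "?W (0, b') (0, b)" "\<lambda>_. 0"] fundamental_form_vertical[OF c] by simp
  have 2: "?W (0, b) (a, 0) = psi c b a" by (simp add: psi_def fun_eq_iff)
  have 3: "dir_deriv NB (?W (a, 0) (0, b')) z v = dir_deriv NB (\<lambda>y. - psi c b' a y) z v" for v
  proof (rule P.A.dir_deriv_cong[OF o])
    fix y assume y: "y \<in> cdom (nchart c)"
    show "?W (a, 0) (0, b') y = - psi c b' a y"
      unfolding psi_def by (rule N.J_skew[OF z_points(1)[OF c y] coord_NB(1)[OF c y] coord_NB(1)[OF c y]])
  qed
  have 4: "dir_deriv NB (\<lambda>y. - psi c b' a y) z v = - dir_deriv NB (psi c b' a) z v" if "v \<in> TN z" for v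
    by (rule P.A.dir_deriv_bounded_linear[OF P.A.smooth_nearI[OF o smooth_psi[OF c]] that bounded_linear_minus[OF bounded_linear_ident]])
  have "dir_deriv NB (?W (0, b) (a, 0)) z (coord_field NB (nchart c) (0, b') z) +
      dir_deriv NB (?W (a, 0) (0, b')) z (coord_field NB (nchart c) (0, b) z) +
      dir_deriv NB (?W (0, b') (0, b)) z (coord_field NB (nchart c) (a, 0) z) = 0"
    by (rule N.fundamental_form_closed[OF e z])
  moreover have "A = B" if "A + - B + 0 = 0" for A B :: real using that by simp
  ultimately show ?thesis unfolding 1 2 3 4[OF coord_NB(1)[OF c z]] by blast
qed

text \<open>Turns a derivative along a vertical coordinate field into that of a function of one real
  variable, on a line inside a single fibre.\<close>

lemma psi_line_derivative:
  fixes v w :: 'e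
  assumes c: "c \<in> L" and x: "x \<in> cdom c"
  defines "z \<equiv> \<lambda>s. (x, normal_frame c x (w + s *\<^sub>R v))"
  shows "((\<lambda>s. psi c b a (z s)) has_real_derivative
    dir_deriv NB (psi c b a) (z 0) (coord_field NB (nchart c) (0, v) (z 0))) (at 0)"
proof -
  have zc: "z s \<in> cdom (nchart c)" for s using x normal_frame_normal[OF c x] by (simp add: z_def)
  have z: "z s = cinv (nchart c) (cmap c x, w + s *\<^sub>R v)" for s
    using cinv_nchart[OF c, of "cmap c x"] x c by (simp add: z_def)
  have cm: "cmap (nchart c) (z 0) = (cmap c x, w + 0 *\<^sub>R v)"
    using fibre_coord_normal_frame[OF c x] by (simp add: cmap_nchart z_def)
  let ?D = "\<lambda>k. dir_deriv NB (psi c b a) (z 0) (coord_field NB (nchart c) k (z 0))"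
  have D: "((\<lambda>k. psi c b a (cinv (nchart c) k)) has_derivative ?D) (at (cmap c x, w + 0 *\<^sub>R v))"
    unfolding cm[symmetric]
    by (rule P.A.smooth_near_has_dir_deriv[OF P.A.smooth_nearI[OF open_nchart[OF c] zc smooth_psi[OF c]] nchart_NB[OF c] zc])
  have "((\<lambda>s. psi c b a (cinv (nchart c) (cmap c x, w + s *\<^sub>R v))) has_derivative (\<lambda>r. ?D (0, r *\<^sub>R v))) (at 0)"
    by (rule has_derivative_compose[where g = "\<lambda>k. psi c b a (cinv (nchart c) k)" and f = "\<lambda>s. (cmap c x, w + s *\<^sub>R v)"
            and f' = "\<lambda>r. (0, r *\<^sub>R v)", OF _ D]) (auto intro!: derivative_eq_intros)
  moreover have "?D (0, r *\<^sub>R v) = ?D (0, v) * r" for r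
    using linear_scale[OF has_derivative_linear[OF D], of r "(0, v)"] by simp
  ultimately show ?thesis by (simp add: has_field_derivative_def z)
qed

text \<open>The symmetry of \<open>psi\<close> is evaluated at the fibre point \<open>e1\<close>
  with directions \<open>e1\<close> and \<open>e2\<close> and base vector \<open>e2\<close>, and
  \<open>t\<close> is arbitrary because \<open>e1\<close> may have any positive length.\<close>

lemma pq_zero:
  assumes q: "q \<ge> 0" and dim: "DIM('e) \<ge> 2" and ne: "points L \<noteq> {}"
  shows "p = 0 \<and> q = 0"
proof (rule exponent_equation[OF q])
  fix t :: real assume t: "t > 0"
  obtain x where "x \<in> points L" using ne by auto
  then obtain c where c: "c \<in> L" "x \<in> cdom c" by (rule I.A.pointsE)
  obtain e1 e2 where e: "gram c x e1 e1 = t" "gram c x e1 e2 = 0" "e2 \<noteq> 0"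
    by (rule gram_orthogonal_pair[OF c dim t])
  have e21: "gram c x e2 e1 = 0" using e(2) gram_sym[OF c] by simp
  let ?a = "gram c x e2 e2" and ?r = "(1 / (1 + t)) powr (p / 2)"
  let ?z = "\<lambda>w. (x, normal_frame c x w)"
  have a: "?a > 0" by (rule gram_pos[OF c e(3)])
  have zc: "?z w \<in> cdom (nchart c)" for w using c normal_frame_normal[OF c] by simp
  note gr = gram_add_left[OF c] gram_add_right[OF c] gram_scaleR_left[OF c] gram_scaleR_right[OF c]
  have P: "psi c b a' (?z w) = - ((1 / (1 + gram c x w w)) powr (p / 2) *
    (gram c x b a' + q / (1 + sqrt (1 + q * gram c x w w)) * gram c x b w * gram c x w a'))" for b a' w
    using psi_eq[OF c(1) zc] fibre_coord_normal_frame[OF c(1,2)] by simp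
  \<comment> \<open>Along the radial line the fibre point stays orthogonal to \<open>e2\<close>, so
    the \<open>q\<close> term is zero and only the weight changes.\<close>
  have "((\<lambda>s. psi c e2 e2 (?z (e1 + s *\<^sub>R e1))) has_real_derivative ?r * (p * t / (1 + t)) * ?a) (at 0)"
  proof -
    have "psi c e2 e2 (?z (e1 + s *\<^sub>R e1)) = - ((1 / (1 + (1 + s)\<^sup>2 * t)) powr (p / 2) * ?a)" for s
      unfolding P by (simp add: gr e e21 power2_eq_square algebra_simps)
    then show ?thesis using profile_derivative[OF t] by simp
  qed
  then have 1: "dir_deriv NB (psi c e2 e2) (?z e1) (coord_field NB (nchart c) (0, e1) (?z e1)) = ?r * (p * t / (1 + t)) * ?a"
    using psi_line_derivative[OF c, of e2 e2 e1 e1] DERIV_unique by fastforce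
  \<comment> \<open>Here the leading term \<open>gram c x e1 e2\<close> is zero and the
    \<open>q\<close> term alone survives; its last factor is \<open>s\<close> times the squared
    length of \<open>e2\<close>.\<close>
  have "((\<lambda>s. psi c e1 e2 (?z (e1 + s *\<^sub>R e2))) has_real_derivative - (?r * (q / (1 + sqrt (1 + q * t)) * t * ?a))) (at 0)"
  proof -
    have "psi c e1 e2 (?z (e1 + s *\<^sub>R e2)) = - ((1 / (1 + (t + s\<^sup>2 * ?a))) powr (p / 2) *
      (q / (1 + sqrt (1 + q * (t + s\<^sup>2 * ?a))) * t * (s * ?a)))" for s
      unfolding P by (simp add: gr e e21 power2_eq_square mult.assoc)
    then show ?thesis using transverse_derivative[OF t q] by simp
  qed
  then have 2: "dir_deriv NB (psi c e1 e2) (?z e1) (coord_field NB (nchart c) (0, e2) (?z e1)) = - (?r * (q / (1 + sqrt (1 + q * t)) * t * ?a))"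
    using psi_line_derivative[OF c, of e1 e2 e1 e2] DERIV_unique by fastforce
  have "?r * (p * t / (1 + t)) * ?a = - (?r * (q / (1 + sqrt (1 + q * t)) * t * ?a))"
    using psi_symmetric[OF c(1) zc, of e2 e2 e1 e1] 1 2 by simp
  moreover have "?r > 0" using t by simp
  ultimately have "(?r * t * ?a) * (p / (1 + t)) = (?r * t * ?a) * (- (q / (1 + sqrt (1 + q * t))))"
    by (simp add: mult.assoc mult.left_commute mult.commute)
  moreover have "?r * t * ?a \<noteq> 0" using \<open>?r > 0\<close> t a by simp
  ultimately show "p / (1 + t) = - (q / (1 + sqrt (1 + q * t)))"
    using mult_left_cancel by blast
qed

end

text \<open>The chart component of \<open>J_tilde\<close> on a vertical coordinate field has this
  form when both exponents are zero. It varies with the base point through the symbols and with the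
  fibre coordinate linearly.\<close>

lemma dir_deriv_horizontal_component:
  assumes c: "c \<in> L" and z: "z \<in> cdom (nchart c)" and v: "v \<in> TN z"
  shows "dir_deriv NB (\<lambda>y. (k :: 'e, christoffel c (fst y) b (fibre_coord c y))) z v =
    (0, dir_deriv L (\<lambda>y. christoffel c y b (fibre_coord c z)) (fst z) (coord_field L c (fst (v (nchart c))) (fst z))
      + christoffel c (fst z) b (snd (v (nchart c))))"
proof -
  note zp = z_points[OF c z] and o = open_nchart[OF c]
  have lin: "linear (\<lambda>a. christoffel c (fst y) a d)" "linear (christoffel c (fst y) d)" if "y \<in> cdom (nchart c)" for y d
    using linear_christoffel_left[OF c] linear_christoffel_right[OF c] z_points(3)[OF c that] by auto
  note sm = smooth_christoffel_fst[OF c order_refl]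
  have fc: "smooth_fn NB (cdom (nchart c)) (\<lambda>y. christoffel c (fst y) b (fibre_coord c y))"
    by (rule P.A.smooth_fn_linear_family[where F = "\<lambda>y. christoffel c (fst y) b", OF o lin(2) sm smooth_fibre_coord[OF c]])
  have D: "dir_deriv NB (\<lambda>y. christoffel c (fst y) b (fibre_coord c y)) z v =
      dir_deriv NB (\<lambda>y. christoffel c (fst y) b (fibre_coord c z)) z v + christoffel c (fst z) b (snd (v (nchart c)))"
    using P.A.dir_deriv_linear_family[where F = "\<lambda>y. christoffel c (fst y) b", OF o z lin(2) sm
        P.A.smooth_nearI[OF o z smooth_fibre_coord[OF c]] v] dir_deriv_fibre_coord[OF c z v] by simp
  have "dir_deriv NB (\<lambda>y. christoffel c (fst y) b (fibre_coord c z)) z v =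
      dir_deriv L (\<lambda>y. christoffel c y b (fibre_coord c z)) (fst z) (proj z v)"
    unfolding proj_push
    by (rule P.dir_deriv_comp[OF zp(1) I.A.smooth_nearI[OF I.A.open_in_cdom[OF c] zp(3) smooth_christoffel[OF c]] v])
  moreover have "proj z v = coord_field L c (fst (v (nchart c))) (fst z)"
    using I.A.coord_field_component[OF c zp(3) proj_tangent[OF c z v]] proj_chart[OF c z v] by simp
  moreover have "dir_deriv NB (\<lambda>y. (k, 0) + (0, christoffel c (fst y) b (fibre_coord c y))) z v =
      0 + (0, dir_deriv NB (\<lambda>y. christoffel c (fst y) b (fibre_coord c y)) z v)"
  proof -
    have bl: "bounded_linear (\<lambda>r::'e. (0 :: 'e, r))"
      by (intro bounded_linear_Pair bounded_linear_ident bounded_linear_zero)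
    have n: "P.A.smooth_near z (\<lambda>y. (k, 0 :: 'e))" "P.A.smooth_near z (\<lambda>y. (0 :: 'e, christoffel c (fst y) b (fibre_coord c y)))"
      using P.A.smooth_nearI[OF o z P.A.smooth_fn_const] P.A.smooth_nearI[OF o z P.A.smooth_fn_bounded_linear[OF o bl fc]] by auto
    show ?thesis
      using P.A.dir_deriv_add[OF n v] P.A.dir_deriv_bounded_linear[OF P.A.smooth_nearI[OF o z fc] v bl] by simp
  qed
  ultimately show ?thesis by (simp add: D)
qed

text \<open>For two vertical coordinate fields the Nijenhuis identity reduces to the vanishing of
  the bracket of their images. These images are horizontal, and the bracket of horizontal fields
  measures the curvature.\<close>

theorem flat_if_kaehlerian_0_0:
  assumes k: "kaehlerian NB (J_tilde L M J g K 0 0) (pq_metric L M g K 0 0)"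
  shows "flat_normal_conn L M g nab"
  unfolding flat_iff_curvature
proof (intro ballI allI)
  fix c x a b w assume c: "c \<in> L" and x: "x \<in> cdom c"
  let ?J = "J_tilde L M J g K 0 0" and ?e = "nchart c"
  obtain nab' where "levi_civita NB (pq_metric L M g K 0 0) nab'" using k by (auto simp: kaehlerian_def)
  then interpret N: kaehler_manifold NB nab' "pq_metric L M g K 0 0" ?J by (rule P.A.kaehler_manifoldI[OF k])
  \<comment> \<open>The point of the fibre over \<open>x\<close> with fibre coordinate
    \<open>w\<close>, the vector to which the curvature is applied.\<close>
  define z where "z = (x, normal_frame c x w)"
  have z: "z \<in> cdom ?e" using x normal_frame_normal[OF c x] by (simp add: z_def)
  have zx: "fst z = x" "fibre_coord c z = w" using fibre_coord_normal_frame[OF c x] by (simp_all add: z_def)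
  note e = nchart_NB[OF c] and o = open_nchart[OF c]
  let ?X = "coord_field NB ?e (0, a)" and ?Y = "coord_field NB ?e (0, b)"
  note cf = P.A.vector_field_coord_field[OF e]
  have J: "?J y (coord_field NB ?e (0, u) y) = coord_field NB ?e (- u, christoffel c (fst y) u (fibre_coord c y)) y"
    if "y \<in> cdom ?e" for y u
    using J_tilde_coord_0[OF c that, of 0 u] linear_0[OF linear_christoffel_left[OF c z_points(3)[OF c that]]] by simp
  have Jc: "?J y (coord_field NB ?e (0, u) y) ?e = (- u, christoffel c (fst y) u (fibre_coord c y))" if "y \<in> cdom ?e" for y u
    unfolding J[OF that] by (rule coord_NB(2)[OF c that])
  have Jt: "?J z (coord_field NB ?e (0, u) z) \<in> TN z" for u
    unfolding J[OF z] by (rule coord_NB(1)[OF c z])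
  let ?JX = "\<lambda>y. ?J y (?X y)" and ?JY = "\<lambda>y. ?J y (?Y y)"
  have DJ: "dir_deriv NB (\<lambda>y. ?J y (coord_field NB ?e (0, u) y) ?e) z v =
      (0, dir_deriv L (\<lambda>y. christoffel c y u w) x (coord_field L c (fst (v ?e)) x) + christoffel c x u (snd (v ?e)))"
    if "v \<in> TN z" for u v
  proof -
    have "dir_deriv NB (\<lambda>y. ?J y (coord_field NB ?e (0, u) y) ?e) z v =
        dir_deriv NB (\<lambda>y. (- u, christoffel c (fst y) u (fibre_coord c y))) z v"
      by (rule P.A.dir_deriv_cong[OF o z]) (rule Jc)
    then show ?thesis using dir_deriv_horizontal_component[OF c z that, of "- u" u] by (simp add: zx)
  qed
  have DC: "dir_deriv NB (\<lambda>y. coord_field NB ?e (0, u) y ?e) z v = 0" for u v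
    using P.A.dir_deriv_cong[OF o z, of "\<lambda>y. coord_field NB ?e (0, u) y ?e" "\<lambda>_. (0, u)"] coord_NB(2)[OF c] by simp
  have Jvf: "vector_field_on NB (cdom ?e) (\<lambda>y. ?J y (coord_field NB ?e (0, u) y))" for u
    by (rule N.J_vector_field[OF o cf])
  have lb: "lie_bracket NB X Y z ?e = dir_deriv NB (\<lambda>y. Y y ?e) z (X z) - dir_deriv NB (\<lambda>y. X y ?e) z (Y z)" for X Y
    using e z by (simp add: lie_bracket_def)
  note lt = P.A.lie_bracket_tangent[OF o _ _ z]
  have d0: "dir_deriv L (\<lambda>y. christoffel c y u w) x 0 = 0" for u
    using I.A.dir_deriv_scaleR_vec[OF I.A.smooth_nearI[OF I.A.open_in_cdom[OF c] x smooth_christoffel[OF c]]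
        I.A.tangent_0, of u w 0] by simp
  \<comment> \<open>Each mixed bracket is vertical, with the Christoffel symbol of \<open>a\<close>
    and \<open>b\<close> as its component up to sign; symmetry makes the two opposite.\<close>
  have "lie_bracket NB ?JX ?Y z + lie_bracket NB ?X ?JY z = 0"
  proof (rule P.A.tangent_eqI[OF P.A.tangent_add[OF lt[OF Jvf cf] lt[OF cf Jvf]] P.A.tangent_0 e z])
    show "(lie_bracket NB ?JX ?Y z + lie_bracket NB ?X ?JY z) ?e = (0 :: ('a, 'e, 'f) nbtvec) ?e"
      using christoffel_symmetric[OF c x, of a b] linear_0[OF I.A.linear_coord_field[OF c x]]
      by (simp add: lb DJ[OF coord_NB(1)[OF c z]] DC coord_NB(2)[OF c z] d0 zero_prod_def)
  qed
  then have "lie_bracket NB ?JX ?JY z = 0"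
    using N.nijenhuis_zero[OF o z cf cf, of "(0, a)" "(0, b)"] P.A.lie_bracket_coord_field[OF e z]
      N.J_zero[OF z_points(1)[OF c z]] by simp
  then have "lie_bracket NB ?JX ?JY z ?e = 0" by simp
  \<comment> \<open>The fibre component of the bracket. The base directions are \<open>- a\<close>
    and \<open>- b\<close> because \<open>J_tilde\<close> introduces a sign, hence minus the
    curvature.\<close>
  then have 0: "dir_deriv L (\<lambda>y. christoffel c y b w) x (coord_field L c (- a) x) + christoffel c x b (christoffel c x a w)
      - (dir_deriv L (\<lambda>y. christoffel c y a w) x (coord_field L c (- b) x) + christoffel c x a (christoffel c x b w)) = 0"
    unfolding lb DJ[OF Jt] Jc[OF z] by (simp add: zx zero_prod_def)
  have neg: "dir_deriv L (\<lambda>y. christoffel c y u w) x (coord_field L c (- v) x) =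
      - dir_deriv L (\<lambda>y. christoffel c y u w) x (coord_field L c v x)" for u v
    using I.A.dir_deriv_scaleR_vec[OF I.A.smooth_nearI[OF I.A.open_in_cdom[OF c] x smooth_christoffel[OF c]]
        I.A.coord_field_tangent[OF c x], of u w "-1" v] linear_neg[OF I.A.linear_coord_field[OF c x], of v] by simp
  show "curvature c x a b w = 0"
    using 0 unfolding neg curvature_def by (simp add: algebra_simps)
qed

end

theorem theorem3:
  fixes M :: "('a, 'f::euclidean_space) atlas"
    and L :: "('a, 'e::euclidean_space) atlas"
    and J :: "('a, 'f) endo"
    and g :: "('a, 'f) metric"
    and nab :: "('a, 'f) conn"
    and K :: "('a, 'f) nvec \<Rightarrow> ('a, 'e, 'f) nbtvec \<Rightarrow> ('a, 'f) tvec"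
    and p q :: real
  assumes "smooth_manifold M" and "smooth_manifold L" and "points L \<noteq> {}"
    and "DIM('f) = 2 * DIM('e)" and "DIM('e) \<ge> 2"
    and "kaehlerian M J g"
    and "submanifold L M"
    and "totally_real L M J g"
    and "levi_civita M g nab"
    and "totally_geodesic L M g nab"
    and "connection_map L M g nab K"
    and "q \<ge> 0"
  shows "kaehlerian (normal_bundle L M g :: (('a, 'f) nvec, 'e \<times> 'e) atlas)
           (J_tilde L M J g K p q) (pq_metric L M g K p q)
         \<longleftrightarrow> p = 0 \<and> q = 0 \<and> flat_normal_conn L M g nab"
proof -
  interpret M: atlas M
    by unfold_locales (use assms(1) in \<open>simp add: smooth_manifold_def\<close>)
  interpret M: kaehler_manifold M nab g J
    by (rule M.kaehler_manifoldI) fact+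
  interpret normal_bundle_connection L M nab g J K
  proof unfold_locales
    show "smooth_atlas L" using assms(2) by (simp add: smooth_manifold_def)
    show "smooth_map L M (\<lambda>x. x)" using assms(7) by (simp add: submanifold_def)
    show "inj_on (incl_map L M x) (tangent_space L x)" if "x \<in> points L" for x
      using assms(7) that by (simp add: submanifold_def)
  qed fact+
  show ?thesis
  proof
    assume k: "kaehlerian NB (J_tilde L M J g K p q) (pq_metric L M g K p q)"
    then have "p = 0 \<and> q = 0" by (rule pq_zero) fact+
    then show "p = 0 \<and> q = 0 \<and> flat_normal_conn L M g nab" using flat_if_kaehlerian_0_0 k by simp
  next
    assume "p = 0 \<and> q = 0 \<and> flat_normal_conn L M g nab"
    then show "kaehlerian NB (J_tilde L M J g K p q) (pq_metric L M g K p q)" using kaehlerian_0_0 by simp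
  qed
qed

end
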